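(* Let $G$ be a finite group, let $Z$ be the centre of a Sylow $3$-subgroup of $G$ and set $Q:=O_3(C_G(Z))$. Suppose that $Q\cong 3_+^{1+4}$, that $C_G(Q)\leq Q$, and that $x\in G$ satisfies $Z\neq Z^x\leq Q$. Then the following hold. (i) $Z\leq Q^x$, and so $Y:=ZZ^x\leq Q\cap Q^x$. (ii) $L:=\langle Q,Q^x\rangle\leq N_G(Y)$. (iii) $W:=C_L(Y)=O_3(L)$ has order $3^5$ and $L/W\cong \mathrm{SL}_2(3)$. (iv) $\mathcal{Z}(W)=W'=Y$ and $W$ has exponent three. (v) $S:=QW\in \mathrm{Syl}_3(L)$, and there is an involution $s\in L$ such that $Ws\in\mathcal{Z}(L/W)$; for this $s$, $J:=J(S)=J(W)=[S,s]=[W,s]=[J,s]$ is elementary abelian of order $3^4$ and is inverted by $s$. (vi) $Z_2:=J\cap Q$ has order $27$ and $Z_2/Z=\mathcal{Z}(S/Z)$. (vii) $Y\leq S'\leq Z_2$. (viii) If $J<S_0<S$ (proper inclusions of subgroups) then $|\mathcal{Z}(S_0)|=9$. (ix) $Y$, $W/(Q\cap Q^x)$ and $J/Y$ are natural $L/W$-modules. (x) $L/J\cong 3\times \mathrm{SL}_2(3)$. (xi) $Q\cap Q^x=Y\times C_W(s)$ has order $3^3$. (xii) If $N\leq G$ is a $3'$-subgroup of $G$ which is normalized by $Y$ then $[Y,N]=1$. (xiii) If $u\in C_G(Z)$ is an involution and $[Qu,S/Q]=1$ then either $u$ inverts $Q/Z$, $|C_J(u)|=3^2$ and $u$ inverts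 $S/J$; or $Q$ is a central product of the two groups $C_Q(u)\cong [Q,u]\cong 3_+^{1+2}$, $u$ does not normalize $Y$, $|C_S(u)|=3^4$, $|C_J(u)|=3^3$ and $[J,u]=[Y,u]$ has order $3$.
   Context: $3_+^{1+2n}$ is the extraspecial group of order $3^{1+2n}$ and exponent $3$ (a non-abelian $p$-group $E$ is extraspecial if $E'=\mathcal{Z}(E)=\Phi(E)$ has order $p$). $\mathcal{Z}(X)$ is the centre and $X'$ the derived subgroup of $X$; $O_3(X)$ is the largest normal $3$-subgroup of $X$; $Z^x=x^{-1}Zx$. For a $3$-group $P$, $J(P)$ is the Thompson subgroup: the subgroup generated by all abelian subgroups of $P$ of maximal order among abelian subgroups of $P$. A $3'$-group is a group of order coprime to $3$. An element inverts a group (or section) if it acts on it by $g\mapsto g^{-1}$. A natural $\mathrm{SL}_2(3)$-module is an elementary abelian group of order $9$ on which $\mathrm{SL}_2(3)$ acts as on its natural $2$-dimensional module over $\mathrm{GF}(3)$. In (x), $3$ denotes the cyclic group of order $3$. *)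

theory Defs
  imports
    "HOL-Analysis.Determinants"
    "HOL-Library.Numeral_Type"
    "HOL-Computational_Algebra.Primes"
    "HOL-Algebra.Elementary_Groups"
    "HOL-Algebra.Multiplicative_Group"
    "HOL-Algebra.Generated_Groups"
    "HOL-Algebra.Group_Action"
begin

text \<open>
  Subgroups of an ambient group are carrier sets; \<open>grp_on G H\<close> is such a subgroup as a group
  in its own right.  Sections \<open>A/N\<close> are written \<open>grp_on G A Mod N\<close>, whose elements are the
  cosets \<open>N #> a\<close> with \<open>a \<in> A\<close>.
\<close>

abbreviation grp_on :: "('a, 'm) monoid_scheme \<Rightarrow> 'a set \<Rightarrow> ('a, 'm) monoid_scheme" where
  "grp_on G H \<equiv> G\<lparr>carrier := H\<rparr>"


section \<open>Conjugation, commutators, centralisers\<close>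

text \<open>Conjugation is a right action, \<open>a\<^sup>x = x\<inverse> a x\<close>, and \<open>[a, b] = a\<inverse> b\<inverse> a b\<close>.\<close>

definition conj_el :: "('a, 'm) monoid_scheme \<Rightarrow> 'a \<Rightarrow> 'a \<Rightarrow> 'a" where
  "conj_el G a x = inv\<^bsub>G\<^esub> x \<otimes>\<^bsub>G\<^esub> a \<otimes>\<^bsub>G\<^esub> x"

definition conj_set :: "('a, 'm) monoid_scheme \<Rightarrow> 'a set \<Rightarrow> 'a \<Rightarrow> 'a set" where
  "conj_set G A x = (\<lambda>a. conj_el G a x) ` A"

definition commutator_subgroup :: "('a, 'm) monoid_scheme \<Rightarrow> 'a set \<Rightarrow> 'a set \<Rightarrow> 'a set" where
  "commutator_subgroup G A B =
     generate G {inv\<^bsub>G\<^esub> a \<otimes>\<^bsub>G\<^esub> inv\<^bsub>G\<^esub> b \<otimes>\<^bsub>G\<^esub> a \<otimes>\<^bsub>G\<^esub> b | a b. a \<in> A \<and> b \<in> B}"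

definition centralizer :: "('a, 'm) monoid_scheme \<Rightarrow> 'a set \<Rightarrow> 'a set" where
  "centralizer G A = {g \<in> carrier G. \<forall>a\<in>A. g \<otimes>\<^bsub>G\<^esub> a = a \<otimes>\<^bsub>G\<^esub> g}"

definition centre :: "('a, 'm) monoid_scheme \<Rightarrow> 'a set" where
  "centre G = centralizer G (carrier G)"

definition involution :: "('a, 'm) monoid_scheme \<Rightarrow> 'a \<Rightarrow> bool" where
  "involution G u \<longleftrightarrow> u \<in> carrier G \<and> group.ord G u = 2"

definition inverts :: "('a, 'm) monoid_scheme \<Rightarrow> 'a \<Rightarrow> 'a set \<Rightarrow> bool" where
  "inverts G u A \<longleftrightarrow> (\<forall>a\<in>A. conj_el G a u = inv\<^bsub>G\<^esub> a)"

definition inverts_section :: "('a, 'm) monoid_scheme \<Rightarrow> 'a \<Rightarrow> 'a set \<Rightarrow> 'a set \<Rightarrow> bool" where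
  "inverts_section G u A N \<longleftrightarrow>
     conj_set G A u = A \<and> conj_set G N u = N \<and>
     (\<forall>a\<in>A. N #>\<^bsub>G\<^esub> conj_el G a u = inv\<^bsub>grp_on G A Mod N\<^esub> (N #>\<^bsub>G\<^esub> a))"


section \<open>Finite \<open>p\<close>-groups\<close>

definition p_group :: "nat \<Rightarrow> ('a, 'm) monoid_scheme \<Rightarrow> bool" where
  "p_group p G \<longleftrightarrow> group G \<and> (\<exists>k. order G = p ^ k)"

definition sylow_subgroup :: "nat \<Rightarrow> ('a, 'm) monoid_scheme \<Rightarrow> 'a set \<Rightarrow> bool" where
  "sylow_subgroup p G P \<longleftrightarrow> subgroup P G \<and> card P = p ^ multiplicity p (order G)"

text \<open>The largest normal \<open>p\<close>-subgroup \<open>O\<^sub>p(G)\<close>; the order is set inclusion, and the greatest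
  element exists when \<open>G\<close> is finite and \<open>p\<close> is prime.\<close>

definition p_core :: "nat \<Rightarrow> ('a, 'm) monoid_scheme \<Rightarrow> 'a set" where
  "p_core p G = (GREATEST N. N \<lhd> G \<and> p_group p (grp_on G N))"

definition abelian_max_order :: "('a, 'm) monoid_scheme \<Rightarrow> 'a set set" where
  "abelian_max_order G =
     {A. subgroup A G \<and> comm_group (grp_on G A) \<and>
         (\<forall>B. subgroup B G \<and> comm_group (grp_on G B) \<longrightarrow> card B \<le> card A)}"

definition thompson :: "('a, 'm) monoid_scheme \<Rightarrow> 'a set" where
  "thompson G = generate G (\<Union>(abelian_max_order G))"

definition maximal_subgroup :: "('a, 'm) monoid_scheme \<Rightarrow> 'a set \<Rightarrow> bool" where
  "maximal_subgroup G M \<longleftrightarrow>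
     subgroup M G \<and> M \<noteq> carrier G \<and>
     (\<forall>K. subgroup K G \<and> M \<subseteq> K \<longrightarrow> K = M \<or> K = carrier G)"

definition frattini :: "('a, 'm) monoid_scheme \<Rightarrow> 'a set" where
  "frattini G = carrier G \<inter> \<Inter>{M. maximal_subgroup G M}"

definition group_exponent :: "('a, 'm) monoid_scheme \<Rightarrow> nat" where
  "group_exponent G = (LEAST n::nat. n > 0 \<and> (\<forall>g\<in>carrier G. g [^]\<^bsub>G\<^esub> n = \<one>\<^bsub>G\<^esub>))"

definition elementary_abelian :: "nat \<Rightarrow> ('a, 'm) monoid_scheme \<Rightarrow> bool" where
  "elementary_abelian p G \<longleftrightarrow>
     comm_group G \<and> (\<forall>g\<in>carrier G. g [^]\<^bsub>G\<^esub> p = \<one>\<^bsub>G\<^esub>)"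

definition extraspecial :: "nat \<Rightarrow> ('a, 'm) monoid_scheme \<Rightarrow> bool" where
  "extraspecial p G \<longleftrightarrow>
     p_group p G \<and> \<not> comm_group G \<and>
     derived G (carrier G) = centre G \<and> centre G = frattini G \<and> card (centre G) = p"

text \<open>For odd primes \<open>p\<close> the following determines \<open>G\<close> up to isomorphism: \<open>G\<close> is the
  extraspecial group of order \<open>p ^ (1 + 2 * n)\<close> and exponent \<open>p\<close>, i.e. of type \<open>+\<close>.\<close>

definition extraspecial_plus :: "nat \<Rightarrow> nat \<Rightarrow> ('a, 'm) monoid_scheme \<Rightarrow> bool" where
  "extraspecial_plus p n G \<longleftrightarrow>
     extraspecial p G \<and> order G = p ^ (1 + 2 * n) \<and> group_exponent G = p"


section \<open>Internal products\<close>

definition internal_direct_product ::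
    "('a, 'm) monoid_scheme \<Rightarrow> 'a set \<Rightarrow> 'a set \<Rightarrow> 'a set \<Rightarrow> bool" where
  "internal_direct_product G H A B \<longleftrightarrow>
     subgroup A G \<and> subgroup B G \<and> H = A <#>\<^bsub>G\<^esub> B \<and> A \<inter> B = {\<one>\<^bsub>G\<^esub>} \<and>
     (\<forall>a\<in>A. \<forall>b\<in>B. a \<otimes>\<^bsub>G\<^esub> b = b \<otimes>\<^bsub>G\<^esub> a)"

definition central_product ::
    "('a, 'm) monoid_scheme \<Rightarrow> 'a set \<Rightarrow> 'a set \<Rightarrow> 'a set \<Rightarrow> bool" where
  "central_product G H A B \<longleftrightarrow>
     subgroup A G \<and> subgroup B G \<and> H = A <#>\<^bsub>G\<^esub> B \<and>
     (\<forall>a\<in>A. \<forall>b\<in>B. a \<otimes>\<^bsub>G\<^esub> b = b \<otimes>\<^bsub>G\<^esub> a)"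


section \<open>\<open>SL\<^sub>2(3)\<close> and its natural module\<close>

text \<open>The numeral type \<^typ>\<open>3\<close> is the ring of integers modulo 3, i.e. \<open>GF(3)\<close>.\<close>

definition SL23 :: "(3 ^ 2 ^ 2) monoid" where
  "SL23 = \<lparr>carrier = {A. det A = 1}, monoid.mult = (**), one = mat 1\<rparr>"

definition GF3_plane :: "(3 ^ 2) monoid" where
  "GF3_plane = \<lparr>carrier = UNIV, monoid.mult = (+), one = 0\<rparr>"

text \<open>\<open>natural_SL23_module G L W A B\<close>: conjugation by \<open>L\<close> on the section \<open>A/B\<close> makes it a natural
  module for \<open>L/W \<cong> SL\<^sub>2(3)\<close>.  As conjugation acts from the right, it corresponds to the action of
  \<open>SL\<^sub>2(3)\<close> on row vectors.  That \<open>W\<close> acts trivially and that \<open>A/B\<close> is elementary abelian of order 9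
  is forced by the two isomorphisms.\<close>

definition natural_SL23_module ::
    "('a, 'm) monoid_scheme \<Rightarrow> 'a set \<Rightarrow> 'a set \<Rightarrow> 'a set \<Rightarrow> 'a set \<Rightarrow> bool" where
  "natural_SL23_module G L W A B \<longleftrightarrow>
     subgroup A G \<and> B \<lhd> grp_on G A \<and> W \<lhd> grp_on G L \<and>
     (\<forall>g\<in>L. conj_set G A g = A \<and> conj_set G B g = B) \<and>
     (\<exists>\<phi> \<in> iso (grp_on G L Mod W) SL23. \<exists>\<psi> \<in> iso (grp_on G A Mod B) GF3_plane.
        \<forall>g\<in>L. \<forall>a\<in>A. \<psi> (B #>\<^bsub>G\<^esub> conj_el G a g) = \<psi> (B #>\<^bsub>G\<^esub> a) v* \<phi> (W #>\<^bsub>G\<^esub> g))"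

end

theory Submission
 imports Defs "HOL-Algebra.SndIsomorphismGrp" "HOL-Algebra.Sylow" "HOL-Number_Theory.Cong"
begin

text \<open>
 Put \<open>Z\<^sub>1 = Z\<^sup>x\<close>, \<open>Q\<^sub>1 = Q\<^sup>x\<close>, \<open>A = C(Z\<^sub>1)\<inter>Q\<close>, \<open>B = C(Z)\<inter>Q\<^sub>1\<close> and \<open>E = Q\<inter>Q\<^sub>1\<close>.  The locale
 \<open>large_extraspecial\<close> collects what the argument needs about \<open>(Z, Q)\<close>; these properties are invariant
 under conjugation, so they hold for \<open>(Z\<^sub>1, Q\<^sub>1)\<close> as well.  A fixed point argument shows \<open>Z\<subseteq>Q\<^sub>1\<close>
 (\<open>conjugate_centre_symmetric\<close>); from then on the two conjugates play symmetric roles.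

 \<open>Q\<close> and \<open>Q\<^sub>1\<close> act on \<open>Y = ZZ\<^sub>1\<close> as opposite groups of transvections, so \<open>L/W\<close> is \<open>SL\<^sub>2(3)\<close>
 (\<open>natural_module_recognition\<close>).  To find \<open>W = C\<^sub>L(Y)\<close>, choose \<open>a\<in>Q\<close> and \<open>b\<in>Q\<^sub>1\<close> that satisfy the
 braid relation \<open>aba = bab\<close> on \<open>Y\<close>.  As \<open>ab\<close> conjugates \<open>Q\<^sub>1\<close> to \<open>Q\<close>, the relation holds modulo \<open>B\<close>
 (\<open>braid_pair\<close>), and two elements of order 3 satisfying it generate at most 24 elements
 (\<open>braid_group_bound\<close>).  Hence \<open>W = AB\<close> (\<open>W_eq_N\<close>).  If \<open>E\<close> were \<open>Y\<close>, commutation with an element of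
 \<open>Q - A\<close> would map \<open>B/Y\<close> onto \<open>A/Y\<close> with commuting images and \<open>A\<close> would be abelian, but abelian subgroups
 of \<open>Q\<close> have order at most 27 (\<open>E_not_Y\<close>).  So \<open>|E| = 27\<close> and \<open>|W| = 3\<^sup>5\<close>.

 An involution \<open>s\<close> mapping to \<open>-1\<close> inverts \<open>Y\<close> and \<open>W/E\<close> and centralizes \<open>E/Y\<close>.  The elements of \<open>W\<close>
 inverted by \<open>s\<close> form a subgroup \<open>J\<close> with \<open>W = JE\<close> and \<open>J\<inter>E = Y\<close>, and any abelian subgroup of \<open>S\<close> of
 order at least 81 equals \<open>J\<close> (\<open>abelian_large_eq_J\<close>).  Since \<open>W/J\<close> is central in \<open>L/J\<close>, the braid
 generators can be corrected so that the relation holds modulo \<open>J\<close>; this splits \<open>L/J\<close> (\<open>L_mod_J\<close>).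

 Every nontrivial \<open>y\<in>Y\<close> lies in some conjugate \<open>Z'\<close> of \<open>Z\<close> whose \<open>Q'\<close> contains \<open>Y\<close>, so an element of
 \<open>N\<close> commuting with \<open>y\<close> normalizes \<open>Q'\<close> and commutes with \<open>Y\<close> (\<open>coprime_centralized\<close>).  Finally, an
 involution \<open>u\<close> of \<open>C(Z)\<close> splits \<open>Q\<close> into commuting subgroups \<open>C\<close>, fixed by \<open>u\<close>, and \<open>I\<close>, inverted
 modulo \<open>Z\<close>, with \<open>C\<inter>I = Z\<close>; so \<open>C\<close> has order 3 or 27 (\<open>card_C\<close>).
\<close>

section \<open>Conjugation and commutators\<close>

context group
begin

abbreviation conj_elem (infixl "\<up>" 76) where "a\<up>g \<equiv> conj_el G a g"
abbreviation conj_sub (infixl "\<Up>" 76) where "A\<Up>g \<equiv> conj_set G A g"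
abbreviation comm (\<open>[._,/ _.]\<close>) where "[.a, b.] \<equiv> inv a\<otimes>inv b\<otimes>a\<otimes>b"
abbreviation CG where "CG \<equiv> centralizer G"

lemma inv_cancel_left [simp]:
 "[|a\<in>carrier G; b\<in>carrier G|] ==> inv a\<otimes>(a\<otimes>b) = b"
 "[|a\<in>carrier G; b\<in>carrier G|] ==> a\<otimes>(inv a\<otimes>b) = b"
 by (simp_all flip: m_assoc)

lemmas word_simps = conj_el_def m_assoc inv_mult_group

lemma conj_el_closed [simp, intro]: "[|a\<in>carrier G; g\<in>carrier G|] ==> a\<up>g\<in>carrier G"
 by (simp add: conj_el_def)

lemma conj_el_mult: "[|a\<in>carrier G; b\<in>carrier G; g\<in>carrier G|] ==> (a\<otimes>b)\<up>g = (a\<up>g)\<otimes>(b\<up>g)"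
 by (simp add: word_simps)

lemma conj_el_inv: "[|a\<in>carrier G; g\<in>carrier G|] ==> inv a\<up>g = inv (a\<up>g)"
 by (simp add: word_simps)

lemma conj_el_conj: "[|a\<in>carrier G; g\<in>carrier G; h\<in>carrier G|] ==> (a\<up>g)\<up>h = a\<up>(g\<otimes>h)"
 by (simp add: word_simps)

lemma conj_el_one [simp]: "a\<in>carrier G ==> a\<up>\<one> = a" "g\<in>carrier G ==> \<one>\<up>g = \<one>"
 by (simp_all add: word_simps)

lemma conj_el_cancel [simp]:
 "[|a\<in>carrier G; g\<in>carrier G|] ==> (a\<up>g)\<up>inv g = a"
 "[|a\<in>carrier G; g\<in>carrier G|] ==> (a\<up>inv g)\<up>g = a"
 by (simp_all add: word_simps)

lemma conj_el_self [simp]: "a\<in>carrier G ==> a\<up>a = a"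
 by (simp add: word_simps)

lemma conj_el_eq_comm: "[|a\<in>carrier G; g\<in>carrier G|] ==> a\<up>g = a\<otimes>[.a, g.]"
 by (simp add: word_simps)

lemma comm_eq_conj: "[|a\<in>carrier G; g\<in>carrier G|] ==> [.a, g.] = inv a\<otimes>(a\<up>g)"
 by (simp add: word_simps)

lemma conj_el_comm: "[|a\<in>carrier G; b\<in>carrier G; g\<in>carrier G|] ==> [.a, b.]\<up>g = [.a\<up>g, b\<up>g.]"
 by (simp add: word_simps)

lemma conj_el_pow: "[|a\<in>carrier G; g\<in>carrier G|] ==> (a [^] (n::nat))\<up>g = (a\<up>g) [^] n"
 by (induction n) (simp_all add: conj_el_mult)

lemma conj_el_inj: "[|a\<in>carrier G; b\<in>carrier G; g\<in>carrier G|] ==> a\<up>g = b\<up>g \<longleftrightarrow> a = b"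
 by (metis conj_el_cancel(1))

lemma conj_el_fixed: "[|a\<in>carrier G; g\<in>carrier G|] ==> a\<up>g = a \<longleftrightarrow> a\<otimes>g = g\<otimes>a"
 unfolding conj_el_def by (metis inv_solve_left m_assoc m_closed inv_closed)

lemma comm_one_iff: "[|a\<in>carrier G; g\<in>carrier G|] ==> [.a, g.] = \<one> \<longleftrightarrow> a\<otimes>g = g\<otimes>a"
 by (metis conj_el_eq_comm conj_el_fixed inv_closed l_cancel_one m_closed)

lemma comm_one_iff': "[|a\<in>carrier G; g\<in>carrier G|] ==> [.a, g.] = \<one> \<longleftrightarrow> a\<up>g = a"
 by (simp add: comm_one_iff conj_el_fixed)

lemma inv_comm_swap: "[|a\<in>carrier G; b\<in>carrier G|] ==> inv [.a, b.] = [.b, a.]"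
 by (simp add: word_simps)

lemma comm_mult_left:
 "[|a\<in>carrier G; b\<in>carrier G; c\<in>carrier G|] ==> [.a\<otimes>b, c.] = ([.a, c.]\<up>b)\<otimes>[.b, c.]"
 by (simp add: word_simps)

lemma comm_mult_right:
 "[|a\<in>carrier G; b\<in>carrier G; c\<in>carrier G|] ==> [.a, b\<otimes>c.] = [.a, c.]\<otimes>([.a, b.]\<up>c)"
 by (simp add: word_simps)

lemma subgroup_carrier: "subgroup H G ==> h\<in>H ==> h\<in>carrier G"
 by (rule subgroup.mem_carrier)

lemma subgroup_conj: "[|subgroup H G; a\<in>H; b\<in>H|] ==> a\<up>b\<in>H"
 by (simp add: conj_el_def subgroup.m_closed subgroup.m_inv_closed)

lemma subgroup_comm: "[|subgroup H G; a\<in>H; b\<in>H|] ==> [.a, b.]\<in>H"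
 by (simp add: subgroup.m_closed subgroup.m_inv_closed)

lemma subgroup_pow: "[|subgroup H G; a\<in>H|] ==> a [^] (n::nat)\<in>H"
 by (induction n) (simp_all add: subgroup.m_closed subgroup.one_closed)

lemma subgroup_mult_cancel:
 assumes "subgroup H G" "a\<in>H" "b\<in>carrier G"
 shows "a\<otimes>b\<in>H \<longleftrightarrow> b\<in>H" "b\<otimes>a\<in>H \<longleftrightarrow> b\<in>H"
proof -
 have a: "a\<in>carrier G" using assms subgroup_carrier by blast
 have "b = inv a\<otimes>(a\<otimes>b)" "b = (b\<otimes>a)\<otimes>inv a" using a assms by (simp_all add: m_assoc)
 then show "a\<otimes>b\<in>H \<longleftrightarrow> b\<in>H" "b\<otimes>a\<in>H \<longleftrightarrow> b\<in>H"
  using assms by (metis subgroup.m_closed subgroup.m_inv_closed)+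
qed

lemma subgroup_inv_iff: "[|subgroup H G; a\<in>carrier G|] ==> inv a\<in>H \<longleftrightarrow> a\<in>H"
 by (metis inv_inv subgroup.m_inv_closed)


lemma conj_set_carrier: "[|A\<subseteq>carrier G; g\<in>carrier G|] ==> A\<Up>g\<subseteq>carrier G"
 by (auto simp: conj_set_def)

lemma conj_setI: "a\<in>A ==> a\<up>g\<in>A\<Up>g"
 by (auto simp: conj_set_def)

lemma mem_conj_set:
 assumes "A\<subseteq>carrier G" "g\<in>carrier G" "y\<in>carrier G"
 shows "y\<in>A\<Up>g \<longleftrightarrow> y\<up>inv g\<in>A"
proof
 assume "y\<in>A\<Up>g" then show "y\<up>inv g\<in>A"
  using assms by (auto simp: conj_set_def dest!: subsetD)
next
 assume "y\<up>inv g\<in>A"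
 then have "(y\<up>inv g)\<up>g\<in>A\<Up>g" by (rule conj_setI)
 then show "y\<in>A\<Up>g" using assms by simp
qed

lemma conj_set_conj:
 "[|A\<subseteq>carrier G; g\<in>carrier G; h\<in>carrier G|] ==> (A\<Up>g)\<Up>h = A\<Up>(g\<otimes>h)"
 unfolding conj_set_def image_image by (intro image_cong) (auto simp: conj_el_conj)

lemma conj_set_one: "A\<subseteq>carrier G ==> A\<Up>\<one> = A"
 by (force simp: conj_set_def)

lemma conj_set_mono: "A\<subseteq>B ==> A\<Up>g\<subseteq>B\<Up>g"
 by (auto simp: conj_set_def)

lemma conj_set_cancel:
 "[|A\<subseteq>carrier G; g\<in>carrier G|] ==> (A\<Up>g)\<Up>inv g = A"
 "[|A\<subseteq>carrier G; g\<in>carrier G|] ==> (A\<Up>inv g)\<Up>g = A"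
 by (simp_all add: conj_set_conj conj_set_one)

lemma card_conj_set: "[|A\<subseteq>carrier G; g\<in>carrier G|] ==> card (A\<Up>g) = card A"
 unfolding conj_set_def by (intro card_image inj_onI) (metis conj_el_inj subsetD)

lemma conj_set_subgroup:
 assumes "subgroup H G" "g\<in>carrier G" shows "subgroup (H\<Up>g) G"
proof (rule subgroupI)
 have H: "H\<subseteq>carrier G" using assms subgroup.subset by blast
 show "H\<Up>g\<subseteq>carrier G" using H assms conj_set_carrier by blast
 show "H\<Up>g~={}" using subgroup.one_closed[OF assms(1)] by (auto simp: conj_set_def)
 fix a assume a: "a\<in>H\<Up>g"
 then obtain h where h: "h\<in>H" "a = h\<up>g" by (auto simp: conj_set_def)
 then have "inv a = inv h\<up>g" using H assms by (simp add: conj_el_inv subsetD)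
 then show "inv a\<in>H\<Up>g" using h assms by (metis conj_setI subgroup.m_inv_closed)
 fix b assume "b\<in>H\<Up>g"
 then obtain k where k: "k\<in>H" "b = k\<up>g" by (auto simp: conj_set_def)
 have "a\<otimes>b = (h\<otimes>k)\<up>g" using h k H assms by (simp add: conj_el_mult subsetD)
 then show "a\<otimes>b\<in>H\<Up>g" using h k assms by (metis conj_setI subgroup.m_closed)
qed

definition normalizing :: "'a set \<Rightarrow> 'a set" where
 "normalizing K = {g\<in>carrier G. K\<Up>g = K}"

definition trivial_on :: "'a set \<Rightarrow> 'a set \<Rightarrow> 'a set" where
 "trivial_on K N = {g\<in>normalizing K\<inter>normalizing N. \<forall>k\<in>K. [.k, g.]\<in>N}"

lemma normalizing_carrier: "g\<in>normalizing K ==> g\<in>carrier G"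
 by (simp add: normalizing_def)

lemma normalizing_conj: "g\<in>normalizing K ==> k\<in>K ==> k\<up>g\<in>K"
 using conj_setI[of k K g] by (simp add: normalizing_def)

lemma normalizingI:
 assumes "finite K" "K\<subseteq>carrier G" "g\<in>carrier G" "\<And>k. k\<in>K ==> k\<up>g\<in>K"
 shows "g\<in>normalizing K"
proof -
 have "K\<Up>g\<subseteq>K" using assms by (auto simp: conj_set_def)
 then have "K\<Up>g = K" using assms card_conj_set card_subset_eq by metis
 then show ?thesis using assms by (simp add: normalizing_def)
qed

lemma normalizing_subgroup: "K\<subseteq>carrier G ==> subgroup (normalizing K) G"
 apply (rule subgroupI)
 subgoal by (auto simp: normalizing_def)
 subgoal using conj_set_one[of K] by (auto simp: normalizing_def)
 subgoal by (simp add: normalizing_def) (metis conj_set_cancel(1))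
 subgoal by (simp add: normalizing_def flip: conj_set_conj)
 done

lemma normalizer_eq_normalizing:
 assumes "K\<subseteq>carrier G" shows "normalizer G K = normalizing K"
proof -
 have eq: "g <# K #> inv g = K\<Up>inv g" if "g\<in>carrier G" for g
  using that assms unfolding l_coset_def r_coset_def conj_set_def conj_el_def by auto
 have "K\<Up>inv g = K \<longleftrightarrow> K\<Up>g = K" if "g\<in>carrier G" for g
  using that assms by (metis conj_set_cancel)
 with eq have "g <# K #> inv g = K \<longleftrightarrow> K\<Up>g = K" if "g\<in>carrier G" for g
  using that by presburger
 then show ?thesis
  unfolding normalizer_def stabilizer_def normalizing_def using assms by (auto simp del: set_eq_subset)
qed

lemma trivial_onI:
 "[|g\<in>normalizing K; g\<in>normalizing N; \<And>k. k\<in>K ==> [.k, g.]\<in>N|] ==> g\<in>trivial_on K N"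
 by (simp add: trivial_on_def)

lemma trivial_onD: "g\<in>trivial_on K N ==> k\<in>K ==> [.k, g.]\<in>N"
 by (simp add: trivial_on_def)

lemma trivial_on_subgroup:
 assumes K: "K\<subseteq>carrier G" and N: "subgroup N G"
 shows "subgroup (trivial_on K N) G"
proof (rule subgroupI)
 have NC: "N\<subseteq>carrier G" using N subgroup.subset by blast
 note nK = normalizing_subgroup[OF K] and nN = normalizing_subgroup[OF NC]
 show "trivial_on K N\<subseteq>carrier G" by (auto simp: trivial_on_def normalizing_def)
 have "\<one>\<in>trivial_on K N"
 proof (rule trivial_onI)
  show "\<one>\<in>normalizing K" "\<one>\<in>normalizing N" using nK nN subgroup.one_closed by auto
  fix k assume "k\<in>K" then have "[.k, \<one>.] = \<one>" using K by (simp add: subsetD)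
  then show "[.k, \<one>.]\<in>N" using N subgroup.one_closed by auto
 qed
 then show "trivial_on K N~={}" by blast
 fix a assume a: "a\<in>trivial_on K N"
 have ac: "a\<in>carrier G" using a by (auto simp: trivial_on_def normalizing_def)
 show "inv a\<in>trivial_on K N"
 proof (rule trivial_onI)
  have *: "inv a\<in>normalizing K" "inv a\<in>normalizing N"
   using a nK nN subgroup.m_inv_closed by (auto simp: trivial_on_def)
  then show "inv a\<in>normalizing K" "inv a\<in>normalizing N" by auto
  fix k assume k: "k\<in>K"
  then have kc: "k\<in>carrier G" using K by auto
  let ?k = "k\<up>inv a"
  have "[.k, inv a.] = inv [.?k, a.]" using kc ac by (simp add: word_simps)
  moreover have "[.?k, a.]\<in>N" using a * k normalizing_conj trivial_onD by blast
  ultimately show "[.k, inv a.]\<in>N" using N subgroup.m_inv_closed by metis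
 qed
 fix b assume b: "b\<in>trivial_on K N"
 have bc: "b\<in>carrier G" using b by (auto simp: trivial_on_def normalizing_def)
 show "a\<otimes>b\<in>trivial_on K N"
 proof (rule trivial_onI)
  show "a\<otimes>b\<in>normalizing K" "a\<otimes>b\<in>normalizing N"
   using a b nK nN subgroup.m_closed by (auto simp: trivial_on_def)
  fix k assume k: "k\<in>K"
  then have kc: "k\<in>carrier G" using K by auto
  have "[.k, a.]\<up>b\<in>N" using a b k by (intro normalizing_conj trivial_onD) (auto simp: trivial_on_def)
  moreover have "[.k, b.]\<in>N" using b k trivial_onD by blast
  ultimately have "[.k, b.]\<otimes>([.k, a.]\<up>b)\<in>N" using N subgroup.m_closed by metis
  then show "[.k, a\<otimes>b.]\<in>N" using comm_mult_right[OF kc ac bc] by metis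
 qed
qed

lemma centralizer_carrier: "CG A\<subseteq>carrier G"
 by (auto simp: centralizer_def)

lemma centralizerD: "g\<in>CG A ==> a\<in>A ==> g\<otimes>a = a\<otimes>g"
 by (simp add: centralizer_def)

lemma centralizer_subgroup: assumes "A\<subseteq>carrier G" shows "subgroup (CG A) G"
proof (rule subgroupI)
 show "CG A\<subseteq>carrier G" by (rule centralizer_carrier)
 have "\<one>\<in>CG A" using assms by (auto simp: centralizer_def)
 then show "CG A~={}" by blast
 fix a assume a: "a\<in>CG A"
 then have ac: "a\<in>carrier G" by (simp add: centralizer_def)
 show "inv a\<in>CG A"
  unfolding centralizer_def
 proof (simp add: ac, intro ballI)
  fix y assume y: "y\<in>A" then have yc: "y\<in>carrier G" using assms by auto
  have "y\<up>a = y" using conj_el_fixed centralizerD[OF a y] ac yc by metis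
  then have "y\<up>inv a = y" using conj_el_cancel(1)[OF yc ac] by metis
  then show "inv a\<otimes>y = y\<otimes>inv a" using conj_el_fixed yc ac inv_closed by metis
 qed
 fix b assume b: "b\<in>CG A"
 then have bc: "b\<in>carrier G" by (simp add: centralizer_def)
 show "a\<otimes>b\<in>CG A"
  unfolding centralizer_def
 proof (simp add: ac bc, intro ballI)
  fix y assume y: "y\<in>A" then have yc: "y\<in>carrier G" using assms by auto
  have "y\<up>a = y" "y\<up>b = y" using conj_el_fixed centralizerD[OF a y] centralizerD[OF b y] ac bc yc by metis+
  then have "y\<up>(a\<otimes>b) = y" using conj_el_conj[OF yc ac bc] by metis
  then show "a\<otimes>b\<otimes>y = y\<otimes>(a\<otimes>b)" using conj_el_fixed yc ac bc m_closed by metis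
 qed
qed

lemma centralizer_conj_el: "g\<in>CG A ==> a\<in>A ==> a\<in>carrier G ==> a\<up>g = a"
 by (simp add: conj_el_fixed centralizer_def)

lemma centralizerI:
 assumes "g\<in>carrier G" "A\<subseteq>carrier G" "\<And>a. a\<in>A ==> a\<up>g = a"
 shows "g\<in>CG A"
proof -
 have "g\<otimes>a = a\<otimes>g" if "a\<in>A" for a
  using conj_el_fixed[of a g] assms that by (simp add: subsetD)
 then show ?thesis using assms by (simp add: centralizer_def)
qed

end

section \<open>Counting in finite groups\<close>

context group
begin


lemma card_fibres:
 assumes H: "subgroup H G" and K: "subgroup K G" "K\<subseteq>H" and fin: "finite H"
  and f: "\<And>x y. x\<in>H ==> y\<in>H ==> f x = f y \<longleftrightarrow> x\<otimes>inv y\<in>K"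
 shows "card (f ` H) * card K = card H"
proof -
 let ?H = "G\<lparr>carrier := H\<rparr>"
 interpret HG: group ?H using H subgroup_imp_group by blast
 have KH: "subgroup K ?H" using H K subgroup_incl by blast
 have Hc: "x\<in>carrier G" if "x\<in>H" for x using that H subgroup_carrier by blast
 have eq: "f x = f y \<longleftrightarrow> K #> x = K #> y" if "x\<in>H" "y\<in>H" for x y
 proof -
  have "K #> x = K #> y \<longleftrightarrow> x\<in>K #> y"
   using that Hc K(1) repr_independence rcos_self by metis
  also have "\<dots> \<longleftrightarrow> x\<otimes>inv y\<in>K"
   using subgroup.rcos_module[OF K(1) is_group Hc[OF that(2)] Hc[OF that(1)]] by blast
  finally show ?thesis using f that by blast
 qed
 have "bij_betw (\<lambda>C. f (SOME x. x\<in>H \<and> C = K #> x)) ((\<lambda>x. K #> x) ` H) (f ` H)"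
 proof -
  have *: "(SOME x. x\<in>H \<and> K #> y = K #> x)\<in>H \<and> K #> y = K #> (SOME x. x\<in>H \<and> K #> y = K #> x)"
   if "y\<in>H" for y
   using someI[of "\<lambda>x. x\<in>H \<and> K #> y = K #> x" y] that by blast
  then have **: "f (SOME x. x\<in>H \<and> K #> y = K #> x) = f y" if "y\<in>H" for y
   using eq[OF conjunct1[OF *[OF that]] that] conjunct2[OF *[OF that]] by simp
  show ?thesis
   unfolding bij_betw_def inj_on_def using ** eq by (auto simp: image_image)
 qed
 from bij_betw_same_card[OF this] have "card (f ` H) = card ((\<lambda>x. K #> x) ` H)" by (rule sym)
 also have "(\<lambda>x. K #> x) ` H = rcosets\<^bsub>?H\<^esub> K" unfolding RCOSETS_def by (auto simp: r_coset_def)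
 finally show ?thesis using HG.lagrange[OF KH] by (simp add: order_def)
qed

lemma card_subgroup_dvd:
 assumes "subgroup H G" "subgroup K G" "K\<subseteq>H" "finite H"
 shows "card K dvd card H"
proof -
 interpret HG: group "G\<lparr>carrier := H\<rparr>" using assms subgroup_imp_group by blast
 have "subgroup K (grp_on G H)" using assms subgroup_incl by blast
 from HG.lagrange[OF this] have "card (rcosets\<^bsub>G\<lparr>carrier := H\<rparr>\<^esub> K) * card K = card H"
  by (simp add: order_def)
 then show ?thesis by (metis dvd_triv_right)
qed

lemma card_set_mult_inter:
 assumes H: "subgroup H G" "finite H" and K: "subgroup K G" "finite K"
 shows "card (H<#>K) * card (H\<inter>K) = card H * card K"
proof -
 have Hc: "x\<in>carrier G" if "x\<in>H" for x using that H subgroup_carrier by blast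
 have Kc: "x\<in>carrier G" if "x\<in>K" for x using that K subgroup_carrier by blast
 have "\<forall>x\<in>H<#>K. \<exists>p. fst p\<in>H \<and> snd p\<in>K \<and> x = fst p\<otimes>snd p"
  by (auto simp: set_mult_def)
 then obtain p where p: "\<And>x. x\<in>H<#>K ==> fst (p x)\<in>H \<and> snd (p x)\<in>K \<and> x = fst (p x)\<otimes>snd (p x)"
  by metis
 let ?F = "\<lambda>(x, d). (fst (p x)\<otimes>d, inv d\<otimes>snd (p x))"
 have "bij_betw ?F ((H<#>K) \<times> (H\<inter>K)) (H \<times> K)"
 proof (rule bij_betw_imageI)
  show "inj_on ?F ((H<#>K) \<times> (H\<inter>K))"
  proof (rule inj_onI, clarify)
   fix x d x' d'
   assume x: "x\<in>H<#>K" "x'\<in>H<#>K" and d: "d\<in>H" "d\<in>K" "d'\<in>H" "d'\<in>K"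
    and e: "fst (p x)\<otimes>d = fst (p x')\<otimes>d'" "inv d\<otimes>snd (p x) = inv d'\<otimes>snd (p x')"
   have c: "fst (p x)\<in>carrier G" "snd (p x)\<in>carrier G" "fst (p x')\<in>carrier G" "snd (p x')\<in>carrier G"
    "d\<in>carrier G" "d'\<in>carrier G"
    using p x d Hc Kc by blast+
   have "x = (fst (p x)\<otimes>d)\<otimes>(inv d\<otimes>snd (p x))" using p[OF x(1)] c by (simp add: m_assoc)
   also have "\<dots> = (fst (p x')\<otimes>d')\<otimes>(inv d'\<otimes>snd (p x'))" by (simp add: e)
   also have "\<dots> = x'" using p[OF x(2)] c by (simp add: m_assoc)
   finally have "x = x'" .
   then show "x = x' \<and> d = d'" using e c by simp
  qed
  show "?F ` ((H<#>K) \<times> (H\<inter>K)) = H \<times> K"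
  proof (rule Set.set_eqI)
   fix hk :: "'a \<times> 'a"
   obtain h k where hk: "hk = (h, k)" by fastforce
   have "(h, k)\<in>?F ` ((H<#>K) \<times> (H\<inter>K)) \<longleftrightarrow> (h, k)\<in>H \<times> K"
   proof
    assume "(h, k)\<in>?F ` ((H<#>K) \<times> (H\<inter>K))"
    then obtain x d where "x\<in>H<#>K" "d\<in>H" "d\<in>K" "h = fst (p x)\<otimes>d" "k = inv d\<otimes>snd (p x)" by auto
    then show "(h, k)\<in>H \<times> K" using p H K by (simp add: subgroup.m_closed subgroup.m_inv_closed)
   next
    assume "(h, k)\<in>H \<times> K"
    then have h: "h\<in>H" "k\<in>K" by auto
    let ?x = "h\<otimes>k"
    have x: "?x\<in>H<#>K" using h by (auto simp: set_mult_def)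
    note px = p[OF x]
    have c: "fst (p ?x)\<in>carrier G" "snd (p ?x)\<in>carrier G" "h\<in>carrier G" "k\<in>carrier G"
     using px h Hc Kc by blast+
    let ?d = "inv fst (p ?x)\<otimes>h"
    have dH: "?d\<in>H" using px h H by (simp add: subgroup.m_closed subgroup.m_inv_closed)
    have "?d = snd (p ?x)\<otimes>inv k"
     using px c by (metis inv_closed inv_solve_left m_assoc m_closed r_inv r_one)
    then have "?d\<in>K"
     using px h K by (simp add: subgroup.m_closed subgroup.m_inv_closed)
    moreover note dH
    moreover have "fst (p ?x)\<otimes>?d = h" using c by simp
    moreover have "inv ?d\<otimes>snd (p ?x) = k"
    proof -
     have "inv ?d\<otimes>snd (p ?x) = inv h\<otimes>(fst (p ?x)\<otimes>snd (p ?x))" using c by (simp add: inv_mult_group m_assoc)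
     also have "\<dots> = inv h\<otimes>(h\<otimes>k)" using px by argo
     finally show ?thesis using c by simp
    qed
    ultimately show "(h, k)\<in>?F ` ((H<#>K) \<times> (H\<inter>K))" using x by (intro image_eqI[of _ _ "(?x, ?d)"]) auto
   qed
   then show "hk\<in>?F ` ((H<#>K) \<times> (H\<inter>K)) \<longleftrightarrow> hk\<in>H \<times> K" unfolding hk .
  qed
 qed
 from bij_betw_same_card[OF this] show ?thesis by (simp add: card_cartesian_product)
qed

lemma set_mult_subgroup:
 assumes H: "subgroup H G" and K: "subgroup K G" and n: "\<And>h k. h\<in>H ==> k\<in>K ==> k\<up>h\<in>K"
 shows "subgroup (H<#>K) G"
proof (rule subgroupI)
 have Hc: "x\<in>carrier G" if "x\<in>H" for x using that H subgroup_carrier by blast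
 have Kc: "x\<in>carrier G" if "x\<in>K" for x using that K subgroup_carrier by blast
 show "H<#>K\<subseteq>carrier G" using Hc Kc by (auto simp: set_mult_def)
 show "H<#>K~={}" using H K subgroup.one_closed by (force simp: set_mult_def)
 fix x assume "x\<in>H<#>K"
 then obtain h k where h: "h\<in>H" "k\<in>K" "x = h\<otimes>k" by (auto simp: set_mult_def)
 have "inv x = inv h\<otimes>((inv k)\<up>(inv h))" using h Hc Kc by (simp add: word_simps)
 moreover have "inv h\<in>H" "(inv k)\<up>(inv h)\<in>K" using h H K n subgroup.m_inv_closed by metis+
 ultimately show "inv x\<in>H<#>K" unfolding set_mult_def by blast
 fix y assume "y\<in>H<#>K"
 then obtain h' k' where h': "h'\<in>H" "k'\<in>K" "y = h'\<otimes>k'" by (auto simp: set_mult_def)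
 have "x\<otimes>y = (h\<otimes>h')\<otimes>((k\<up>h')\<otimes>k')" using h h' Hc Kc by (simp add: word_simps)
 moreover have "h\<otimes>h'\<in>H" "(k\<up>h')\<otimes>k'\<in>K" using h h' H K n by (auto simp: subgroup.m_closed)
 ultimately show "x\<otimes>y\<in>H<#>K" unfolding set_mult_def by blast
qed

lemma set_multI: "h\<in>H ==> k\<in>K ==> h\<otimes>k\<in>H<#>K"
 by (auto simp: set_mult_def)

lemma set_mult_left: "subgroup K G ==> H\<subseteq>carrier G ==> H\<subseteq>H<#>K"
 using set_multI[of _ H \<one> K] subgroup.one_closed[of K G] by force

lemma set_mult_right: "subgroup H G ==> K\<subseteq>carrier G ==> K\<subseteq>H<#>K"
 using set_multI[of \<one> H _ K] subgroup.one_closed[of H G] by force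

lemma set_mult_subset: "subgroup S G ==> H\<subseteq>S ==> K\<subseteq>S ==> H<#>K\<subseteq>S"
 by (auto simp: set_mult_def intro!: subgroup.m_closed)


lemma p_group_fixed_points:
 fixes act :: "'a \<Rightarrow> 'c \<Rightarrow> 'c"
 assumes P: "subgroup P G" "card P = p ^ k" and p: "prime p" and X: "finite X"
  and act: "\<And>g x. g\<in>P ==> x\<in>X ==> act g x\<in>X"
   "\<And>x. x\<in>X ==> act \<one> x = x"
   "\<And>g h x. g\<in>P ==> h\<in>P ==> x\<in>X ==> act (g\<otimes>h) x = act h (act g x)"
 shows "card X mod p = card {x\<in>X. \<forall>g\<in>P. act g x = x} mod p"
proof -
 let ?P = "G\<lparr>carrier := P\<rparr>"
 let ?\<phi> = "\<lambda>g. \<lambda>x\<in>X. act (inv g) x"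
 interpret PG: group ?P using P subgroup_imp_group by blast
 have Pc: "x\<in>carrier G" if "x\<in>P" for x using that P subgroup_carrier by blast
 have iP: "inv g\<in>P" if "g\<in>P" for g using that by (rule subgroup.m_inv_closed[OF P(1)])
 have inv1: "act (inv g) (act g x) = x" "act g (act (inv g) x) = x" if "g\<in>P" "x\<in>X" for g x
  using act(3)[OF that(1) iP[OF that(1)] that(2)] act(3)[OF iP[OF that(1)] that(1) that(2)] act(2)[OF that(2)] Pc[OF that(1)]
  by simp_all
 have bij: "bij_betw (?\<phi> g) X X" if "g\<in>P" for g
  by (rule bij_betw_byWitness[of _ "act g"]) (use that act iP inv1 in auto)
 have hom: "?\<phi>\<in>hom ?P (BijGroup X)"
 proof (rule homI)
  fix g assume g: "g\<in>carrier ?P" then show "?\<phi> g\<in>carrier (BijGroup X)"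
   using bij by (simp add: BijGroup_def Bij_def)
  fix h assume h: "h\<in>carrier ?P"
  have "?\<phi> (g\<otimes>h) = compose X (?\<phi> g) (?\<phi> h)"
   unfolding compose_def using g h P Pc iP act
   by (intro ext) (auto simp: inv_mult_group subgroup.m_closed)
  then show "?\<phi> (g \<otimes>\<^bsub>?P\<^esub> h) = ?\<phi> g \<otimes>\<^bsub>BijGroup X\<^esub> ?\<phi> h"
   using bij g h by (simp add: BijGroup_def Bij_def)
 qed
 interpret A: group_action ?P X ?\<phi>
  unfolding group_action_def group_hom_def group_hom_axioms_def
  using hom group_BijGroup PG.is_group by blast
 let ?F = "{x\<in>X. \<forall>g\<in>P. act g x = x}"
 have orb: "Ob\<in>orbits ?P X ?\<phi> ==> card Ob dvd p ^ k" for Ob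
 proof -
  assume "Ob\<in>orbits ?P X ?\<phi>"
  then obtain x where x: "x\<in>X" "Ob = orbit ?P ?\<phi> x" by (auto simp: orbits_def)
  have "card Ob * card (stabilizer ?P ?\<phi> x) = p ^ k"
   using A.orbit_stabilizer_theorem[OF x(1)] x P by (simp add: order_def)
  then show "card Ob dvd p ^ k" by (metis dvd_triv_left)
 qed
 have fixI: "x\<in>?F" if O1: "Ob\<in>orbits ?P X ?\<phi>" "card Ob = 1" "x\<in>Ob" for Ob x
 proof -
  obtain y where y: "y\<in>X" "Ob = orbit ?P ?\<phi> y" using O1(1) by (auto simp: orbits_def)
  have xX: "x\<in>X" using O1 y act iP by (auto simp: orbit_def)
  have Ob: "Ob = {x}" using O1 by (metis card_1_singletonE singletonD)
  have "y\<in>Ob" using A.orbit_refl y by auto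
  then have xy: "x = y" using Ob by auto
  have "act g x = x" if "g\<in>P" for g
  proof -
   have "?\<phi> (inv g) y\<in>Ob" unfolding y(2) orbit_def using iP that by auto
   then show ?thesis using Ob xy y that Pc by auto
  qed
  then show ?thesis using xX by blast
 qed
 have finO: "finite (orbits ?P X ?\<phi>)"
  using X by (simp add: orbits_def setcompr_eq_image)
 let ?O1 = "{Ob\<in>orbits ?P X ?\<phi>. card Ob = 1}"
 let ?O2 = "{Ob\<in>orbits ?P X ?\<phi>. card Ob~=1}"
 have cX: "card X = (\<Sum>Ob\<in>orbits ?P X ?\<phi>. card Ob)"
  using A.disjoint_sum[OF X, of "\<lambda>_. 1::nat"] by simp
 also have "\<dots> = (\<Sum>Ob\<in>?O1. card Ob) + (\<Sum>Ob\<in>?O2. card Ob)"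
  by (subst sum.union_disjoint[symmetric]) (use finO in \<open>auto intro!: sum.cong\<close>)
 also have "(\<Sum>Ob\<in>?O1. card Ob) = card ?F"
 proof -
  have "bij_betw (\<lambda>x. {x}) ?F ?O1"
  proof (rule bij_betw_imageI)
   show "inj_on (\<lambda>x. {x}) ?F" by simp
   have "{x}\<in>?O1" if "x\<in>?F" for x
   proof -
    have "orbit ?P ?\<phi> x = {x}" using that iP PG.one_closed by (auto simp: orbit_def intro!: exI[of _ \<one>])
    then show ?thesis using that unfolding orbits_def by force
   qed
   moreover have "Ob\<in>(\<lambda>x. {x}) ` ?F" if O1: "Ob\<in>?O1" for Ob
   proof -
    obtain x where x: "Ob = {x}" using O1 by (auto simp: card_1_singleton_iff)
    have "x\<in>?F" by (rule fixI[of Ob]) (use O1 x in auto)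
    then show ?thesis using x by blast
   qed
   ultimately show "(\<lambda>x. {x}) ` ?F = ?O1" by blast
  qed
  then have "card ?F = card ?O1" using bij_betw_same_card by blast
  then show ?thesis by simp
 qed
 finally have "card X = card ?F + (\<Sum>Ob\<in>?O2. card Ob)" .
 moreover have "p dvd (\<Sum>Ob\<in>?O2. card Ob)"
 proof (rule dvd_sum)
  fix Ob assume Ob: "Ob\<in>?O2"
  then have "card Ob dvd p ^ k" using orb by auto
  then obtain i where "card Ob = p ^ i" using divides_primepow_nat[OF p] by blast
  then show "p dvd card Ob" using Ob by (cases i) auto
 qed
 then obtain c where "(\<Sum>Ob\<in>?O2. card Ob) = p * c" by (rule dvdE)
 ultimately show ?thesis by simp
qed

lemma prime_power_orderI:
 assumes K: "subgroup K G" "finite K" and p: "prime (p::nat)" and e: "\<And>g. g\<in>K ==> g [^] (p ^ n) = \<one>"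
 shows "\<exists>k. card K = p ^ k"
proof (rule ccontr)
 assume n: "\<not> ?thesis"
 have K0: "card K > 0" using K by (metis card_gt_0_iff empty_iff subgroup.one_closed)
 obtain m where m: "card K = p ^ multiplicity p (card K) * m" "\<not> p dvd m"
  using multiplicity_decompose'[of "card K" p] K0 p not_prime_unit by (metis not_gr_zero)
 have "m~=1" using n m by (metis mult.right_neutral)
 then obtain q where q: "prime q" "q dvd m" using prime_factor_nat by blast
 have qp: "q~=p" using q m by auto
 interpret KG: group "G\<lparr>carrier := K\<rparr>" using K subgroup_imp_group by blast
 obtain c where "card K = q ^ 1 * c" using q m by (metis dvd_def mult.left_commute power_one_right)
 then obtain R where R: "subgroup R (grp_on G K)" "card R = q ^ 1"
  using sylow_thm[of q "G\<lparr>carrier := K\<rparr>" 1 c] q K KG.is_group by (auto simp: order_def)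
 have RG: "subgroup R G" using R K incl_subgroup by blast
 have "R~={\<one>}" using R q by (auto simp: prime_nat_iff)
 then obtain g where g: "g\<in>R" "g~=\<one>" using RG subgroup.one_closed by blast
 have RK: "R\<subseteq>K" using R subgroup.subset by fastforce
 have gc: "g\<in>carrier G" using g RG subgroup_carrier by blast
 interpret RGr: group "G\<lparr>carrier := R\<rparr>" using RG subgroup_imp_group by blast
 have "g [^]\<^bsub>G\<lparr>carrier := R\<rparr>\<^esub> card R = \<one>"
  using RGr.pow_order_eq_1[of g] g by (simp add: order_def)
 then have "g [^] q = \<one>" using R by (simp add: nat_pow_consistent[symmetric])
 then have "ord g dvd q" using gc pow_eq_id by blast
 moreover have "ord g dvd p ^ n" using gc pow_eq_id e RK g by blast
 moreover have "coprime q (p ^ n)" using qp q p by (simp add: primes_coprime)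
 ultimately have "ord g = 1" by (metis coprime_common_divisor_nat nat_dvd_1_iff_1 coprime_common_divisor)
 then show False using g gc ord_eq_1 by blast
qed

end

section \<open>The group of two by two matrices of determinant one over the field of order 3\<close>

lemma GF3_cases: obtains "x = (0::3)" | "x = 1" | "x = 2"
 using exhaust_3[of x] by auto

lemma GF3_all: "(\<forall>x::3. P x) \<longleftrightarrow> P 0 \<and> P 1 \<and> P 2"
 by (metis GF3_cases)

lemma UNIV_GF3: "(UNIV :: 3 set) = {0, 1, 2}"
 using GF3_cases by blast

lemma sum_GF3: "sum f (UNIV :: 3 set) = f 0 + f 1 + f 2"
 unfolding UNIV_GF3 by (simp add: add.assoc)

lemma GF3_square: "(x::3)~=0 ==> x * x = 1"
 by (cases x rule: GF3_cases) simp_all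

lemma GF3_of_nat_eq: "(of_nat m :: 3) = of_nat n \<longleftrightarrow> m mod 3 = n mod 3"
 by (simp add: of_nat_eq_iff_cong_CHAR cong_def)

abbreviation mat2 :: "3 \<Rightarrow> 3 \<Rightarrow> 3 \<Rightarrow> 3 \<Rightarrow> 3^2^2" where
 "mat2 p q r s \<equiv> vector [vector [p, q], vector [r, s]]"

abbreviation vec2 :: "3 \<Rightarrow> 3 \<Rightarrow> 3^2" where
 "vec2 p q \<equiv> vector [p, q]"

lemma vec2_cases: obtains p q where "v = vec2 p q"
proof -
 have "v = vec2 (v $ 1) (v $ 2)" by (simp add: vec_eq_iff forall_2)
 then show ?thesis using that by blast
qed

lemma mat2_cases: obtains p q r s where "A = mat2 p q r s"
proof -
 have "A = mat2 (A $ 1 $ 1) (A $ 1 $ 2) (A $ 2 $ 1) (A $ 2 $ 2)" by (simp add: vec_eq_iff forall_2)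
 then show ?thesis using that by blast
qed

lemma vec2_eq_iff [simp]: "vec2 p q = vec2 p' q' \<longleftrightarrow> p = p' \<and> q = q'"
 by (auto simp: vec_eq_iff forall_2)

lemma mat2_eq_iff: "mat2 p q r s = mat2 p' q' r' s' \<longleftrightarrow> p = p' \<and> q = q' \<and> r = r' \<and> s = s'"
 by (auto simp: vec_eq_iff forall_2)

lemma vec2_add: "vec2 p q + vec2 p' q' = vec2 (p + p') (q + q')"
 by (simp add: vec_eq_iff forall_2)

lemma vec2_zero: "0 = vec2 0 0"
 by (simp add: vec_eq_iff forall_2)

lemma mat2_mult: "mat2 p q r s ** mat2 p' q' r' s' =
  mat2 (p * p' + q * r') (p * q' + q * s') (r * p' + s * r') (r * q' + s * s')"
 by (simp add: vec_eq_iff forall_2 matrix_matrix_mult_def sum_2)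

lemma mat2_det: "det (mat2 p q r s) = p * s - q * r"
 by (simp add: det_2)

lemma mat2_one: "mat 1 = mat2 1 0 0 1"
 by (simp add: vec_eq_iff forall_2 mat_def)

lemma vec2_mat2: "vec2 x y v* mat2 p q r s = vec2 (x * p + y * r) (x * q + y * s)"
 by (simp add: vec_eq_iff forall_2 vector_matrix_mult_def sum_2 mult.commute)

lemma SL23_sel [simp]: "carrier SL23 = {A. det A = 1}" "monoid.mult SL23 = (**)" "one SL23 = mat 1"
 by (simp_all add: SL23_def)

lemma GF3_plane_sel [simp]: "carrier GF3_plane = UNIV" "monoid.mult GF3_plane = (+)" "one GF3_plane = 0"
 by (simp_all add: GF3_plane_def)

lemma SL23_group: "group SL23"
proof (rule groupI)
 fix A assume A: "A\<in>carrier SL23"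
 obtain p q r s where pq: "A = mat2 p q r s" by (rule mat2_cases)
 have "mat2 s (-q) (-r) p\<in>carrier SL23" "mat2 s (-q) (-r) p \<otimes>\<^bsub>SL23\<^esub> A = \<one>\<^bsub>SL23\<^esub>"
  using A by (simp_all add: pq mat2_det mat2_mult mat2_one mat2_eq_iff algebra_simps)
 then show "\<exists>B\<in>carrier SL23. B \<otimes>\<^bsub>SL23\<^esub> A = \<one>\<^bsub>SL23\<^esub>" by blast
qed (auto simp: det_mul matrix_mul_assoc)

lemma GF3_plane_group: "group GF3_plane"
 by (rule groupI) (auto simp: add.assoc intro: exI[of _ "- _"])

lemma order_SL23: "order SL23 = 24"
proof -
 let ?f = "\<lambda>(p, q, r, s). mat2 p q r s"
 let ?X = "{(p, q, r, s). p * s - q * r = (1::3)}"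
 have "bij_betw ?f ?X (carrier SL23)"
 proof (rule bij_betw_imageI)
  show "inj_on ?f ?X" by (auto simp: inj_on_def mat2_eq_iff)
  have "A\<in>?f ` ?X" if A: "det A = 1" for A
  proof -
   obtain p q r s where pq: "A = mat2 p q r s" by (rule mat2_cases)
   then show ?thesis using A by (intro image_eqI[of _ _ "(p, q, r, s)"]) (auto simp: mat2_det)
  qed
  then show "?f ` ?X = carrier SL23" by (auto simp: mat2_det)
 qed
 then have "order SL23 = card ?X" by (simp add: order_def bij_betw_same_card)
 also have "\<dots> = (\<Sum>(p, q, r, s)\<in>UNIV. if p * s - q * r = (1::3) then 1 else 0)"
  by (simp add: sum.If_cases case_prod_unfold)
 also have "\<dots> = (\<Sum>p\<in>UNIV. \<Sum>q\<in>UNIV. \<Sum>r\<in>UNIV. \<Sum>s\<in>UNIV. if p * s - q * r = (1::3) then 1 else 0)"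
  by (simp add: sum.cartesian_product UNIV_Times_UNIV[symmetric] del: UNIV_Times_UNIV)
 also have "\<dots> = (\<Sum>p\<in>UNIV. \<Sum>q\<in>UNIV. \<Sum>r\<in>UNIV. if p = (0::3) then if q * r = (2::3) then 3 else 0 else 1)"
 proof -
  have "(\<Sum>s\<in>UNIV. if p * s - c = (1::3) then 1 else 0) = (if p = 0 then if c = 2 then 3 else 0 else (1::nat))" for p c
   unfolding UNIV_GF3 by (cases p rule: GF3_cases; cases c rule: GF3_cases) simp_all
  then show ?thesis by simp
 qed
 also have "\<dots> = 24"
  unfolding sum_GF3 by simp
 finally show ?thesis .
qed

lemma SL23_generated:
 assumes K: "subgroup K SL23" and x: "mat2 1 0 x 1\<in>K" "x~=0" and y: "mat2 1 y 0 1\<in>K" "y~=0"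
 shows "K = carrier SL23"
proof -
 have m: "A ** B\<in>K" if "A\<in>K" "B\<in>K" for A B
  using subgroup.m_closed[OF K that] by simp
 have one: "mat2 1 0 0 1\<in>K" using subgroup.one_closed[OF K] by (simp add: mat2_one)
 have four: "(4::3) = 1" by simp
 have low: "mat2 1 0 t 1\<in>K" for t
 proof -
  have "mat2 1 0 (2 * x) 1\<in>K" using m[OF x(1) x(1)] by (simp add: mat2_mult)
  then show ?thesis using one x four by (cases t rule: GF3_cases; cases x rule: GF3_cases) auto
 qed
 have up: "mat2 1 t 0 1\<in>K" for t
 proof -
  have "mat2 1 (2 * y) 0 1\<in>K" using m[OF y(1) y(1)] by (simp add: mat2_mult)
  then show ?thesis using one y four by (cases t rule: GF3_cases; cases y rule: GF3_cases) auto
 qed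
 have main: "mat2 p q r s\<in>K" if d: "p * s - q * r = 1" and q: "q~=0" for p q r s
 proof -
  have "mat2 1 0 (q * (s - 1)) 1 ** mat2 1 q 0 1 ** mat2 1 0 (q * (p - 1)) 1\<in>K"
   using m low up by blast
  moreover have "mat2 1 0 (q * (s - 1)) 1 ** mat2 1 q 0 1 ** mat2 1 0 (q * (p - 1)) 1 = mat2 p q r s"
  proof -
   have qq: "q * (q * t) = t" for t using GF3_square[OF q] by (simp flip: mult.assoc)
   have e1: "q * (s - 1) * q + 1 = s" using qq[of "s - 1"] by (simp add: mult.commute)
   have e2: "1 + q * (q * (p - 1)) = p" using qq[of "p - 1"] by simp
   have "q * (s - 1) + s * (q * (p - 1)) = q * (p * s - 1)" by (simp add: algebra_simps)
   also have "p * s - 1 = q * r" using d by (simp add: algebra_simps)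
   finally have e3: "q * (s - 1) + s * (q * (p - 1)) = r" by (simp add: qq)
   have "mat2 1 0 (q * (s - 1)) 1 ** mat2 1 q 0 1 = mat2 1 q (q * (s - 1)) s"
    by (simp add: mat2_mult e1)
   then show ?thesis by (simp add: mat2_mult e2 e3)
  qed
  ultimately show ?thesis by metis
 qed
 have "A\<in>K" if "det A = 1" for A
 proof -
  obtain p q r s where pq: "A = mat2 p q r s" by (rule mat2_cases)
  have d: "p * s - q * r = 1" using that by (simp add: pq mat2_det)
  show ?thesis
  proof (cases "q = 0")
   case False then show ?thesis using main d pq by blast
  next
   case True
   then have "s~=0" using d by auto
   then have "mat2 (p + r) s r s\<in>K" using d True by (intro main) (auto simp: algebra_simps)
   from m[OF up[of "-1"] this] show ?thesis by (simp add: mat2_mult pq True)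
  qed
 qed
 then show ?thesis using subgroup.subset[OF K] by auto
qed

lemma SL23_centre:
 assumes "A\<in>centre SL23" "A~=mat 1"
 shows "A = mat2 (-1) 0 0 (-1)"
proof -
 obtain p q r s where pq: "A = mat2 p q r s" by (rule mat2_cases)
 have c: "A ** B = B ** A" if "det B = 1" for B
  using assms(1) that by (auto simp: centre_def centralizer_def)
 have d: "p * s - q * r = 1" using assms(1) by (auto simp: centre_def centralizer_def pq mat2_det)
 have "q = 0" "p = s" using c[of "mat2 1 0 1 1"] by (auto simp: pq mat2_mult mat2_det mat2_eq_iff)
 moreover have "r = 0" using c[of "mat2 1 1 0 1"] by (auto simp: pq mat2_mult mat2_det mat2_eq_iff)
 ultimately show ?thesis using d assms(2) unfolding pq mat2_one mat2_eq_iff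
  by (cases s rule: GF3_cases) auto
qed

lemma SL23_minus_one_central: "mat2 (-1) 0 0 (-1)\<in>centre SL23"
proof -
 have "mat2 (-1) 0 0 (-1) ** A = A ** mat2 (-1) 0 0 (-1)" for A
  by (rule mat2_cases[of A]) (simp add: mat2_mult)
 then show ?thesis by (simp add: centre_def centralizer_def mat2_det)
qed

text \<open>\<open>n = aba\<close> interchanges \<open>a\<close> and \<open>b\<close>, so
 \<open>n\<^sup>2\<close> is central, and the cubes force \<open>n\<^sup>4 = 1\<close>.  A list of 24 words in
 \<open>a\<close> and \<open>n\<close> is then closed under right multiplication.\<close>

lemma (in group) braid_group_bound:
 assumes a: "a\<in>carrier G" "a [^] (3::nat) = \<one>" and b: "b\<in>carrier G" "b [^] (3::nat) = \<one>"
  and braid: "a\<otimes>b\<otimes>a = b\<otimes>a\<otimes>b"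
 shows "finite (generate G {a, b})" "card (generate G {a, b}) \<le> 24"
proof -
 note ac = a(1) b(1)
 define n where "n = a\<otimes>b\<otimes>a"
 define z where "z = n\<otimes>n"
 have nc: "n\<in>carrier G" and zc: "z\<in>carrier G" using ac by (simp_all add: n_def z_def)
 have a3: "a\<otimes>(a\<otimes>a) = \<one>" using a by (simp add: numeral_3_eq_3 m_assoc)
 have a3': "a\<otimes>(a\<otimes>(a\<otimes>w)) = w" if "w\<in>carrier G" for w
  using a3 that ac by (metis l_one m_assoc m_closed)
 have b3: "b\<otimes>(b\<otimes>b) = \<one>" using b by (simp add: numeral_3_eq_3 m_assoc)
 have ia: "inv a = a\<otimes>a" using a3 ac by (metis inv_equality m_assoc m_closed)
 have na: "n\<otimes>a = b\<otimes>n"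
  using braid ac unfolding n_def by (metis m_assoc m_closed)
 have nb: "n\<otimes>b = a\<otimes>n"
  using braid ac unfolding n_def by (metis m_assoc m_closed)
 have za: "z\<otimes>a = a\<otimes>z"
  unfolding z_def using na nb nc ac by (metis m_assoc)
 have zn: "z\<otimes>n = n\<otimes>z" unfolding z_def using nc by (simp add: m_assoc)
 have b_eq: "b = a\<otimes>(a\<otimes>(n\<otimes>(a\<otimes>a)))"
  unfolding n_def using ac a3 a3' by (simp add: m_assoc)
 have nan: "n\<otimes>(a\<otimes>n) = a\<otimes>(a\<otimes>(n\<otimes>(a\<otimes>(a\<otimes>z))))"
 proof -
  have "n\<otimes>(a\<otimes>n) = b\<otimes>z" using na nc ac unfolding z_def by (simp flip: m_assoc)
  then show ?thesis using b_eq nc zc ac by (simp add: m_assoc)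
 qed
 have zz: "z\<otimes>z = \<one>"
 proof -
  have "b\<otimes>(b\<otimes>b) = a\<otimes>(a\<otimes>(n\<otimes>(a\<otimes>(n\<otimes>(a\<otimes>(n\<otimes>(a\<otimes>a)))))))"
   unfolding b_eq using nc ac a3' by (simp add: m_assoc)
  also have "n\<otimes>(a\<otimes>(n\<otimes>(a\<otimes>(n\<otimes>(a\<otimes>a))))) = (n\<otimes>(a\<otimes>n))\<otimes>(a\<otimes>(n\<otimes>(a\<otimes>a)))"
   using nc ac by (simp add: m_assoc)
  also have "\<dots> = a\<otimes>(a\<otimes>(n\<otimes>(a\<otimes>(a\<otimes>(a\<otimes>(z\<otimes>(n\<otimes>(a\<otimes>a))))))))"
   unfolding nan using za nc zc ac by (simp add: m_assoc) (metis m_assoc m_closed)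
  also have "\<dots> = a\<otimes>(a\<otimes>(n\<otimes>(z\<otimes>(n\<otimes>(a\<otimes>a)))))"
   using nc zc ac a3' by simp
  also have "\<dots> = a\<otimes>(a\<otimes>(z\<otimes>(z\<otimes>(a\<otimes>a))))"
   using zn nc zc ac unfolding z_def by (simp add: m_assoc)
  finally have "\<one> = a\<otimes>(a\<otimes>(a\<otimes>(a\<otimes>(z\<otimes>(z\<otimes>(a\<otimes>a))))))"
   using b3 by simp
  also have "\<dots> = a\<otimes>(z\<otimes>(z\<otimes>(a\<otimes>a)))" using a3' ac zc by simp
  also have "\<dots> = z\<otimes>(z\<otimes>(a\<otimes>(a\<otimes>a)))" using za ac zc by (metis m_assoc m_closed)
  finally show ?thesis using a3 zc by simp
 qed
 have zz': "z\<otimes>(z\<otimes>w) = w" if "w\<in>carrier G" for w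
  using zz that zc by (metis l_one m_assoc)
 have za': "z\<otimes>(a\<otimes>w) = a\<otimes>(z\<otimes>w)" if "w\<in>carrier G" for w
  using za that zc ac by (metis m_assoc)
 have zn': "z\<otimes>(n\<otimes>w) = n\<otimes>(z\<otimes>w)" if "w\<in>carrier G" for w
  using zn that zc nc by (metis m_assoc)
 have nn: "n\<otimes>n = z" by (simp add: z_def)
 have nn': "n\<otimes>(n\<otimes>w) = z\<otimes>w" if "w\<in>carrier G" for w
  using that nc unfolding z_def by (simp add: m_assoc)
 have nan': "n\<otimes>(a\<otimes>(n\<otimes>w)) = a\<otimes>(a\<otimes>(n\<otimes>(a\<otimes>(a\<otimes>(z\<otimes>w)))))" if "w\<in>carrier G" for w
 proof -
  have "n\<otimes>(a\<otimes>(n\<otimes>w)) = (n\<otimes>(a\<otimes>n))\<otimes>w" using that nc ac by (simp add: m_assoc)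
  then show ?thesis unfolding nan using that nc ac zc by (simp add: m_assoc)
 qed
 have naan: "n\<otimes>(a\<otimes>(a\<otimes>n)) = a\<otimes>(n\<otimes>a)"
 proof -
  have 1: "n\<otimes>(a\<otimes>(a\<otimes>n)) = b\<otimes>(b\<otimes>z)"
   using na nc ac unfolding z_def by (metis m_assoc m_closed)
  have bb: "b\<otimes>b = a\<otimes>(a\<otimes>(n\<otimes>(a\<otimes>(n\<otimes>(a\<otimes>a)))))"
   unfolding b_eq using nc ac a3' by (simp add: m_assoc)
  have "b\<otimes>(b\<otimes>z) = (b\<otimes>b)\<otimes>z" using ac zc by (simp add: m_assoc)
  also have "\<dots> = a\<otimes>(a\<otimes>(n\<otimes>(a\<otimes>(n\<otimes>(a\<otimes>(a\<otimes>z))))))"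
   unfolding bb using nc ac zc by (simp add: m_assoc)
  also have "\<dots> = a\<otimes>(a\<otimes>(a\<otimes>(a\<otimes>(n\<otimes>(a\<otimes>(a\<otimes>(z\<otimes>(a\<otimes>(a\<otimes>z)))))))))"
   using nc ac zc nan' by simp
  also have "\<dots> = a\<otimes>(n\<otimes>a)"
   using nc ac zc a3' za' zz by simp
  finally show ?thesis unfolding 1 .
 qed
 have naan': "n\<otimes>(a\<otimes>(a\<otimes>(n\<otimes>w))) = a\<otimes>(n\<otimes>(a\<otimes>w))" if "w\<in>carrier G" for w
 proof -
  have "n\<otimes>(a\<otimes>(a\<otimes>(n\<otimes>w))) = (n\<otimes>(a\<otimes>(a\<otimes>n)))\<otimes>w" using that nc ac by (simp add: m_assoc)
  then show ?thesis unfolding naan using that nc ac zc by (simp add: m_assoc)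
 qed
 let ?P = "{\<one>, a, a\<otimes>a}" and ?Z = "{\<one>, z}"
 define X where "X = (\<lambda>(i, e). i\<otimes>e) ` (?P \<times> ?Z) \<union> (\<lambda>(i, j, e). i\<otimes>(n\<otimes>(j\<otimes>e))) ` (?P \<times> ?P \<times> ?Z)"
 have Xa: "x\<otimes>a\<in>X" if "x\<in>X" for x
  using that ac nc zc unfolding X_def by (auto simp: m_assoc za za' zz zz' a3 a3' image_iff)
 have Xn: "x\<otimes>n\<in>X" if "x\<in>X" for x
  using that ac nc zc unfolding X_def by (auto simp: m_assoc nn nn' zn zn' za za' zz zz' a3 a3' nan nan' naan naan' image_iff)
 have Xc: "X\<subseteq>carrier G" using ac nc zc unfolding X_def by auto
 have Xb: "x\<otimes>b\<in>X" if x: "x\<in>X" for x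
 proof -
  have "x\<otimes>a\<otimes>a\<otimes>n\<otimes>a\<otimes>a\<in>X" using Xa Xn x by meson
  moreover have xc: "x\<in>carrier G" using x Xc by blast
  have "x\<otimes>b = x\<otimes>a\<otimes>a\<otimes>n\<otimes>a\<otimes>a" by (subst b_eq) (simp add: ac nc xc m_assoc)
  ultimately show ?thesis by metis
 qed
 have "\<forall>x\<in>X. x\<otimes>g\<in>X" if "g\<in>generate G {a, b}" for g
  using that
 proof (induction rule: generate.induct)
  case one show ?case using Xc by (metis (no_types, lifting) r_one subsetD)
 next
  case (incl h) then show ?case using Xa Xb by blast
 next
  case (inv h)
  have ib: "inv b = b\<otimes>b" using b3 ac by (metis inv_equality m_assoc m_closed)
  have "x\<otimes>inv h\<in>X" if x: "x\<in>X" for x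
  proof -
   have "x\<otimes>a\<otimes>a\<in>X" "x\<otimes>b\<otimes>b\<in>X" using x Xa Xb by meson+
   moreover have xc: "x\<in>carrier G" using x Xc by blast
   have "x\<otimes>inv a = x\<otimes>a\<otimes>a" "x\<otimes>inv b = x\<otimes>b\<otimes>b"
    unfolding ia ib by (simp_all add: ac xc m_assoc)
   ultimately show ?thesis using inv by (metis insertE singletonD)
  qed
  then show ?case by blast
 next
  case (eng g h)
  have "{a, b}\<subseteq>carrier G" using ac by simp
  then have gc: "g\<in>carrier G" "h\<in>carrier G" using eng generate_in_carrier by blast+
  have "x\<otimes>(g\<otimes>h)\<in>X" if x: "x\<in>X" for x
  proof -
   have "x\<otimes>g\<otimes>h\<in>X" using x eng by meson
   moreover have "x\<in>carrier G" using x Xc by blast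
   then have "x\<otimes>g\<otimes>h = x\<otimes>(g\<otimes>h)" using gc by (simp add: m_assoc)
   ultimately show ?thesis by metis
  qed
  then show ?case by blast
 qed
 moreover have "\<one>\<in>X" unfolding X_def by force
 moreover have "generate G {a, b}\<subseteq>carrier G" using ac by (simp add: generate_incl)
 ultimately have sub: "generate G {a, b}\<subseteq>X" by (metis (no_types, lifting) l_one subsetD subsetI)
 have fin: "finite X" unfolding X_def by simp
 show "finite (generate G {a, b})" using sub fin finite_subset by blast
 have cP: "card ?P \<le> 3" "card ?Z \<le> 2" by (auto simp: card_insert_if)
 have "card X \<le> card (?P \<times> ?Z) + card (?P \<times> ?P \<times> ?Z)"
  unfolding X_def by (rule order_trans[OF card_Un_le]) (intro add_mono card_image_le; simp add: mult.commute)
 also have "\<dots> \<le> 3 * 2 + 3 * (3 * 2)"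
  unfolding card_cartesian_product using cP by (intro add_mono mult_mono) auto
 finally show "card (generate G {a, b}) \<le> 24"
  using card_mono[OF fin sub] by simp
qed

section \<open>Sections as natural modules\<close>

context group
begin

lemma pow_mod_3: "[|x\<in>carrier G; x [^] (3::nat) = \<one>|] ==> x [^] (n::nat) = x [^] (n mod 3)"
proof -
 assume x: "x\<in>carrier G" "x [^] (3::nat) = \<one>"
 have "x [^] n = x [^] (3 * (n div 3))\<otimes>x [^] (n mod 3)" using x by (simp add: nat_pow_mult)
 also have "x [^] (3 * (n div 3)) = \<one>" using x by (simp flip: nat_pow_pow)
 finally show ?thesis using x by simp
qed

lemma rcos_eq_iff:
 assumes "subgroup B G" "x\<in>carrier G" "y\<in>carrier G"
 shows "B #> x = B #> y \<longleftrightarrow> x\<otimes>inv y\<in>B"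
proof -
 have "B #> x = B #> y \<longleftrightarrow> x\<in>B #> y"
  using assms repr_independence rcos_self by metis
 then show ?thesis using subgroup.rcos_module[OF assms(1) is_group assms(3,2)] by blast
qed

lemma rcos_eq_self_iff:
 assumes "subgroup B G" "x\<in>carrier G" shows "B #> x = B \<longleftrightarrow> x\<in>B"
 using rcos_eq_iff[OF assms one_closed] assms subgroup.subset[OF assms(1)] by simp

lemma normal_onI:
 assumes A: "subgroup A G" and B: "subgroup B G" "B\<subseteq>A" and c: "\<And>a b. a\<in>A ==> b\<in>B ==> b\<up>a\<in>B"
 shows "B \<lhd> G\<lparr>carrier := A\<rparr>"
proof -
 interpret AG: group "G\<lparr>carrier := A\<rparr>" using A subgroup_imp_group by blast
 have "x\<otimes>h\<otimes>inv x\<in>B" if "x\<in>A" "h\<in>B" for x h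
 proof -
  have "h\<up>inv x\<in>B" using c[OF subgroup.m_inv_closed[OF A that(1)] that(2)] .
  then show ?thesis using subgroup_carrier[OF A that(1)] by (simp add: conj_el_def)
 qed
 moreover have "subgroup B (grp_on G A)" using A B subgroup_incl by blast
 ultimately show ?thesis unfolding AG.normal_inv_iff using A m_inv_consistent by simp
qed

lemma normal_on_conj:
 assumes A: "subgroup A G" and B: "B \<lhd> G\<lparr>carrier := A\<rparr>" and x: "x\<in>A" "h\<in>B"
 shows "h\<up>x\<in>B"
proof -
 interpret N: normal B "G\<lparr>carrier := A\<rparr>" by fact
 have "inv\<^bsub>G\<lparr>carrier := A\<rparr>\<^esub> x\<otimes>h\<otimes>x\<in>B" using N.inv_op_closed1[of x h] x by simp
 then show ?thesis using A x by (simp add: conj_el_def)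
qed

lemma section_mult:
 assumes A: "subgroup A G" and B: "B \<lhd> G\<lparr>carrier := A\<rparr>" and x: "x\<in>A" "y\<in>A"
 shows "(B #> x)<#>(B #> y) = B #> (x\<otimes>y)"
 using normal.rcos_sum[OF B] x by simp

lemma section_carrier: "carrier (G\<lparr>carrier := A\<rparr> Mod B) = (\<lambda>a. B #> a) ` A"
 by (auto simp: carrier_FactGroup)

lemma section_order:
 assumes A: "subgroup A G" "finite A" and B: "subgroup B G" "B\<subseteq>A"
 shows "order (G\<lparr>carrier := A\<rparr> Mod B) * card B = card A"
proof -
 interpret AG: group "G\<lparr>carrier := A\<rparr>" using A subgroup_imp_group by blast
 have "subgroup B (grp_on G A)" using A B subgroup_incl by blast
 from AG.lagrange[OF this] show ?thesis by (simp add: order_def FactGroup_def)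
qed

end

definition GF3_rep :: "3 \<Rightarrow> nat" where
 "GF3_rep x = (if x = 0 then 0 else if x = 1 then 1 else 2)"

lemma GF3_rep_add: "GF3_rep (x + y) mod 3 = (GF3_rep x + GF3_rep y) mod 3"
proof -
 have "(3::3) = 0" "(4::3) = 1" by simp_all
 then show ?thesis
  by (cases x rule: GF3_cases; cases y rule: GF3_cases) (simp_all add: GF3_rep_def)
qed

lemma GF3_of_nat_rep: "of_nat (GF3_rep x) = x"
 by (cases x rule: GF3_cases) (simp_all add: GF3_rep_def)

lemma GF3_rep_eq_0: "GF3_rep x = 0 \<longleftrightarrow> x = 0"
 by (simp add: GF3_rep_def)

lemma GF3_rep_cases: "GF3_rep x = 0 \<or> GF3_rep x = 1 \<or> GF3_rep x = 2"
 by (simp add: GF3_rep_def)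

lemma (in comm_group) plane_iso:
 assumes o: "order G = 9" and e: "\<And>x. x\<in>carrier G ==> x [^] (3::nat) = \<one>"
  and u: "u\<in>carrier G" "u~=\<one>" and v: "v\<in>carrier G" "\<And>n::nat. v~=u [^] n"
 obtains \<psi> where "\<psi>\<in>iso G GF3_plane" "\<psi> u = vec2 1 0" "\<psi> v = vec2 0 1"
proof -
 define h where "h w = u [^] GF3_rep (w $ 1)\<otimes>v [^] GF3_rep (w $ 2)" for w :: "3^2"
 have add: "x [^] GF3_rep (i + j) = x [^] GF3_rep i\<otimes>x [^] GF3_rep j" if "x\<in>carrier G" for x i j
 proof -
  have "x [^] GF3_rep (i + j) = x [^] ((GF3_rep i + GF3_rep j) mod 3)"
   using pow_mod_3[OF that e[OF that], of "GF3_rep (i + j)"] by (simp add: GF3_rep_add)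
  also have "\<dots> = x [^] (GF3_rep i + GF3_rep j)" using pow_mod_3[OF that e[OF that]] by metis
  finally show ?thesis using that by (simp add: nat_pow_mult)
 qed
 have hom: "h\<in>hom GF3_plane G"
 proof (rule homI)
  fix x y :: "3^2"
  show "h x\<in>carrier G" using u v by (simp add: h_def)
  have "h (x + y) = (u [^] GF3_rep (x $ 1)\<otimes>u [^] GF3_rep (y $ 1))\<otimes>(v [^] GF3_rep (x $ 2)\<otimes>v [^] GF3_rep (y $ 2))"
   using u v by (simp add: h_def add)
  also have "\<dots> = h x\<otimes>h y" using u v by (simp add: h_def m_ac)
  finally show "h (x \<otimes>\<^bsub>GF3_plane\<^esub> y) = h x\<otimes>h y" by simp
 qed
 interpret GH: group_hom GF3_plane G h
  unfolding group_hom_def group_hom_axioms_def using hom GF3_plane_group is_group by blast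
 have inv_u: "inv (u [^] n) = u [^] (2 * n)" for n :: nat
 proof (rule inv_equality)
  have "u [^] (2 * n)\<otimes>u [^] n = u [^] (3 * n)" using u by (simp add: nat_pow_mult)
  then show "u [^] (2 * n)\<otimes>u [^] n = \<one>" using u e by (simp flip: nat_pow_pow)
 qed (use u in auto)
 have ker: "w = 0" if w: "h w = \<one>" for w
 proof -
  let ?i = "GF3_rep (w $ 1)" and ?j = "GF3_rep (w $ 2)"
  have eq: "v [^] ?j = u [^] (2 * ?i)"
  proof -
   have "v [^] ?j = inv (u [^] ?i)" using w u v unfolding h_def
    by (metis inv_equality m_comm nat_pow_closed)
   then show ?thesis by (simp add: inv_u)
  qed
  have j0: "?j = 0"
  proof (rule ccontr)
   assume "?j~=0"
   then consider "?j = 1" | "?j = 2" using GF3_rep_cases[of "w $ 2"] by metis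
   then show False
   proof cases
    case 1 then have "v = u [^] (2 * ?i)" using eq v(1) by simp
    then show False using v(2) by blast
   next
    case 2
    have "v = v [^] (4::nat)" using pow_mod_3[OF v(1) e[OF v(1)], of 4] v by simp
    also have "\<dots> = (v [^] (2::nat)) [^] (2::nat)" using v by (simp add: nat_pow_pow)
    also have "\<dots> = u [^] (2 * ?i * 2)" using eq 2 u by (simp add: nat_pow_pow)
    finally show False using v(2) by blast
   qed
  qed
  then have "u [^] ?i = \<one>" using w u v by (simp add: h_def)
  moreover have "?i = 0 \<or> ?i = 1 \<or> ?i = 2" by (rule GF3_rep_cases)
  moreover have "u [^] (2::nat)~=\<one>"
  proof
   assume "u [^] (2::nat) = \<one>"
   then have "u [^] (3::nat) = u" using u by (simp add: numeral_3_eq_3 numeral_2_eq_2)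
   then show False using e u by auto
  qed
  ultimately have "?i = 0" using u by auto
  with j0 show "w = 0" by (simp add: GF3_rep_eq_0 vec_eq_iff forall_2)
 qed
 have inj: "inj h"
 proof (rule injI)
  fix x y assume "h x = h y"
  then have "h (x - y) = \<one>"
   using GH.hom_mult[of "x - y" y] u v by (metis GF3_plane_sel(1,2) GH.hom_closed UNIV_I diff_add_cancel l_cancel_one' m_comm)
  then show "x = y" using ker by fastforce
 qed
 have fin: "finite (carrier G)" using o by (metis card.infinite order_def zero_neq_numeral)
 have "card (range h) = card (carrier G)"
  using inj o by (simp add: card_image order_def)
 then have surj: "range h = carrier G" using GH.hom_closed fin by (intro card_subset_eq) auto
 have "h\<in>iso GF3_plane G" using hom inj surj by (simp add: iso_def bij_betw_def)
 then have "inv_into (carrier GF3_plane) h\<in>iso G GF3_plane"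
  by (rule group.iso_set_sym[OF GF3_plane_group])
 moreover have "h (vec2 1 0) = u" "h (vec2 0 1) = v" using u v by (simp_all add: h_def GF3_rep_def)
 then have "inv_into UNIV h u = vec2 1 0" "inv_into UNIV h v = vec2 0 1" using inj by (metis inv_f_f)+
 ultimately show ?thesis using that[of "inv_into UNIV h"] by simp
qed

lemma mat_row_mult: "((A :: 3^2^2) ** B) $ i = A $ i v* B"
 by (simp add: vec_eq_iff matrix_matrix_mult_def vector_matrix_mult_def mult.commute)

text \<open>In a basis of \<open>A/B\<close> adapted to \<open>U/B\<close> and \<open>V/B\<close>, the groups
 \<open>P\<close> and \<open>R\<close> act by upper and lower transvections, which generate
 \<open>SL\<^sub>2(3)\<close>.\<close>

lemma (in group) natural_module_recognition:
 assumes A: "subgroup A G" "finite A" and B: "subgroup B G" and card: "card A = 9 * card B"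
  and U: "subgroup U G" "B\<subseteq>U" "U\<subseteq>A" "U~=B"
  and V: "subgroup V G" "B\<subseteq>V" "V\<subseteq>A" "V~=B" and A12: "U\<inter>V\<subseteq>B"
  and cube: "\<And>x. x\<in>A ==> x [^] (3::nat)\<in>B" and ab: "\<And>x y. x\<in>A ==> y\<in>A ==> [.x, y.]\<in>B"
  and L: "L = generate G (P \<union> R)" "P \<union> R\<subseteq>carrier G" "L\<subseteq>normalizing A\<inter>normalizing B"
  and P: "\<And>a g. a\<in>A ==> g\<in>P ==> [.a, g.]\<in>U" "\<And>a g. a\<in>U ==> g\<in>P ==> [.a, g.]\<in>B"
   "\<exists>a\<in>A. \<exists>g\<in>P. [.a, g.]~:B"
  and R: "\<And>a g. a\<in>A ==> g\<in>R ==> [.a, g.]\<in>V" "\<And>a g. a\<in>V ==> g\<in>R ==> [.a, g.]\<in>B"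
   "\<exists>a\<in>A. \<exists>g\<in>R. [.a, g.]~:B"
 shows "natural_SL23_module G L (L\<inter>trivial_on A B) A B"
proof -
 have Lsub: "subgroup L G" unfolding L(1) using L(2) by (rule generate_is_subgroup)
 have Lc: "g\<in>carrier G" if "g\<in>L" for g using Lsub that subgroup_carrier by blast
 have PL: "g\<in>L" if "g\<in>P" for g unfolding L(1) using that by (intro generate.incl) auto
 have RL: "g\<in>L" if "g\<in>R" for g unfolding L(1) using that by (intro generate.incl) auto
 have Ac: "a\<in>carrier G" if "a\<in>A" for a using A that subgroup_carrier by blast
 have BA: "B\<subseteq>A" using U by blast
 have Lconj: "a\<up>g\<in>A" "b\<up>g\<in>B" if "g\<in>L" "a\<in>A" "b\<in>B" for a b g
  using that L(3) normalizing_conj by blast+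
 note Am = subgroup.m_closed[OF A(1)] and Ai = subgroup.m_inv_closed[OF A(1)]
 have BnA: "B \<lhd> G\<lparr>carrier := A\<rparr>"
 proof (rule normal_onI[OF A(1) B BA])
  fix a b assume x: "a\<in>A" "b\<in>B"
  then have "b\<up>a = b\<otimes>[.b, a.]" using Ac BA by (intro conj_el_eq_comm) auto
  moreover have "[.b, a.]\<in>B" using x ab[of b a] BA by blast
  ultimately show "b\<up>a\<in>B" using x B subgroup.m_closed[of B G b] by metis
 qed
 let ?M = "G\<lparr>carrier := A\<rparr> Mod B"
 interpret BN: normal B "G\<lparr>carrier := A\<rparr>" by (rule BnA)
 interpret M: group ?M by (rule BN.factorgroup_is_group)
 have Mc: "carrier ?M = (\<lambda>a. B #> a) ` A" by (rule section_carrier)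
 have Mm: "(B #> x) \<otimes>\<^bsub>?M\<^esub> (B #> y) = B #> (x\<otimes>y)" if "x\<in>A" "y\<in>A" for x y
  using section_mult[OF A(1) BnA that] by simp
 have Beq: "B #> x = B #> y \<longleftrightarrow> x\<otimes>inv y\<in>B" if "x\<in>A" "y\<in>A" for x y
  using rcos_eq_iff[OF B] that Ac by blast
 interpret M: comm_group ?M
 proof (rule M.group_comm_groupI)
  fix X Y assume "X\<in>carrier ?M" "Y\<in>carrier ?M"
  then obtain x y where x: "x\<in>A" "X = B #> x" and y: "y\<in>A" "Y = B #> y" unfolding Mc by auto
  have "(x\<otimes>y)\<otimes>inv (y\<otimes>x) = [.inv x, inv y.]" using x y Ac by (simp add: word_simps)
  then have "(x\<otimes>y)\<otimes>inv (y\<otimes>x)\<in>B" using ab[OF Ai[OF x(1)] Ai[OF y(1)]] by argo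
  then have "B #> (x\<otimes>y) = B #> (y\<otimes>x)" using Beq x y Am by simp
  then show "X \<otimes>\<^bsub>?M\<^esub> Y = Y \<otimes>\<^bsub>?M\<^esub> X" using x y Mm by metis
 qed
 have Mpow: "(B #> x) [^]\<^bsub>?M\<^esub> (n::nat) = B #> (x [^] n)" if "x\<in>A" for x n
  using BN.FactGroup_pow[of x n] that A nat_pow_consistent by (simp add: nat_pow_consistent[symmetric])
 have cB: "card B > 0" using B BA A by (metis card_gt_0_iff empty_iff finite_subset subgroup.one_closed)
 have Mo: "order ?M = 9" using section_order[OF A B BA] card cB by simp
 have M3: "X [^]\<^bsub>?M\<^esub> (3::nat) = \<one>\<^bsub>?M\<^esub>" if X: "X\<in>carrier ?M" for X
 proof -
  obtain x where x: "x\<in>A" "X = B #> x" using X unfolding Mc by auto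
  then show ?thesis using Mpow cube[OF x(1)] rcos_eq_self_iff[OF B] Ac[OF x(1)] by simp
 qed
 obtain u where u: "u\<in>U" "u~:B" using U by blast
 obtain v where v: "v\<in>V" "v~:B" using V by blast
 have uA: "u\<in>A" and vA: "v\<in>A" using u v U V by auto
 have upow: "u [^] (n::nat)\<in>U" "v [^] (n::nat)\<in>V" for n using u v U V subgroup_pow by blast+
 have upowA: "u [^] (n::nat)\<in>A" "v [^] (n::nat)\<in>A" for n using upow U V by blast+
 have "B #> u~=\<one>\<^bsub>?M\<^esub>" using rcos_eq_self_iff[OF B] u uA Ac by simp
 moreover have "B #> v~=(B #> u) [^]\<^bsub>?M\<^esub> (n::nat)" for n
 proof
  assume "B #> v = (B #> u) [^]\<^bsub>?M\<^esub> n"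
  then have "v\<otimes>inv (u [^] n)\<in>B" using Mpow uA Beq vA upowA by simp
  then have "v\<otimes>inv (u [^] n)\<in>U" using U by blast
  then have "v\<in>U"
   using subgroup_mult_cancel(2)[OF U(1) subgroup.m_inv_closed[OF U(1) upow(1)] Ac[OF vA]] by blast
  then show False using v A12 by blast
 qed
 moreover have "B #> u\<in>carrier ?M" "B #> v\<in>carrier ?M" using uA vA unfolding Mc by auto
 ultimately obtain \<psi> where \<psi>: "\<psi>\<in>iso ?M GF3_plane" "\<psi> (B #> u) = vec2 1 0" "\<psi> (B #> v) = vec2 0 1"
  using M.plane_iso[OF Mo M3] by metis
 define ps where "ps a = \<psi> (B #> a)" for a
 have ps_mult: "ps (x\<otimes>y) = ps x + ps y" if "x\<in>A" "y\<in>A" for x y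
 proof -
  have "\<psi> ((B #> x) \<otimes>\<^bsub>?M\<^esub> (B #> y)) = \<psi> (B #> x) + \<psi> (B #> y)"
   using hom_mult[of \<psi> ?M GF3_plane "B #> x" "B #> y"] \<psi>(1) that unfolding iso_def Mc by auto
  then show ?thesis unfolding ps_def using Mm that by metis
 qed
 have \<psi>inj: "inj_on \<psi> (carrier ?M)" using \<psi>(1) by (auto simp: iso_def bij_betw_def)
 have ps_eq: "ps x = ps y \<longleftrightarrow> x\<otimes>inv y\<in>B" if "x\<in>A" "y\<in>A" for x y
  unfolding ps_def using inj_on_eq_iff[OF \<psi>inj, of "B #> x" "B #> y"] that Beq Mc by auto
 have ps_1: "ps \<one> = 0" using ps_mult[of \<one> \<one>] subgroup.one_closed[OF A(1)] by simp
 have ps_0: "ps x = 0 \<longleftrightarrow> x\<in>B" if "x\<in>A" for x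
  using ps_eq[of x \<one>] that ps_1 subgroup.one_closed[OF A(1)] Ac by simp
 have ps_uv: "ps u = vec2 1 0" "ps v = vec2 0 1" using \<psi> by (simp_all add: ps_def)
 have ps_pow: "ps (x [^] (n::nat)) $ i = of_nat n * ps x $ i" if "x\<in>A" for x n i
 proof (induction n)
  case 0 then show ?case using ps_1 by simp
 next
  case (Suc n)
  have "ps (x [^] Suc n) = ps (x [^] n) + ps x"
   using that A(1) subgroup_pow by (simp add: ps_mult)
  then show ?case using Suc by (simp add: algebra_simps)
 qed
 have ps_uv_pow: "ps (u [^] (m::nat)\<otimes>v [^] (n::nat)) = vec2 (of_nat m) (of_nat n)" for m n
  using ps_mult[OF upowA] by (simp add: vec_eq_iff forall_2 ps_pow uA vA ps_uv)
 have decomp: "\<exists>b\<in>B. \<exists>m n::nat. a = b\<otimes>(u [^] m\<otimes>v [^] n) \<and> ps a = vec2 (of_nat m) (of_nat n)"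
  if a: "a\<in>A" for a
 proof -
  obtain p q where pq: "ps a = vec2 p q" by (rule vec2_cases)
  let ?m = "GF3_rep p" and ?n = "GF3_rep q"
  let ?w = "u [^] ?m\<otimes>v [^] ?n"
  have w: "?w\<in>A" using Am upowA by blast
  have "ps a = ps ?w" by (simp add: ps_uv_pow pq GF3_of_nat_rep)
  then have "a\<otimes>inv ?w\<in>B" using ps_eq a w by blast
  moreover have "a = (a\<otimes>inv ?w)\<otimes>?w" using Ac[OF a] Ac[OF w] by (simp only: m_assoc inv_closed l_inv r_one)
  moreover have "ps a = vec2 (of_nat ?m) (of_nat ?n)" by (simp add: pq GF3_of_nat_rep)
  ultimately show ?thesis by blast
 qed
 have ps_A1: "ps a $ 2 = 0" if a: "a\<in>U" for a
 proof -
  obtain b m n where d: "b\<in>B" "a = b\<otimes>(u [^] (m::nat)\<otimes>v [^] (n::nat))" "ps a = vec2 (of_nat m) (of_nat n)"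
   using decomp a U by blast
  have vc: "v [^] n\<in>carrier G" using upowA Ac by blast
  have "u [^] m\<otimes>v [^] n\<in>U"
   using subgroup_mult_cancel(1)[OF U(1), of b] a d U(2) upowA Ac by auto
  then have "v [^] n\<in>U" using subgroup_mult_cancel(1)[OF U(1) upow(1) vc] by blast
  then have "v [^] n\<in>B" using upow A12 by blast
  then have "ps (v [^] n) = 0" using ps_0[OF upowA(2)] by blast
  then have "ps (v [^] n) $ 2 = 0" by simp
  then show ?thesis using d(3) by (simp add: ps_pow vA ps_uv)
 qed
 have ps_A2: "ps a $ 1 = 0" if a: "a\<in>V" for a
 proof -
  obtain b m n where d: "b\<in>B" "a = b\<otimes>(u [^] (m::nat)\<otimes>v [^] (n::nat))" "ps a = vec2 (of_nat m) (of_nat n)"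
   using decomp a V by blast
  have uc: "u [^] m\<in>carrier G" using upowA Ac by blast
  have "u [^] m\<otimes>v [^] n\<in>V"
   using subgroup_mult_cancel(1)[OF V(1), of b] a d V(2) upowA Ac by auto
  then have "u [^] m\<in>V" using subgroup_mult_cancel(2)[OF V(1) upow(2) uc] by blast
  then have "u [^] m\<in>B" using upow A12 by blast
  then have "ps (u [^] m) = 0" using ps_0[OF upowA(1)] by blast
  then have "ps (u [^] m) $ 1 = 0" by simp
  then show ?thesis using d(3) by (simp add: ps_pow uA ps_uv)
 qed
 define \<phi> where "\<phi> g = (vector [ps (u\<up>g), ps (v\<up>g)] :: 3^2^2)" for g
 have \<phi>_row: "\<phi> g $ 1 = ps (u\<up>g)" "\<phi> g $ 2 = ps (v\<up>g)" for g by (simp_all add: \<phi>_def)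
 have key: "ps (a\<up>g) = ps a v* \<phi> g" if a: "a\<in>A" and g: "g\<in>L" for a g
 proof -
  obtain b m n where d: "b\<in>B" "a = b\<otimes>(u [^] (m::nat)\<otimes>v [^] (n::nat))" "ps a = vec2 (of_nat m) (of_nat n)"
   using decomp a by blast
  have bA: "b\<in>A" using d BA by blast
  have cA: "u\<up>g\<in>A" "v\<up>g\<in>A" "b\<up>g\<in>A" "b\<up>g\<in>B" using Lconj g uA vA bA d by blast+
  have "a\<up>g = (b\<up>g)\<otimes>((u\<up>g) [^] m\<otimes>(v\<up>g) [^] n)"
   using Ac[OF bA] Ac[OF uA] Ac[OF vA] Lc[OF g] unfolding d(2) by (simp add: conj_el_mult conj_el_pow)
  then have "ps (a\<up>g) = ps (b\<up>g) + (ps ((u\<up>g) [^] m) + ps ((v\<up>g) [^] n))"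
   using cA Am subgroup_pow[OF A(1)] by (simp add: ps_mult)
  then have "ps (a\<up>g) = ps ((u\<up>g) [^] m) + ps ((v\<up>g) [^] n)" using ps_0 cA by simp
  then show ?thesis unfolding d(3)
   by (simp add: vec_eq_iff ps_pow cA vector_matrix_mult_def sum_2 \<phi>_row mult.commute)
 qed
 have \<phi>_mult: "\<phi> (g\<otimes>h) = \<phi> g ** \<phi> h" if "g\<in>L" "h\<in>L" for g h
 proof -
  have "ps (a\<up>(g\<otimes>h)) = ps (a\<up>g) v* \<phi> h" if a: "a\<in>A" for a
   using key[of "a\<up>g" h] Lconj(1)[of g a] a \<open>g\<in>L\<close> \<open>h\<in>L\<close> Ac Lc subgroup.one_closed[OF B] by (simp add: conj_el_conj)
  then have "\<phi> (g\<otimes>h) $ i = (\<phi> g ** \<phi> h) $ i" for i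
   using exhaust_2[of i] uA vA by (auto simp: mat_row_mult \<phi>_row)
  then show ?thesis by (simp add: vec_eq_iff)
 qed
 have \<phi>_triv: "\<phi> g = mat 1 \<longleftrightarrow> (\<forall>a\<in>A. [.a, g.]\<in>B)" if g: "g\<in>L" for g
 proof -
  have cg: "ps (a\<up>g) = ps a + ps [.a, g.]" "[.a, g.]\<in>A" if a: "a\<in>A" for a
  proof -
   have "[.a, g.] = inv a\<otimes>(a\<up>g)" using a Ac Lc g by (intro comm_eq_conj) auto
   then show *: "[.a, g.]\<in>A" using Lconj(1)[OF g a] Am Ai a subgroup.one_closed[OF B] by auto
   have "a\<up>g = a\<otimes>[.a, g.]" using a Ac Lc g by (intro conj_el_eq_comm) auto
   then show "ps (a\<up>g) = ps a + ps [.a, g.]" using ps_mult[OF a *] by metis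
  qed
  show ?thesis
  proof
   assume e: "\<phi> g = mat 1"
   show "\<forall>a\<in>A. [.a, g.]\<in>B"
   proof
    fix a assume a: "a\<in>A"
    have "ps (a\<up>g) = ps a" using key[OF a g] e by (simp add: vec_eq_iff vector_matrix_mult_def mat_def sum_2 forall_2)
    then have "ps [.a, g.] = 0" using cg(1)[OF a] by simp
    then show "[.a, g.]\<in>B" using ps_0 cg(2)[OF a] by blast
   qed
  next
   assume "\<forall>a\<in>A. [.a, g.]\<in>B"
   then have "ps (u\<up>g) = ps u" "ps (v\<up>g) = ps v" using cg uA vA ps_0 by simp_all
   then show "\<phi> g = mat 1" by (simp add: vec_eq_iff forall_2 \<phi>_row ps_uv mat_def)
  qed
 qed
 have \<phi>P: "\<exists>t. \<phi> g = mat2 1 0 t 1" if g: "g\<in>P" for g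
 proof -
  have gL: "g\<in>L" using PL g by blast
  have c: "u\<up>g = u\<otimes>[.u, g.]" "v\<up>g = v\<otimes>[.v, g.]" using uA vA Ac Lc gL by (intro conj_el_eq_comm; blast)+
  have m: "[.u, g.]\<in>B" "[.v, g.]\<in>U" using P g u vA by blast+
  then have mA: "[.u, g.]\<in>A" "[.v, g.]\<in>A" using BA U by blast+
  have "ps (u\<up>g) = vec2 1 0" using c(1) ps_mult[OF uA mA(1)] ps_0[OF mA(1)] m ps_uv by simp
  moreover have "ps (v\<up>g) $ 2 = 1" using c(2) ps_mult[OF vA mA(2)] ps_A1[OF m(2)] ps_uv by simp
  ultimately have "\<phi> g = mat2 1 0 (ps (v\<up>g) $ 1) 1" by (simp add: vec_eq_iff forall_2 \<phi>_row)
  then show ?thesis by blast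
 qed
 have \<phi>R: "\<exists>t. \<phi> g = mat2 1 t 0 1" if g: "g\<in>R" for g
 proof -
  have gL: "g\<in>L" using RL g by blast
  have c: "u\<up>g = u\<otimes>[.u, g.]" "v\<up>g = v\<otimes>[.v, g.]" using uA vA Ac Lc gL by (intro conj_el_eq_comm; blast)+
  have m: "[.v, g.]\<in>B" "[.u, g.]\<in>V" using R g v uA by blast+
  then have mA: "[.u, g.]\<in>A" "[.v, g.]\<in>A" using BA V by blast+
  have "ps (v\<up>g) = vec2 0 1" using c(2) ps_mult[OF vA mA(2)] ps_0[OF mA(2)] m ps_uv by simp
  moreover have "ps (u\<up>g) $ 1 = 1" using c(1) ps_mult[OF uA mA(1)] ps_A2[OF m(2)] ps_uv by simp
  ultimately have "\<phi> g = mat2 1 (ps (u\<up>g) $ 2) 0 1" by (simp add: vec_eq_iff forall_2 \<phi>_row)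
  then show ?thesis by blast
 qed
 have \<phi>1: "\<phi> \<one> = mat 1"
  using uA vA Ac by (simp add: vec_eq_iff forall_2 \<phi>_row ps_uv mat_def)
 have det: "det (\<phi> g) = 1" if "g\<in>generate G (P \<union> R)" for g
  using that
 proof (induction rule: generate.induct)
  case one show ?case by (simp add: \<phi>1)
 next
  case (incl h)
  then show ?case using \<phi>P \<phi>R by (metis Un_iff mat2_det mult.right_neutral mult_zero_left mult_zero_right diff_zero)
 next
  case (inv h)
  then have hL: "h\<in>L" using PL RL by blast
  have "\<exists>t. \<phi> h = mat2 1 0 t 1 \<or> \<phi> h = mat2 1 t 0 1" using inv \<phi>P \<phi>R by blast
  then have "det (\<phi> h) = 1" by (auto simp: mat2_det)
  with hL have h: "h\<in>L" "inv h\<in>L" "det (\<phi> h) = 1"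
   using subgroup.m_inv_closed[OF Lsub hL] by blast+
  have "\<phi> (inv h) ** \<phi> h = mat 1" using \<phi>_mult[OF h(2,1)] \<phi>1 Lc[OF h(1)] by simp
  then have "det (\<phi> (inv h)) * det (\<phi> h) = 1" by (metis det_mul det_I)
  then show ?case using h by simp
 next
  case (eng g h)
  then have "g\<in>L" "h\<in>L" by (simp_all add: L(1))
  then show ?case using eng by (simp add: \<phi>_mult det_mul)
 qed
 let ?L = "G\<lparr>carrier := L\<rparr>"
 interpret LG: group ?L using Lsub subgroup_imp_group by blast
 have hom: "\<phi>\<in>hom ?L SL23"
  by (rule homI) (use det L(1) \<phi>_mult in auto)
 interpret H: group_hom ?L SL23 \<phi>
  unfolding group_hom_def group_hom_axioms_def using hom SL23_group LG.is_group by blast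
 have img: "\<phi> ` carrier ?L = carrier SL23"
 proof -
  obtain g a where g: "g\<in>P" "a\<in>A" "[.a, g.]~:B" using P(3) by blast
  obtain t where t: "\<phi> g = mat2 1 0 t 1" using \<phi>P g by blast
  have "\<phi> g~=mat 1" using \<phi>_triv[OF PL[OF g(1)]] g by blast
  then have t0: "t~=0" using t by (auto simp: mat2_one)
  obtain g' a' where g': "g'\<in>R" "a'\<in>A" "[.a', g'.]~:B" using R(3) by blast
  obtain t' where t': "\<phi> g' = mat2 1 t' 0 1" using \<phi>R g' by blast
  have "\<phi> g'~=mat 1" using \<phi>_triv[OF RL[OF g'(1)]] g' by blast
  then have t'0: "t'~=0" using t' by (auto simp: mat2_one)
  show ?thesis
  proof (rule SL23_generated[OF H.img_is_subgroup _ t0 _ t'0])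
   have "\<phi> g\<in>\<phi> ` carrier ?L" using PL[OF g(1)] by simp
   then show "mat2 1 0 t 1\<in>\<phi> ` carrier ?L" unfolding t .
   have "\<phi> g'\<in>\<phi> ` carrier ?L" using RL[OF g'(1)] by simp
   then show "mat2 1 t' 0 1\<in>\<phi> ` carrier ?L" unfolding t' .
  qed
 qed
 have ker: "kernel ?L SL23 \<phi> = L\<inter>trivial_on A B"
  unfolding kernel_def trivial_on_def using L(3) \<phi>_triv by auto
 let ?K = "L\<inter>trivial_on A B"
 have iso: "(\<lambda>X. the_elem (\<phi> ` X))\<in>iso (?L Mod ?K) SL23"
  using H.FactGroup_iso_set[OF img] unfolding ker .
 have val: "the_elem (\<phi> ` (?K #> g)) = \<phi> g" if g: "g\<in>L" for g
 proof -
  have "\<phi> ` (?K #> g) = {\<phi> g}"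
  proof -
   have "\<phi> (k\<otimes>g) = \<phi> g" if "k\<in>?K" for k
   proof -
    have "\<phi> k = mat 1" using that \<phi>_triv trivial_onD by blast
    then show ?thesis using \<phi>_mult that g by simp
   qed
   then have "(\<lambda>k. \<phi> (k\<otimes>g)) ` ?K = (\<lambda>k. \<phi> g) ` ?K" by (rule image_cong[OF refl])
   also have "\<dots> = {\<phi> g}"
   proof (rule image_constant)
    show "\<one>\<in>?K" using subgroup.one_closed[OF H.subgroup_kernel] unfolding ker by simp
   qed
   also have "(\<lambda>k. \<phi> (k\<otimes>g)) ` ?K = \<phi> ` (?K #> g)"
    unfolding r_coset_def UNION_singleton_eq_range image_image ..
   finally show ?thesis .
  qed
  from arg_cong[OF this, of the_elem] show ?thesis unfolding the_elem_eq .
 qed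
 have KL: "?K \<lhd> ?L" using H.normal_kernel unfolding ker .
 let ?\<Phi> = "\<lambda>X. the_elem (\<phi> ` X)"
 have act: "\<forall>g\<in>L. \<forall>a\<in>A. \<psi> (B #> a\<up>g) = \<psi> (B #> a) v* ?\<Phi> (?K #> g)"
 proof (intro ballI)
  fix g a assume g: "g\<in>L" and a: "a\<in>A"
  show "\<psi> (B #> a\<up>g) = \<psi> (B #> a) v* ?\<Phi> (?K #> g)"
   unfolding val[OF g] using key[OF a g] by (simp only: ps_def)
 qed
 have inv: "\<forall>g\<in>L. A\<Up>g = A \<and> B\<Up>g = B"
  using L(3) unfolding normalizing_def by blast
 have ex: "\<exists>\<phi>'\<in>iso (?L Mod ?K) SL23. \<exists>\<psi>'\<in>iso ?M GF3_plane.
   \<forall>g\<in>L. \<forall>a\<in>A. \<psi>' (B #> a\<up>g) = \<psi>' (B #> a) v* \<phi>' (?K #> g)"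
  by (rule bexI[where x = ?\<Phi>], rule bexI[where x = \<psi>], rule act, rule \<psi>(1), rule iso)
 show ?thesis
  unfolding natural_SL23_module_def
  by (intro conjI; fact A(1) BnA KL inv ex)
qed

lemma (in group) central_coset_exists:
 assumes L: "subgroup L G" and W: "W \<lhd> G\<lparr>carrier := L\<rparr>" and i: "\<phi>\<in>iso (G\<lparr>carrier := L\<rparr> Mod W) SL23"
 shows "\<exists>l\<in>L. l~:W \<and> l\<otimes>l\<in>W \<and> W #> l\<in>centre (G\<lparr>carrier := L\<rparr> Mod W)"
proof -
 let ?M = "G\<lparr>carrier := L\<rparr> Mod W"
 interpret M: group ?M by (rule normal.factorgroup_is_group[OF W])
 have Ws: "subgroup W G" using normal_imp_subgroup[OF W] incl_subgroup[OF L] by blast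
 have Lc: "g\<in>carrier G" if "g\<in>L" for g using L that subgroup_carrier by blast
 let ?m = "mat2 (-1) 0 0 (-1)"
 have mc: "?m\<in>carrier SL23" by (simp add: mat2_det)
 have bij: "bij_betw \<phi> (carrier ?M) (carrier SL23)" and hom: "\<phi>\<in>hom ?M SL23" using i by (auto simp: iso_def)
 have "?m\<in>\<phi> ` carrier ?M" unfolding bij_betw_imp_surj_on[OF bij] by (rule mc)
 then obtain X where X: "X\<in>carrier ?M" "\<phi> X = ?m" by (elim imageE) simp
 then obtain l where l: "l\<in>L" "X = W #> l" unfolding section_carrier by auto
 have inj: "\<phi> x = \<phi> y \<longleftrightarrow> x = y" if "x\<in>carrier ?M" "y\<in>carrier ?M" for x y
  by (rule inj_on_eq_iff[OF bij_betw_imp_inj_on[OF bij] that])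
 have one: "\<phi> \<one>\<^bsub>?M\<^esub> = mat 1" using hom_one[OF hom M.is_group SL23_group] by simp
 have "X~=\<one>\<^bsub>?M\<^esub>" using X one by (auto simp: mat2_one mat2_eq_iff)
 then have "l~:W" using rcos_eq_self_iff[OF Ws Lc[OF l(1)]] l by simp
 moreover have "l\<otimes>l\<in>W"
 proof -
  have "\<phi> (X \<otimes>\<^bsub>?M\<^esub> X) = mat 1" using hom_mult[OF hom X(1) X(1)] X by (simp add: mat2_mult mat2_one)
  then have "X \<otimes>\<^bsub>?M\<^esub> X = \<one>\<^bsub>?M\<^esub>" using inj[OF M.m_closed[OF X(1) X(1)] M.one_closed] one by simp
  then have "W #> (l\<otimes>l) = W" using section_mult[OF L W l(1) l(1)] l(2) by simp
  then show ?thesis using rcos_eq_self_iff[OF Ws] Lc[OF l(1)] by simp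
 qed
 moreover have "X\<in>centre ?M"
 proof -
  have "X \<otimes>\<^bsub>?M\<^esub> Z = Z \<otimes>\<^bsub>?M\<^esub> X" if Z: "Z\<in>carrier ?M" for Z
  proof -
   have "\<phi> Z\<in>carrier SL23" using hom Z by (rule hom_in_carrier)
   then have "?m ** \<phi> Z = \<phi> Z ** ?m" using SL23_minus_one_central by (auto simp: centre_def centralizer_def)
   then have "\<phi> (X \<otimes>\<^bsub>?M\<^esub> Z) = \<phi> (Z \<otimes>\<^bsub>?M\<^esub> X)"
    using hom_mult[OF hom X(1) Z] hom_mult[OF hom Z X(1)] X by simp
   then show ?thesis using inj[OF M.m_closed[OF X(1) Z] M.m_closed[OF Z X(1)]] by blast
  qed
  then show ?thesis using X by (simp add: centre_def centralizer_def)
 qed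
 ultimately show ?thesis using l by blast
qed

text \<open>The centre of \<open>SL\<^sub>2(3)\<close> is \<open>{1, -1}\<close>, and \<open>-1\<close> inverts
 the plane.\<close>

lemma (in group) natural_module_central_inverts:
 assumes nat: "natural_SL23_module G L W A B" and L: "subgroup L G" and s: "s\<in>L" "s~:W"
  and c: "W #> s\<in>centre (G\<lparr>carrier := L\<rparr> Mod W)" and a: "a\<in>A"
 shows "(a\<up>s)\<otimes>a\<in>B"
proof -
 let ?M = "G\<lparr>carrier := L\<rparr> Mod W" and ?N = "G\<lparr>carrier := A\<rparr> Mod B"
 from nat obtain \<phi> \<psi> where A: "subgroup A G" and B: "B \<lhd> G\<lparr>carrier := A\<rparr>" and W: "W \<lhd> G\<lparr>carrier := L\<rparr>"
  and cs: "\<And>g. g\<in>L ==> conj_set G A g = A"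
  and \<phi>: "\<phi>\<in>iso ?M SL23" and \<psi>: "\<psi>\<in>iso ?N GF3_plane"
  and act: "\<And>g a. g\<in>L ==> a\<in>A ==> \<psi> (B #> (a\<up>g)) = \<psi> (B #> a) v* \<phi> (W #> g)"
  unfolding natural_SL23_module_def by blast
 interpret M: group ?M by (rule normal.factorgroup_is_group[OF W])
 interpret N: group ?N by (rule normal.factorgroup_is_group[OF B])
 have Ws: "subgroup W G" using normal_imp_subgroup[OF W] incl_subgroup[OF L] by blast
 have Bs: "subgroup B G" using normal_imp_subgroup[OF B] incl_subgroup[OF A] by blast
 have bij: "bij_betw \<phi> (carrier ?M) (carrier SL23)" and hom: "\<phi>\<in>hom ?M SL23" using \<phi> by (auto simp: iso_def)
 have sM: "W #> s\<in>carrier ?M" using s unfolding section_carrier by blast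
 have sc: "s\<in>carrier G" using s L subgroup_carrier by blast
 have "\<phi> (W #> s)\<in>centre SL23"
 proof -
  have "\<phi> (W #> s) ** C = C ** \<phi> (W #> s)" if "det C = 1" for C
  proof -
   have "C\<in>\<phi> ` carrier ?M" unfolding bij_betw_imp_surj_on[OF bij] using that by simp
   then obtain X where X: "X\<in>carrier ?M" "\<phi> X = C" by (elim imageE) simp
   have "(W #> s) \<otimes>\<^bsub>?M\<^esub> X = X \<otimes>\<^bsub>?M\<^esub> (W #> s)" using c X by (simp add: centre_def centralizer_def)
   then have "\<phi> (W #> s) \<otimes>\<^bsub>SL23\<^esub> \<phi> X = \<phi> X \<otimes>\<^bsub>SL23\<^esub> \<phi> (W #> s)"
    using hom_mult[OF hom sM X(1)] hom_mult[OF hom X(1) sM] by argo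
   then show ?thesis using X by simp
  qed
  moreover have "\<phi> (W #> s)\<in>carrier SL23" using hom sM by (rule hom_in_carrier)
  ultimately show ?thesis by (simp add: centre_def centralizer_def)
 qed
 moreover have "\<phi> (W #> s)~=mat 1"
 proof
  assume "\<phi> (W #> s) = mat 1"
  then have "\<phi> (W #> s) = \<phi> \<one>\<^bsub>?M\<^esub>" using hom_one[OF hom M.is_group SL23_group] by simp
  then have "W #> s = \<one>\<^bsub>?M\<^esub>"
   using inj_on_eq_iff[OF bij_betw_imp_inj_on[OF bij] sM M.one_closed] by blast
  then show False using s rcos_eq_self_iff[OF Ws sc] by simp
 qed
 ultimately have m: "\<phi> (W #> s) = mat2 (-1) 0 0 (-1)" by (rule SL23_centre)
 have as: "a\<up>s\<in>A" using cs[OF s(1)] a conj_setI by metis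
 have aM: "B #> (a\<up>s)\<in>carrier ?N" "B #> a\<in>carrier ?N" using a as unfolding section_carrier by blast+
 have hom\<psi>: "\<psi>\<in>hom ?N GF3_plane" and bij\<psi>: "bij_betw \<psi> (carrier ?N) (carrier GF3_plane)" using \<psi> by (auto simp: iso_def)
 obtain p q where pq: "\<psi> (B #> a) = vec2 p q" by (rule vec2_cases)
 have "\<psi> ((B #> (a\<up>s)) \<otimes>\<^bsub>?N\<^esub> (B #> a)) = 0"
  using hom_mult[OF hom\<psi> aM] act[OF s(1) a] by (simp add: m pq vec2_mat2 vec2_add vec2_zero)
 also have "0 = \<psi> \<one>\<^bsub>?N\<^esub>" using hom_one[OF hom\<psi> N.is_group GF3_plane_group] by simp
 finally have "(B #> (a\<up>s)) \<otimes>\<^bsub>?N\<^esub> (B #> a) = \<one>\<^bsub>?N\<^esub>"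
  using inj_on_eq_iff[OF bij_betw_imp_inj_on[OF bij\<psi>] N.m_closed[OF aM] N.one_closed] by blast
 then have "B #> ((a\<up>s)\<otimes>a) = B" using section_mult[OF A B as a] by simp
 moreover have "(a\<up>s)\<otimes>a\<in>carrier G" using a as A subgroup_carrier by blast
 ultimately show ?thesis using rcos_eq_self_iff[OF Bs] by blast
qed

text \<open>The product of two normal \<open>p\<close>-subgroups is a normal \<open>p\<close>-subgroup.\<close>

lemma p_core_greatest:
 assumes G: "group H" "finite (carrier H)" and p: "prime p"
 shows "p_core p H \<lhd> H" "p_group p (H\<lparr>carrier := p_core p H\<rparr>)"
  "\<And>N. N \<lhd> H ==> p_group p (H\<lparr>carrier := N\<rparr>) ==> N\<subseteq>p_core p H"
proof -
 interpret group H by fact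
 let ?P = "\<lambda>N. N \<lhd> H \<and> p_group p (H\<lparr>carrier := N\<rparr>)"
 have pg: "p_group p (H\<lparr>carrier := N\<rparr>) \<longleftrightarrow> (\<exists>k. card N = p ^ k)" if "N \<lhd> H" for N
  using that normal_imp_subgroup[OF that] subgroup_imp_group by (auto simp: p_group_def order_def)
 have sub: "N\<subseteq>carrier H" if "N \<lhd> H" for N using that normal_imp_subgroup subgroup.subset by blast
 have "?P {\<one>\<^bsub>H\<^esub>}" using one_is_normal pg[OF one_is_normal] by (metis card.empty card.insert empty_iff finite.emptyI power_0 One_nat_def)
 then have "\<exists>M. ?P M \<and> (\<forall>N. ?P N \<longrightarrow> card N \<le> card M)"
 proof (rule ex_has_greatest_nat[of ?P _ card "Suc (card (carrier H))"])
  show "\<forall>N. ?P N \<longrightarrow> card N < Suc (card (carrier H))" using sub G card_mono by (metis le_imp_less_Suc)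
 qed
 then obtain M where M: "?P M" "\<And>N. ?P N ==> card N \<le> card M" by blast
 have Msub: "subgroup M H" using M normal_imp_subgroup by blast
 have le: "N\<subseteq>M" if N: "?P N" for N
 proof -
  have Nsub: "subgroup N H" using N normal_imp_subgroup by blast
  have fin: "finite M" "finite N" using sub M N G finite_subset by blast+
  have n: "M <#>\<^bsub>H\<^esub> N \<lhd> H" using M N normal_subgroup_set_mult_closed by blast
  obtain i j where ij: "card M = p ^ i" "card N = p ^ j" using M N pg by metis
  have "card (M <#>\<^bsub>H\<^esub> N) * card (M\<inter>N) = p ^ (i + j)"
   using card_set_mult_inter[OF Msub fin(1) Nsub fin(2)] ij by (simp add: power_add)
  then have "card (M <#>\<^bsub>H\<^esub> N) dvd p ^ (i + j)" by (metis dvd_triv_left)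
  then have "?P (M <#>\<^bsub>H\<^esub> N)" using n pg[OF n] divides_primepow_nat[OF p] by blast
  then have c: "card (M <#>\<^bsub>H\<^esub> N) \<le> card M" using M by blast
  have MN: "M\<subseteq>M <#>\<^bsub>H\<^esub> N" "N\<subseteq>M <#>\<^bsub>H\<^esub> N"
   by (rule set_mult_left[OF Nsub subgroup.subset[OF Msub]], rule set_mult_right[OF Msub subgroup.subset[OF Nsub]])
  have "finite (M <#>\<^bsub>H\<^esub> N)" using sub[OF n] G finite_subset by blast
  then have "M = M <#>\<^bsub>H\<^esub> N" using c MN(1) card_seteq by blast
  then show ?thesis using MN by blast
 qed
 have eq: "p_core p H = M" unfolding p_core_def
  by (rule Greatest_equality) (use M le in blast)+
 show "p_core p H \<lhd> H" "p_group p (H\<lparr>carrier := p_core p H\<rparr>)" unfolding eq using M by blast+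
 show "\<And>N. N \<lhd> H ==> p_group p (H\<lparr>carrier := N\<rparr>) ==> N\<subseteq>p_core p H" unfolding eq using le by blast
qed

section \<open>The extraspecial subgroup and its conjugates\<close>

lemma (in group) order_3_subgroup:
 assumes K: "subgroup K G" "card K = 3" and k: "k\<in>K" "k~=\<one>"
 shows "K = {\<one>, k, k\<otimes>k}" "k\<otimes>(k\<otimes>k) = \<one>" "k\<otimes>k~=\<one>" "inv k = k\<otimes>k"
proof -
 have kc: "k\<in>carrier G" using K k subgroup_carrier by blast
 interpret KG: group "G\<lparr>carrier := K\<rparr>" using K subgroup_imp_group by blast
 have "k [^]\<^bsub>G\<lparr>carrier := K\<rparr>\<^esub> (3::nat) = \<one>"
  using KG.pow_order_eq_1[of k] k K by (simp add: order_def)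
 then have p3: "k [^] (3::nat) = \<one>" by (simp add: nat_pow_consistent[symmetric])
 then show c: "k\<otimes>(k\<otimes>k) = \<one>" using kc by (simp add: numeral_3_eq_3 m_assoc)
 show n: "k\<otimes>k~=\<one>" using c k kc by auto
 show "inv k = k\<otimes>k" using c kc by (metis inv_equality m_assoc m_closed)
 have "card {\<one>, k, k\<otimes>k} = 3" using k n kc by auto
 moreover have "{\<one>, k, k\<otimes>k}\<subseteq>K" using K k subgroup.one_closed subgroup.m_closed[of K G k k] by auto
 ultimately show "K = {\<one>, k, k\<otimes>k}" using K by (metis card.infinite card_subset_eq zero_neq_numeral)
qed

lemma (in group) cube_eq: "x\<in>carrier G ==> x [^] (3::nat) = x\<otimes>(x\<otimes>x)"
 by (simp add: numeral_3_eq_3 m_assoc)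

lemma (in group) cube_one_inv: "x\<in>carrier G ==> x [^] (3::nat) = \<one> ==> inv x = x\<otimes>x"
 by (metis cube_eq inv_equality m_assoc m_closed)

lemma other_member: "d\<in>F ==> F~={d} ==> \<exists>X\<in>F. X~=d"
 by blast

text \<open>The assumptions on \<open>(Z, Q)\<close> are stated so that they pass to conjugates; the last two
 replace the definition of \<open>Q\<close> as a 3-core.\<close>

locale large_extraspecial = group G for G (structure) +
 fixes Z Q :: "'a set"
 assumes fin: "finite (carrier G)"
  and Q_sub: "subgroup Q G" and Q_card: "card Q = 243"
  and Z_sub: "subgroup Z G" and Z_card: "card Z = 3" and ZQ: "Z\<subseteq>Q"
  and Z_centre: "\<And>q. q\<in>Q ==> q\<in>Z \<longleftrightarrow> (\<forall>r\<in>Q. q\<otimes>r = r\<otimes>q)"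
  and Q_comm: "\<And>q r. q\<in>Q ==> r\<in>Q ==> [.q, r.]\<in>Z"
  and Q_cube: "\<And>q. q\<in>Q ==> q [^] (3::nat) = \<one>"
  and Q_self: "CG Q\<subseteq>Q"
  and Q_stab: "\<And>g. g\<in>CG Z ==> (\<And>q. q\<in>Q ==> [.q, g.]\<in>Z) ==> g\<in>Q"
  and Q_norm: "normalizing Z\<subseteq>normalizing Q"
begin

lemma Qc [simp]: "q\<in>Q ==> q\<in>carrier G" using Q_sub subgroup_carrier by blast
lemma Zc [simp]: "z\<in>Z ==> z\<in>carrier G" using Z_sub subgroup_carrier by blast
lemma Q_carrier: "Q\<subseteq>carrier G" by auto
lemma Z_carrier: "Z\<subseteq>carrier G" by auto
lemma finQ: "finite Q" using Q_card by (metis card.infinite zero_neq_numeral)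
lemma finZ: "finite Z" using Z_card by (metis card.infinite zero_neq_numeral)
lemmas Qm = subgroup.m_closed[OF Q_sub] and Qi = subgroup.m_inv_closed[OF Q_sub] and Q1 = subgroup.one_closed[OF Q_sub]
lemmas Zm = subgroup.m_closed[OF Z_sub] and Zi = subgroup.m_inv_closed[OF Z_sub] and Z1 = subgroup.one_closed[OF Z_sub]

lemma Z_gen: "z\<in>Z ==> z~=\<one> ==> Z = {\<one>, z, z\<otimes>z}" "z\<in>Z ==> z~=\<one> ==> z\<otimes>(z\<otimes>z) = \<one>"
 using order_3_subgroup[OF Z_sub Z_card] by blast+

lemma Z_ex: obtains z where "z\<in>Z" "z~=\<one>"
proof -
 have "Z~={\<one>}" using Z_card by auto
 then show ?thesis using that Z1 by blast
qed

lemma Z_commutes: "z\<in>Z ==> q\<in>Q ==> z\<otimes>q = q\<otimes>z"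
 using Z_centre ZQ by blast

lemma Z_fixed: "z\<in>Z ==> q\<in>Q ==> z\<up>q = z"
 using conj_el_fixed[of z q] Z_commutes by simp

lemma Q_cent_Z: "Q\<subseteq>CG Z"
 by (auto intro!: centralizerI simp: Z_fixed)

lemma comm_left: "[|q\<in>Q; r\<in>Q; t\<in>Q|] ==> [.q\<otimes>r, t.] = [.q, t.]\<otimes>[.r, t.]"
 using comm_mult_left[of q r t] Z_fixed[OF Q_comm] by simp

lemma comm_right: "[|q\<in>Q; r\<in>Q; t\<in>Q|] ==> [.q, r\<otimes>t.] = [.q, r.]\<otimes>[.q, t.]"
 using comm_mult_right[of q r t] Z_fixed[OF Q_comm[of q r], of t] Z_commutes[OF Q_comm[of q t], of "[.q, r.]"]
  subsetD[OF ZQ Q_comm[of q r]] by simp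

lemma cent_Q_sub: "y\<in>Q ==> subgroup (Q\<inter>CG {y}) G"
 using subgroups_Inter_pair[OF Q_sub centralizer_subgroup[of "{y}"]] by simp

lemma mem_cent: "[|q\<in>Q; y\<in>Q|] ==> q\<in>CG {y} \<longleftrightarrow> [.q, y.] = \<one>"
 using comm_one_iff[of q y] by (simp add: centralizer_def)

lemma comm_onto:
 assumes y: "y\<in>Q" "y~:Z" and z: "z\<in>Z"
 shows "\<exists>q\<in>Q. [.q, y.] = z"
proof -
 obtain q where q: "q\<in>Q" "q\<otimes>y~=y\<otimes>q" using Z_centre[OF y(1)] y by metis
 let ?c = "[.q, y.]"
 have c: "?c\<in>Z" "?c~=\<one>" using Q_comm q y comm_one_iff[of q y] by auto
 have "[.q\<otimes>q, y.] = ?c\<otimes>?c" "[.\<one>, y.] = \<one>" using comm_left[OF q(1) q(1) y(1)] y by simp_all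
 moreover have "z\<in>{\<one>, ?c, ?c\<otimes>?c}" using Z_gen(1)[OF c] z by blast
 ultimately show ?thesis using q Qm Q1 by (metis empty_iff insert_iff)
qed

lemma card_cent:
 assumes y: "y\<in>Q" "y~:Z"
 shows "card (Q\<inter>CG {y}) = 81"
proof -
 let ?C = "Q\<inter>CG {y}"
 have "(\<lambda>q. [.q, y.]) ` Q = Z" using comm_onto[OF y] Q_comm y by blast
 moreover have "card ((\<lambda>q. [.q, y.]) ` Q) * card ?C = card Q"
 proof (rule card_fibres[OF Q_sub cent_Q_sub[OF y(1)] _ finQ])
  fix p q assume p: "p\<in>Q" "q\<in>Q"
  have "[.(p\<otimes>inv q)\<otimes>q, y.] = [.p\<otimes>inv q, y.]\<otimes>[.q, y.]" using comm_left p y Qm Qi by simp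
  moreover have "(p\<otimes>inv q)\<otimes>q = p" using p by (simp add: m_assoc)
  ultimately have "[.p, y.] = [.p\<otimes>inv q, y.]\<otimes>[.q, y.]" by metis
  moreover have "[.p\<otimes>inv q, y.]\<in>carrier G" "[.q, y.]\<in>carrier G" using p y by simp_all
  ultimately have "[.p, y.] = [.q, y.] \<longleftrightarrow> [.p\<otimes>inv q, y.] = \<one>" by (metis r_cancel_one)
  then show "[.p, y.] = [.q, y.] \<longleftrightarrow> p\<otimes>inv q\<in>?C"
   using mem_cent[OF _ y(1)] p Qm Qi by simp
 qed auto
 ultimately show ?thesis using Z_card Q_card by simp
qed

lemma cent_cent:
 assumes y: "y\<in>Q" "y\<notin>Z" and d: "d\<in>Q" "\<And>a. a\<in>Q\<inter>CG {y} ==> a\<otimes>d = d\<otimes>a"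
 obtains w where "w\<in>Z" "d = w \<or> d = w\<otimes>y \<or> d = w\<otimes>(y\<otimes>y)"
proof -
 obtain z where z: "z\<in>Z" "z\<noteq>\<one>" by (rule Z_ex)
 obtain q where q: "q\<in>Q" "[.q, y.] = z" using comm_onto[OF y z(1)] by blast
 have iy: "inv y = y\<otimes>y" using cube_one_inv[of y] Q_cube y by simp
 \<comment> \<open>The functional of \<open>d\<close> is a multiple of that of \<open>y\<close>; cancel it with \<open>y\<close> or its square.\<close>
 have "[.q, d.]\<in>{\<one>, z, z\<otimes>z}" using Q_comm[OF q(1) d(1)] Z_gen[OF z] by blast
 then have "\<exists>e\<in>{\<one>, y, y\<otimes>y}. [.q, d\<otimes>e.] = \<one>"
 proof -
  have 1: "[.q, d\<otimes>y.] = [.q, d.]\<otimes>z" "[.q, d\<otimes>(y\<otimes>y).] = [.q, d.]\<otimes>(z\<otimes>z)"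
   using comm_right q d y Qm by simp_all
  have 2: "[.q, d\<otimes>\<one>.] = [.q, d.]" using q d by simp
  have 3: "z\<otimes>(z\<otimes>z) = \<one>" "z\<otimes>z\<otimes>z = \<one>" using Z_gen(2)[OF z] z by (simp_all add: m_assoc)
  show ?thesis using \<open>[.q, d.]\<in>{\<one>, z, z\<otimes>z}\<close> 1 2 3 by (metis insertE insertI1 insertI2 singletonD)
 qed
 then obtain e where e: "e\<in>{\<one>, y, y\<otimes>y}" "[.q, d\<otimes>e.] = \<one>" by blast
 have eQ: "e\<in>Q" using e y Q1 Qm by auto
 let ?f = "d\<otimes>e"
 have fQ: "?f\<in>Q" using d eQ Qm by blast
 have cf: "subgroup (CG {?f}) G" using fQ by (intro centralizer_subgroup) simp
 have "a\<otimes>?f = ?f\<otimes>a" if a: "a\<in>Q\<inter>CG {y}" for a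
 proof -
  have ay: "a\<otimes>y = y\<otimes>a" and ac: "a\<in>carrier G" using a by (auto simp: centralizer_def)
  have ae: "a\<otimes>e = e\<otimes>a" using e(1) ay ac y by (auto simp: m_assoc) (metis Qc m_assoc)
  have ad: "a\<otimes>d = d\<otimes>a" using d a by blast
  show ?thesis using ae ad ac d eQ by (metis Qc m_assoc)
 qed
 then have sub: "Q\<inter>CG {y}\<subseteq>Q\<inter>CG {?f}" by (auto simp: centralizer_def)
 have "q\<in>Q\<inter>CG {?f}" "q\<notin>Q\<inter>CG {y}"
  using mem_cent q e fQ y z by auto
 then have less: "card (Q\<inter>CG {y}) < card (Q\<inter>CG {?f})"
  using sub finQ by (intro psubset_card_mono) auto
 have fZ: "?f\<in>Z" using card_cent[OF fQ] card_cent[OF y] less by auto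
 have d_eq: "d = ?f\<otimes>inv e" using d eQ by (simp add: m_assoc)
 have iyy: "inv (y\<otimes>y) = y" using iy y by (metis Qc inv_inv)
 from e(1) consider "e = \<one>" | "e = y" | "e = y\<otimes>y" by blast
 then show ?thesis
 proof cases
  case 1 show ?thesis by (rule that[OF fZ]) (use 1 d in simp)
 next
  case 2 show ?thesis by (rule that[OF fZ]) (use 2 d_eq iy in simp)
 next
  case 3 show ?thesis by (rule that[OF fZ]) (use 3 d_eq iyy in simp)
 qed
qed

lemma abelian_card_le:
 assumes B: "subgroup B G" "B\<subseteq>Q" and ab: "\<And>a b. a\<in>B ==> b\<in>B ==> a\<otimes>b = b\<otimes>a"
 shows "card B \<le> 27"
proof (rule ccontr)
 assume n: "\<not> card B \<le> 27"
 have "card B dvd 3 ^ 5" using card_subgroup_dvd[OF Q_sub B finQ] Q_card by simp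
 then obtain i where i: "card B = 3 ^ i" "i \<le> 5"
  using divides_primepow_nat[of 3 "card B" 5] by auto
 have ge: "card B \<ge> 81"
 proof (rule ccontr)
  assume "\<not> card B \<ge> 81"
  then have "(3::nat) ^ i < 3 ^ 4" using i by simp
  then have "i < 4" by (metis power_less_imp_less_exp one_less_numeral_iff semiring_norm(77))
  then have "(3::nat) ^ i \<le> 3 ^ 3" by (intro power_increasing) auto
  then show False using n i by simp
 qed
 have "\<not> B\<subseteq>Z" using ge Z_card card_mono[OF finZ, of B] by auto
 then obtain y where y: "y\<in>B" "y~:Z" by blast
 have yQ: "y\<in>Q" using y B by blast
 have "B\<subseteq>Q\<inter>CG {y}" using ab y B by (auto simp: centralizer_def)
 then have Beq: "B = Q\<inter>CG {y}"
  using ge card_cent[OF yQ y(2)] finQ by (intro card_seteq) auto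
 have "B\<subseteq>Z \<union> (\<lambda>w. w\<otimes>y) ` Z \<union> (\<lambda>w. w\<otimes>(y\<otimes>y)) ` Z"
 proof
  fix d assume d: "d\<in>B"
  then have dQ: "d\<in>Q" using B by blast
  obtain w where "w\<in>Z" "d = w \<or> d = w\<otimes>y \<or> d = w\<otimes>(y\<otimes>y)"
   by (rule cent_cent[OF yQ y(2) dQ]) (use ab d Beq in blast)
  then show "d\<in>Z \<union> (\<lambda>w. w\<otimes>y) ` Z \<union> (\<lambda>w. w\<otimes>(y\<otimes>y)) ` Z" by blast
 qed
 then have "card B \<le> card (Z \<union> (\<lambda>w. w\<otimes>y) ` Z \<union> (\<lambda>w. w\<otimes>(y\<otimes>y)) ` Z)"
  using finZ by (intro card_mono) auto
 also have "\<dots> \<le> 3 + 3 + 3"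
  using Z_card card_image_le[OF finZ, of "\<lambda>w. w\<otimes>y"] card_image_le[OF finZ, of "\<lambda>w. w\<otimes>(y\<otimes>y)"]
   card_Un_le[of Z "(\<lambda>w. w\<otimes>y) ` Z"] card_Un_le[of "Z \<union> (\<lambda>w. w\<otimes>y) ` Z" "(\<lambda>w. w\<otimes>(y\<otimes>y)) ` Z"] by linarith
 finally show False using ge by simp
qed

lemma cent_Z_normalizes: "CG Z\<subseteq>normalizing Q"
proof -
 have "g\<in>normalizing Z" if "g\<in>CG Z" for g
  using that centralizer_carrier centralizer_conj_el[OF that] finZ Z_carrier by (intro normalizingI) auto
 then show ?thesis using Q_norm by blast
qed

lemma conj_large:
 assumes g: "g\<in>carrier G"
 shows "large_extraspecial G (Z\<Up>g) (Q\<Up>g)"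
proof (rule large_extraspecial.intro[OF is_group], rule large_extraspecial_axioms.intro)
 note mem = mem_conj_set[OF Q_carrier g] mem_conj_set[OF Z_carrier g]
 have cQ: "subgroup (Q\<Up>g) G" by (rule conj_set_subgroup[OF Q_sub g])
 then have cc: "q\<in>carrier G" if "q\<in>Q\<Up>g" for q using that subgroup_carrier by blast
 show "finite (carrier G)" by (rule fin)
 show "subgroup (Q\<Up>g) G" by (rule cQ)
 show "card (Q\<Up>g) = 243" "card (Z\<Up>g) = 3" using card_conj_set g Q_card Z_card Q_carrier Z_carrier by metis+
 show "subgroup (Z\<Up>g) G" by (rule conj_set_subgroup[OF Z_sub g])
 show "Z\<Up>g\<subseteq>Q\<Up>g" by (rule conj_set_mono[OF ZQ])
 have pull: "\<exists>p\<in>Q. q = p\<up>g" if "q\<in>Q\<Up>g" for q using that by (auto simp: conj_set_def)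
 fix q assume q: "q\<in>Q\<Up>g"
 then obtain p where p: "p\<in>Q" "q = p\<up>g" using pull by blast
 show "q\<in>Z\<Up>g \<longleftrightarrow> (\<forall>r\<in>Q\<Up>g. q\<otimes>r = r\<otimes>q)"
 proof -
  have "q\<in>Z\<Up>g \<longleftrightarrow> p\<in>Z" using mem(2)[OF cc[OF q]] p g by simp
  also have "\<dots> \<longleftrightarrow> (\<forall>r\<in>Q. p\<otimes>r = r\<otimes>p)" by (rule Z_centre[OF p(1)])
  also have "\<dots> \<longleftrightarrow> (\<forall>r\<in>Q. q\<otimes>(r\<up>g) = (r\<up>g)\<otimes>q)"
  proof -
   have "p\<otimes>r = r\<otimes>p \<longleftrightarrow> q\<otimes>(r\<up>g) = (r\<up>g)\<otimes>q" if "r\<in>Q" for r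
    using conj_el_inj[of "p\<otimes>r" "r\<otimes>p" g] that p g by (simp add: conj_el_mult)
   then show ?thesis by blast
  qed
  finally show ?thesis by (simp add: conj_set_def)
 qed
 show "q [^] (3::nat) = \<one>" using p Q_cube[OF p(1)] g by (simp flip: conj_el_pow)
 fix r assume "r\<in>Q\<Up>g"
 then obtain t where t: "t\<in>Q" "r = t\<up>g" using pull by blast
 have "[.q, r.] = [.p, t.]\<up>g" using p t g by (simp add: conj_el_comm)
 then show "[.q, r.]\<in>Z\<Up>g" using Q_comm[OF p(1) t(1)] conj_setI by metis
next
 note mem = mem_conj_set[OF Q_carrier g] mem_conj_set[OF Z_carrier g]
 have pull_cent: "h\<up>inv g\<in>CG M" if "h\<in>CG (M\<Up>g)" "M\<subseteq>carrier G" for h M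
 proof -
  note h = that(1)
  have hc: "h\<in>carrier G" using h centralizer_carrier by blast
  have "a\<up>(h\<up>inv g) = a" if a: "a\<in>M" for a
  proof -
   have ac: "a\<in>carrier G" using a \<open>M\<subseteq>carrier G\<close> by blast
   have "(a\<up>g)\<up>h = a\<up>g" using centralizer_conj_el[OF h conj_setI[OF a]] ac g by simp
   then have "((a\<up>g)\<up>h)\<up>inv g = a" using ac g by simp
   moreover have "((a\<up>g)\<up>h)\<up>inv g = a\<up>(h\<up>inv g)" using ac g hc by (simp add: word_simps)
   ultimately show ?thesis by simp
  qed
  then show ?thesis using that(2) hc g by (intro centralizerI) auto
 qed
 show "CG (Q\<Up>g)\<subseteq>Q\<Up>g"
 proof
  fix h assume h: "h\<in>CG (Q\<Up>g)"
  then have "h\<up>inv g\<in>Q" using pull_cent[OF h Q_carrier] Q_self by blast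
  then show "h\<in>Q\<Up>g" using mem(1) h centralizer_carrier by blast
 qed
 {
  fix h assume h: "h\<in>CG (Z\<Up>g)" and st: "\<And>q. q\<in>Q\<Up>g ==> [.q, h.]\<in>Z\<Up>g"
  have hc: "h\<in>carrier G" using h centralizer_carrier by blast
  have "h\<up>inv g\<in>Q"
  proof (rule Q_stab[OF pull_cent[OF h Z_carrier]])
   fix q assume q: "q\<in>Q"
   have "[.q\<up>g, h.]\<in>Z\<Up>g" by (rule st[OF conj_setI[OF q]])
   then have "[.q\<up>g, h.]\<up>inv g\<in>Z" using mem(2) q g hc by simp
   then show "[.q, h\<up>inv g.]\<in>Z" using q g hc by (simp add: conj_el_comm)
  qed
  then show "h\<in>Q\<Up>g" using mem(1)[OF hc] by blast
 }
 show "normalizing (Z\<Up>g)\<subseteq>normalizing (Q\<Up>g)"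
 proof
  fix h assume "h\<in>normalizing (Z\<Up>g)"
  then have h: "h\<in>carrier G" "(Z\<Up>g)\<Up>h = Z\<Up>g" by (auto simp: normalizing_def)
  let ?k = "g\<otimes>h\<otimes>inv g"
  have "Z\<Up>?k = Z" using h g Z_carrier by (simp flip: conj_set_conj) (simp add: conj_set_cancel)
  then have "?k\<in>normalizing Z" using h g by (simp add: normalizing_def)
  then have "Q\<Up>?k = Q" using Q_norm by (auto simp: normalizing_def)
  then have "(Q\<Up>?k)\<Up>g = Q\<Up>g" by simp
  then have "(Q\<Up>g)\<Up>h = Q\<Up>g" using h g Q_carrier by (simp add: conj_set_conj m_assoc)
  then show "h\<in>normalizing (Q\<Up>g)" using h by (simp add: normalizing_def)
 qed
qed

lemma conj_unique:
 assumes g: "g\<in>carrier G" and x: "x\<in>carrier G" and e: "Z\<Up>g = Z\<Up>x"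
 shows "Q\<Up>g = Q\<Up>x"
proof -
 have "Z\<Up>(g\<otimes>inv x) = Z" using e g x Z_carrier by (metis conj_set_cancel(1) conj_set_conj inv_closed)
 then have "g\<otimes>inv x\<in>normalizing Z" using g x by (simp add: normalizing_def)
 then have "Q\<Up>(g\<otimes>inv x) = Q" using Q_norm by (auto simp: normalizing_def)
 then have "(Q\<Up>(g\<otimes>inv x))\<Up>x = Q\<Up>x" by simp
 then show ?thesis using g x Q_carrier by (simp add: conj_set_conj m_assoc)
qed

lemma Z_conj_eqI:
 assumes g: "g\<in>carrier G" and K: "subgroup K G" "card K = 3" and z: "z\<in>Z" "z~=\<one>" "z\<up>g\<in>K"
 shows "Z\<Up>g = K"
proof -
 have n: "z\<up>g~=\<one>" using z g by (metis Zc conj_el_inj conj_el_one(2) one_closed)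
 have "K = {\<one>, z\<up>g, (z\<up>g)\<otimes>(z\<up>g)}" by (rule order_3_subgroup(1)[OF K z(3) n])
 also have "\<dots> = Z\<Up>g" using z g by (subst Z_gen(1)[OF z(1,2)]) (auto simp: conj_set_def conj_el_mult)
 finally show ?thesis by simp
qed

lemma distinct_order_3:
 assumes K: "subgroup K G" "card K = 3" "K~=Z"
 shows "K\<inter>Z = {\<one>}"
proof -
 have "k = \<one>" if "k\<in>K" "k\<in>Z" for k
  using order_3_subgroup(1)[OF K(1,2) that(1)] Z_gen(1)[OF that(2)] K(3) by blast
 then show ?thesis using Z1 subgroup.one_closed[OF K(1)] by blast
qed

text \<open>Let \<open>A = C(Z\<^sup>x)\<inter>Q\<close> and \<open>1\<noteq>z = [a, a']\<close> with
 \<open>a, a'\<in>A\<close>.  If some \<open>h\<in>Q\<^sup>x\<close> has \<open>1\<noteq>[h, z] \<in>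
 Z\<^sup>x\<close>, then a product \<open>hq\<close> with \<open>q\<in>Q\<close> maps \<open>Z\<close> to
 \<open>Z\<^sup>x\<close>, hence \<open>Q\<close> to \<open>Q\<^sup>x\<close>, and some element of
 \<open>Q\<close> to \<open>z\<close>.  Otherwise \<open>A\<close> normalizes \<open>Q\<^sup>x\<close> and
 fixes a coset \<open>Dh\<noteq>D\<close> of \<open>D = C(z)\<inter>Q\<^sup>x\<close>; as \<open>z\<close>
 is a commutator in \<open>A\<close>, it moves \<open>h\<close> only by \<open>Z\<^sup>x\<close>, so \<open>h
 \<in> D\<close> after all.\<close>

lemma conjugate_centre_symmetric:
 assumes x: "x\<in>carrier G" and ne: "Z\<noteq>Z\<Up>x" and sub: "Z\<Up>x\<subseteq>Q"
 shows "Z\<subseteq>Q\<Up>x"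
proof -
 interpret P: large_extraspecial G "Z\<Up>x" "Q\<Up>x" by (rule conj_large[OF x])
 let ?Z1 = "Z\<Up>x" and ?Q1 = "Q\<Up>x"
 have dis: "?Z1\<inter>Z = {\<one>}" using distinct_order_3[OF P.Z_sub P.Z_card] ne by blast
 obtain z1 where z1: "z1\<in>?Z1" "z1\<noteq>\<one>" by (rule P.Z_ex)
 have z1Q: "z1\<in>Q" "z1\<notin>Z" using z1 sub dis by blast+
 have z1c: "z1\<in>carrier G" using z1Q by simp
 let ?A = "Q\<inter>CG {z1}"
 have cz1: "g\<in>CG ?Z1" if "g\<in>CG {z1}" for g
 proof -
  have gc: "g\<in>carrier G" using that centralizer_carrier by blast
  have f: "z1\<up>g = z1" using centralizer_conj_el[OF that] z1c by blast
  have "w\<up>g = w" if "w\<in>?Z1" for w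
  proof -
   have "w\<in>{\<one>, z1, z1\<otimes>z1}" using P.Z_gen(1)[OF z1] that by blast
   then show ?thesis using f gc z1c by (auto simp: conj_el_mult)
  qed
  then show ?thesis using gc P.Z_carrier by (intro centralizerI) auto
 qed
 have A_sub: "subgroup ?A G" by (rule cent_Q_sub[OF z1Q(1)])
 have "\<not> (\<forall>a\<in>?A. \<forall>b\<in>?A. a\<otimes>b = b\<otimes>a)"
  using abelian_card_le[OF A_sub] card_cent[OF z1Q] by auto
 then obtain a a' where a: "a\<in>?A" "a'\<in>?A" "a\<otimes>a'\<noteq>a'\<otimes>a" by blast
 have ac: "a\<in>carrier G" "a'\<in>carrier G" using a by auto
 define z where "z = [.a, a'.]"
 have z: "z\<in>Z" "z\<noteq>\<one>" using a Q_comm comm_one_iff[OF ac] by (auto simp: z_def)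
 have zc: "z\<in>carrier G" using z by simp
 have goal: "Z\<subseteq>?Q1" if "z\<in>?Q1"
  using Z_gen(1)[OF z] that P.Qm P.Q1 by auto
 have z1z: "z\<otimes>z1 = z1\<otimes>z" by (rule Z_commutes[OF z(1) z1Q(1)])
 have zcent: "z\<in>CG ?Z1" by (rule cz1) (use z1z zc in \<open>auto simp: centralizer_def\<close>)
 show ?thesis
 proof (cases "\<exists>h\<in>?Q1. [.h, z.]\<in>?Z1 \<and> [.h, z.]\<noteq>\<one>")
  case True
  then obtain h where h: "h\<in>?Q1" "[.h, z.]\<in>?Z1" "[.h, z.]\<noteq>\<one>" by blast
  define t where "t = inv [.h, z.]"
  have hc: "h\<in>carrier G" using h by simp
  have t: "t\<in>?Z1" "t\<noteq>\<one>" using h P.Zi hc zc by (auto simp: t_def)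
  have tQ: "t\<in>Q" "t\<notin>Z" and tc: "t\<in>carrier G" using t sub dis by auto
  have zh: "z\<up>h = z\<otimes>t" using zc hc by (simp add: t_def word_simps)
  have th: "t\<up>h = t" by (rule P.Z_fixed[OF t(1) h(1)])
  obtain q where q: "q\<in>Q" "[.q, t.] = z" using comm_onto[OF tQ z(1)] by blast
  have qc: "q\<in>carrier G" using q by simp
  have tq: "t\<up>q = t\<otimes>inv z" unfolding q(2)[symmetric] using tc qc by (simp add: word_simps)
  have zq: "z\<up>q = z" by (rule Z_fixed[OF z(1) q(1)])
  have tz: "z\<otimes>t = t\<otimes>z" by (rule Z_commutes[OF z(1) tQ(1)])
  let ?g = "h\<otimes>q"
  have gc: "?g\<in>carrier G" using hc qc by simp
  have zg: "z\<up>?g = t"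
  proof -
   have "z\<up>?g = (z\<otimes>t)\<up>q" using zh zc hc qc by (simp flip: conj_el_conj)
   also have "\<dots> = z\<otimes>(t\<otimes>inv z)" using zq tq zc tc qc by (simp add: conj_el_mult)
   also have "\<dots> = (t\<otimes>z)\<otimes>inv z" using tz tc zc by (simp flip: m_assoc)
   finally show ?thesis using tc zc by (simp add: m_assoc)
  qed
  have "Z\<Up>?g = ?Z1" by (rule Z_conj_eqI[OF gc P.Z_sub P.Z_card z]) (use zg t in simp)
  then have Qg: "Q\<Up>?g = ?Q1" using conj_unique[OF gc x] by blast
  have "t\<up>?g = t\<otimes>inv z" using th tq tc hc qc by (simp flip: conj_el_conj)
  then have "(inv t\<otimes>z)\<up>?g = inv (t\<otimes>inv z)\<otimes>t"
   using zg tc zc gc by (simp add: conj_el_mult conj_el_inv)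
  also have "\<dots> = z" using tc zc by (simp add: inv_mult_group m_assoc)
  finally have "(inv t\<otimes>z)\<up>?g = z" .
  moreover have "inv t\<otimes>z\<in>Q" using tQ z ZQ Qm Qi by blast
  ultimately have "z\<in>Q\<Up>?g" using conj_setI by metis
  then show ?thesis using goal Qg by simp
 next
  case False
  then have triv: "[.h, z.] = \<one>" if "h\<in>?Q1" "[.h, z.]\<in>?Z1" for h using that by blast
  show ?thesis
  proof (rule ccontr)
   assume "\<not> Z\<subseteq>?Q1"
   then have zQ1: "z\<notin>?Q1" using goal by blast
   have ZQ1: "w = \<one>" if w: "w\<in>Z" "w\<in>?Q1" for w
   proof (rule ccontr)
    assume "w\<noteq>\<one>"
    then have "z\<in>{\<one>, w, w\<otimes>w}" using Z_gen(1)[OF w(1)] z by blast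
    then show False using zQ1 w P.Qm P.Q1 by auto
   qed
   have iz: "subgroup (CG {z}) G" using zc by (intro centralizer_subgroup) simp
   let ?D = "?Q1\<inter>CG {z}"
   have D_sub: "subgroup ?D G" by (rule subgroups_Inter_pair[OF P.Q_sub iz])
   have memD: "h\<in>?D \<longleftrightarrow> h\<in>?Q1 \<and> [.h, z.] = \<one>" for h
    using comm_one_iff[of h z] zc by (auto simp: centralizer_def)
   have Dne: "?D\<noteq>?Q1"
   proof
    assume "?D = ?Q1"
    then have "[.h, z.]\<in>?Z1" if "h\<in>?Q1" for h using that memD[of h] P.Z1 by auto
    then have "z\<in>?Q1" using P.Q_stab[OF zcent] by blast
    then show False using zQ1 by blast
   qed
   have Z1D: "?Z1\<subseteq>?D"
   proof
    fix w assume w: "w\<in>?Z1"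
    then have "w\<otimes>z = z\<otimes>w" using zcent by (auto simp: centralizer_def)
    then show "w\<in>?D" using w P.ZQ by (auto simp: centralizer_def)
   qed
   have A_norm: "h\<up>b\<in>?Q1" if "h\<in>?Q1" "b\<in>?A" for h b
    using that cz1[of b] P.cent_Z_normalizes normalizing_conj by blast
   have bz: "z\<up>b = z" if "b\<in>?A" for b using that Z_fixed[OF z(1)] by blast
   have A_D: "h\<up>b\<in>?D" if h: "h\<in>?D" and b: "b\<in>?A" for h b
   proof -
    have "[.h\<up>b, z.] = [.h, z.]\<up>b" using conj_el_comm[of h z b] bz[OF b] h b zc by simp
    then have "[.h\<up>b, z.] = \<one>" using h b memD by simp
    then show ?thesis using memD A_norm h b by blast
   qed
   \<comment> \<open>\<open>A\<close> meets \<open>Q\<^sup>x\<close> only in \<open>Z\<^sup>x\<close>: the intersection is central in \<open>A\<close>.\<close>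
   have AQ1: "m\<in>?Z1" if m: "m\<in>?A" "m\<in>?Q1" for m
   proof -
    have "b\<otimes>m = m\<otimes>b" if b: "b\<in>?A" for b
    proof -
     have mc: "m\<in>carrier G" "b\<in>carrier G" using m b by auto
     have "[.m, b.]\<in>?Q1"
     using comm_eq_conj[OF mc] A_norm[OF m(2) b] P.Qm[OF P.Qi[OF m(2)]] by auto
     then have "[.m, b.] = \<one>" using ZQ1 Q_comm m b by blast
     then show ?thesis using comm_one_iff[OF mc] by simp
    qed
    then obtain w where w: "w\<in>Z" "m = w \<or> m = w\<otimes>z1 \<or> m = w\<otimes>(z1\<otimes>z1)"
     using cent_cent[OF z1Q, of m] m by blast
    have zz: "z1\<in>?Q1" "z1\<otimes>z1\<in>?Q1" using z1 P.ZQ P.Qm by blast+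
    have "w\<in>?Q1"
     using w m(2) subgroup_mult_cancel(2)[OF P.Q_sub zz(1), of w] subgroup_mult_cancel(2)[OF P.Q_sub zz(2), of w] by auto
    then have "w = \<one>" using ZQ1 w by blast
    then show ?thesis using w z1 P.Zm P.Z1 by auto
   qed
   have DA: "[.h, b.]\<in>?Z1" if h: "h\<in>?D" and b: "b\<in>?A" for h b
   proof (rule AQ1)
    have hc: "h\<in>carrier G" "b\<in>carrier G" using h b by auto
    show Q1: "[.h, b.]\<in>?Q1"
     using comm_eq_conj[OF hc] A_norm[of h b] h b P.Qm P.Qi by auto
    have "h\<in>CG Z"
    proof (rule centralizerI[OF hc(1) Z_carrier])
     fix w assume "w\<in>Z"
     then have "w\<in>{\<one>, z, z\<otimes>z}" using Z_gen(1)[OF z] by blast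
     moreover have "z\<up>h = z" using conj_el_fixed[OF zc hc(1)] h by (auto simp: centralizer_def)
     ultimately show "w\<up>h = w" using zc hc by (auto simp: conj_el_mult)
    qed
    then have "inv b\<up>h\<in>Q" using cent_Z_normalizes normalizing_conj Qi b by blast
    moreover have "[.h, b.] = (inv b\<up>h)\<otimes>b" using hc by (simp add: word_simps)
    ultimately have "[.h, b.]\<in>Q" using b Qm by auto
    moreover have "[.h, b.]\<in>CG {z1}"
     using P.Z_commutes[OF z1(1) Q1] hc by (auto simp: centralizer_def)
    ultimately show "[.h, b.]\<in>?A" by blast
   qed
   \<comment> \<open>A fixed point of \<open>A\<close> on the nontrivial cosets of \<open>D\<close>.\<close>
   let ?X = "(\<lambda>h. ?D #> h) ` ?Q1"
   have cosD: "?D #> h = ?D #> k \<longleftrightarrow> h\<otimes>inv k\<in>?D" if "h\<in>?Q1" "k\<in>?Q1" for h k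
    using rcos_eq_iff[OF D_sub] that by simp
   have cX: "card ?X * card ?D = 243"
    using card_fibres[OF P.Q_sub D_sub _ P.finQ, of "\<lambda>h. ?D #> h"] cosD P.Q_card by simp
   have X3: "3 dvd card ?X"
   proof -
    have "card ?X dvd 243" using cX by (metis dvd_triv_left)
    then obtain i where i: "card ?X = 3 ^ i" using divides_primepow_nat[of 3 "card ?X" 5] by auto
    have "i\<noteq>0"
    proof
     assume "i = 0"
     then have "card ?D = 243" using cX i by simp
     then have "?D = ?Q1" using P.Q_card P.finQ by (intro card_subset_eq) auto
     then show False using Dne by blast
    qed
    then show ?thesis using i by (simp add: dvd_power)
   qed
   have act: "(?D #> h)\<Up>b = ?D #> (h\<up>b)" if h: "h\<in>?Q1" and b: "b\<in>?A" for h b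
   proof
    have bc: "b\<in>carrier G" and hc: "h\<in>carrier G" using b h by auto
    show "(?D #> h)\<Up>b\<subseteq>?D #> (h\<up>b)"
    proof
     fix y assume "y\<in>(?D #> h)\<Up>b"
     then obtain c where c: "c\<in>?D #> h" "y = c\<up>b" unfolding conj_set_def by blast
     from c(1) obtain d where "d\<in>?D" "c = d\<otimes>h" unfolding r_coset_def by blast
     with c have d: "d\<in>?D" "y = (d\<otimes>h)\<up>b" by simp_all
     have "y = (d\<up>b)\<otimes>(h\<up>b)" using d bc hc by (simp add: conj_el_mult)
     then show "y\<in>?D #> (h\<up>b)" using A_D[OF d(1) b] unfolding r_coset_def by blast
    qed
    show "?D #> (h\<up>b)\<subseteq>(?D #> h)\<Up>b"
    proof
     fix y assume "y\<in>?D #> (h\<up>b)"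
     then obtain d where d: "d\<in>?D" "y = d\<otimes>(h\<up>b)" by (auto simp: r_coset_def)
     have bi: "inv b\<in>?A" by (rule subgroup.m_inv_closed[OF A_sub b])
     have "d\<up>inv b\<in>?D" by (rule A_D[OF d(1) bi])
     moreover have "y = ((d\<up>inv b)\<otimes>h)\<up>b" using d bc hc by (simp add: conj_el_mult)
     ultimately show "y\<in>(?D #> h)\<Up>b" unfolding conj_set_def r_coset_def by blast
    qed
   qed
   have "card ?X mod 3 = card {X\<in>?X. \<forall>b\<in>?A. X\<Up>b = X} mod 3"
   proof (rule p_group_fixed_points[OF A_sub, where k = 4])
    show "card ?A = 3 ^ 4" using card_cent[OF z1Q] by simp
    show "finite ?X" using P.finQ by simp
    fix X assume "X\<in>?X"
    then obtain h where h: "h\<in>?Q1" "X = ?D #> h" by blast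
    have Xc: "X\<subseteq>carrier G" using h subgroup.subset[OF D_sub] by (simp add: r_coset_subset_G)
    show "X\<Up>\<one> = X" by (rule conj_set_one[OF Xc])
    fix b assume b: "b\<in>?A"
    show "X\<Up>b\<in>?X" using act[OF h(1) b] h A_norm b by blast
    fix b' assume "b'\<in>?A"
    then show "X\<Up>(b\<otimes>b') = (X\<Up>b)\<Up>b'" using b Xc by (simp add: conj_set_conj)
   qed simp
   from trans[OF sym[OF this] dvd_imp_mod_0[OF X3]]
   have "3 dvd card {X\<in>?X. \<forall>b\<in>?A. X\<Up>b = X}" by (rule mod_0_imp_dvd)
   moreover have D0: "?D\<in>{X\<in>?X. \<forall>b\<in>?A. X\<Up>b = X}"
   proof -
    have "?D = ?D #> \<one>" using subgroup.subset[OF D_sub] by simp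
    then show ?thesis using act[OF P.Q1] P.Q1 by auto
   qed
   ultimately have ne: "{X\<in>?X. \<forall>b\<in>?A. X\<Up>b = X}\<noteq>{?D}" by auto
   from other_member[OF D0 ne] obtain X
    where XF: "X\<in>{X\<in>?X. \<forall>b\<in>?A. X\<Up>b = X}" and XD: "X\<noteq>?D" by (rule bexE)
   have X: "X\<in>?X" "\<forall>b\<in>?A. X\<Up>b = X" "X\<noteq>?D" using XF XD by simp_all
   from X(1) obtain h where h: "h\<in>?Q1" "X = ?D #> h" by (elim imageE) simp
   have hc: "h\<in>carrier G" using h by simp
   have hD: "h\<notin>?D" using X(3) h rcos_eq_self_iff[OF D_sub hc] by blast
   have hb: "[.h, b.]\<in>?D" if b: "b\<in>?A" for b
   proof -
    have bc: "b\<in>carrier G" using b by simp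
    have "?D #> (h\<up>b) = ?D #> h" using act[OF h(1) b] X(2) b h by metis
    then have d: "(h\<up>b)\<otimes>inv h\<in>?D" using cosD A_norm h b by blast
    let ?d = "(h\<up>b)\<otimes>inv h"
    have "[.h, b.] = ?d\<otimes>[.?d, h.]" using hc bc by (simp add: word_simps)
    moreover have "[.?d, h.]\<in>?D" using P.Q_comm[of ?d h] d h Z1D by blast
    ultimately show ?thesis using subgroup.m_closed[OF D_sub d] by metis
   qed
   let ?d = "[.h, a.]" and ?e = "[.h, a'.]"
   have d: "?d\<in>?D" "?e\<in>?D" using hb a by blast+
   have dc: "?d\<in>carrier G" "?e\<in>carrier G" using hc ac by simp_all
   have aa: "a\<otimes>a'\<in>?A" "a'\<otimes>a\<in>?A" using a subgroup.m_closed[OF A_sub] by blast+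
   have e1: "h\<up>(a\<otimes>a') = h\<otimes>?e\<otimes>?d\<otimes>[.?d, a'.]"
    using hc ac by (simp add: word_simps)
   have e2: "h\<up>(a'\<otimes>a) = h\<otimes>?d\<otimes>?e\<otimes>[.?e, a.]"
    using hc ac by (simp add: word_simps)
   let ?k = "h\<up>(a'\<otimes>a)"
   have kQ: "?k\<in>?Q1" by (rule A_norm[OF h(1) aa(2)])
   have kc: "?k\<in>carrier G" using kQ by simp
   have "?k\<up>z = h\<up>(a\<otimes>a')" unfolding z_def using hc ac by (simp add: word_simps)
   then have "[.?k, z.] = inv ?k\<otimes>(h\<up>(a\<otimes>a'))" using comm_eq_conj[OF kc zc] by simp
   also have "\<dots> = inv [.?e, a.]\<otimes>[.?e, ?d.]\<otimes>[.?d, a'.]"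
    unfolding e1 e2 using hc ac by (simp add: word_simps)
   also have "\<dots>\<in>?Z1"
    by (rule P.Zm[OF P.Zm[OF P.Zi[OF DA[OF d(2) a(1)]] P.Q_comm[OF IntD1[OF d(2)] IntD1[OF d(1)]]] DA[OF d(1) a(2)]])
   finally have "[.?k, z.] = \<one>" using triv kQ by blast
   then have "?k\<in>?D" using memD kQ by blast
   then have "?k\<up>inv (a'\<otimes>a)\<in>?D" using A_D subgroup.m_inv_closed[OF A_sub aa(2)] by blast
   then show False using hD hc ac by simp
  qed
 qed
qed

end

section \<open>Two conjugates centralizing each other's centres\<close>

lemma (in group) centralizer_normal:
 assumes Y: "Y\<subseteq>carrier G" and c: "c\<in>CG Y" and g: "g\<in>normalizing Y"
 shows "c\<up>g\<in>CG Y"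
proof -
 have gc: "g\<in>carrier G" and cc: "c\<in>carrier G" using g c normalizing_carrier centralizer_carrier by blast+
 have gi: "inv g\<in>normalizing Y" by (rule subgroup.m_inv_closed[OF normalizing_subgroup[OF Y] g])
 show ?thesis
 proof (rule centralizerI)
  show "c\<up>g\<in>carrier G" using gc cc by simp
  fix y assume y: "y\<in>Y"
  then have yc: "y\<in>carrier G" using Y by blast
  have "(y\<up>inv g)\<up>c = y\<up>inv g"
   by (rule centralizer_conj_el[OF c normalizing_conj[OF gi y]]) (use yc gc in simp)
  then have "((y\<up>inv g)\<up>c)\<up>g = y" using yc gc by simp
  moreover have "((y\<up>inv g)\<up>c)\<up>g = y\<up>(c\<up>g)" using yc gc cc by (simp add: word_simps)
  ultimately show "y\<up>(c\<up>g) = y" by simp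
 qed (rule Y)
qed

lemma (in group) comm_in_centralizer:
 assumes Y: "Y\<subseteq>carrier G" and c: "c\<in>CG Y" and g: "g\<in>normalizing Y"
 shows "[.c, g.]\<in>CG Y" "[.g, c.]\<in>CG Y"
proof -
 have gc: "g\<in>carrier G" and cc: "c\<in>carrier G" using g c normalizing_carrier centralizer_carrier by blast+
 note cs = centralizer_subgroup[OF Y]
 have "[.c, g.] = inv c\<otimes>(c\<up>g)" by (rule comm_eq_conj[OF cc gc])
 then show 1: "[.c, g.]\<in>CG Y"
  using subgroup.m_closed[OF cs subgroup.m_inv_closed[OF cs c] centralizer_normal[OF Y c g]] by simp
 show "[.g, c.]\<in>CG Y"
  using subgroup.m_inv_closed[OF cs 1] inv_comm_swap[OF cc gc] by simp
qed

context group begin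

lemma index_3_cosets:
 assumes H: "subgroup H G" "finite H" and K: "subgroup K G" "K\<subseteq>H" and c: "card H = 3 * card K"
  and g: "g\<in>H" "g~:K" "g\<otimes>(g\<otimes>g)\<in>K" and h: "h\<in>H"
 shows "\<exists>k\<in>K. h = k \<or> h = k\<otimes>g \<or> h = k\<otimes>(g\<otimes>g)"
proof -
 have Hc: "u\<in>carrier G" if "u\<in>H" for u using that H subgroup_carrier by blast
 have Kc: "K\<subseteq>carrier G" using K subgroup.subset by blast
 have gc: "g\<in>carrier G" "g\<otimes>g\<in>carrier G" using g Hc by simp_all
 have gg: "g\<otimes>g~:K"
  using subgroup_mult_cancel(2)[OF K(1), of "g\<otimes>g" g] g gc by auto
 have ig: "inv g~:K" using subgroup_inv_iff[OF K(1) gc(1)] g by simp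
 have d1: "K #> g~=K" using rcos_eq_self_iff[OF K(1) gc(1)] g by simp
 have d2: "K #> (g\<otimes>g)~=K" using rcos_eq_self_iff[OF K(1) gc(2)] gg by simp
 have d3: "K #> (g\<otimes>g)~=K #> g" using rcos_eq_iff[OF K(1) gc(2,1)] gc g by (simp add: m_assoc)
 have fK: "finite K" using K H finite_subset by blast
 have cK: "card K > 0" using fK subgroup.one_closed[OF K(1)] by (auto simp: card_gt_0_iff)
 let ?C = "{K, K #> g, K #> (g\<otimes>g)}"
 let ?X = "(\<lambda>u. K #> u) ` H"
 have "card ?X * card K = card H"
  by (rule card_fibres[OF H(1) K H(2)]) (use rcos_eq_iff[OF K(1)] Hc in blast)
 then have cX: "card ?X = 3" using c cK by simp
 have KK: "K = K #> \<one>" using Kc by simp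
 have "?C\<subseteq>?X"
  using g H(1) KK subgroup.one_closed[OF H(1)] subgroup.m_closed[OF H(1) g(1) g(1)] by blast
 moreover have "card ?C = 3" using d1 d2 d3 by auto
 ultimately have "?C = ?X" using cX H(2) by (intro card_subset_eq) auto
 then have "K #> h\<in>?C" using h by blast
 moreover have "h\<in>K #> h" using rcos_self[OF Hc[OF h] K(1)] .
 ultimately show ?thesis using h by (auto simp: r_coset_def)
qed

end

locale extraspecial_pair = group G + P: large_extraspecial G Z Q + R: large_extraspecial G Z1 Q1
  for G (structure) and Z Q Z1 Q1 +
 fixes x
 assumes x: "x\<in>carrier G" "Z1 = Z\<Up>x" "Q1 = Q\<Up>x" and ne: "Z~=Z1" and Z1Q: "Z1\<subseteq>Q" and ZQ1: "Z\<subseteq>Q1"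
begin

lemma swap: "extraspecial_pair G Z1 Q1 Z Q (inv x)"
proof (rule extraspecial_pair.intro[OF is_group R.large_extraspecial_axioms P.large_extraspecial_axioms], rule extraspecial_pair_axioms.intro)
 show "inv x\<in>carrier G" using x by simp
 show "Z = Z1\<Up>inv x" "Q = Q1\<Up>inv x"
  unfolding x using conj_set_cancel(1) P.Z_carrier P.Q_carrier x(1) by simp_all
qed (use ne Z1Q ZQ1 in auto)

abbreviation "Y \<equiv> Z<#>Z1"
abbreviation "A \<equiv> Q\<inter>CG Z1"
abbreviation "B \<equiv> Q1\<inter>CG Z"
abbreviation "E \<equiv> Q\<inter>Q1"
abbreviation "L \<equiv> generate G (Q \<union> Q1)"
abbreviation "N \<equiv> A<#>B"
abbreviation "W \<equiv> L\<inter>CG Y"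

lemma dis: "Z\<inter>Z1 = {\<one>}" "w\<in>Z ==> w\<in>Z1 ==> w = \<one>"
 using P.distinct_order_3[OF R.Z_sub R.Z_card] ne by blast+

lemma ZZ1_commute: "w\<in>Z ==> v\<in>Z1 ==> w\<otimes>v = v\<otimes>w"
 using P.Z_commutes Z1Q by blast

lemma cent_Z1_eq: assumes z1: "z1\<in>Z1" "z1~=\<one>" shows "CG Z1 = CG {z1}"
proof
 show "CG Z1\<subseteq>CG {z1}" using z1 by (auto simp: centralizer_def)
 show "CG {z1}\<subseteq>CG Z1"
 proof
  fix g assume g: "g\<in>CG {z1}"
  have gc: "g\<in>carrier G" using g centralizer_carrier by blast
  have f: "z1\<up>g = z1" by (rule centralizer_conj_el[OF g]) (use z1 in auto)
  show "g\<in>CG Z1"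
  proof (rule centralizerI[OF gc R.Z_carrier])
   fix w assume "w\<in>Z1"
   then have "w\<in>{\<one>, z1, z1\<otimes>z1}" using R.Z_gen(1)[OF z1] by blast
   then show "w\<up>g = w" using f gc z1 by (auto simp: conj_el_mult)
  qed
 qed
qed

lemma A_sub: "subgroup A G"
 by (rule subgroups_Inter_pair[OF P.Q_sub centralizer_subgroup[OF R.Z_carrier]])

lemma A_carrier: "A\<subseteq>carrier G" by auto
lemma finA: "finite A" using P.finQ by simp

lemma A_card: "card A = 81"
proof -
 obtain z1 where z1: "z1\<in>Z1" "z1~=\<one>" by (rule R.Z_ex)
 then have "z1\<in>Q" "z1~:Z" using Z1Q dis by blast+
 then show ?thesis using P.card_cent cent_Z1_eq[OF z1] by simp
qed

lemma Y_sub: "subgroup Y G"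
proof (rule set_mult_subgroup[OF P.Z_sub R.Z_sub])
 fix w v assume "w\<in>Z" "v\<in>Z1"
 then have "v\<up>w = v" using conj_el_fixed[of v w] ZZ1_commute by simp
 then show "v\<up>w\<in>Z1" using \<open>v\<in>Z1\<close> by simp
qed

lemma Y_card: "card Y = 9"
 using card_set_mult_inter[OF P.Z_sub P.finZ R.Z_sub R.finZ] dis P.Z_card R.Z_card by simp

lemma YQ: "Y\<subseteq>Q" by (rule set_mult_subset[OF P.Q_sub P.ZQ Z1Q])
lemma YQ1: "Y\<subseteq>Q1" by (rule set_mult_subset[OF R.Q_sub ZQ1 R.ZQ])
lemma Y_carrier: "Y\<subseteq>carrier G" using YQ by auto
lemma Yc [simp]: "y\<in>Y ==> y\<in>carrier G" using Y_carrier by blast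
lemma finY: "finite Y" using Y_card by (metis card.infinite zero_neq_numeral)
lemma ZY: "Z\<subseteq>Y" by (rule set_mult_left[OF R.Z_sub P.Z_carrier])
lemma Z1Y: "Z1\<subseteq>Y" by (rule set_mult_right[OF P.Z_sub R.Z_carrier])
lemmas Ym = subgroup.m_closed[OF Y_sub] and Yi = subgroup.m_inv_closed[OF Y_sub] and Y1 = subgroup.one_closed[OF Y_sub]
lemmas Am = subgroup.m_closed[OF A_sub] and Ai = subgroup.m_inv_closed[OF A_sub] and A1 = subgroup.one_closed[OF A_sub]

lemma cent_Y: "CG Y = CG Z\<inter>CG Z1"
proof
 show "CG Y\<subseteq>CG Z\<inter>CG Z1" using ZY Z1Y by (auto simp: centralizer_def)
 show "CG Z\<inter>CG Z1\<subseteq>CG Y"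
 proof
  fix g assume g: "g\<in>CG Z\<inter>CG Z1"
  then have gc: "g\<in>carrier G" using centralizer_carrier by blast
  show "g\<in>CG Y"
  proof (rule centralizerI[OF gc Y_carrier])
   fix y assume "y\<in>Y"
   then obtain w v where y: "w\<in>Z" "v\<in>Z1" "y = w\<otimes>v" by (auto simp: set_mult_def)
   have "w\<up>g = w" "v\<up>g = v" using g y centralizer_conj_el by auto
   then show "y\<up>g = y" using y gc by (simp add: conj_el_mult)
  qed
 qed
qed

lemma A_alt: "A = Q\<inter>CG Y"
 using cent_Y P.Q_cent_Z by blast

lemma C_sub: "subgroup (CG Y) G" by (rule centralizer_subgroup[OF Y_carrier])

lemma Y_abelian: "y\<in>Y ==> y'\<in>Y ==> y\<otimes>y' = y'\<otimes>y"
proof -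
 assume y: "y\<in>Y" "y'\<in>Y"
 then obtain w v where wv: "w\<in>Z" "v\<in>Z1" "y = w\<otimes>v" by (auto simp: set_mult_def)
 have 1: "w\<otimes>y' = y'\<otimes>w" using P.Z_commutes[OF wv(1)] YQ y by blast
 have 2: "v\<otimes>y' = y'\<otimes>v" using R.Z_commutes[OF wv(2)] YQ1 y by blast
 show ?thesis using 1 2 wv y by (metis P.Zc R.Zc Yc m_assoc)
qed

lemma Y_cent: "Y\<subseteq>CG Y" using Y_abelian by (auto simp: centralizer_def)
lemma YA: "Y\<subseteq>A" using A_alt Y_cent YQ by blast

lemma Y_fixed: "y\<in>Y ==> c\<in>CG Y ==> y\<up>c = y"
 by (rule centralizer_conj_el) auto

lemma A_centre:
 assumes d: "d\<in>A" "\<And>a. a\<in>A ==> a\<otimes>d = d\<otimes>a" shows "d\<in>Y"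
proof -
 obtain z1 where z1: "z1\<in>Z1" "z1~=\<one>" by (rule R.Z_ex)
 then have z1Q: "z1\<in>Q" "z1~:Z" using Z1Q dis by blast+
 obtain w where w: "w\<in>Z" "d = w \<or> d = w\<otimes>z1 \<or> d = w\<otimes>(z1\<otimes>z1)"
  using P.cent_cent[OF z1Q, of d] d cent_Z1_eq[OF z1] by blast
 have "w\<in>Y" "z1\<in>Y" "z1\<otimes>z1\<in>Y" using w z1 ZY Z1Y Ym by blast+
 then show ?thesis using w Ym by blast
qed

lemma A_nonabelian: "\<exists>a\<in>A. \<exists>b\<in>A. [.a, b.]~=\<one>"
proof (rule ccontr)
 assume "\<not> ?thesis"
 then have "a\<otimes>b = b\<otimes>a" if "a\<in>A" "b\<in>A" for a b using that comm_one_iff[of a b] by auto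
 then have "card A \<le> 27" by (intro P.abelian_card_le[OF A_sub]) auto
 then show False using A_card by simp
qed

lemma Q_norm_Y: "Q\<subseteq>normalizing Y"
proof
 fix q assume q: "q\<in>Q"
 show "q\<in>normalizing Y"
 proof (rule normalizingI[OF finY Y_carrier])
  fix y assume y: "y\<in>Y"
  then have "y\<up>q = y\<otimes>[.y, q.]" using q by (intro conj_el_eq_comm) auto
  moreover have "[.y, q.]\<in>Y" using P.Q_comm[of y q] y q YQ ZY by blast
  ultimately show "y\<up>q\<in>Y" using Ym y by simp
 qed (use q in simp)
qed

lemma Q_norm_A: "q\<in>Q ==> a\<in>A ==> a\<up>q\<in>A"
 using centralizer_normal[OF Y_carrier, of a q] Q_norm_Y subgroup_conj[OF P.Q_sub, of a q] A_alt by blast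

lemma A_norm_Q1: "A\<subseteq>normalizing Q1" using R.cent_Z_normalizes by blast

lemma C_norm_Q: "CG Y\<subseteq>normalizing Q" using cent_Y P.cent_Z_normalizes by blast

lemma comm_Q_C: assumes q: "q\<in>Q" and c: "c\<in>CG Y" shows "[.q, c.]\<in>A" "[.c, q.]\<in>A"
proof -
 have cc: "c\<in>carrier G" using c centralizer_carrier by blast
 have "[.q, c.] = inv q\<otimes>(q\<up>c)" using q cc by (intro comm_eq_conj) auto
 then have "[.q, c.]\<in>Q" using P.Qm P.Qi q normalizing_conj[of c Q q] C_norm_Q c by auto
 then show 1: "[.q, c.]\<in>A" using comm_in_centralizer(2)[OF Y_carrier c] Q_norm_Y q A_alt by blast
 show "[.c, q.]\<in>A" using Ai[OF 1] inv_comm_swap[of q c] q cc by simp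
qed

lemma EA: "E\<subseteq>A" using R.Q_cent_Z by blast
lemma E_sub: "subgroup E G" by (rule subgroups_Inter_pair[OF P.Q_sub R.Q_sub])
lemma YE: "Y\<subseteq>E" using YQ YQ1 by blast
lemma E_abelian: "e\<in>E ==> e'\<in>E ==> e\<otimes>e' = e'\<otimes>e"
 using P.Q_comm[of e e'] R.Q_comm[of e e'] dis comm_one_iff[of e e'] by auto

lemma Q_power_coset:
 assumes a: "a\<in>Q" "a~:A" and q: "q\<in>Q" shows "\<exists>a'\<in>A. q = a' \<or> q = a'\<otimes>a \<or> q = a'\<otimes>(a\<otimes>a)"
proof (rule index_3_cosets[OF P.Q_sub P.finQ A_sub _ _ a _ q])
 show "a\<otimes>(a\<otimes>a)\<in>A" using P.Q_cube[OF a(1)] cube_eq[of a] a A1 by simp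
qed (use P.Q_card A_card in auto)

lemma N_subset: "A\<subseteq>N"
proof (rule set_mult_left[OF _ A_carrier])
 show "subgroup B G" by (rule subgroups_Inter_pair[OF R.Q_sub centralizer_subgroup[OF P.Z_carrier]])
qed

lemma L_sub: "subgroup L G"
 using P.Q_carrier R.Q_carrier by (intro generate_is_subgroup) blast

lemma QL: "Q\<subseteq>L" "Q1\<subseteq>L" by (auto intro: generate.incl)

lemma L_subsetI: "subgroup H G ==> Q\<subseteq>H ==> Q1\<subseteq>H ==> L\<subseteq>H"
 by (intro generate_subgroup_incl) auto

end

context extraspecial_pair begin

interpretation S: extraspecial_pair G Z1 Q1 Z Q "inv x" by (rule swap)

lemma Y_swap: "Z1<#>Z = Y"
 unfolding set_mult_def using ZZ1_commute by auto (metis+)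

lemmas B_sub = S.A_sub and B_card = S.A_card and B_carrier = S.A_carrier and finB = S.finA
lemmas B_alt = S.A_alt[unfolded Y_swap] and YB = S.YA[unfolded Y_swap]
lemmas B_centre = S.A_centre[unfolded Y_swap] and B_nonabelian = S.A_nonabelian
lemmas Q1_norm_Y = S.Q_norm_Y[unfolded Y_swap] and Q1_norm_B = S.Q_norm_A
lemmas B_norm_Q = S.A_norm_Q1 and C_norm_Q1 = S.C_norm_Q[unfolded Y_swap]
lemmas comm_Q1_C = S.comm_Q_C[unfolded Y_swap]
lemmas Q1_power_coset = S.Q_power_coset
lemmas Bm = subgroup.m_closed[OF B_sub] and Bi = subgroup.m_inv_closed[OF B_sub] and B1 = subgroup.one_closed[OF B_sub]
lemmas Em = subgroup.m_closed[OF E_sub] and Ei = subgroup.m_inv_closed[OF E_sub] and E1 = subgroup.one_closed[OF E_sub]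

lemma EB: "E\<subseteq>B" using P.Q_cent_Z by blast
lemma E_AB: "E = A\<inter>B" using EA EB by blast

lemma comm_AB: "a\<in>A ==> b\<in>B ==> [.a, b.]\<in>E" "a\<in>A ==> b\<in>B ==> [.b, a.]\<in>E"
proof -
 assume a: "a\<in>A" and b: "b\<in>B"
 have "[.a, b.]\<in>A" "[.b, a.]\<in>A" using comm_Q_C[of a b] a b B_alt by blast+
 moreover have "[.a, b.]\<in>B" "[.b, a.]\<in>B" using comm_Q1_C[of b a] a b A_alt by blast+
 ultimately show "[.a, b.]\<in>E" "[.b, a.]\<in>E" using E_AB by blast+
qed

lemma N_sub: "subgroup N G"
proof (rule set_mult_subgroup[OF A_sub B_sub])
 fix a b assume a: "a\<in>A" and b: "b\<in>B"
 then have "b\<up>a = b\<otimes>[.b, a.]" by (intro conj_el_eq_comm) auto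
 moreover have "[.b, a.]\<in>B" using comm_AB(2)[OF a b] EB by blast
 ultimately show "b\<up>a\<in>B" using Bm b by simp
qed

lemmas Nm = subgroup.m_closed[OF N_sub] and Ni = subgroup.m_inv_closed[OF N_sub] and N1 = subgroup.one_closed[OF N_sub]
lemma BN: "B\<subseteq>N" by (rule set_mult_right[OF A_sub B_carrier])
lemma Nc [simp]: "n\<in>N ==> n\<in>carrier G" using N_sub subgroup_carrier by blast
lemma finN: "finite N" using P.fin subgroup.subset[OF N_sub] finite_subset by blast
lemma N_carrier: "N\<subseteq>carrier G" by (rule subgroup.subset[OF N_sub])

lemma L_norm_Y: "L\<subseteq>normalizing Y"
 by (rule L_subsetI[OF normalizing_subgroup[OF Y_carrier] Q_norm_Y Q1_norm_Y])

lemma L_norm_N: "L\<subseteq>normalizing N"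
proof (rule L_subsetI[OF normalizing_subgroup[OF N_carrier]])
 show "Q\<subseteq>normalizing N"
 proof
  fix q assume q: "q\<in>Q"
  show "q\<in>normalizing N"
  proof (rule normalizingI[OF finN N_carrier])
   fix n assume "n\<in>N"
   then obtain a b where ab: "a\<in>A" "b\<in>B" "n = a\<otimes>b" by (auto simp: set_mult_def)
   have "a\<up>q\<in>N" using Q_norm_A q ab N_subset by blast
   moreover have "b\<up>q = b\<otimes>[.b, q.]" using ab q by (intro conj_el_eq_comm) auto
   moreover have "[.b, q.]\<in>N" using comm_Q_C(2)[OF q, of b] ab B_alt N_subset by blast
   moreover have "b\<in>N" using ab BN by blast
   moreover have "n\<up>q = (a\<up>q)\<otimes>(b\<up>q)" using ab q by (simp add: conj_el_mult)
   ultimately show "n\<up>q\<in>N" using Nm by simp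
  qed (use q in simp)
 qed
 show "Q1\<subseteq>normalizing N"
 proof
  fix q assume q: "q\<in>Q1"
  show "q\<in>normalizing N"
  proof (rule normalizingI[OF finN N_carrier])
   fix n assume "n\<in>N"
   then obtain a b where ab: "a\<in>A" "b\<in>B" "n = a\<otimes>b" by (auto simp: set_mult_def)
   have "b\<up>q\<in>N" using Q1_norm_B q ab BN by blast
   moreover have "a\<up>q = a\<otimes>[.a, q.]" using ab q by (intro conj_el_eq_comm) auto
   moreover have "[.a, q.]\<in>N" using comm_Q1_C(2)[OF q, of a] ab A_alt BN by blast
   moreover have "a\<in>N" using ab N_subset by blast
   moreover have "n\<up>q = (a\<up>q)\<otimes>(b\<up>q)" using ab q by (simp add: conj_el_mult)
   ultimately show "n\<up>q\<in>N" using Nm by simp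
  qed (use q in simp)
 qed
qed

lemma Lc [simp]: "g\<in>L ==> g\<in>carrier G" using L_sub subgroup_carrier by blast
lemmas Lm = subgroup.m_closed[OF L_sub] and Li = subgroup.m_inv_closed[OF L_sub] and L1 = subgroup.one_closed[OF L_sub]
lemma finL: "finite L" using P.fin subgroup.subset[OF L_sub] finite_subset by blast
lemma W_sub: "subgroup W G" by (rule subgroups_Inter_pair[OF L_sub C_sub])
lemmas Wm = subgroup.m_closed[OF W_sub] and Wi = subgroup.m_inv_closed[OF W_sub] and W1 = subgroup.one_closed[OF W_sub]
lemma Wc [simp]: "w\<in>W ==> w\<in>carrier G" by simp
lemma finW: "finite W" using finL by simp
lemma W_carrier: "W\<subseteq>carrier G" by auto

lemma NW: "N\<subseteq>W"
 by (rule set_mult_subset[OF W_sub]) (use A_alt B_alt QL in blast)+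

lemma L_norm_W: "g\<in>L ==> w\<in>W ==> w\<up>g\<in>W"
 using centralizer_normal[OF Y_carrier, of w g] L_norm_Y subgroup_conj[OF L_sub, of w g] by blast

lemma L_normalizing_W: "L\<subseteq>normalizing W"
 using normalizingI[OF finW W_carrier] L_norm_W Lc by blast

lemma W_normal: "W \<lhd> G\<lparr>carrier := L\<rparr>"
 by (rule normal_onI[OF L_sub W_sub]) (use L_norm_W in auto)

lemma N_normal: "N \<lhd> G\<lparr>carrier := L\<rparr>"
 by (rule normal_onI[OF L_sub N_sub]) (use NW L_norm_N normalizing_conj in blast)+

lemma Y_module: "natural_SL23_module G L W Y {\<one>}"
proof -
 have W: "W = L\<inter>trivial_on Y {\<one>}"
 proof -
  have "\<one>\<up>g = \<one>" if "g\<in>carrier G" for g using that by simp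
  then have n1: "g\<in>normalizing {\<one>}" if "g\<in>carrier G" for g
   using that by (intro normalizingI) auto
  have "g\<in>CG Y \<longleftrightarrow> (\<forall>y\<in>Y. [.y, g.] = \<one>)" if g: "g\<in>L" for g
  proof -
   have gc: "g\<in>carrier G" using g by (rule Lc)
   have 1: "[.y, g.] = \<one> \<longleftrightarrow> g\<otimes>y = y\<otimes>g" if "y\<in>Y" for y
    using comm_one_iff[OF Yc[OF that] gc] by (metis (no_types))
   have "g\<in>CG Y \<longleftrightarrow> (\<forall>y\<in>Y. g\<otimes>y = y\<otimes>g)" unfolding centralizer_def mem_Collect_eq using gc by blast
   also have "\<dots> \<longleftrightarrow> (\<forall>y\<in>Y. [.y, g.] = \<one>)" using 1 by (intro ball_cong) simp_all
   finally show ?thesis .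
  qed
  then show ?thesis using n1 L_norm_Y Lc unfolding trivial_on_def by blast
 qed
 obtain z where z: "z\<in>Z" "z~=\<one>" by (rule P.Z_ex)
 obtain z1 where z1: "z1\<in>Z1" "z1~=\<one>" by (rule R.Z_ex)
 have zQ: "z\<in>Q1" "z~:Z1" and z1Q: "z1\<in>Q" "z1~:Z" using z z1 ZQ1 Z1Q dis by blast+
 obtain q where q: "q\<in>Q" "[.q, z1.] = z" using P.comm_onto[OF z1Q z(1)] by blast
 obtain r where r: "r\<in>Q1" "[.r, z.] = z1" using R.comm_onto[OF zQ z1(1)] by blast
 show ?thesis unfolding W
 proof (rule natural_module_recognition[where P = Q and R = Q1 and U = Z and V = Z1])
  show "L\<subseteq>normalizing Y\<inter>normalizing {\<one>}"
   using L_norm_Y Lc by (auto intro!: normalizingI)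
  show "\<exists>a\<in>Y. \<exists>g\<in>Q. [.a, g.]~:{\<one>}"
  proof -
   have "[.z1, q.]~=\<one>" using inv_comm_swap[OF P.Qc[OF q(1)] P.Qc[OF z1Q(1)]] q(2) z inv_eq_1_iff[OF P.Zc[OF z(1)]] by simp
   then show ?thesis using q z1 Z1Y by blast
  qed
  show "\<exists>a\<in>Y. \<exists>g\<in>Q1. [.a, g.]~:{\<one>}"
  proof -
   have "[.z, r.]~=\<one>" using inv_comm_swap[OF R.Qc[OF r(1)] R.Qc[OF zQ(1)]] r(2) z1 inv_eq_1_iff[OF R.Zc[OF z1(1)]] by simp
   then show ?thesis using r z ZY by blast
  qed
  show "[.a, g.]\<in>Z" if "a\<in>Y" "g\<in>Q" for a g using that P.Q_comm YQ by blast
  show "[.a, g.]\<in>Z1" if "a\<in>Y" "g\<in>Q1" for a g using that R.Q_comm YQ1 by blast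
  show "[.a, g.]\<in>{\<one>}" if "a\<in>Z" "g\<in>Q" for a g
   using that P.Z_commutes[OF that] comm_one_iff[of a g] by simp
  show "[.a, g.]\<in>{\<one>}" if "a\<in>Z1" "g\<in>Q1" for a g
   using that R.Z_commutes[OF that] comm_one_iff[of a g] by simp
  show "a [^] (3::nat)\<in>{\<one>}" if "a\<in>Y" for a using P.Q_cube that YQ by blast
  show "[.a, b.]\<in>{\<one>}" if "a\<in>Y" "b\<in>Y" for a b
   using that Y_abelian[OF that] comm_one_iff[of a b] by simp
  show "card Y = 9 * card {\<one>}" by (simp add: Y_card)
  show "Z~={\<one>}" "Z1~={\<one>}" using z z1 by blast+
  show "{\<one>}\<subseteq>Z" "{\<one>}\<subseteq>Z1" using P.Z1 R.Z1 by auto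
 qed (use Y_sub finY triv_subgroup P.Z_sub R.Z_sub ZY Z1Y dis P.Q_carrier R.Q_carrier in auto)
qed

lemma L_mod_W_iso: "\<exists>\<phi>. \<phi>\<in>iso (G\<lparr>carrier := L\<rparr> Mod W) SL23"
 using Y_module unfolding natural_SL23_module_def by blast

lemma card_L_W: "card L = 24 * card W"
proof -
 obtain \<phi> where "\<phi>\<in>iso (G\<lparr>carrier := L\<rparr> Mod W) SL23" using L_mod_W_iso by blast
 then have "order (G\<lparr>carrier := L\<rparr> Mod W) = 24"
  using iso_same_card[of "G\<lparr>carrier := L\<rparr> Mod W" SL23] order_SL23 by (auto simp: order_def is_iso_def)
 then show ?thesis using section_order[OF L_sub finL W_sub] by simp
qed

text \<open>\<open>a\<close> and \<open>b\<close> are chosen so that their matrices on \<open>Y\<close> satisfy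
 the relation.  The quotient of the two sides is \<open>a\<^sup>g b\<inverse>\<close> with \<open>g =
 (ab)\<inverse>\<close>, which lies in \<open>Q\<^sub>1\<close> because \<open>g\<close> maps \<open>Z\<close>
 to \<open>Z\<^sub>1\<close>.\<close>

lemma braid_pair:
 obtains a b where "a\<in>Q" "a~:A" "b\<in>Q1" "b~:B" "(a\<otimes>b\<otimes>a)\<otimes>inv (b\<otimes>a\<otimes>b)\<in>B"
  "Q\<Up>inv (a\<otimes>b) = Q1"
proof -
 obtain z where z: "z\<in>Z" "z~=\<one>" by (rule P.Z_ex)
 obtain z1 where z1: "z1\<in>Z1" "z1~=\<one>" by (rule R.Z_ex)
 have zQ: "z\<in>Q1" "z~:Z1" and z1Q: "z1\<in>Q" "z1~:Z" using z z1 ZQ1 Z1Q dis by blast+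
 have zc: "z\<in>carrier G" "z1\<in>carrier G" using z z1 by simp_all
 have zi: "inv z\<in>Z" by (rule P.Zi[OF z(1)])
 obtain a where a: "a\<in>Q" "[.a, z1.] = inv z" using P.comm_onto[OF z1Q zi] by blast
 obtain b where b: "b\<in>Q1" "[.b, z.] = z1" using R.comm_onto[OF zQ z1(1)] by blast
 have ac: "a\<in>carrier G" "b\<in>carrier G" using a b by simp_all
 have comm: "z\<otimes>z1 = z1\<otimes>z" by (rule ZZ1_commute[OF z(1) z1(1)])
 have "[.z1, a.] = z" using inv_comm_swap[OF ac(1) zc(2)] a zc by simp
 then have z1a: "z1\<up>a = z1\<otimes>z" using conj_el_eq_comm[OF zc(2) ac(1)] by simp
 have "[.z, b.] = inv z1" using inv_comm_swap[OF ac(2) zc(1)] b by simp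
 then have zb: "z\<up>b = z\<otimes>inv z1" using conj_el_eq_comm[OF zc(1) ac(2)] by simp
 have za: "z\<up>a = z" by (rule P.Z_fixed[OF z(1) a(1)])
 have z1b: "z1\<up>b = z1" by (rule R.Z_fixed[OF z1(1) b(1)])
 have zz1: "z\<otimes>(inv z1\<otimes>w) = inv z1\<otimes>(z\<otimes>w)" if "w\<in>carrier G" for w
 proof -
  have "inv z1\<otimes>z = z\<otimes>inv z1" using comm zc by (metis inv_closed inv_solve_right m_assoc m_closed r_inv r_one l_inv l_one)
  then show ?thesis using zc that by (metis inv_closed m_assoc)
 qed
 have A0: "a~:A"
 proof
  assume "a\<in>A"
  then have "a\<otimes>z1 = z1\<otimes>a" using centralizerD[of a Z1 z1] z1(1) by blast
  then have "inv z = \<one>" using a comm_one_iff[OF ac(1) zc(2)] by simp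
  then show False using z zc by simp
 qed
 have B0: "b~:B"
 proof
  assume "b\<in>B"
  then have "b\<otimes>z = z\<otimes>b" using centralizerD[of b Z z] z(1) by blast
  then show False using b z1 comm_one_iff[OF ac(2) zc(1)] by simp
 qed
 have z1ab: "z1\<up>(a\<otimes>b) = z"
 proof -
  have "z1\<up>(a\<otimes>b) = z1\<otimes>(z\<otimes>inv z1)"
   using z1a z1b zb zc ac by (simp add: conj_el_mult flip: conj_el_conj)
  also have "\<dots> = (z\<otimes>z1)\<otimes>inv z1" using comm zc by (simp flip: m_assoc)
  finally show ?thesis using zc by (simp add: m_assoc)
 qed
 let ?g = "inv (a\<otimes>b)"
 have gc: "?g\<in>carrier G" using ac by simp
 have zg: "z\<up>?g = z1" using z1ab zc ac by (metis conj_el_cancel(1) m_closed)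
 have "Z\<Up>?g = Z1" by (rule P.Z_conj_eqI[OF gc R.Z_sub R.Z_card z]) (use zg z1 in simp)
 then have Qg: "Q\<Up>?g = Q1" using P.conj_unique[OF gc x(1)] x by simp
 then have "a\<up>?g\<in>Q1" using conj_setI[OF a(1)] by blast
 then have q: "(a\<up>?g)\<otimes>inv b\<in>Q1" using R.Qm R.Qi b by blast
 have eq: "(a\<otimes>b\<otimes>a)\<otimes>inv (b\<otimes>a\<otimes>b) = (a\<up>?g)\<otimes>inv b"
  using ac by (simp add: word_simps)
 have act1: "z\<up>(a\<otimes>b\<otimes>a) = inv z1" "z\<up>(b\<otimes>a\<otimes>b) = inv z1"
  using za z1a zb z1b zc ac comm zz1 by (simp_all add: conj_el_mult conj_el_inv inv_mult_group m_assoc flip: conj_el_conj)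
 have act2: "z1\<up>(a\<otimes>b\<otimes>a) = z" "z1\<up>(b\<otimes>a\<otimes>b) = z"
  using z1ab za z1b zc ac by (simp_all add: m_assoc flip: conj_el_conj)
 let ?c = "(a\<otimes>b\<otimes>a)\<otimes>inv (b\<otimes>a\<otimes>b)"
 have cc: "?c\<in>carrier G" using ac by simp
 have "z\<up>?c = (z\<up>(a\<otimes>b\<otimes>a))\<up>inv (b\<otimes>a\<otimes>b)"
  using zc ac conj_el_conj[of z "a\<otimes>b\<otimes>a" "inv (b\<otimes>a\<otimes>b)"] by simp
 also have "\<dots> = z" unfolding act1(1) act1(2)[symmetric] using zc ac by (intro conj_el_cancel) auto
 finally have cz: "z\<up>?c = z" .
 have "z1\<up>?c = (z1\<up>(a\<otimes>b\<otimes>a))\<up>inv (b\<otimes>a\<otimes>b)"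
  using zc ac conj_el_conj[of z1 "a\<otimes>b\<otimes>a" "inv (b\<otimes>a\<otimes>b)"] by simp
 also have "\<dots> = z1" unfolding act2(1) act2(2)[symmetric] using zc ac by (intro conj_el_cancel) auto
 finally have cz1: "z1\<up>?c = z1" .
 have "?c\<in>CG Z1"
  unfolding cent_Z1_eq[OF z1] using cc zc cz1 by (intro centralizerI) auto
 moreover have "?c\<in>CG Z"
  unfolding S.cent_Z1_eq[OF z] using cc zc cz by (intro centralizerI) auto
 ultimately have "?c\<in>B" using q eq by simp
 then show ?thesis using that[OF a(1) A0 b(1) B0 _ Qg] by blast
qed

end

lemma (in group) braid_quotient_bound:
 assumes L: "subgroup L G" "finite L" and N: "N \<lhd> G\<lparr>carrier := L\<rparr>"
  and a: "a\<in>L" "a [^] (3::nat)\<in>N" and b: "b\<in>L" "b [^] (3::nat)\<in>N"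
  and braid: "(a\<otimes>b\<otimes>a)\<otimes>inv (b\<otimes>a\<otimes>b)\<in>N"
 shows "card (generate (G\<lparr>carrier := L\<rparr> Mod N) {N #> a, N #> b}) \<le> 24"
proof -
 let ?M = "G\<lparr>carrier := L\<rparr> Mod N"
 interpret NN: normal N "G\<lparr>carrier := L\<rparr>" by fact
 interpret M: group ?M by (rule NN.factorgroup_is_group)
 have Ns: "subgroup N G" using normal_imp_subgroup[OF N] incl_subgroup[OF L(1)] by blast
 have Lc: "g\<in>carrier G" if "g\<in>L" for g using L that subgroup_carrier by blast
 note Lm = subgroup.m_closed[OF L(1)]
 have mult: "(N #> x)<#>(N #> y) = N #> (x\<otimes>y)" if "x\<in>L" "y\<in>L" for x y
  by (rule section_mult[OF L(1) N that])
 have mem: "N #> x\<in>carrier ?M" if "x\<in>L" for x unfolding section_carrier using that by blast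
 have cube: "(N #> x) [^]\<^bsub>?M\<^esub> (3::nat) = \<one>\<^bsub>?M\<^esub>" if x: "x\<in>L" "x [^] (3::nat)\<in>N" for x
 proof -
  have "(N #> x) [^]\<^bsub>?M\<^esub> (3::nat) = N #> (x [^] (3::nat))"
   using NN.FactGroup_pow[of x 3] x by (simp add: nat_pow_consistent[symmetric])
  then show ?thesis using rcos_eq_self_iff[OF Ns] x Lc by simp
 qed
 have "N #> (a\<otimes>b\<otimes>a) = N #> (b\<otimes>a\<otimes>b)"
  using rcos_eq_iff[OF Ns] braid Lc a b by simp
 then have br: "(N #> a) \<otimes>\<^bsub>?M\<^esub> (N #> b) \<otimes>\<^bsub>?M\<^esub> (N #> a) = (N #> b) \<otimes>\<^bsub>?M\<^esub> (N #> a) \<otimes>\<^bsub>?M\<^esub> (N #> b)"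
  using mult a b Lm by simp
 show ?thesis by (rule M.braid_group_bound(2)[OF mem[OF a(1)] cube[OF a] mem[OF b(1)] cube[OF b] br])
qed

context extraspecial_pair begin

interpretation S: extraspecial_pair G Z1 Q1 Z Q "inv x" by (rule swap)

lemma cosets_generated:
 assumes K: "K \<lhd> G\<lparr>carrier := L\<rparr>" and a: "a\<in>Q" "a~:A" and b: "b\<in>Q1" "b~:B"
  and H: "subgroup H (G\<lparr>carrier := L\<rparr> Mod K)" "K #> a\<in>H" "K #> b\<in>H" "\<And>w. w\<in>N ==> K #> w\<in>H"
  and g: "g\<in>L"
 shows "K #> g\<in>H"
proof -
 let ?M = "G\<lparr>carrier := L\<rparr> Mod K"
 interpret M: group ?M by (rule normal.factorgroup_is_group[OF K])
 have mult: "(K #> x) \<otimes>\<^bsub>?M\<^esub> (K #> y) = K #> (x\<otimes>y)" if "x\<in>L" "y\<in>L" for x y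
  using section_mult[OF L_sub K that] by simp
 have Ks: "subgroup K G" using normal_imp_subgroup[OF K] incl_subgroup[OF L_sub] by blast
 let ?H = "{g\<in>L. K #> g\<in>H}"
 have one: "K #> \<one> = \<one>\<^bsub>?M\<^esub>" using subgroup.subset[OF Ks] by simp
 have mH: "u\<otimes>v\<in>?H" if "u\<in>?H" "v\<in>?H" for u v
  using that mult[of u v] Lm subgroup.m_closed[OF H(1), of "K #> u" "K #> v"] by auto
 have iH: "inv u\<in>?H" if u: "u\<in>?H" for u
 proof -
  have uL: "u\<in>L" "inv u\<in>L" using u Li by blast+
  have "(K #> inv u) \<otimes>\<^bsub>?M\<^esub> (K #> u) = \<one>\<^bsub>?M\<^esub>" using mult[OF uL(2,1)] uL one by simp
  then have "inv\<^bsub>?M\<^esub> (K #> u) = K #> inv u"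
   using M.inv_equality[of "K #> inv u" "K #> u"] uL unfolding section_carrier by blast
  then show ?thesis using subgroup.m_inv_closed[OF H(1), of "K #> u"] u uL by auto
 qed
 have Hs: "subgroup ?H G"
 proof (rule subgroupI)
  show "?H\<subseteq>carrier G" by auto
  have "\<one>\<in>?H" using L1 one subgroup.one_closed[OF H(1)] by auto
  then show "?H~={}" by blast
 qed (use mH iH in blast)+
 have NH: "n\<in>?H" if "n\<in>N" for n using that H(4) NW by blast
 have aH: "a\<in>?H" "a\<otimes>a\<in>?H" using a QL H mH[of a a] by blast+
 have bH: "b\<in>?H" "b\<otimes>b\<in>?H" using b QL H mH[of b b] by blast+
 have "Q\<subseteq>?H"
 proof
  fix q assume "q\<in>Q"
  then obtain a' where a': "a'\<in>A" "q = a' \<or> q = a'\<otimes>a \<or> q = a'\<otimes>(a\<otimes>a)"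
   using Q_power_coset[OF a] by blast
  have "a'\<in>?H" using a' N_subset NH by blast
  then show "q\<in>?H" using a'(2) mH aH by blast
 qed
 moreover have "Q1\<subseteq>?H"
 proof
  fix q assume "q\<in>Q1"
  then obtain b' where b': "b'\<in>B" "q = b' \<or> q = b'\<otimes>b \<or> q = b'\<otimes>(b\<otimes>b)"
   using Q1_power_coset[OF b] by blast
  have "b'\<in>?H" using b' BN NH by blast
  then show "q\<in>?H" using b'(2) mH bH by blast
 qed
 ultimately have "L\<subseteq>?H" by (rule L_subsetI[OF Hs])
 then show ?thesis using g by blast
qed

text \<open>\<open>L/AB\<close> has at most 24 elements by the braid relation, and \<open>L/W\<close> has
 exactly 24.\<close>

lemma W_eq_N: "W = N"
proof -
 let ?M = "G\<lparr>carrier := L\<rparr> Mod N"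
 interpret M: group ?M by (rule normal.factorgroup_is_group[OF N_normal])
 obtain a b where ab: "a\<in>Q" "a~:A" "b\<in>Q1" "b~:B" "(a\<otimes>b\<otimes>a)\<otimes>inv (b\<otimes>a\<otimes>b)\<in>B"
  by (rule braid_pair)
 let ?K = "generate ?M {N #> a, N #> b}"
 have aL: "a\<in>L" "b\<in>L" using ab QL by blast+
 have c24: "card ?K \<le> 24"
  by (rule braid_quotient_bound[OF L_sub finL N_normal aL(1) _ aL(2)])
   (use ab P.Q_cube R.Q_cube N1 BN in auto)
 have sub: "{N #> a, N #> b}\<subseteq>carrier ?M" unfolding section_carrier using aL by blast
 have Ksub: "subgroup ?K ?M" by (rule M.generate_is_subgroup[OF sub])
 have "carrier ?M\<subseteq>?K"
 proof
  fix X assume "X\<in>carrier ?M"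
  then obtain g where g: "g\<in>L" "X = N #> g" unfolding section_carrier by blast
  have "N #> g\<in>?K"
  proof (rule cosets_generated[OF N_normal ab(1-4) Ksub])
   show "N #> a\<in>?K" "N #> b\<in>?K" by (auto intro: generate.incl)
   fix w assume "w\<in>N"
   then have "N #> w = \<one>\<^bsub>?M\<^esub>" using rcos_eq_self_iff[OF N_sub] by simp
   then show "N #> w\<in>?K" using subgroup.one_closed[OF Ksub] by simp
  qed (rule g)
  then show "X\<in>?K" using g by simp
 qed
 moreover have "?K\<subseteq>carrier ?M" by (rule subgroup.subset[OF Ksub])
 ultimately have "order ?M \<le> 24" using c24 by (metis order_def subset_antisym)
 moreover have "order ?M * card N = card L"
  by (rule section_order[OF L_sub finL N_sub]) (use NW in blast)
 ultimately have "24 * card W \<le> 24 * card N" using card_L_W by (metis mult_le_mono1)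
 then show ?thesis using card_seteq[OF finW NW] by simp
qed

end

section \<open>The normal subgroup W\<close>

context group begin

lemma centralizer_commutes: "g\<in>CG A ==> a\<in>A ==> a\<otimes>g = g\<otimes>a"
 by (rule sym) (rule centralizerD)

lemma centralizer_singletonI: "g\<in>carrier G ==> g\<otimes>d = d\<otimes>g ==> g\<in>CG {d}"
 unfolding centralizer_def by blast

lemma centralizer_singletonD: "g\<in>CG {d} ==> g\<otimes>d = d\<otimes>g"
 by (erule centralizerD) simp

lemma centre_on: "centre (grp_on G H) = {c\<in>H. \<forall>t\<in>H. c\<otimes>t = t\<otimes>c}"
 by (simp add: centre_def centralizer_def)

lemma centre_carrier: "X\<in>centre H ==> X\<in>carrier H"
 unfolding centre_def centralizer_def by blast

lemma order_3_subset:
 assumes K: "subgroup K G" "card K = 3" and k: "k\<in>K" "k~=\<one>" and H: "subgroup H G" "k\<in>H"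
 shows "K\<subseteq>H"
 using order_3_subgroup(1)[OF K k] H(2) subgroup.m_closed[OF H(1) H(2) H(2)] subgroup.one_closed[OF H(1)] by simp

lemma mult_swap_comm: "[|a\<in>carrier G; b\<in>carrier G|] ==> a\<otimes>b = (b\<otimes>a)\<otimes>[.a, b.]"
 by (simp add: word_simps)

lemma comm_set_subgroup:
 assumes M: "subgroup M G" and b: "b\<in>carrier G"
 shows "subgroup {g\<in>normalizing M. [.b, g.]\<in>M} G"
proof (rule subgroupI)
 have nM: "subgroup (normalizing M) G" by (rule normalizing_subgroup[OF subgroup.subset[OF M]])
 show "{g\<in>normalizing M. [.b, g.]\<in>M}\<subseteq>carrier G" using normalizing_carrier by blast
 have "[.b, \<one>.] = \<one>" using b by simp
 then have "\<one>\<in>{g\<in>normalizing M. [.b, g.]\<in>M}"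
  using subgroup.one_closed[OF nM] subgroup.one_closed[OF M] by simp
 then show "{g\<in>normalizing M. [.b, g.]\<in>M}~={}" by blast
 fix g assume g: "g\<in>{g\<in>normalizing M. [.b, g.]\<in>M}"
 then have gc: "g\<in>carrier G" using normalizing_carrier by blast
 have gi: "inv g\<in>normalizing M" using subgroup.m_inv_closed[OF nM] g by blast
 have "[.b, inv g.] = inv ([.b, g.]\<up>inv g)" using b gc by (simp add: word_simps)
 moreover have "[.b, g.]\<up>inv g\<in>M" using normalizing_conj[OF gi] g by blast
 ultimately have "[.b, inv g.]\<in>M" using subgroup.m_inv_closed[OF M] by simp
 then show "inv g\<in>{g\<in>normalizing M. [.b, g.]\<in>M}" using gi by simp
 fix h assume h: "h\<in>{g\<in>normalizing M. [.b, g.]\<in>M}"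
 then have hc: "h\<in>carrier G" using normalizing_carrier by blast
 have "[.b, g\<otimes>h.] = [.b, h.]\<otimes>([.b, g.]\<up>h)" by (rule comm_mult_right[OF b gc hc])
 moreover have "[.b, g.]\<up>h\<in>M" using normalizing_conj[of h M] g h by blast
 ultimately have "[.b, g\<otimes>h.]\<in>M" using subgroup.m_closed[OF M] h by simp
 then show "g\<otimes>h\<in>{g\<in>normalizing M. [.b, g.]\<in>M}" using subgroup.m_closed[OF nM] g h by simp
qed

text \<open>Expanding \<open>(xy\<inverse>)\<^sup>3 = 1\<close> and \<open>(xy)\<^sup>3 = 1\<close> shows that
 the conjugates of \<open>x\<close> under powers of \<open>y\<close> have trivial product in both cyclic
 orders.\<close>

lemma exponent_3_engel:
 assumes c: "x\<in>carrier G" "y\<in>carrier G"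
  and y: "y [^] (3::nat) = \<one>" and e: "(x\<otimes>inv y) [^] (3::nat) = \<one>" "(x\<otimes>y) [^] (3::nat) = \<one>"
 shows "x\<otimes>(x\<up>y) = (x\<up>y)\<otimes>x"
proof -
 have y3: "y\<otimes>(y\<otimes>y) = \<one>" using y c by (simp add: cube_eq)
 have iy: "inv y = y\<otimes>y" by (rule cube_one_inv[OF c(2) y])
 have iyy: "inv y\<otimes>inv y = y"
 proof -
  have "inv y\<otimes>inv y = inv (inv y)" unfolding iy using c iy by (simp add: inv_mult_group)
  then show ?thesis using c by simp
 qed
 let ?a = "x\<up>y" and ?b = "x\<up>(y\<otimes>y)"
 have cc: "?a\<in>carrier G" "?b\<in>carrier G" using c by simp_all
 have "x\<otimes>(?a\<otimes>?b) = (x\<otimes>inv y) [^] (3::nat)\<otimes>(y\<otimes>(y\<otimes>y))"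
  using c by (simp add: cube_eq word_simps)
 then have i: "x\<otimes>(?a\<otimes>?b) = \<one>" using e y3 by simp
 have "x\<otimes>((x\<up>inv y)\<otimes>(x\<up>(inv y\<otimes>inv y))) = (x\<otimes>y) [^] (3::nat)\<otimes>inv (y\<otimes>(y\<otimes>y))"
  using c by (simp add: cube_eq word_simps)
 then have "x\<otimes>((x\<up>inv y)\<otimes>(x\<up>(inv y\<otimes>inv y))) = \<one>" using e y3 by simp
 then have ii: "x\<otimes>(?b\<otimes>?a) = \<one>" unfolding iyy by (simp add: iy)
 have "?a\<otimes>?b = ?b\<otimes>?a" using i ii c cc by (metis Units_eq Units_l_cancel m_closed)
 then have "(?a\<otimes>?b)\<up>inv y = (?b\<otimes>?a)\<up>inv y" by simp
 moreover have "?a\<up>inv y = x" "?b\<up>inv y = ?a" using c by (simp_all add: conj_el_conj m_assoc)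
 ultimately show ?thesis using c cc by (simp add: conj_el_mult)
qed

lemma comm_bilinear:
 assumes "u\<in>carrier G" "v\<in>carrier G" "w\<in>carrier G"
 shows "[.u, w.]\<otimes>v = v\<otimes>[.u, w.] ==> [.u\<otimes>v, w.] = [.u, w.]\<otimes>[.v, w.]"
  "[.u, v.]\<otimes>w = w\<otimes>[.u, v.] ==> [.u, v\<otimes>w.] = [.u, w.]\<otimes>[.u, v.]"
 using comm_mult_left[OF assms] comm_mult_right[OF assms] conj_el_fixed[of "[.u, w.]" v] conj_el_fixed[of "[.u, v.]" w] assms
 by auto

end

context extraspecial_pair begin

interpretation S: extraspecial_pair G Z1 Q1 Z Q "inv x" by (rule swap)

lemma L_moves: obtains g where "g\<in>L" "Q1\<Up>g = Q"
proof -
 obtain a b where "a\<in>Q" "a~:A" "b\<in>Q1" "b~:B" "(a\<otimes>b\<otimes>a)\<otimes>inv (b\<otimes>a\<otimes>b)\<in>B" and e: "Q\<Up>inv (a\<otimes>b) = Q1"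
  by (rule braid_pair)
 then have ab: "a\<otimes>b\<in>L" using Lm QL by blast
 have "Q1\<Up>(a\<otimes>b) = Q" unfolding e[symmetric] using conj_set_cancel(2)[OF P.Q_carrier, of "a\<otimes>b"] ab by simp
 then show ?thesis using that ab by blast
qed

lemma E_carrier: "E\<subseteq>carrier G" by auto
lemma finE: "finite E" using P.finQ by simp

lemma L_norm_E: "L\<subseteq>normalizing E"
proof (rule L_subsetI[OF normalizing_subgroup[OF E_carrier]])
 show "Q\<subseteq>normalizing E"
 proof
  fix q assume q: "q\<in>Q"
  show "q\<in>normalizing E"
  proof (rule normalizingI[OF finE E_carrier])
   fix e assume e: "e\<in>E"
   then have "e\<up>q = e\<otimes>[.e, q.]" using q by (intro conj_el_eq_comm) auto
   moreover have "[.e, q.]\<in>E" using P.Q_comm[of e q] e q P.ZQ ZQ1 by blast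
   ultimately show "e\<up>q\<in>E" using Em e by simp
  qed (use q in simp)
 qed
 show "Q1\<subseteq>normalizing E"
 proof
  fix q assume q: "q\<in>Q1"
  show "q\<in>normalizing E"
  proof (rule normalizingI[OF finE E_carrier])
   fix e assume e: "e\<in>E"
   then have "e\<up>q = e\<otimes>[.e, q.]" using q by (intro conj_el_eq_comm) auto
   moreover have "[.e, q.]\<in>E" using R.Q_comm[of e q] e q R.ZQ Z1Q by blast
   ultimately show "e\<up>q\<in>E" using Em e by simp
  qed (use q in simp)
 qed
qed

lemma L_centralizes_E_mod_Y: assumes e: "e\<in>E" and g: "g\<in>L" shows "[.e, g.]\<in>Y"
proof -
 have ec: "e\<in>carrier G" using e by simp
 have "L\<subseteq>{g\<in>normalizing Y. [.e, g.]\<in>Y}"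
 proof (rule L_subsetI[OF comm_set_subgroup[OF Y_sub ec]])
  show "Q\<subseteq>{g\<in>normalizing Y. [.e, g.]\<in>Y}" using Q_norm_Y P.Q_comm[of e] e ZY by blast
  show "Q1\<subseteq>{g\<in>normalizing Y. [.e, g.]\<in>Y}" using Q1_norm_Y R.Q_comm[of e] e Z1Y by blast
 qed
 then show ?thesis using g by blast
qed

text \<open>An element of \<open>B\<close> that \<open>Q\<close> centralises modulo \<open>E\<close> is centralised by \<open>L\<close> modulo \<open>E\<close>, hence
 lies in every conjugate of \<open>Q\<^sub>1\<close>, in particular in \<open>Q\<close>.\<close>

lemma B_nontrivial_mod_E:
 assumes a: "a\<in>Q" "a~:A" and b: "b\<in>B" "[.b, a.]\<in>E"
 shows "b\<in>E"
proof -
 have bc: "b\<in>carrier G" using b by simp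
 let ?H = "{g\<in>normalizing E. [.b, g.]\<in>E}"
 note Hs = comm_set_subgroup[OF E_sub bc]
 have AH: "A\<subseteq>?H" using L_norm_E QL comm_AB(2)[OF _ b(1)] by blast
 have aH: "a\<in>?H" "a\<otimes>a\<in>?H"
 proof -
  show 1: "a\<in>?H" using a b L_norm_E QL by blast
  show "a\<otimes>a\<in>?H" by (rule subgroup.m_closed[OF Hs 1 1])
 qed
 have "L\<subseteq>?H"
 proof (rule L_subsetI[OF Hs])
  show "Q\<subseteq>?H"
  proof
   fix q assume "q\<in>Q"
   then obtain a' where a': "a'\<in>A" "q = a' \<or> q = a'\<otimes>a \<or> q = a'\<otimes>(a\<otimes>a)"
    using Q_power_coset[OF a] by blast
   have "a'\<in>?H" using a' AH by blast
   then show "q\<in>?H" using a'(2) subgroup.m_closed[OF Hs _ aH(1)] subgroup.m_closed[OF Hs _ aH(2)] by blast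
  qed
  have "[.b, q.]\<in>E" if "q\<in>Q1" for q using R.Q_comm[of b q] b that Z1Q R.ZQ by blast
  then show "Q1\<subseteq>?H" using L_norm_E QL by blast
 qed
 moreover obtain g where g: "g\<in>L" "Q1\<Up>g = Q" by (rule L_moves)
 ultimately have bg: "[.b, g.]\<in>E" by blast
 have "b\<up>g\<in>Q" using conj_setI[of b Q1 g] g b by simp
 moreover have "b\<up>g = b\<otimes>[.b, g.]" using bc g by (intro conj_el_eq_comm) auto
 ultimately have "b\<otimes>[.b, g.]\<in>Q" by simp
 then have "b\<in>Q" using subgroup_mult_cancel(2)[OF P.Q_sub _ bc, of "[.b, g.]"] bg by blast
 then show ?thesis using b by blast
qed

lemma Q_not_A: obtains a where "a\<in>Q" "a~:A"
proof -
 have "A~=Q" using A_card P.Q_card by auto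
 then show ?thesis using that by blast
qed

lemma Y_lcomm: "y\<in>Y ==> y'\<in>Y ==> y''\<in>Y ==> y\<otimes>(y'\<otimes>y'') = y'\<otimes>(y\<otimes>y'')"
 using Y_abelian[of y y'] by (simp flip: m_assoc)

lemma Y_cube: "y\<in>Y ==> y\<otimes>(y\<otimes>y) = \<one>"
 using P.Q_cube[of y] YQ cube_eq[of y] by auto

lemma A_in_cent_Y: "u\<in>A \<or> u\<in>B ==> u\<in>CG Y"
 using A_alt B_alt by blast

text \<open>Assume \<open>E = Y\<close>.  For \<open>p, r\<in>B\<close> the commutator \<open>[p, r]\<close>
 is shifted by \<open>a\<close> and by \<open>a\<^sup>2\<close>; comparing the two shifts gives \<open>[[p, a],
 [r, a]] = 1\<close>.  These commuting elements cover \<open>A/Y\<close>, so \<open>A\<close> would be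
 abelian.\<close>

lemma E_not_Y: "E\<noteq>Y"
proof
 assume EY: "E = Y"
 obtain a where a: "a\<in>Q" "a\<notin>A" by (rule Q_not_A)
 have ac: "a\<in>carrier G" using a by simp
 have Y_central: "y\<otimes>u = u\<otimes>y" if "y\<in>Y" "u\<in>A \<or> u\<in>B" for u y
  by (rule centralizer_commutes[OF A_in_cent_Y[OF that(2)] that(1)])
 have alA: "[.p, a.]\<in>A" if "p\<in>B" for p using comm_Q_C(2)[OF a(1)] B_alt that by blast
 \<comment> \<open>The images of \<open>B\<close> under \<open>p \<mapsto> [p, a]\<close> commute with one another.\<close>
 have key: "[.[.p, a.], [.r, a.].] = \<one>" if p: "p\<in>B" and r: "r\<in>B" for p r
 proof -
  define al where "al = [.p, a.]"
  define be where "be = [.r, a.]"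
  have A: "al\<in>A" "be\<in>A" using alA p r by (simp_all add: al_def be_def)
  have c: "al\<in>carrier G" "be\<in>carrier G" "p\<in>carrier G" "r\<in>carrier G" using A p r by auto
  define k1 where "k1 = [.p, r.]"
  define k2 where "k2 = [.p, be.]"
  define k3 where "k3 = [.al, r.]"
  define k4 where "k4 = [.al, be.]"
  have k1Z: "k1\<in>Z1" using R.Q_comm p r by (simp add: k1_def)
  have kY: "k1\<in>Y" "k2\<in>Y" "k3\<in>Y" "k4\<in>Y"
   using k1Z Z1Y comm_AB A p r EY P.Q_comm[of al be] ZY by (auto simp: k2_def k3_def k4_def)
  have kc: "k1\<in>carrier G" "k2\<in>carrier G" "k3\<in>carrier G" "k4\<in>carrier G" using kY by simp_all
  note cent = Y_central[OF kY(1)] Y_central[OF kY(2)] Y_central[OF kY(3)] Y_central[OF kY(4)]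
  have pa: "p\<up>a = p\<otimes>al" "r\<up>a = r\<otimes>be"
   using conj_el_eq_comm[of p a] conj_el_eq_comm[of r a] c ac by (simp_all add: al_def be_def)
  define y1 where "y1 = [.al, a.]"
  define y2 where "y2 = [.be, a.]"
  have yY: "y1\<in>Y" "y2\<in>Y" using P.Q_comm[of al a] P.Q_comm[of be a] A a ZY by (auto simp: y1_def y2_def)
  have yc: "y1\<in>carrier G" "y2\<in>carrier G" using yY by simp_all
  have aa: "al\<up>a = al\<otimes>y1" "be\<up>a = be\<otimes>y2"
   using conj_el_eq_comm[of al a] conj_el_eq_comm[of be a] c ac by (simp_all add: y1_def y2_def)
  have bil_r: "[.u, be\<otimes>be.] = [.u, be.]\<otimes>[.u, be.]" if "u\<in>carrier G" "[.u, be.]\<in>Y" for u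
   by (rule comm_bilinear(2)[OF that(1) c(2) c(2)]) (use Y_central[OF that(2)] A in blast)
  have e1: "[.p\<otimes>al, r\<otimes>be.] = k1\<otimes>(k2\<otimes>(k3\<otimes>k4))"
  proof -
   have 1: "[.p, r\<otimes>be.] = k2\<otimes>k1" unfolding k1_def k2_def
    by (rule comm_bilinear(2)) (use c cent A k1_def in auto)
   have 2: "[.al, r\<otimes>be.] = k4\<otimes>k3" unfolding k3_def k4_def
    by (rule comm_bilinear(2)) (use c cent A k3_def in auto)
   have "[.p\<otimes>al, r\<otimes>be.] = [.p, r\<otimes>be.]\<otimes>[.al, r\<otimes>be.]"
   proof (rule comm_bilinear(1))
    show "[.p, r\<otimes>be.]\<otimes>al = al\<otimes>[.p, r\<otimes>be.]"
     unfolding 1 using Y_central[OF Ym[OF kY(2) kY(1)]] A by blast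
   qed (use c in auto)
   then show ?thesis unfolding 1 2 using kY by (simp add: m_assoc Y_abelian Y_lcomm Ym)
  qed
  have e2: "[.(p\<otimes>(al\<otimes>al))\<otimes>y1, (r\<otimes>(be\<otimes>be))\<otimes>y2.] = [.p\<otimes>(al\<otimes>al), r\<otimes>(be\<otimes>be).]"
  proof -
   let ?u = "p\<otimes>(al\<otimes>al)" and ?v = "r\<otimes>(be\<otimes>be)"
   have uc: "?u\<in>carrier G" "?v\<in>carrier G" using c by simp_all
   have uW: "?u\<in>CG Y" "?v\<in>CG Y"
    using A p r subgroup.m_closed[OF C_sub] A_in_cent_Y by simp_all
   have cu: "?u\<otimes>y = y\<otimes>?u" "?v\<otimes>y = y\<otimes>?v" if "y\<in>Y" for y
    using centralizerD[OF uW(1) that] centralizerD[OF uW(2) that] by simp_all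
   have iv: "inv y1\<otimes>w = w\<otimes>inv y1" "inv y2\<otimes>w = w\<otimes>inv y2" if "w = inv ?u \<or> w = inv ?v \<or> w = ?u \<or> w = ?v" for w
   proof -
    have "w\<in>CG Y" using that uW subgroup.m_inv_closed[OF C_sub] by blast
    then show "inv y1\<otimes>w = w\<otimes>inv y1" "inv y2\<otimes>w = w\<otimes>inv y2"
     using centralizer_commutes[OF _ Yi[OF yY(1)]] centralizer_commutes[OF _ Yi[OF yY(2)]] by blast+
   qed
   have f1: "[.y1, ?v\<otimes>y2.] = \<one>" and f2: "[.?u, y2.] = \<one>"
   proof -
    have "?v\<otimes>y2\<in>CG Y" using uW Y_cent yY subgroup.m_closed[OF C_sub] by blast
    then show "[.y1, ?v\<otimes>y2.] = \<one>" using comm_one_iff[of y1 "?v\<otimes>y2"] uc yc centralizer_commutes[OF _ yY(1)] by blast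
    show "[.?u, y2.] = \<one>" using comm_one_iff[of ?u y2] uc yc cu yY by auto
   qed
   have "[.?u\<otimes>y1, ?v\<otimes>y2.] = ([.?u, ?v\<otimes>y2.]\<up>y1)\<otimes>[.y1, ?v\<otimes>y2.]"
    by (rule comm_mult_left) (use uc yc in auto)
   also have "\<dots> = [.?u\<up>y1, (?v\<otimes>y2)\<up>y1.]" unfolding f1 using uc yc by (simp add: conj_el_comm)
   also have "?u\<up>y1 = ?u" using conj_el_fixed[OF uc(1) yc(1)] cu yY by simp
   also have "(?v\<otimes>y2)\<up>y1 = ?v\<otimes>y2"
    using conj_el_fixed[OF uc(2) yc(1)] conj_el_fixed[OF yc(2,1)] cu yY Y_abelian uc yc by (simp add: conj_el_mult)
   also have "[.?u, ?v\<otimes>y2.] = [.?u, y2.]\<otimes>([.?u, ?v.]\<up>y2)"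
    by (rule comm_mult_right) (use uc yc in auto)
   also have "\<dots> = [.?u\<up>y2, ?v\<up>y2.]" unfolding f2 using uc yc by (simp add: conj_el_comm)
   also have "?u\<up>y2 = ?u" using conj_el_fixed[OF uc(1) yc(2)] cu yY by simp
   also have "?v\<up>y2 = ?v" using conj_el_fixed[OF uc(2) yc(2)] cu yY by simp
   finally show ?thesis .
  qed
  have e3: "[.p\<otimes>(al\<otimes>al), r\<otimes>(be\<otimes>be).]
   = k1\<otimes>((k2\<otimes>k2)\<otimes>((k3\<otimes>k3)\<otimes>((k4\<otimes>k4)\<otimes>(k4\<otimes>k4))))"
  proof -
   have pbb: "[.p, be\<otimes>be.] = k2\<otimes>k2" using bil_r[OF c(3)] kY by (simp add: k2_def)
   have abb: "[.al, be\<otimes>be.] = k4\<otimes>k4" using bil_r[OF c(1)] kY by (simp add: k4_def)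
   have cb: "be\<otimes>be\<in>carrier G" "al\<otimes>al\<in>carrier G" "be\<otimes>be\<in>A" using c A Am by simp_all
   have 1: "[.p, r\<otimes>(be\<otimes>be).] = (k2\<otimes>k2)\<otimes>k1"
    unfolding pbb[symmetric] k1_def by (rule comm_bilinear(2)) (use c cb cent k1_def in auto)
   have 2: "[.al, r\<otimes>(be\<otimes>be).] = (k4\<otimes>k4)\<otimes>k3"
    unfolding abb[symmetric] k3_def by (rule comm_bilinear(2)) (use c cb cent k3_def in auto)
   have d2: "[.al, r\<otimes>(be\<otimes>be).]\<in>Y" "[.p, r\<otimes>(be\<otimes>be).]\<in>Y" unfolding 1 2 using kY Ym by simp_all
   have 3: "[.al\<otimes>al, r\<otimes>(be\<otimes>be).] = [.al, r\<otimes>(be\<otimes>be).]\<otimes>[.al, r\<otimes>(be\<otimes>be).]"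
    by (rule comm_bilinear(1)) (use c cb Y_central[OF d2(1)] A in auto)
   have "[.p\<otimes>(al\<otimes>al), r\<otimes>(be\<otimes>be).] = [.p, r\<otimes>(be\<otimes>be).]\<otimes>[.al\<otimes>al, r\<otimes>(be\<otimes>be).]"
    by (rule comm_bilinear(1)) (use c cb Y_central[OF d2(2)] A Am in auto)
   then show ?thesis unfolding 3 1 2 using kY by (simp add: m_assoc Y_abelian Y_lcomm Ym)
  qed
  have k1a: "k1\<up>a = k1\<otimes>(k2\<otimes>(k3\<otimes>k4))"
   using conj_el_comm[of p r a] c ac pa e1 by (simp add: k1_def)
  have k1aa: "(k1\<up>a)\<up>a = k1\<otimes>((k2\<otimes>k2)\<otimes>((k3\<otimes>k3)\<otimes>((k4\<otimes>k4)\<otimes>(k4\<otimes>k4))))"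
  proof -
   have "(p\<otimes>al)\<up>a = (p\<otimes>(al\<otimes>al))\<otimes>y1" "(r\<otimes>be)\<up>a = (r\<otimes>(be\<otimes>be))\<otimes>y2"
    using pa aa c ac yc by (simp_all add: conj_el_mult m_assoc)
   moreover have "(k1\<up>a)\<up>a = [.(p\<otimes>al)\<up>a, (r\<otimes>be)\<up>a.]"
    using conj_el_comm[of p r a] conj_el_comm[of "p\<otimes>al" "r\<otimes>be" a] c ac pa by (simp add: k1_def)
   ultimately show ?thesis using e2 e3 by simp
  qed
  define t where "t = [.k1, a.]"
  have k1Q: "k1\<in>Q" using kY YQ by blast
  have tZ: "t\<in>Z" using P.Q_comm[OF k1Q a(1)] by (simp add: t_def)
  have tY: "t\<in>Y" using tZ ZY by blast
  have t1: "k1\<up>a = k1\<otimes>t" using conj_el_eq_comm[OF kc(1) ac] by (simp add: t_def)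
  then have t2: "(k1\<up>a)\<up>a = k1\<otimes>(t\<otimes>t)"
   using P.Z_fixed[OF tZ a(1)] kc ac tZ by (simp add: conj_el_mult m_assoc)
  have tk: "t = k2\<otimes>(k3\<otimes>k4)" using t1 k1a kc tY by simp
  have tt: "t\<otimes>t = (k2\<otimes>k2)\<otimes>((k3\<otimes>k3)\<otimes>((k4\<otimes>k4)\<otimes>(k4\<otimes>k4)))"
   using t2 k1aa kc tY by simp
  have "t\<otimes>t = (k2\<otimes>k2)\<otimes>((k3\<otimes>k3)\<otimes>(k4\<otimes>k4))"
   unfolding tk using kY by (simp add: m_assoc Y_abelian Y_lcomm Ym)
  then have "k4\<otimes>k4 = (k4\<otimes>k4)\<otimes>(k4\<otimes>k4)" using tt kc by simp
  then have "k4\<otimes>k4 = \<one>" using kc by (metis l_cancel_one' m_closed)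
  then show ?thesis using Y_cube[OF kY(4)] kc by (simp add: k4_def al_def be_def)
 qed
 let ?f = "\<lambda>p. Y #> [.p, a.]"
 have "card (?f ` B) * card Y = card B"
 proof (rule card_fibres[OF B_sub Y_sub YB finB])
  fix p r assume p: "p\<in>B" and r: "r\<in>B"
  let ?s = "p\<otimes>inv r"
  have s: "?s\<in>B" using p r Bm Bi by blast
  have c: "p\<in>carrier G" "r\<in>carrier G" "?s\<in>carrier G" using p r by auto
  let ?k = "[.[.?s, a.], r.]"
  have kY: "?k\<in>Y" using comm_AB(1)[OF alA[OF s] r] EY by simp
  have kc: "?k\<in>carrier G" "[.?s, a.]\<in>carrier G" "[.r, a.]\<in>carrier G" using kY c ac by simp_all
  have "[.?s\<otimes>r, a.] = ([.?s, a.]\<up>r)\<otimes>[.r, a.]" by (rule comm_mult_left[OF c(3,2) ac])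
  moreover have "?s\<otimes>r = p" using c by (simp add: m_assoc)
  moreover have "[.?s, a.]\<up>r = [.?s, a.]\<otimes>?k" using kc c by (intro conj_el_eq_comm) auto
  ultimately have pe: "[.p, a.] = [.?s, a.]\<otimes>?k\<otimes>[.r, a.]" by simp
  have "?f p = ?f r \<longleftrightarrow> [.p, a.]\<otimes>inv [.r, a.]\<in>Y"
   by (rule rcos_eq_iff[OF Y_sub]) (use c ac in simp_all)
  also have "[.p, a.]\<otimes>inv [.r, a.] = [.?s, a.]\<otimes>?k" unfolding pe using kc by (simp only: m_assoc m_closed r_inv r_one inv_closed)
  also have "\<dots>\<in>Y \<longleftrightarrow> [.?s, a.]\<in>Y" by (rule subgroup_mult_cancel(2)[OF Y_sub kY kc(2)])
  also have "\<dots> \<longleftrightarrow> ?s\<in>Y"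
   using B_nontrivial_mod_E[OF a s] P.Q_comm[of ?s a] a YQ ZY EY by blast
  finally show "?f p = ?f r \<longleftrightarrow> p\<otimes>inv r\<in>Y" .
 qed
 then have cf: "card (?f ` B) = 9" using B_card Y_card by simp
 have "card ((\<lambda>u. Y #> u) ` A) * card Y = card A"
  by (rule card_fibres[OF A_sub Y_sub YA finA]) (use rcos_eq_iff[OF Y_sub] A_carrier in blast)
 then have cA: "card ((\<lambda>u. Y #> u) ` A) = 9" using A_card Y_card by simp
 have onto: "?f ` B = (\<lambda>u. Y #> u) ` A"
  using alA cf cA finA by (intro card_subset_eq) auto
 have rep: "\<exists>p\<in>B. \<exists>y\<in>Y. u = y\<otimes>[.p, a.]" if u: "u\<in>A" for u
 proof -
  have "Y #> u\<in>?f ` B" using onto u by blast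
  then obtain p where p: "p\<in>B" "Y #> u = Y #> [.p, a.]" by blast
  have "u\<in>Y #> u" using rcos_self[OF _ Y_sub] u by simp
  then have "u\<in>Y #> [.p, a.]" using p by simp
  then show ?thesis using p by (auto simp: r_coset_def)
 qed
 have "[.u, v.] = \<one>" if u: "u\<in>A" and v: "v\<in>A" for u v
 proof -
  obtain p y where p: "p\<in>B" "y\<in>Y" "u = y\<otimes>[.p, a.]" using rep u by blast
  obtain r y' where r: "r\<in>B" "y'\<in>Y" "v = y'\<otimes>[.r, a.]" using rep v by blast
  have al: "[.p, a.]\<in>A" "[.r, a.]\<in>A" using alA p r by blast+
  have "[.p, a.]\<otimes>[.r, a.] = [.r, a.]\<otimes>[.p, a.]"
   using key[OF p(1) r(1)] comm_one_iff[of "[.p, a.]" "[.r, a.]"] p r ac by simp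
  moreover have "y\<otimes>[.r, a.] = [.r, a.]\<otimes>y" "y'\<otimes>[.p, a.] = [.p, a.]\<otimes>y'" "y\<otimes>y' = y'\<otimes>y"
   using Y_central al p r Y_abelian by blast+
  ultimately have "u\<up>v = u"
   unfolding p(3) r(3) using conj_el_fixed[of "[.p, a.]" "[.r, a.]"] conj_el_fixed[of y "[.r, a.]"]
    conj_el_fixed[of "[.p, a.]" y'] conj_el_fixed[of y y'] p r ac
   by (simp add: conj_el_mult flip: conj_el_conj)
  then show ?thesis using comm_one_iff'[of u v] u v by simp
 qed
 then show False using A_nonabelian by blast
qed

lemma E_card: "card E = 27"
proof -
 have "card E dvd 81" using card_subgroup_dvd[OF A_sub E_sub EA finA] A_card by simp
 then obtain i where i: "card E = 3 ^ i" "i \<le> 4" using divides_primepow_nat[of 3 "card E" 4] by auto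
 have le: "card E \<le> 27" using P.abelian_card_le[OF E_sub _ E_abelian] by blast
 have ge: "card E > 9"
  using psubset_card_mono[OF finE, of Y] YE E_not_Y Y_card by auto
 have "i = 0 \<or> i = 1 \<or> i = 2 \<or> i = 3 \<or> i = 4" using i(2) by arith
 then show ?thesis using i(1) le ge by auto
qed

lemma W_AB: "w\<in>W ==> \<exists>a\<in>A. \<exists>b\<in>B. w = a\<otimes>b"
 unfolding W_eq_N by (auto simp: set_mult_def)

lemma AW: "A\<subseteq>W" and BW: "B\<subseteq>W" using W_eq_N N_subset BN by auto

lemma W_card: "card W = 243"
 using card_set_mult_inter[OF A_sub finA B_sub finB] A_card B_card E_card E_AB W_eq_N by simp

lemma A_cube: "a\<in>A ==> a [^] (3::nat) = \<one>" using P.Q_cube by blast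

lemma A_index_E: "a\<in>A ==> a~:E ==> u\<in>A ==> \<exists>e\<in>E. u = e \<or> u = e\<otimes>a \<or> u = e\<otimes>(a\<otimes>a)"
 by (rule index_3_cosets[OF A_sub finA E_sub EA]) (use A_card E_card A_cube[of a] cube_eq[of a] E1 in auto)

text \<open>\<open>W\<close> is covered by \<open>A\<close> and the conjugates of \<open>B\<close> under \<open>Q\<close>, all of exponent 3.\<close>

lemma W_cube: assumes w: "w\<in>W" shows "w [^] (3::nat) = \<one>"
proof -
 obtain u v where uv: "u\<in>A" "v\<in>B" "w = u\<otimes>v" using W_AB[OF w] by blast
 obtain a where a: "a\<in>Q" "a~:A" by (rule Q_not_A)
 have c: "u\<in>carrier G" "v\<in>carrier G" "a\<in>carrier G" using uv a by auto
 have pullback: "w [^] (3::nat) = \<one>" if g: "g\<in>carrier G" "w\<up>g\<in>B" for g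
 proof -
  have "(w\<up>g) [^] (3::nat) = \<one>" using R.Q_cube g by blast
  then have "(w [^] (3::nat))\<up>g = \<one>\<up>g" using w g by (simp add: conj_el_pow)
  then show ?thesis using conj_el_inj[of "w [^] (3::nat)" \<one> g] w g by simp
 qed
 have nE: "e\<up>inv a\<in>E" if "e\<in>E" for e
  using normalizing_conj[of "inv a" E e] L_norm_E Li QL a that by blast
 show ?thesis
 proof (cases "v\<in>E")
  case True then show ?thesis using uv Am EA A_cube by blast
 next
  case False
  let ?c = "[.v, a.]"
  have cA: "?c\<in>A" using comm_Q_C(2)[OF a(1)] B_alt uv by blast
  have cE: "?c~:E" using B_nontrivial_mod_E[OF a uv(2)] False by blast
  have cc: "?c\<in>carrier G" using c by simp
  have va: "v\<up>a = v\<otimes>?c" using conj_el_eq_comm c by simp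
  obtain e where e: "e\<in>E" "u = e \<or> u = e\<otimes>?c \<or> u = e\<otimes>(?c\<otimes>?c)"
   using A_index_E[OF cA cE uv(1)] by blast
  have ec: "e\<in>carrier G" using e by simp
  from e(2) consider "u = e" | "u = e\<otimes>?c" | "u = e\<otimes>(?c\<otimes>?c)" by blast
  then show ?thesis
  proof cases
   case 1 then show ?thesis using uv e EB Bm R.Q_cube by blast
  next
   case 2
   let ?k = "[.?c, v.]"
   have k: "?k\<in>E" by (rule comm_AB(1)[OF cA uv(2)])
   have kc: "?k\<in>carrier G" using k by simp
   have "w = e\<otimes>((v\<otimes>?c)\<otimes>?k)" unfolding uv(3) 2 using ec cc c by (simp add: word_simps)
   then have "w = e\<otimes>((v\<up>a)\<otimes>?k)" using va by simp
   then have "w\<up>inv a = (e\<up>inv a)\<otimes>(v\<otimes>(?k\<up>inv a))" using ec kc c by (simp add: conj_el_mult)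
   moreover have "(e\<up>inv a)\<otimes>(v\<otimes>(?k\<up>inv a))\<in>B"
    using Bm[OF _ Bm[OF uv(2)]] nE[OF e(1)] nE[OF k] EB by blast
   ultimately have "w\<up>inv a\<in>B" by (simp only:)
   then show ?thesis using pullback[of "inv a"] c by simp
  next
   case 3
   let ?d = "?c\<otimes>?c"
   let ?k = "[.?d, v.]" and ?m = "[.?c, a.]"
   have dA: "?d\<in>A" using cA Am by blast
   have dc: "?d\<in>carrier G" using cc by simp
   have k: "?k\<in>E" by (rule comm_AB(1)[OF dA uv(2)])
   have m: "inv ?m\<in>E" using P.Q_comm[of ?c a] cA a ZY YE P.Zi by blast
   have mc: "?m\<in>carrier G" "?k\<in>carrier G" using cc dc c by simp_all
   have vaa: "v\<up>(a\<otimes>a) = v\<otimes>?d\<otimes>?m"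
   proof -
    have "v\<up>(a\<otimes>a) = (v\<otimes>?c)\<up>a" using va c by (simp flip: conj_el_conj)
    also have "\<dots> = (v\<otimes>?c)\<otimes>(?c\<otimes>?m)"
     using va conj_el_eq_comm[OF cc c(3)] cc c by (simp only: conj_el_mult)
    finally show ?thesis using c cc mc by (simp only: m_assoc m_closed)
   qed
   have "w = e\<otimes>(?d\<otimes>v)" unfolding uv(3) 3 using ec dc c by (simp only: m_assoc[OF ec dc])
   also have "?d\<otimes>v = (v\<otimes>?d)\<otimes>?k" using dc c by (intro mult_swap_comm)
   also have "v\<otimes>?d = (v\<up>(a\<otimes>a))\<otimes>inv ?m"
    unfolding vaa using c dc mc by (simp only: m_assoc m_closed inv_closed r_inv r_one)
   finally have "w = e\<otimes>(((v\<up>(a\<otimes>a))\<otimes>inv ?m)\<otimes>?k)" .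
   then have "w\<up>inv (a\<otimes>a) = (e\<up>inv (a\<otimes>a))\<otimes>((v\<otimes>(inv ?m\<up>inv (a\<otimes>a)))\<otimes>(?k\<up>inv (a\<otimes>a)))"
    using ec c mc by (simp only: conj_el_mult conj_el_cancel m_closed inv_closed conj_el_closed)
   moreover have nE2: "f\<up>inv (a\<otimes>a)\<in>E" if "f\<in>E" for f
    by (rule normalizing_conj[OF subsetD[OF L_norm_E Li[OF Lm]] that]) (rule subsetD[OF QL(1) a(1)])+
   moreover have "(e\<up>inv (a\<otimes>a))\<otimes>((v\<otimes>(inv ?m\<up>inv (a\<otimes>a)))\<otimes>(?k\<up>inv (a\<otimes>a)))\<in>B"
    using Bm[OF _ Bm[OF Bm[OF uv(2)]]] nE2[OF e(1)] nE2[OF k] nE2[OF m] EB by blast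
   ultimately have "w\<up>inv (a\<otimes>a)\<in>B" by (simp only:)
   then show ?thesis using pullback[of "inv (a\<otimes>a)"] c by simp
  qed
 qed
qed

lemma comm_AB_Y: assumes p: "p\<in>A" and r: "r\<in>B" shows "[.p, r.]\<in>Y"
proof (cases "p\<in>E")
 case True then show ?thesis using L_centralizes_E_mod_Y r QL by blast
next
 case False
 let ?d = "[.p, r.]"
 have c: "p\<in>carrier G" "r\<in>carrier G" "?d\<in>carrier G" using p r by auto
 have pW: "p\<in>W" "r\<in>W" using p r AW BW by blast+
 have dE: "?d\<in>E" by (rule comm_AB(1)[OF p r])
 have "p\<otimes>(p\<up>r) = (p\<up>r)\<otimes>p"
  by (rule exponent_3_engel) (use c pW W_cube Wm Wi in auto)
 moreover have "p\<up>r = p\<otimes>?d" using c by (intro conj_el_eq_comm) auto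
 ultimately have "p\<otimes>(p\<otimes>?d) = p\<otimes>(?d\<otimes>p)" using c by (simp add: m_assoc)
 then have pd: "p\<otimes>?d = ?d\<otimes>p" using c by (metis Units_eq Units_l_cancel m_closed)
 show ?thesis
 proof (rule A_centre)
  show "?d\<in>A" using dE EA by blast
  fix u assume "u\<in>A"
  then obtain e where e: "e\<in>E" "u = e \<or> u = e\<otimes>p \<or> u = e\<otimes>(p\<otimes>p)" using A_index_E[OF p False] by blast
  have ec: "e\<in>carrier G" using e by simp
  have cs: "subgroup (CG {?d}) G" using c by (intro centralizer_subgroup) simp
  have "e\<in>CG {?d}" using E_abelian[OF e(1) dE] ec by (intro centralizer_singletonI) simp_all
  moreover have pc: "p\<in>CG {?d}" using pd c by (intro centralizer_singletonI) simp_all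
  ultimately have "u\<in>CG {?d}"
   using e(2) subgroup.m_closed[OF cs] by blast
  then show "u\<otimes>?d = ?d\<otimes>u" by (rule centralizer_singletonD)
 qed
qed

lemma W_comm: assumes w: "w\<in>W" and v: "v\<in>W" shows "[.w, v.]\<in>Y"
proof -
 have nY: "A\<subseteq>normalizing Y" "B\<subseteq>normalizing Y" using L_norm_Y QL by blast+
 have 1: "[.b, u.]\<in>Y" if b: "b\<in>A \<union> B" and u: "u\<in>W" for b u
 proof -
  have bc: "b\<in>carrier G" using b by auto
  let ?H = "{g\<in>normalizing Y. [.b, g.]\<in>Y}"
  note H = comm_set_subgroup[OF Y_sub bc]
  have sw: "[.q, p.]\<in>Y" if "p\<in>A" "q\<in>B" for p q
   using Yi[OF comm_AB_Y[OF that]] inv_comm_swap[of p q] that by simp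
  have "[.b, p.]\<in>Y" if "p\<in>A" for p using b that sw P.Q_comm[of b p] ZY by blast
  moreover have "[.b, q.]\<in>Y" if "q\<in>B" for q using b that comm_AB_Y R.Q_comm[of b q] Z1Y by blast
  ultimately have "N\<subseteq>?H" using nY by (intro set_mult_subset[OF H]) blast+
  then show ?thesis using u W_eq_N by blast
 qed
 let ?H = "{g\<in>normalizing Y. [.w, g.]\<in>Y}"
 note H = comm_set_subgroup[OF Y_sub Wc[OF w]]
 have sw: "[.w, b.]\<in>Y" if "b\<in>A \<union> B" for b
  using Yi[OF 1[OF that w]] inv_comm_swap[of b w] that w by auto
 then have "N\<subseteq>?H" using nY by (intro set_mult_subset[OF H]) blast+
 then show ?thesis using v W_eq_N by blast
qed

lemma W_centre: assumes w: "w\<in>W" "\<And>v. v\<in>W ==> v\<otimes>w = w\<otimes>v" shows "w\<in>Y"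
proof (cases "w\<in>A")
 case True then show ?thesis using A_centre w AW by blast
next
 case False
 \<comment> \<open>Otherwise \<open>W = A\<langle>w\<rangle>\<close> has the same commutators as \<open>A\<close>, so those of \<open>B\<close> lie in \<open>Z\<inter>Z\<^sub>1\<close>.\<close>
 have cos: "\<exists>a\<in>A. v = a \<or> v = a\<otimes>w \<or> v = a\<otimes>(w\<otimes>w)" if "v\<in>W" for v
 proof -
  have 1: "w\<otimes>(w\<otimes>w)\<in>A" using W_cube[OF w(1)] cube_eq[OF Wc[OF w(1)]] A1 by (simp only:)
  have 2: "card W = 3 * card A" unfolding W_card A_card by simp
  show ?thesis by (rule index_3_cosets[OF W_sub finW A_sub AW 2 w(1) False 1 that])
 qed
 have cs: "subgroup (CG W) G" by (rule centralizer_subgroup[OF W_carrier])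
 have cw: "\<one>\<in>CG W" "w\<in>CG W" "w\<otimes>w\<in>CG W"
 proof -
  show 1: "w\<in>CG W"
  proof (rule centralizerI[OF Wc[OF w(1)] W_carrier])
   fix v assume v: "v\<in>W"
   show "v\<up>w = v" using conj_el_fixed[OF Wc[OF v] Wc[OF w(1)]] w(2)[OF v] by blast
  qed
  show "\<one>\<in>CG W" "w\<otimes>w\<in>CG W"
   using subgroup.one_closed[OF cs] subgroup.m_closed[OF cs 1 1] by blast+
 qed
 have cos': "\<exists>a\<in>A. \<exists>c\<in>CG W. v = a\<otimes>c" if v: "v\<in>W" for v
 proof -
  obtain a where a: "a\<in>A" "v = a \<or> v = a\<otimes>w \<or> v = a\<otimes>(w\<otimes>w)" using cos[OF v] by blast
  have "a = a\<otimes>\<one>" using a by simp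
  then show ?thesis using a cw by blast
 qed
 have "[.u, v.] = \<one>" if u: "u\<in>B" and v: "v\<in>B" for u v
 proof -
  obtain a c where a: "a\<in>A" "c\<in>CG W" "u = a\<otimes>c" using cos' u BW by blast
  obtain b d where b: "b\<in>A" "d\<in>CG W" "v = b\<otimes>d" using cos' v BW by blast
  have cc: "a\<in>carrier G" "b\<in>carrier G" "c\<in>carrier G" "d\<in>carrier G"
   using a b centralizer_carrier by auto
  have uW: "u\<in>W" "v\<in>W" "a\<in>W" "b\<in>W" using u v a b AW BW by blast+
  have uc: "u\<in>carrier G" "v\<in>carrier G" using u v by auto
  have ud: "u\<up>d = u" by (rule centralizer_conj_el[OF b(2) uW(1) uc(1)])
  have bc: "b\<up>c = b" by (rule centralizer_conj_el[OF a(2) uW(4) cc(2)])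
  have cb: "c\<up>b = c" using bc conj_el_fixed[OF cc(2,3)] conj_el_fixed[OF cc(3,2)] by simp
  have "u\<up>v = (a\<up>b)\<otimes>c"
  proof -
   have "u\<up>v = u\<up>(d\<otimes>b)" using b centralizerD[OF b(2) uW(4)] by simp
   also have "\<dots> = u\<up>b" using ud uc cc by (simp flip: conj_el_conj)
   finally show ?thesis unfolding a(3) using cb cc by (simp add: conj_el_mult)
  qed
  then have "[.u, v.] = inv c\<otimes>([.a, b.]\<otimes>c)"
   using comm_eq_conj[OF uc] unfolding a(3) using cc by (simp add: word_simps)
  also have "\<dots> = [.a, b.]\<up>c" using cc by (simp add: word_simps)
  also have "\<dots> = [.a, b.]"
   by (rule centralizer_conj_el[OF a(2) subgroup_comm[OF W_sub uW(3,4)]]) (use cc in simp)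
  finally have "[.u, v.]\<in>Z" using P.Q_comm a b by auto
  then show ?thesis using R.Q_comm u v dis by blast
 qed
 then show ?thesis using B_nonabelian by blast
qed

lemma W_centre_eq: "centre (grp_on G W) = Y"
proof
 show "centre (grp_on G W)\<subseteq>Y"
 proof
  fix w assume "w\<in>centre (grp_on G W)"
  then have w: "w\<in>W" "\<And>v. v\<in>W ==> v\<otimes>w = w\<otimes>v" unfolding centre_on by auto
  show "w\<in>Y" by (rule W_centre) (fact w)+
 qed
 show "Y\<subseteq>centre (grp_on G W)"
 proof
  fix y assume y: "y\<in>Y"
  have "y\<in>W" using y YA AW by blast
  moreover have "y\<otimes>w = w\<otimes>y" if "w\<in>W" for w
   using centralizerD[of w Y y] that y by simp
  ultimately show "y\<in>centre (grp_on G W)" unfolding centre_on by blast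
 qed
qed

lemma W_derived: "derived G W = Y"
proof
 show "derived G W\<subseteq>Y" unfolding derived_def
 proof (rule generate_subgroup_incl[OF _ Y_sub], rule subsetI)
  fix t assume "t\<in>derived_set G W"
  then obtain u v where uv: "u\<in>W" "v\<in>W" and t: "t = u\<otimes>v\<otimes>inv u\<otimes>inv v" by blast
  have "u\<otimes>v\<otimes>inv u\<otimes>inv v = [.inv u, inv v.]" using uv by simp
  then show "t\<in>Y" unfolding t using W_comm[OF Wi[OF uv(1)] Wi[OF uv(2)]] by argo
 qed
 have ds: "subgroup (derived G W) G" by (rule derived_is_subgroup[OF W_carrier])
 have comm_in: "[.u, v.]\<in>derived G W" if uv: "u\<in>W" "v\<in>W" for u v
 proof -
  have "inv u\<otimes>inv v\<otimes>inv (inv u)\<otimes>inv (inv v)\<in>derived G W"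
   unfolding derived_def by (rule generate.incl) (use Wi uv in blast)
  then show ?thesis using uv by simp
 qed
 have "Z\<subseteq>derived G W"
 proof -
  obtain u v where uv: "u\<in>A" "v\<in>A" "[.u, v.]~=\<one>" using A_nonabelian by blast
  have c: "[.u, v.]\<in>Z" "[.u, v.]\<in>derived G W" using P.Q_comm uv comm_in AW by blast+
  show ?thesis by (rule order_3_subset[OF P.Z_sub P.Z_card c(1) uv(3) ds c(2)])
 qed
 moreover have "Z1\<subseteq>derived G W"
 proof -
  obtain u v where uv: "u\<in>B" "v\<in>B" "[.u, v.]~=\<one>" using B_nonabelian by blast
  have c: "[.u, v.]\<in>Z1" "[.u, v.]\<in>derived G W" using R.Q_comm uv comm_in BW by blast+
  show ?thesis by (rule order_3_subset[OF R.Z_sub R.Z_card c(1) uv(3) ds c(2)])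
 qed
 ultimately show "Y\<subseteq>derived G W" by (rule set_mult_subset[OF ds])
qed

text \<open>\<open>K\<close> and \<open>W\<close> both have index 24 in \<open>L\<close>.\<close>

lemma kernel_eq_W:
 assumes nat: "natural_SL23_module G L K M M'" and K: "W\<subseteq>K" "K\<subseteq>L" "subgroup K G"
 shows "natural_SL23_module G L W M M'"
proof -
 obtain \<phi> where "\<phi>\<in>iso (G\<lparr>carrier := L\<rparr> Mod K) SL23" using nat unfolding natural_SL23_module_def by blast
 then have "order (G\<lparr>carrier := L\<rparr> Mod K) = 24"
  using iso_same_card[of "G\<lparr>carrier := L\<rparr> Mod K" SL23] order_SL23 by (auto simp: order_def is_iso_def)
 then have "24 * card K = card L" using section_order[OF L_sub finL K(3,2)] by simp
 then have "card K = card W" using card_L_W by simp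
 moreover have "finite K" by (rule finite_subset[OF K(2) finL])
 ultimately have "W = K" using card_subset_eq[OF _ K(1)] by simp
 then show ?thesis using nat by simp
qed

lemma W_E_module: "natural_SL23_module G L W W E"
proof (rule kernel_eq_W)
 obtain a where a: "a\<in>Q" "a~:A" by (rule Q_not_A)
 obtain a' where a': "a'\<in>Q1" "a'~:B" by (rule extraspecial_pair.Q_not_A[OF swap])
 have neA: "A~=E" and neB: "B~=E" using A_card B_card E_card by auto
 obtain b where b: "b\<in>B" "b~:E" using neB EB by blast
 obtain b' where b': "b'\<in>A" "b'~:E" using neA EA by blast
 show "natural_SL23_module G L (L\<inter>trivial_on W E) W E"
 proof (rule natural_module_recognition[where P = Q and R = Q1 and U = A and V = B])
  show "L\<subseteq>normalizing W\<inter>normalizing E" using L_normalizing_W L_norm_E by blast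
  show "\<exists>u\<in>W. \<exists>g\<in>Q. [.u, g.]~:E" using B_nontrivial_mod_E[OF a b(1)] b a BW by blast
  show "\<exists>u\<in>W. \<exists>g\<in>Q1. [.u, g.]~:E"
   using extraspecial_pair.B_nontrivial_mod_E[OF swap a' b'(1)] b' a' AW unfolding Int_commute[of Q1 Q] by blast
  show "[.u, g.]\<in>A" if "u\<in>W" "g\<in>Q" for u g using comm_Q_C that by blast
  show "[.u, g.]\<in>B" if "u\<in>W" "g\<in>Q1" for u g using comm_Q1_C that by blast
  show "[.u, g.]\<in>E" if "u\<in>A" "g\<in>Q" for u g using P.Q_comm[of u g] that ZY YE by blast
  show "[.u, g.]\<in>E" if "u\<in>B" "g\<in>Q1" for u g using R.Q_comm[of u g] that Z1Y YE by blast
  show "u [^] (3::nat)\<in>E" if "u\<in>W" for u using W_cube[OF that] E1 by simp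
  show "[.u, v.]\<in>E" if "u\<in>W" "v\<in>W" for u v using W_comm[OF that] YE by blast
  show "card W = 9 * card E" using W_card E_card by simp
  show "A\<inter>B\<subseteq>E" using E_AB by blast
  show "Q \<union> Q1\<subseteq>carrier G" using P.Q_carrier R.Q_carrier by blast
 qed (use W_sub finW E_sub A_sub B_sub EA EB AW BW neA neB in auto)
 show "W\<subseteq>L\<inter>trivial_on W E"
 proof
  fix w assume w: "w\<in>W"
  have "w\<in>trivial_on W E"
   by (rule trivial_onI) (use w L_normalizing_W L_norm_E W_comm YE in blast)+
  then show "w\<in>L\<inter>trivial_on W E" using w by blast
 qed
 show "subgroup (L\<inter>trivial_on W E) G"
  by (rule subgroups_Inter_pair[OF L_sub trivial_on_subgroup[OF W_carrier E_sub]])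
qed blast

end

section \<open>The Sylow 3-subgroup and its Thompson subgroup\<close>

context extraspecial_pair begin

abbreviation "Syl \<equiv> Q<#>W"

lemma QW: "Q\<inter>W = A" using A_alt QL by blast

lemma Q_norm_W: "q\<in>Q ==> w\<in>W ==> w\<up>q\<in>W" using L_norm_W QL by blast

lemma S_sub: "subgroup Syl G" by (rule set_mult_subgroup[OF P.Q_sub W_sub Q_norm_W])
lemma QS: "Q\<subseteq>Syl" by (rule set_mult_left[OF W_sub P.Q_carrier])
lemma WS: "W\<subseteq>Syl" by (rule set_mult_right[OF P.Q_sub W_carrier])
lemma SL: "Syl\<subseteq>L" by (rule set_mult_subset[OF L_sub QL(1)]) blast
lemma finS: "finite Syl" using SL finL finite_subset by blast
lemma S_card: "card Syl = 729"
 using card_set_mult_inter[OF P.Q_sub P.finQ W_sub finW] QW P.Q_card W_card A_card by simp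
lemma Sc [simp]: "g\<in>Syl ==> g\<in>carrier G" using S_sub subgroup_carrier by blast
lemmas Sm = subgroup.m_closed[OF S_sub] and Si = subgroup.m_inv_closed[OF S_sub] and S1 = subgroup.one_closed[OF S_sub]

lemma W_commuting_Q:
 assumes q: "q\<in>Q" "q~:A" and d: "d\<in>W" "[.d, q.]\<in>E"
 shows "d\<in>A"
proof -
 obtain u v where uv: "u\<in>A" "v\<in>B" "d = u\<otimes>v" using W_AB[OF d(1)] by blast
 have c: "u\<in>carrier G" "v\<in>carrier G" "q\<in>carrier G" using uv q by auto
 have kZ: "[.u, q.]\<in>Z" using P.Q_comm uv q by blast
 have "[.u, q.]\<up>v = [.u, q.]" using centralizer_conj_el[of v Z "[.u, q.]"] uv kZ by auto
 then have "[.d, q.] = [.u, q.]\<otimes>[.v, q.]" unfolding uv(3) using comm_mult_left[OF c] by simp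
 moreover have "[.u, q.]\<in>E" using kZ ZY YE by blast
 ultimately have "[.v, q.]\<in>E"
  using subgroup_mult_cancel(1)[OF E_sub, of "[.u, q.]" "[.v, q.]"] d c by auto
 then have "v\<in>E" using B_nontrivial_mod_E[OF q uv(2)] by blast
 then show ?thesis using uv Am EA by blast
qed

lemma Y_commuting_Q:
 assumes q: "q\<in>Q" "q~:A" and y: "y\<in>Y" "y\<up>q = y" shows "y\<in>Z"
proof -
 obtain w v where wv: "w\<in>Z" "v\<in>Z1" "y = w\<otimes>v" using y by (auto simp: set_mult_def)
 have c: "w\<in>carrier G" "v\<in>carrier G" "q\<in>carrier G" using wv q by auto
 have "v\<up>q = v"
  using y(2) unfolding wv(3) using c P.Z_fixed[OF wv(1) q(1)] by (simp add: conj_el_mult)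
 then have "q\<in>CG {v}" using c by (intro centralizerI) auto
 then have "v = \<one>" using cent_Z1_eq[OF wv(2)] q by blast
 then show ?thesis using wv by simp
qed

lemma central_involution_exists:
 "\<exists>s\<in>L. involution G s \<and> W #> s\<in>centre (G\<lparr>carrier := L\<rparr> Mod W)"
proof -
 obtain \<phi> where \<phi>: "\<phi>\<in>iso (G\<lparr>carrier := L\<rparr> Mod W) SL23" using L_mod_W_iso by blast
 obtain l where l: "l\<in>L" "l\<notin>W" "l\<otimes>l\<in>W" "W #> l\<in>centre (G\<lparr>carrier := L\<rparr> Mod W)"
  using central_coset_exists[OF L_sub W_normal \<phi>] by blast
 \<comment> \<open>\<open>l\<^sup>3\<close> is congruent to \<open>l\<close> modulo \<open>W\<close>, and its square is the cube of \<open>l\<^sup>2\<in>W\<close>.\<close>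
 let ?s = "(l\<otimes>l)\<otimes>l"
 have lc: "l\<in>carrier G" using l by simp
 have sL: "?s\<in>L" using l Lm by blast
 have sW: "?s\<notin>W" using subgroup_mult_cancel(1)[OF W_sub l(3) lc] l by blast
 have "?s\<otimes>?s = (l\<otimes>l) [^] (3::nat)" using lc by (simp add: cube_eq m_assoc)
 also have "\<dots> = \<one>" by (rule W_cube[OF l(3)])
 finally have ss: "?s\<otimes>?s = \<one>" .
 have sc: "?s\<in>carrier G" using lc by simp
 have "ord ?s = 2"
 proof -
  have "?s [^] (2::nat) = \<one>" using ss sc by (simp add: numeral_2_eq_2)
  then have "ord ?s dvd 2" using pow_eq_id[OF sc] by blast
  moreover have "ord ?s\<noteq>1" using ord_eq_1[OF sc] sW W1 by metis
  ultimately show ?thesis by (metis prime_nat_iff two_is_prime_nat)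
 qed
 then have "involution G ?s" using sc by (simp add: involution_def)
 moreover have "W #> ?s = W #> l"
  using rcos_eq_iff[OF W_sub sc lc] l lc by (simp add: m_assoc)
 ultimately show ?thesis using sL l(4) by metis
qed

lemma involution_square: "involution G u ==> u\<in>carrier G \<and> u\<otimes>u = \<one> \<and> u~=\<one>"
proof -
 assume u: "involution G u"
 then have uc: "u\<in>carrier G" and o: "ord u = 2" by (auto simp: involution_def)
 have "u [^] (2::nat) = \<one>" using pow_ord_eq_1[OF uc] o by simp
 then show ?thesis using uc o ord_eq_1[OF uc] by (auto simp: numeral_2_eq_2)
qed

end

locale extraspecial_pair_involution = extraspecial_pair +
 fixes s
 assumes s: "s\<in>L" "s\<otimes>s = \<one>" "s~=\<one>" "W #> s\<in>centre (G\<lparr>carrier := L\<rparr> Mod W)"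
begin

lemma sc [simp]: "s\<in>carrier G" using s by simp
lemma inv_s [simp]: "inv s = s" using s(2) by (simp add: inv_equality)
lemma s_cancel: "w\<in>carrier G ==> s\<otimes>(s\<otimes>w) = w" using s(2) by (simp flip: m_assoc)
lemma conj_ss: "w\<in>carrier G ==> (w\<up>s)\<up>s = w" using s(2) by (simp add: conj_el_conj)

lemma s_not_W: "s~:W"
proof
 assume "s\<in>W"
 then have "s\<otimes>(s\<otimes>s) = \<one>" using W_cube[of s] cube_eq[of s] by simp
 then show False using s by simp
qed

lemma s_inverts_Y: "y\<in>Y ==> y\<up>s = inv y"
 using natural_module_central_inverts[OF Y_module L_sub s(1) s_not_W s(4)] by (simp add: inv_equality[symmetric])

lemma s_inverts_W_mod_E: "w\<in>W ==> (w\<up>s)\<otimes>w\<in>E"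
 by (rule natural_module_central_inverts[OF W_E_module L_sub s(1) s_not_W s(4)])

lemma s_central: assumes l: "l\<in>L" shows "[.l, s.]\<in>W"
proof -
 let ?M = "G\<lparr>carrier := L\<rparr> Mod W"
 have li: "inv l\<in>L" by (rule Li[OF l])
 have "(W #> s) \<otimes>\<^bsub>?M\<^esub> (W #> inv l) = (W #> inv l) \<otimes>\<^bsub>?M\<^esub> (W #> s)"
  using s(4) li unfolding centre_def centralizer_def section_carrier by blast
 then have "W #> (s\<otimes>inv l) = W #> (inv l\<otimes>s)"
  using section_mult[OF L_sub W_normal s(1) li] section_mult[OF L_sub W_normal li s(1)] by simp
 then have 1: "(s\<otimes>inv l)\<otimes>inv (inv l\<otimes>s)\<in>W" using rcos_eq_iff[OF W_sub] l by simp
 have "[.l, s.] = inv ((s\<otimes>inv l)\<otimes>inv (inv l\<otimes>s))"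
  using l by (simp add: word_simps)
 then show ?thesis using Wi[OF 1] by simp
qed

definition J where "J = {w\<in>W. w\<up>s = inv w}"

lemma JW: "J\<subseteq>W" by (auto simp: J_def)
lemma Jc [simp]: "j\<in>J ==> j\<in>carrier G" using JW by auto
lemma finJ: "finite J" using JW finW finite_subset by blast

lemma W_central_Y: "w\<in>W ==> y\<in>Y ==> y\<otimes>w = w\<otimes>y"
 by (rule centralizer_commutes[of w Y]) simp_all

text \<open>The error term \<open>w\<^sup>s w\<close> is fixed by \<open>s\<close> because \<open>Y\<close> is
 central in \<open>W\<close>, while \<open>s\<close> inverts \<open>Y\<close>.\<close>

lemma JI: assumes w: "w\<in>W" "(w\<up>s)\<otimes>w\<in>Y" shows "w\<in>J"
proof -
 let ?y = "(w\<up>s)\<otimes>w"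
 have wc: "w\<in>carrier G" using w by simp
 have yc: "?y\<in>carrier G" using wc by simp
 have "inv ?y = ?y\<up>s" using s_inverts_Y[OF w(2)] by simp
 also have "\<dots> = w\<otimes>(w\<up>s)" using wc conj_ss by (simp add: conj_el_mult)
 also have "\<dots> = w\<otimes>(?y\<otimes>inv w)" using wc by (simp add: m_assoc)
 also have "\<dots> = w\<otimes>(inv w\<otimes>?y)" using W_central_Y[OF Wi[OF w(1)] w(2)] by simp
 also have "\<dots> = ?y" using wc by simp
 finally have "?y\<otimes>?y = \<one>" using yc by (metis r_inv)
 moreover have "?y\<otimes>(?y\<otimes>?y) = \<one>" by (rule Y_cube[OF w(2)])
 ultimately have "?y = \<one>" using yc by simp
 then have "w\<up>s = inv w" using wc by (simp add: inv_equality)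
 then show ?thesis using w by (simp add: J_def)
qed

lemma J_sub: "subgroup J G"
proof (rule subgroupI)
 show "J\<subseteq>carrier G" by auto
 have "\<one>\<in>J" using W1 by (simp add: J_def)
 then show "J~={}" by blast
 fix u assume u: "u\<in>J"
 then have uW: "u\<in>W" "u\<up>s = inv u" by (auto simp: J_def)
 show "inv u\<in>J" using uW Wi by (simp add: J_def conj_el_inv)
 fix v assume v: "v\<in>J"
 then have vW: "v\<in>W" "v\<up>s = inv v" by (auto simp: J_def)
 have c: "u\<in>carrier G" "v\<in>carrier G" using u v by simp_all
 show "u\<otimes>v\<in>J"
 proof (rule JI)
  show "u\<otimes>v\<in>W" using uW vW Wm by blast
  have "((u\<otimes>v)\<up>s)\<otimes>(u\<otimes>v) = [.u, v.]" using uW(2) vW(2) c by (simp add: conj_el_mult m_assoc)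
  then show "((u\<otimes>v)\<up>s)\<otimes>(u\<otimes>v)\<in>Y" using W_comm[OF uW(1) vW(1)] by simp
 qed
qed

lemmas Jm = subgroup.m_closed[OF J_sub] and Ji = subgroup.m_inv_closed[OF J_sub] and J1 = subgroup.one_closed[OF J_sub]

lemma J_inv: "j\<in>J ==> j\<up>s = inv j" by (simp add: J_def)

lemma J_abelian: assumes u: "u\<in>J" and v: "v\<in>J" shows "u\<otimes>v = v\<otimes>u"
proof -
 have c: "u\<in>carrier G" "v\<in>carrier G" using u v by simp_all
 have "inv (v\<otimes>u) = (u\<otimes>v)\<up>s" using J_inv u v c by (simp add: conj_el_mult inv_mult_group)
 also have "\<dots> = inv (u\<otimes>v)" using J_inv[OF Jm[OF u v]] .
 finally show ?thesis using c by (metis inv_inv m_closed)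
qed

lemma J_cube: "j\<in>J ==> j\<otimes>(j\<otimes>j) = \<one>" using W_cube[of j] JW cube_eq[of j] by auto
lemma J_inv_square: "j\<in>J ==> inv j\<otimes>inv j = j"
proof -
 assume j: "j\<in>J"
 have "inv j\<otimes>inv j = inv (j\<otimes>j)" using j by (simp add: inv_mult_group)
 also have "j\<otimes>j = inv j" using J_cube[OF j] j by (metis Jc inv_equality m_assoc m_closed)
 finally show ?thesis using j by simp
qed

lemma YJ: "Y\<subseteq>J"
proof
 fix y assume y: "y\<in>Y"
 have "y\<in>W" using y YA AW by blast
 then show "y\<in>J" using s_inverts_Y[OF y] by (simp add: J_def)
qed

lemma comm_s_J: assumes g: "g\<in>L" shows "[.g, s.]\<in>J"
proof -
 have gc: "g\<in>carrier G" using g by simp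
 have "[.g, s.]\<up>s = inv [.g, s.]" using gc s_cancel by (simp add: word_simps s(2))
 then show ?thesis using s_central[OF g] by (simp add: J_def)
qed

lemma comm_J_s: "j\<in>J ==> [.j, s.] = j"
 using comm_eq_conj[of j s] J_inv J_inv_square by simp

lemma JE: "J\<inter>E = Y"
proof
 show "J\<inter>E\<subseteq>Y"
 proof
  fix e assume e: "e\<in>J\<inter>E"
  then have "[.e, s.]\<in>Y" using L_centralizes_E_mod_Y s by blast
  then show "e\<in>Y" using comm_J_s e by simp
 qed
 show "Y\<subseteq>J\<inter>E" using YJ YE by blast
qed

lemma W_JE: assumes w: "w\<in>W" shows "\<exists>j\<in>J. \<exists>e\<in>E. w = j\<otimes>e"
proof -
 let ?j = "[.w, s.]" and ?e = "(w\<up>s)\<otimes>w"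
 have wc: "w\<in>carrier G" and wL: "w\<in>L" using w by auto
 have jJ: "?j\<in>J" by (rule comm_s_J[OF wL])
 have eE: "?e\<in>E" by (rule s_inverts_W_mod_E[OF w])
 have "w [^] (3::nat) = \<one>" by (rule W_cube[OF w])
 then have iw: "inv w = w\<otimes>w" using cube_one_inv[OF wc] by simp
 have iww: "inv w\<otimes>inv w = w"
 proof -
  have "inv w\<otimes>inv w = inv (w\<otimes>w)" using wc by (simp add: inv_mult_group)
  also have "w\<otimes>w = inv w" by (rule iw[symmetric])
  finally show ?thesis using wc by simp
 qed
 let ?f = "?e\<up>inv w"
 have fE: "?f\<in>E" using normalizing_conj[of "inv w" E ?e] L_norm_E Li[OF wL] eE by blast
 have fc: "?f\<in>carrier G" using fE by simp
 have "?j = inv w\<otimes>(w\<up>s)" using comm_eq_conj[OF wc sc] by simp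
 also have "w\<up>s = ?e\<otimes>inv w" using wc by (simp add: m_assoc)
 also have "inv w\<otimes>(?e\<otimes>inv w) = (inv w\<otimes>inv w)\<otimes>?f" using wc by (simp add: conj_el_def m_assoc)
 finally have "?j = w\<otimes>?f" unfolding iww .
 then have "w = ?j\<otimes>inv ?f" using wc fc by (metis inv_solve_right m_closed)
 then show ?thesis using jJ Ei[OF fE] by blast
qed

lemma J_card: "card J = 81"
proof -
 have "J<#>E = W"
 proof
  show "J<#>E\<subseteq>W" using JW EA AW by (intro set_mult_subset[OF W_sub]) blast+
  show "W\<subseteq>J<#>E" using W_JE by (auto simp: set_mult_def)
 qed
 then show ?thesis
  using card_set_mult_inter[OF J_sub finJ E_sub finE] JE W_card E_card Y_card by simp
qed

lemma L_norm_J: assumes l: "l\<in>L" and w: "w\<in>J" shows "w\<up>l\<in>J"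
proof (rule JI)
 have wW: "w\<in>W" using w JW by blast
 let ?v = "w\<up>l" and ?c = "[.l, s.]"
 show vW: "?v\<in>W" by (rule L_norm_W[OF l wW])
 have c: "w\<in>carrier G" "l\<in>carrier G" "?v\<in>carrier G" "?c\<in>carrier G" using w l by simp_all
 have cW: "?c\<in>W" by (rule s_central[OF l])
 have "?v\<up>s = ((w\<up>s)\<up>l)\<up>?c" using c s_cancel by (simp add: word_simps)
 also have "\<dots> = inv ?v\<up>?c" using J_inv[OF w] c by (simp add: conj_el_inv)
 also have "\<dots> = inv ?v\<otimes>[.inv ?v, ?c.]" using c by (intro conj_el_eq_comm) auto
 finally have 1: "?v\<up>s = inv ?v\<otimes>[.inv ?v, ?c.]" .
 have kY: "[.inv ?v, ?c.]\<in>Y" by (rule W_comm[OF Wi[OF vW] cW])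
 have kc: "[.inv ?v, ?c.]\<in>carrier G" by (rule Yc[OF kY])
 have "(?v\<up>s)\<otimes>?v = inv ?v\<otimes>([.inv ?v, ?c.]\<otimes>?v)"
  unfolding 1 by (rule m_assoc[OF inv_closed[OF c(3)] kc c(3)])
 also have "\<dots> = inv ?v\<otimes>(?v\<otimes>[.inv ?v, ?c.])"
  by (rule arg_cong[OF W_central_Y[OF vW kY], of "\<lambda>t. inv ?v\<otimes>t"])
 also have "\<dots> = [.inv ?v, ?c.]" by (simp only: inv_cancel_left c(3) kc)
 finally have "(?v\<up>s)\<otimes>?v = [.inv ?v, ?c.]" .
 then show "(?v\<up>s)\<otimes>?v\<in>Y" using kY by simp
qed

lemma L_normalizing_J: "L\<subseteq>normalizing J"
 using normalizingI[OF finJ] L_norm_J Lc Jc by blast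

lemma J_normal: "J \<lhd> G\<lparr>carrier := L\<rparr>"
 by (rule normal_onI[OF L_sub J_sub]) (use JW L_norm_J in auto)

lemma J_not_A: "\<not> J\<subseteq>A"
proof
 assume "J\<subseteq>A"
 then have "J = A" using J_card A_card finA by (intro card_subset_eq) auto
 then show False using A_nonabelian J_abelian comm_one_iff by (metis Jc)
qed

lemma J_cap_Q: "J\<inter>Q = J\<inter>A" using JW QW by blast

lemma Z2_sub: "subgroup (J\<inter>Q) G" by (rule subgroups_Inter_pair[OF J_sub P.Q_sub])

lemma Z2_card: "card (J\<inter>Q) = 27"
proof -
 have JA: "subgroup (J\<inter>A) G" by (rule subgroups_Inter_pair[OF J_sub A_sub])
 have "card (J<#>A) * card (J\<inter>A) = 81 * 81"
  using card_set_mult_inter[OF J_sub finJ A_sub finA] J_card A_card by simp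
 moreover have "card (J<#>A) \<le> 243"
  using card_mono[OF finW set_mult_subset[OF W_sub JW AW]] W_card by simp
 ultimately have "243 * card (J\<inter>A) \<ge> 81 * 81" by (metis mult_le_mono1)
 then have ge: "card (J\<inter>A) \<ge> 27" by simp
 have "card (J\<inter>A) dvd 81" using card_subgroup_dvd[OF J_sub JA _ finJ] J_card by simp
 then obtain i where i: "card (J\<inter>A) = 3 ^ i" "i \<le> 4" using divides_primepow_nat[of 3 _ 4] by auto
 have "card (J\<inter>A)~=81"
 proof
  assume "card (J\<inter>A) = 81"
  then have "J\<inter>A = J" using J_card finJ by (intro card_subset_eq) auto
  then show False using J_not_A by blast
 qed
 moreover have "i = 0 \<or> i = 1 \<or> i = 2 \<or> i = 3 \<or> i = 4" using i(2) by arith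
 ultimately show ?thesis using i(1) ge J_cap_Q by auto
qed

lemma JS: "J\<subseteq>Syl" using JW WS by blast

lemma S_QJ: "Syl = Q<#>J"
proof -
 have "card (Q<#>J) = 729"
  using card_set_mult_inter[OF P.Q_sub P.finQ J_sub finJ] Z2_card J_card P.Q_card by (simp add: Int_commute)
 moreover have "Q<#>J\<subseteq>Syl" by (rule set_mult_subset[OF S_sub QS JS])
 ultimately show ?thesis using finS S_card by (metis card_subset_eq)
qed

lemma S_ex: "g\<in>Syl ==> \<exists>q\<in>Q. \<exists>j\<in>J. g = q\<otimes>j"
 unfolding S_QJ by (auto simp: set_mult_def)

text \<open>If \<open>K\<subseteq>W\<close> differs from \<open>J\<close>, then \<open>K\<inter>J\<close> is
 centralized by \<open>JK = W\<close>, so it lies in \<open>Y\<close> and is too small.  If \<open>K\<close>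
 contains \<open>g\<notin>W\<close>, then \<open>D = K\<inter>W\<close> commutes with \<open>g\<close>;
 this forces \<open>D\<subseteq>A\<close> and \<open>D\<inter>Y\<subseteq>Z\<close>, and then \<open>A =
 DY\<close> would be abelian.\<close>

lemma abelian_large_eq_J:
 assumes K: "subgroup K G" "K\<subseteq>Syl" and ab: "\<And>u v. u\<in>K ==> v\<in>K ==> u\<otimes>v = v\<otimes>u" and c: "card K \<ge> 81"
 shows "K = J"
proof -
 have finK: "finite K" using K finS finite_subset by blast
 have Kc: "u\<in>carrier G" if "u\<in>K" for u using K that subgroup_carrier by blast
 show ?thesis
 proof (cases "K\<subseteq>W")
  case True
  have "K\<subseteq>J"
  proof (rule ccontr)
   assume "\<not> K\<subseteq>J"
   then obtain g where g: "g\<in>K" "g~:J" by blast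
   have gW: "g\<in>W" using g True by blast
   have "card (K<#>J) * card (K\<inter>J) = card K * 81"
    using card_set_mult_inter[OF K(1) finK J_sub finJ] J_card by simp
   moreover have "card (K<#>J) \<le> 243"
    using card_mono[OF finW set_mult_subset[OF W_sub True JW]] W_card by simp
   ultimately have "card K * 81 \<le> 243 * card (K\<inter>J)" by (metis mult_le_mono1)
   then have 27: "card (K\<inter>J) \<ge> 27" using c by simp
   have "K\<inter>J\<subseteq>Y"
   proof
    fix d assume d: "d\<in>K\<inter>J"
    have dc: "d\<in>carrier G" using d by simp
    have cs: "subgroup (CG {d}) G" using dc by (intro centralizer_subgroup) simp
    show "d\<in>Y"
    proof (rule W_centre)
     show "d\<in>W" using d JW by blast
     fix w assume "w\<in>W"
     then obtain j where j: "j\<in>J" "w = j \<or> w = j\<otimes>g \<or> w = j\<otimes>(g\<otimes>g)"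
     using index_3_cosets[OF W_sub finW J_sub JW _ gW g(2)] W_card J_card W_cube[OF gW] cube_eq[of g] J1 gW by auto
     have "j\<in>CG {d}" by (rule centralizer_singletonI) (use j d J_abelian in auto)
     moreover have gd: "g\<in>CG {d}" by (rule centralizer_singletonI) (use g d ab Kc in blast)+
     ultimately have "w\<in>CG {d}" using j(2) subgroup.m_closed[OF cs] by blast
     then show "w\<otimes>d = d\<otimes>w" by (rule centralizer_singletonD)
    qed
   qed
   then have "card (K\<inter>J) \<le> 9" using card_mono[OF finY] Y_card by metis
   then show False using 27 by simp
  qed
  then show ?thesis using c J_card finJ by (intro card_seteq) auto
 next
  case False
  then obtain g where g: "g\<in>K" "g~:W" by blast
  have gS: "g\<in>Syl" using g K by blast
  then obtain q j where qj: "q\<in>Q" "j\<in>J" "g = q\<otimes>j" using S_ex by blast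
  have qc: "q\<in>carrier G" "j\<in>carrier G" using qj by simp_all
  have qA: "q~:A" using qj g AW JW Wm by blast
  let ?D = "K\<inter>W"
  have Ds: "subgroup ?D G" by (rule subgroups_Inter_pair[OF K(1) W_sub])
  have finD: "finite ?D" using finK by simp
  have fixg: "(d\<up>q)\<up>j = d" if d: "d\<in>?D" for d
  proof -
   have dc: "d\<in>carrier G" using d by simp
   have "d\<up>g = d" using conj_el_fixed[OF dc Kc[OF g(1)]] ab g d by blast
   then show ?thesis unfolding qj(3) using dc qc by (simp add: conj_el_conj)
  qed
  have DA: "?D\<subseteq>A"
  proof
   fix d assume d: "d\<in>?D"
   have dW: "d\<in>W" and dc: "d\<in>carrier G" using d by auto
   have "d\<up>inv j = ((d\<up>q)\<up>j)\<up>inv j" using fixg[OF d] by simp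
   also have "\<dots> = d\<up>q" using dc qc by simp
   finally have "[.d, q.] = [.d, inv j.]" unfolding comm_eq_conj[OF dc qc(1)] comm_eq_conj[OF dc inv_closed[OF qc(2)]] by (simp only:)
   moreover have "[.d, inv j.]\<in>Y" using W_comm[OF dW] Ji qj JW by blast
   ultimately have "[.d, q.]\<in>E" using YE by auto
   then show "d\<in>A" by (rule W_commuting_Q[OF qj(1) qA dW])
  qed
  have DY: "?D\<inter>Y\<subseteq>Z"
  proof
   fix y assume y: "y\<in>?D\<inter>Y"
   have yq: "y\<up>q\<in>Y" using normalizing_conj[of q Y y] Q_norm_Y qj y by blast
   have "(y\<up>q)\<up>j = y\<up>q" using Y_fixed[OF yq] qj JW by blast
   then have "y\<up>q = y" using fixg y by simp
   then show "y\<in>Z" using Y_commuting_Q[OF qj(1) qA] y by blast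
  qed
  have "card (K<#>W) * card ?D = card K * 243"
   using card_set_mult_inter[OF K(1) finK W_sub finW] W_card by simp
  moreover have "card (K<#>W) \<le> 729"
   using card_mono[OF finS set_mult_subset[OF S_sub K(2) WS]] S_card by simp
  ultimately have "card K * 243 \<le> 729 * card ?D" by (metis mult_le_mono1)
  then have D27: "card ?D \<ge> 27" using c by simp
  have "card (?D<#>Y) * card (?D\<inter>Y) = card ?D * 9"
   using card_set_mult_inter[OF Ds finD Y_sub finY] Y_card by simp
  moreover have "card (?D\<inter>Y) \<le> 3" using card_mono[OF P.finZ DY] P.Z_card by simp
  ultimately have "card ?D * 9 \<le> card (?D<#>Y) * 3" by (metis mult_le_mono2)
  then have "card (?D<#>Y) \<ge> 81" using D27 by simp
  moreover have "?D<#>Y\<subseteq>A" by (rule set_mult_subset[OF A_sub DA YA])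
  ultimately have eq: "?D<#>Y = A" using A_card finA by (intro card_seteq) auto
  have "u\<otimes>v = v\<otimes>u" if u: "u\<in>A" and v: "v\<in>A" for u v
  proof -
   have "u\<in>?D<#>Y" "v\<in>?D<#>Y" unfolding eq by (rule u, rule v)
   then obtain d y d' y' where d: "d\<in>?D" "y\<in>Y" "u = d\<otimes>y" and d': "d'\<in>?D" "y'\<in>Y" "v = d'\<otimes>y'"
    unfolding set_mult_def by blast
   have cc: "d\<in>carrier G" "d'\<in>carrier G" using d d' by auto
   have "y\<otimes>v = v\<otimes>y" using W_central_Y[of v y] v AW d by blast
   moreover have "d\<otimes>v = v\<otimes>d"
   proof -
    have "d\<otimes>d' = d'\<otimes>d" using ab d d' by blast
    moreover have "y'\<otimes>d = d\<otimes>y'" using W_central_Y[of d y'] d d' by blast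
    ultimately show ?thesis unfolding d'(3) using cc d' by (metis Yc m_assoc)
   qed
   ultimately show ?thesis unfolding d(3) using cc d v by (metis P.Qc IntD1 Yc m_assoc)
  qed
  then show ?thesis using A_nonabelian comm_one_iff by (metis A_carrier subsetD)
 qed
qed

lemma thompson_eq_J:
 assumes T: "subgroup T G" "J\<subseteq>T" "T\<subseteq>Syl" shows "thompson (grp_on G T) = J"
proof -
 interpret TG: group "G\<lparr>carrier := T\<rparr>" using T subgroup_imp_group by blast
 have sub: "subgroup K (grp_on G T) \<longleftrightarrow> subgroup K G \<and> K\<subseteq>T" for K
 proof
  assume a: "subgroup K (grp_on G T)"
  show "subgroup K G \<and> K\<subseteq>T" using incl_subgroup[OF T(1) a] subgroup.subset[OF a] by simp
 next
  assume "subgroup K G \<and> K\<subseteq>T"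
  then show "subgroup K (grp_on G T)" using subgroup_incl[OF _ T(1)] by blast
 qed
 have comm: "comm_group (grp_on G K) \<longleftrightarrow> (\<forall>u\<in>K. \<forall>v\<in>K. u\<otimes>v = v\<otimes>u)" if K: "subgroup K G" for K
 proof
  assume "comm_group (grp_on G K)"
  then show "\<forall>u\<in>K. \<forall>v\<in>K. u\<otimes>v = v\<otimes>u" using comm_groupE(4)[of "G\<lparr>carrier := K\<rparr>"] by auto
 next
  assume "\<forall>u\<in>K. \<forall>v\<in>K. u\<otimes>v = v\<otimes>u"
  then show "comm_group (grp_on G K)"
   using group.group_comm_groupI[OF subgroup_imp_group[OF K]] by auto
 qed
 have uniq: "K = J" if K: "subgroup K G" "K\<subseteq>T" "\<forall>u\<in>K. \<forall>v\<in>K. u\<otimes>v = v\<otimes>u" "card J \<le> card K" for K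
  by (rule abelian_large_eq_J) (use K T J_card in auto)
 have "abelian_max_order (grp_on G T) = {J}"
 proof
  show "abelian_max_order (grp_on G T)\<subseteq>{J}"
  proof
   fix K assume K: "K\<in>abelian_max_order (grp_on G T)"
   then have K1: "subgroup K G" "K\<subseteq>T" "comm_group (grp_on G K)"
    using sub by (auto simp: abelian_max_order_def)
   have "card J \<le> card K" using K sub[of J] J_sub T(2) comm[OF J_sub] J_abelian by (auto simp: abelian_max_order_def)
   then show "K\<in>{J}" using uniq[OF K1(1,2)] comm[OF K1(1)] K1(3) by blast
  qed
  have "card K \<le> card J" if K: "subgroup K G" "K\<subseteq>T" "comm_group (grp_on G K)" for K
   using uniq[OF K(1,2)] comm[OF K(1)] K(3) by (metis nat_le_linear order_refl)
  then show "{J}\<subseteq>abelian_max_order (grp_on G T)"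
   using sub J_sub T(2) comm[OF J_sub] J_abelian by (auto simp: abelian_max_order_def)
 qed
 then have "thompson (grp_on G T) = generate G J"
  unfolding thompson_def using generate_consistent[OF T(2,1)] by simp
 also have "\<dots> = J" using generate_subgroup_incl[OF order_refl J_sub] by (auto intro: generate.incl)
 finally show ?thesis .
qed

lemma commutator_s:
 assumes "J\<subseteq>X" "X\<subseteq>L" shows "commutator_subgroup G X {s} = J"
proof
 show "commutator_subgroup G X {s}\<subseteq>J"
  unfolding commutator_subgroup_def
  by (rule generate_subgroup_incl[OF _ J_sub]) (use comm_s_J assms in blast)
 show "J\<subseteq>commutator_subgroup G X {s}"
 proof
  fix j assume j: "j\<in>J"
  have "[.j, s.]\<in>commutator_subgroup G X {s}"
   unfolding commutator_subgroup_def by (rule generate.incl) (use j assms in blast)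
  then show "j\<in>commutator_subgroup G X {s}" using comm_J_s[OF j] by simp
 qed
qed

lemma inverts_J: "inverts G s J" using J_inv by (simp add: inverts_def)

lemma S_norm_J: "g\<in>Syl ==> j\<in>J ==> j\<up>g\<in>J" using L_norm_J SL by blast

lemma S_in_cent_Z: "Syl\<subseteq>CG Z"
 by (rule set_mult_subset[OF centralizer_subgroup[OF P.Z_carrier] P.Q_cent_Z]) (use cent_Y in blast)

lemma S_norm_Q: "Syl\<subseteq>normalizing Q" using S_in_cent_Z P.cent_Z_normalizes by blast

lemma Z_fixed_S: assumes z: "z\<in>Z" and g: "g\<in>Syl" shows "z\<up>g = z"
 by (rule centralizer_conj_el[OF subsetD[OF S_in_cent_Z g] z P.Zc[OF z]])

lemma ZZ2: "Z\<subseteq>J\<inter>Q" using ZY YJ P.ZQ by blast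

lemma Z2_central_mod_Z:
 assumes c: "c\<in>Syl" shows "(\<forall>g\<in>Syl. [.c, g.]\<in>Z) \<longleftrightarrow> c\<in>J\<inter>Q"
proof
 assume cJ: "c\<in>J\<inter>Q"
 show "\<forall>g\<in>Syl. [.c, g.]\<in>Z"
 proof
  fix g assume "g\<in>Syl"
  then obtain q j where qj: "q\<in>Q" "j\<in>J" "g = q\<otimes>j" using S_ex by blast
  have cc: "c\<in>carrier G" "q\<in>carrier G" "j\<in>carrier G" using cJ qj by auto
  have "[.c, j.] = \<one>" using J_abelian comm_one_iff cc cJ qj by simp
  moreover have "[.c, q.]\<in>Z" using P.Q_comm cJ qj by blast
  ultimately show "[.c, g.]\<in>Z"
   unfolding qj(3) using comm_mult_right[OF cc] Z_fixed_S[of "[.c, q.]" j] JS qj cc by auto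
 qed
next
 assume all: "\<forall>g\<in>Syl. [.c, g.]\<in>Z"
 have cc: "c\<in>carrier G" using c by simp
 have all': "[.g, c.]\<in>Z" if "g\<in>Syl" for g
  using all that inv_comm_swap[of c g] P.Zi cc by (metis Sc)
 have nZ: "Syl\<subseteq>normalizing Z"
 proof
  fix g assume g: "g\<in>Syl"
  show "g\<in>normalizing Z"
   by (rule normalizingI[OF P.finZ P.Z_carrier Sc[OF g]]) (simp only: Z_fixed_S[OF _ g])
 qed
 note Hs = comm_set_subgroup[OF P.Z_sub]
 have cW: "c\<in>W"
 proof -
  obtain q j where qj: "q\<in>Q" "j\<in>J" "c = q\<otimes>j" using S_ex c by blast
  have "q\<in>A"
  proof (rule ccontr)
   assume qA: "q~:A"
   have "d\<in>A" if d: "d\<in>J" for d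
   proof -
    have dc: "d\<in>carrier G" "q\<in>carrier G" "j\<in>carrier G" using d qj by auto
    have jd: "[.d, j.] = \<one>" using J_abelian comm_one_iff dc d qj by simp
    have k: "[.d, q.]\<in>J" using Jm[OF Ji[OF d] S_norm_J[OF _ d]] comm_eq_conj[OF dc(1,2)] qj QS by auto
    have "[.d, q.]\<up>j = [.d, q.]" using conj_el_fixed J_abelian k qj by simp
    then have "[.d, c.] = [.d, q.]" unfolding qj(3) using comm_mult_right[OF dc] jd dc by simp
    then have "[.d, q.]\<in>E" using all'[of d] d JS ZY YE by auto
    then show ?thesis using W_commuting_Q[OF qj(1) qA] d JW by blast
   qed
   then show False using J_not_A by blast
  qed
  then show ?thesis using qj AW JW Wm by blast
 qed
 have cJ: "c\<in>J"
 proof (rule ccontr)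
  assume cJ: "c~:J"
  have cos: "\<exists>j\<in>J. w = j \<or> w = j\<otimes>c \<or> w = j\<otimes>(c\<otimes>c)" if "w\<in>W" for w
   by (rule index_3_cosets[OF W_sub finW J_sub JW]) (use W_card J_card cW cJ that W_cube[of c] cube_eq[of c] J1 in auto)
  have gen: "[.b, w.]\<in>Z" if b: "b\<in>carrier G" "\<And>j. j\<in>J ==> [.b, j.]\<in>Z" "[.b, c.]\<in>Z" and w: "w\<in>W" for b w
  proof -
   let ?H = "{g\<in>normalizing Z. [.b, g.]\<in>Z}"
   have cH: "c\<in>?H" using b nZ c by blast
   have ccH: "c\<otimes>c\<in>?H" by (rule subgroup.m_closed[OF Hs[OF b(1)] cH cH])
   obtain j where j: "j\<in>J" "w = j \<or> w = j\<otimes>c \<or> w = j\<otimes>(c\<otimes>c)" using cos[OF w] by blast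
   have "j\<in>?H" using j b nZ JS by blast
   then have "w\<in>?H" using j(2) subgroup.m_closed[OF Hs[OF b(1)] _ cH] subgroup.m_closed[OF Hs[OF b(1)] _ ccH] by blast
   then show ?thesis by blast
  qed
  have Jw: "[.j, w.]\<in>Z" if "j\<in>J" "w\<in>W" for j w
  proof (rule gen[OF _ _ _ that(2)])
   fix i assume "i\<in>J"
   then have "[.j, i.] = \<one>" using J_abelian comm_one_iff that by simp
   then show "[.j, i.]\<in>Z" using P.Z1 by simp
  qed (use that all' JS in auto)
  have "[.v, w.]\<in>Z" if v: "v\<in>W" and w: "w\<in>W" for v w
  proof (rule gen[OF _ _ _ w])
   show "v\<in>carrier G" using v by simp
   fix i assume i: "i\<in>J"
   show "[.v, i.]\<in>Z" using P.Zi[OF Jw[OF i v]] inv_comm_swap[of i v] i v by simp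
  next
   show "[.v, c.]\<in>Z" using all' v WS by blast
  qed
  then have "[.u, v.] = \<one>" if "u\<in>B" "v\<in>B" for u v
   using R.Q_comm[of u v] that BW dis by blast
  then show False using B_nonabelian by blast
 qed
 have "c\<in>Q"
 proof (rule ccontr)
  assume cQ: "c~:Q"
  obtain q where q: "q\<in>Q" "q~:A" by (rule Q_not_A)
  have qc: "q\<in>carrier G" using q by simp
  obtain b where b: "b\<in>B" "b~:E"
  proof -
   have "B~=E" using B_card E_card by auto
   then show ?thesis using that EB by blast
  qed
  obtain a where a: "a\<in>A" "b = a \<or> b = a\<otimes>c \<or> b = a\<otimes>(c\<otimes>c)"
   using index_3_cosets[OF W_sub finW A_sub AW _ cW, of b] W_card A_card cQ W_cube[OF cW] cube_eq[OF cc] A1 b BW by auto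
  let ?H = "{g\<in>normalizing Z. [.q, g.]\<in>Z}"
  have cH: "c\<in>?H" using all' q QS nZ c by blast
  have ccH: "c\<otimes>c\<in>?H" by (rule subgroup.m_closed[OF Hs[OF qc] cH cH])
  have "a\<in>?H" using a P.Q_comm[of q a] q nZ QS by blast
  then have "b\<in>?H" using a(2) subgroup.m_closed[OF Hs[OF qc] _ cH] subgroup.m_closed[OF Hs[OF qc] _ ccH] by blast
  then have "[.q, b.]\<in>Z" by blast
  then have "[.b, q.]\<in>Z" using P.Zi inv_comm_swap[of q b] q b by fastforce
  then show False using B_nontrivial_mod_E[OF q b(1)] b ZY YE by blast
 qed
 then show "c\<in>J\<inter>Q" using cJ by blast
qed

lemma Z_normal_S: "Z \<lhd> G\<lparr>carrier := Syl\<rparr>"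
 by (rule normal_onI[OF S_sub P.Z_sub]) (use P.ZQ QS Z_fixed_S in auto)

lemma Z2_mod_Z_centre: "carrier (G\<lparr>carrier := J\<inter>Q\<rparr> Mod Z) = centre (G\<lparr>carrier := Syl\<rparr> Mod Z)"
proof -
 let ?M = "G\<lparr>carrier := Syl\<rparr> Mod Z"
 have central: "(Z #> d)\<in>centre ?M \<longleftrightarrow> d\<in>J\<inter>Q" if d: "d\<in>Syl" for d
 proof -
  have "(Z #> d)\<in>centre ?M \<longleftrightarrow> (\<forall>g\<in>Syl. Z #> (d\<otimes>g) = Z #> (g\<otimes>d))"
   using d section_mult[OF S_sub Z_normal_S] unfolding centre_def centralizer_def section_carrier by auto
  also have "\<dots> \<longleftrightarrow> (\<forall>g\<in>Syl. [.inv d, inv g.]\<in>Z)"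
  proof -
   have "Z #> (d\<otimes>g) = Z #> (g\<otimes>d) \<longleftrightarrow> [.inv d, inv g.]\<in>Z" if g: "g\<in>Syl" for g
   proof -
    have "(d\<otimes>g)\<otimes>inv (g\<otimes>d) = [.inv d, inv g.]" using d g by (simp add: word_simps)
    then show ?thesis using rcos_eq_iff[OF P.Z_sub, of "d\<otimes>g" "g\<otimes>d"] d g by simp
   qed
   then show ?thesis by blast
  qed
  also have "\<dots> \<longleftrightarrow> (\<forall>g\<in>Syl. [.inv d, g.]\<in>Z)" using Si by (metis Sc inv_inv)
  also have "\<dots> \<longleftrightarrow> inv d\<in>J\<inter>Q" by (rule Z2_central_mod_Z[OF Si[OF d]])
  also have "\<dots> \<longleftrightarrow> d\<in>J\<inter>Q" using subgroup_inv_iff[OF Z2_sub] d by simp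
  finally show ?thesis .
 qed
 show ?thesis
 proof
  show "carrier (G\<lparr>carrier := J\<inter>Q\<rparr> Mod Z)\<subseteq>centre ?M"
   unfolding section_carrier using central JS by blast
  show "centre ?M\<subseteq>carrier (G\<lparr>carrier := J\<inter>Q\<rparr> Mod Z)"
  proof
   fix X assume X: "X\<in>centre ?M"
   then have "X\<in>carrier ?M" by (rule centre_carrier)
   then obtain d where "d\<in>Syl" "X = Z #> d" unfolding section_carrier by blast
   then show "X\<in>carrier (G\<lparr>carrier := J\<inter>Q\<rparr> Mod Z)" using central X unfolding section_carrier by blast
  qed
 qed
qed

lemma S_comm: assumes u: "u\<in>Syl" and v: "v\<in>Syl" shows "[.u, v.]\<in>J\<inter>Q"
proof -
 have Z2c: "J\<inter>Q\<subseteq>carrier G" by auto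
 have n: "Syl\<subseteq>normalizing (J\<inter>Q)"
 proof
  fix g assume g: "g\<in>Syl"
  show "g\<in>normalizing (J\<inter>Q)"
   by (rule normalizingI) (use g finJ S_norm_J S_norm_Q normalizing_conj in auto)
 qed
 have qj: "[.q, j.]\<in>J\<inter>Q" if q: "q\<in>Q" and j: "j\<in>J" for q j
 proof -
  have c: "q\<in>carrier G" "j\<in>carrier G" using that by simp_all
  have "[.q, j.]\<in>A" using comm_Q_C(1)[OF q] j JW by blast
  moreover have "[.q, j.] = inv (j\<up>q)\<otimes>j" using c by (simp add: word_simps)
  moreover have "inv (j\<up>q)\<otimes>j\<in>J" using S_norm_J[of q j] q QS j Ji Jm by blast
  ultimately show ?thesis by simp
 qed
 have jq: "[.j, q.]\<in>J\<inter>Q" if "q\<in>Q" "j\<in>J" for q j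
  using subgroup.m_inv_closed[OF Z2_sub qj[OF that]] inv_comm_swap[of q j] that by simp
 have jj: "[.i, j.]\<in>J\<inter>Q" if "i\<in>J" "j\<in>J" for i j
  using J_abelian[OF that] comm_one_iff[of i j] that subgroup.one_closed[OF Z2_sub] by simp
 have qq: "[.q, r.]\<in>J\<inter>Q" if "q\<in>Q" "r\<in>Q" for q r using P.Q_comm[OF that] ZZ2 by blast
 have 1: "[.b, g.]\<in>J\<inter>Q" if b: "b\<in>Q \<union> J" and g: "g\<in>Syl" for b g
 proof -
  have "b\<in>carrier G" using b by auto
  note H = comm_set_subgroup[OF Z2_sub this]
  have "Q<#>J\<subseteq>{g\<in>normalizing (J\<inter>Q). [.b, g.]\<in>J\<inter>Q}"
  proof (rule set_mult_subset[OF H])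
   show "Q\<subseteq>{g\<in>normalizing (J\<inter>Q). [.b, g.]\<in>J\<inter>Q}"
   proof
    fix r assume r: "r\<in>Q"
    have "[.b, r.]\<in>J\<inter>Q" using b by (rule UnE) (rule qq[OF _ r], assumption, rule jq[OF r], assumption)
    then show "r\<in>{g\<in>normalizing (J\<inter>Q). [.b, g.]\<in>J\<inter>Q}" using subsetD[OF n subsetD[OF QS r]] by simp
   qed
   show "J\<subseteq>{g\<in>normalizing (J\<inter>Q). [.b, g.]\<in>J\<inter>Q}"
   proof
    fix r assume r: "r\<in>J"
    have "[.b, r.]\<in>J\<inter>Q" using b by (rule UnE) (rule qj[OF _ r], assumption, rule jj[OF _ r], assumption)
    then show "r\<in>{g\<in>normalizing (J\<inter>Q). [.b, g.]\<in>J\<inter>Q}" using subsetD[OF n subsetD[OF JS r]] by simp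
   qed
  qed
  then show ?thesis using g S_QJ by blast
 qed
 note H = comm_set_subgroup[OF Z2_sub Sc[OF u]]
 have "[.u, b.]\<in>J\<inter>Q" if b: "b\<in>Q \<union> J" for b
 proof -
  have bc: "b\<in>carrier G" using b by auto
  show ?thesis using subgroup.m_inv_closed[OF Z2_sub 1[OF b u]] inv_comm_swap[OF bc Sc[OF u]] by simp
 qed
 then have "Q<#>J\<subseteq>{g\<in>normalizing (J\<inter>Q). [.u, g.]\<in>J\<inter>Q}"
  using n QS JS by (intro set_mult_subset[OF H]) blast+
 then show ?thesis using v S_QJ by blast
qed

lemma S_derived: "Y\<subseteq>derived G Syl" "derived G Syl\<subseteq>J\<inter>Q"
proof -
 show "Y\<subseteq>derived G Syl" using mono_derived[OF WS] W_derived by simp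
 show "derived G Syl\<subseteq>J\<inter>Q" unfolding derived_def
 proof (rule generate_subgroup_incl[OF _ Z2_sub], rule subsetI)
  fix t assume "t\<in>derived_set G Syl"
  then obtain u v where uv: "u\<in>Syl" "v\<in>Syl" and t: "t = u\<otimes>v\<otimes>inv u\<otimes>inv v" by blast
  have "u\<otimes>v\<otimes>inv u\<otimes>inv v = [.inv u, inv v.]" using uv by simp
  then show "t\<in>J\<inter>Q" unfolding t using S_comm[OF Si[OF uv(1)] Si[OF uv(2)]] by (simp only:)
 qed
qed

lemma J_fixed_card:
 assumes q: "q\<in>Q" "q~:A" shows "card {c\<in>J. c\<up>q = c} = 9"
proof -
 let ?C = "{c\<in>J. c\<up>q = c}"
 have qc: "q\<in>carrier G" using q by simp
 have CZ2: "?C\<subseteq>J\<inter>Q"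
 proof
  fix c assume c: "c\<in>?C"
  then have "[.c, q.] = \<one>" using comm_one_iff'[of c q] qc by simp
  then have "c\<in>A" using W_commuting_Q[OF q, of c] c JW E1 by auto
  then show "c\<in>J\<inter>Q" using c by blast
 qed
 have Ceq: "?C = (J\<inter>Q)\<inter>CG {q}"
  proof -
  have "c\<in>CG {q} \<longleftrightarrow> c\<up>q = c" if "c\<in>J" for c
   using conj_el_fixed[OF Jc[OF that] qc] centralizer_singletonI[OF Jc[OF that], of q] centralizer_singletonD[of c q] by blast
  then show ?thesis using CZ2 by blast
 qed
 have Cs: "subgroup ?C G" unfolding Ceq
  by (rule subgroups_Inter_pair[OF Z2_sub centralizer_subgroup]) (use qc in simp)
 have finC: "finite ?C" using finJ by simp
 have finZ2: "finite (J\<inter>Q)" using finJ by simp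
 have "card ((\<lambda>c. [.c, q.]) ` (J\<inter>Q)) * card ?C = card (J\<inter>Q)"
 proof (rule card_fibres[OF Z2_sub Cs CZ2 finZ2])
  fix u v assume u: "u\<in>J\<inter>Q" and v: "v\<in>J\<inter>Q"
  let ?w = "u\<otimes>inv v"
  have w: "?w\<in>J\<inter>Q" using u v subgroup.m_closed[OF Z2_sub] subgroup.m_inv_closed[OF Z2_sub] by blast
  have c: "u\<in>carrier G" "v\<in>carrier G" "?w\<in>carrier G" using u v by auto
  have "[.?w\<otimes>v, q.] = [.?w, q.]\<otimes>[.v, q.]" using P.comm_left w v q by blast
  moreover have "?w\<otimes>v = u" using c by (simp add: m_assoc)
  ultimately have "[.u, q.] = [.?w, q.]\<otimes>[.v, q.]" by simp
  then have "[.u, q.] = [.v, q.] \<longleftrightarrow> [.?w, q.] = \<one>"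
   using r_cancel_one[of "[.v, q.]" "[.?w, q.]"] c qc by simp
  then show "[.u, q.] = [.v, q.] \<longleftrightarrow> ?w\<in>?C" using comm_one_iff'[OF c(3) qc] w by simp
 qed
 moreover have le3: "card ((\<lambda>c. [.c, q.]) ` (J\<inter>Q)) \<le> 3"
  using card_mono[OF P.finZ, of "(\<lambda>c. [.c, q.]) ` (J\<inter>Q)"] P.Q_comm q P.Z_card by auto
 ultimately have "27 \<le> 3 * card ?C" using Z2_card mult_le_mono1[OF le3, of "card ?C"] by linarith
 then have ge: "card ?C \<ge> 9" by simp
 have "?C\<inter>Y\<subseteq>Z" using Y_commuting_Q[OF q] by blast
 then have "card (?C\<inter>Y) \<le> card Z" by (rule card_mono[OF P.finZ])
 then have c3: "card (?C\<inter>Y) \<le> 3" unfolding P.Z_card .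
 have c27: "card (?C<#>Y) \<le> 27"
  using card_mono[OF finZ2 set_mult_subset[OF Z2_sub CZ2]] YJ YQ Z2_card by auto
 moreover have "card (?C<#>Y) * card (?C\<inter>Y) = card ?C * 9"
  using card_set_mult_inter[OF Cs finC Y_sub finY] Y_card by simp
 ultimately have "card ?C * 9 \<le> 27 * 3" using mult_le_mono[OF c27 c3] by linarith
 then show ?thesis using ge by simp
qed

text \<open>\<open>T = J\<langle>q\<rangle>\<close> with \<open>q\<in>Q\<close>, so the centre is the
 centralizer of \<open>q\<close> in \<open>J\<close>.  It is counted directly if \<open>q\<notin>A\<close>;
 otherwise \<open>T = W\<close>.\<close>

lemma intermediate_centre:
 assumes T: "subgroup T G" "J \<subset> T" "T \<subset> Syl"
 shows "card (centre (grp_on G T)) = 9"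
proof -
 have finT: "finite T" using T finS finite_subset by blast
 have "card T dvd 729" using card_subgroup_dvd[OF S_sub T(1) _ finS] T S_card by auto
 then obtain i where i: "card T = 3 ^ i" "i \<le> 6" using divides_primepow_nat[of 3 "card T" 6] by auto
 have "81 < card T" "card T < 729" using psubset_card_mono[OF finT T(2)] psubset_card_mono[OF finS T(3)] J_card S_card by auto
 moreover have "i = 0 \<or> i = 1 \<or> i = 2 \<or> i = 3 \<or> i = 4 \<or> i = 5 \<or> i = 6" using i(2) by arith
 ultimately have T243: "card T = 243" using i(1) by auto
 obtain g where g: "g\<in>T" "g~:J" using T by blast
 have "g\<in>Syl" using g T by blast
 then obtain q j where qj: "q\<in>Q" "j\<in>J" "g = q\<otimes>j" using S_ex by blast
 have qc: "q\<in>carrier G" "j\<in>carrier G" using qj by auto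
 have qT: "q\<in>T" using subgroup_mult_cancel(2)[OF T(1) _ qc(1), of j] g qj T by blast
 have qJ: "q~:J" using g qj Jm by blast
 have cos: "\<exists>k\<in>J. t = k \<or> t = k\<otimes>h \<or> t = k\<otimes>(h\<otimes>h)" if h: "h\<in>T" "h~:J" and t: "t\<in>T" for h t
 proof (rule index_3_cosets[OF T(1) finT J_sub _ _ h _ t])
  show "J\<subseteq>T" "card T = 3 * card J" using T T243 J_card by auto
  have "h\<in>Syl" using h T by blast
  then obtain r k where rk: "r\<in>Q" "k\<in>J" "h = r\<otimes>k" using S_ex by blast
  have c: "r\<in>carrier G" "k\<in>carrier G" using rk by auto
  have "h\<otimes>(h\<otimes>h) = (r\<otimes>(r\<otimes>r))\<otimes>((k\<up>(r\<otimes>r))\<otimes>((k\<up>r)\<otimes>k))"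
   unfolding rk(3) using c by (simp add: word_simps)
  moreover have "r\<otimes>(r\<otimes>r) = \<one>" using P.Q_cube rk cube_eq c by metis
  moreover have "k\<up>(r\<otimes>r)\<in>J" "k\<up>r\<in>J" using S_norm_J rk QS P.Qm by blast+
  ultimately show "h\<otimes>(h\<otimes>h)\<in>J" using Jm rk by simp
 qed
 have centre_eq: "centre (grp_on G T) = {c\<in>T. \<forall>t\<in>T. c\<otimes>t = t\<otimes>c}"
  by (simp add: centre_def centralizer_def)
 have cen: "centre (grp_on G T) = {c\<in>J. c\<up>q = c}"
 proof
  show "centre (grp_on G T)\<subseteq>{c\<in>J. c\<up>q = c}"
  proof
   fix c assume "c\<in>centre (grp_on G T)"
   then have c: "c\<in>T" "\<And>t. t\<in>T ==> c\<otimes>t = t\<otimes>c" unfolding centre_eq by auto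
   have cc: "c\<in>carrier G" using c T subgroup_carrier by blast
   have "c\<in>J"
   proof (rule ccontr)
    assume cJ: "c~:J"
    have "u\<otimes>v = v\<otimes>u" if u: "u\<in>T" and v: "v\<in>T" for u v
    proof -
     have vc: "v\<in>carrier G" using v T subgroup_carrier by blast
     obtain k where k: "k\<in>J" "v = k \<or> v = k\<otimes>c \<or> v = k\<otimes>(c\<otimes>c)" using cos[OF c(1) cJ v] by blast
     obtain l where l: "l\<in>J" "u = l \<or> u = l\<otimes>c \<or> u = l\<otimes>(c\<otimes>c)" using cos[OF c(1) cJ u] by blast
     have cs: "subgroup (CG {k}) G" using k by (intro centralizer_subgroup) simp
     have "l\<in>CG {k}" by (rule centralizer_singletonI[OF Jc[OF l(1)] J_abelian[OF l(1) k(1)]])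
     moreover have ck: "c\<in>CG {k}" by (rule centralizer_singletonI) (use c(2)[of k] k T cc in blast)+
     ultimately have uk: "u\<in>CG {k}" using l(2) subgroup.m_closed[OF cs] by blast
     have uc: "u\<in>carrier G" using u T subgroup_carrier by blast
     have cs2: "subgroup (CG {u}) G" using uc by (intro centralizer_subgroup) simp
     have "k\<in>CG {u}" by (rule centralizer_singletonI[OF Jc[OF k(1)] centralizer_singletonD[OF uk, symmetric]])
     moreover have "c\<in>CG {u}" by (rule centralizer_singletonI) (use c(2)[OF u] cc in blast)+
     ultimately have "v\<in>CG {u}" using k(2) subgroup.m_closed[OF cs2] by blast
     then show ?thesis using centralizer_singletonD[of v u] centralizer_singletonD[of v u, symmetric] by blast
    qed
    then have "T = J" by (intro abelian_large_eq_J) (use T T243 in auto)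
    then show False using T by blast
   qed
   moreover have "c\<up>q = c" using conj_el_fixed[OF cc qc(1)] c(2)[OF qT] by simp
   ultimately show "c\<in>{c\<in>J. c\<up>q = c}" by blast
  qed
  show "{c\<in>J. c\<up>q = c}\<subseteq>centre (grp_on G T)"
  proof
   fix c assume c: "c\<in>{c\<in>J. c\<up>q = c}"
   then have cc: "c\<in>carrier G" by simp
   have cs: "subgroup (CG {c}) G" using cc by (intro centralizer_subgroup) simp
   have qcen: "q\<in>CG {c}" by (rule centralizer_singletonI[OF qc(1)]) (use conj_el_fixed[OF cc qc(1)] c in simp)
   have "t\<in>CG {c}" if t: "t\<in>T" for t
   proof -
    obtain k where k: "k\<in>J" "t = k \<or> t = k\<otimes>q \<or> t = k\<otimes>(q\<otimes>q)" using cos[OF qT qJ t] by blast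
    have "k\<in>CG {c}" by (rule centralizer_singletonI) (use J_abelian[of k c] k c in auto)
    then show ?thesis using k(2) qcen subgroup.m_closed[OF cs] by blast
   qed
   then have "c\<otimes>t = t\<otimes>c" if "t\<in>T" for t using centralizer_singletonD[of t c] that by (metis (no_types))
   then show "c\<in>centre (grp_on G T)" unfolding centre_eq using c T by blast
  qed
 qed
 show ?thesis
 proof (cases "q\<in>A")
  case False then show ?thesis unfolding cen by (rule J_fixed_card[OF qj(1)])
 next
  case True
  then have qW: "q\<in>W" using AW by blast
  have "T\<subseteq>W"
  proof
   fix t assume "t\<in>T"
   then obtain k where k: "k\<in>J" "t = k \<or> t = k\<otimes>q \<or> t = k\<otimes>(q\<otimes>q)" using cos[OF qT qJ] by blast
   then show "t\<in>W" using JW qW Wm by blast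
  qed
  then have TW: "T = W" using T243 W_card finW by (intro card_subset_eq) auto
  have "centre (grp_on G T) = Y" unfolding TW by (rule W_centre_eq)
  then show ?thesis using Y_card by simp
 qed
qed

end

section \<open>The action modulo J\<close>

context extraspecial_pair_involution begin

lemma swap_involution: "extraspecial_pair_involution G Z1 Q1 Z Q (inv x) s"
proof (rule extraspecial_pair_involution.intro[OF swap], rule extraspecial_pair_involution_axioms.intro)
 have L: "generate G (Q1 \<union> Q) = L" by (simp add: Un_commute)
 show "s\<in>generate G (Q1 \<union> Q)" unfolding L by (rule s(1))
 show "s\<otimes>s = \<one>" "s~=\<one>" by (rule s(2), rule s(3))
 show "(generate G (Q1 \<union> Q)\<inter>CG (Z1<#>Z)) #> s
  \<in> centre (G\<lparr>carrier := generate G (Q1 \<union> Q)\<rparr> Mod (generate G (Q1 \<union> Q)\<inter>CG (Z1<#>Z)))"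
  unfolding L Y_swap by (rule s(4))
qed

lemma J_moved: obtains j g where "j\<in>J" "g\<in>Q" "[.j, g.]~:E"
proof -
 obtain a where a: "a\<in>Q" "a~:A" by (rule Q_not_A)
 obtain j where "j\<in>J" "j~:A" using J_not_A by blast
 then show ?thesis using that[OF _ a(1)] W_commuting_Q[OF a] JW by blast
qed

end

context extraspecial_pair_involution begin

interpretation S: extraspecial_pair_involution G Z1 Q1 Z Q "inv x" s by (rule swap_involution)

lemma J_swap: "S.J = J"
 unfolding S.J_def J_def by (simp add: Un_commute[of Q1 Q] Y_swap)

lemma J_Y_module: "natural_SL23_module G L W J Y"
proof (rule kernel_eq_W)
 have z2: "card (J\<inter>Q1) = 27" "subgroup (J\<inter>Q1) G" using S.Z2_card S.Z2_sub J_swap by auto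
 obtain j g where jg: "j\<in>J" "g\<in>Q" "[.j, g.]~:E" by (rule J_moved)
 obtain j' g' where jg': "j'\<in>J" "g'\<in>Q1" "[.j', g'.]~:E"
  using S.J_moved J_swap by (metis Int_commute)
 have Jcomm: "[.u, g.]\<in>J" if "u\<in>J" "g\<in>L" for u g
  using Jm[OF Ji[OF that(1)] L_norm_J[OF that(2,1)]] comm_eq_conj[of u g] that by simp
 show "natural_SL23_module G L (L\<inter>trivial_on J Y) J Y"
 proof (rule natural_module_recognition[where P = Q and R = Q1 and U = "J\<inter>Q" and V = "J\<inter>Q1"])
  show "L\<subseteq>normalizing J\<inter>normalizing Y" using L_normalizing_J L_norm_Y by blast
  show "\<exists>u\<in>J. \<exists>g\<in>Q. [.u, g.]~:Y" using jg YE by blast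
  show "\<exists>u\<in>J. \<exists>g\<in>Q1. [.u, g.]~:Y" using jg' YE by blast
  show "[.u, g.]\<in>J\<inter>Q" if "u\<in>J" "g\<in>Q" for u g
   using Jcomm[of u g] comm_Q_C(2)[of g u] that JW QL by blast
  show "[.u, g.]\<in>J\<inter>Q1" if "u\<in>J" "g\<in>Q1" for u g
   using Jcomm[of u g] comm_Q1_C(2)[of g u] that JW QL by blast
  show "[.u, g.]\<in>Y" if "u\<in>J\<inter>Q" "g\<in>Q" for u g using P.Q_comm[of u g] that ZY by blast
  show "[.u, g.]\<in>Y" if "u\<in>J\<inter>Q1" "g\<in>Q1" for u g using R.Q_comm[of u g] that Z1Y by blast
  show "u [^] (3::nat)\<in>Y" if "u\<in>J" for u unfolding W_cube[OF subsetD[OF JW that]] by (rule Y1)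
  show "[.u, v.]\<in>Y" if "u\<in>J" "v\<in>J" for u v using W_comm[of u v] that JW by blast
  show "card J = 9 * card Y" using J_card Y_card by simp
  show "(J\<inter>Q)\<inter>(J\<inter>Q1)\<subseteq>Y" using JE by blast
  show "Q \<union> Q1\<subseteq>carrier G" using P.Q_carrier R.Q_carrier by blast
  show "J\<inter>Q~=Y" using Z2_card Y_card by auto
  show "J\<inter>Q1~=Y" using z2 Y_card by auto
  show "Y\<subseteq>J\<inter>Q" "Y\<subseteq>J\<inter>Q1" using YJ YQ YQ1 by blast+
 qed (use J_sub finJ Y_sub Z2_sub z2 in auto)
 show "W\<subseteq>L\<inter>trivial_on J Y"
 proof
  fix w assume w: "w\<in>W"
  have "w\<in>trivial_on J Y"
   by (rule trivial_onI) (use w L_normalizing_J L_norm_Y W_comm JW in blast)+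
  then show "w\<in>L\<inter>trivial_on J Y" using w by blast
 qed
 show "subgroup (L\<inter>trivial_on J Y) G"
  by (rule subgroups_Inter_pair[OF L_sub trivial_on_subgroup[OF subgroup.subset[OF J_sub] Y_sub]])
qed blast

lemma E_split: "internal_direct_product G E Y (W\<inter>CG {s})"
proof -
 let ?C = "W\<inter>CG {s}"
 have Cs: "subgroup ?C G" by (rule subgroups_Inter_pair[OF W_sub centralizer_subgroup]) simp
 have memC: "w\<in>?C \<longleftrightarrow> w\<in>W \<and> w\<up>s = w" for w
 proof -
  have "w\<in>CG {s} \<longleftrightarrow> w\<up>s = w" if w: "w\<in>W"
   using conj_el_fixed[OF Wc[OF w] sc] centralizer_singletonI[OF Wc[OF w], of s] centralizer_singletonD[of w s] by blast
  then show ?thesis by blast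
 qed
 have CE: "?C\<subseteq>E"
 proof
  fix w assume w: "w\<in>?C"
  then have ww: "w\<otimes>w\<in>E" using s_inverts_W_mod_E[of w] memC by simp
  have wW: "w\<in>W" and wc: "w\<in>carrier G" using w by auto
  have "w\<otimes>(w\<otimes>w) = \<one>" using W_cube[OF wW] cube_eq[OF wc] by simp
  then have "(w\<otimes>w)\<otimes>(w\<otimes>w) = w" using wc by (simp add: m_assoc)
  then show "w\<in>E" using Em[OF ww ww] by simp
 qed
 have "E = Y<#>?C"
 proof
  show "Y<#>?C\<subseteq>E" by (rule set_mult_subset[OF E_sub YE CE])
  show "E\<subseteq>Y<#>?C"
  proof
   fix e assume e: "e\<in>E"
   let ?y = "[.e, s.]"
   have y: "?y\<in>Y" by (rule L_centralizes_E_mod_Y[OF e s(1)])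
   have ec: "e\<in>carrier G" and yc: "?y\<in>carrier G" using e by simp_all
   have eW: "e\<in>W" "?y\<in>W" using e EA AW y YA by blast+
   have es: "e\<up>s = e\<otimes>?y" using ec by (intro conj_el_eq_comm) auto
   let ?c = "e\<otimes>inv ?y"
   have "?c\<up>s = (e\<otimes>?y)\<otimes>inv (inv ?y)"
    using es s_inverts_Y[OF y] ec yc by (simp only: conj_el_mult conj_el_inv inv_closed sc)
   also have "\<dots> = e\<otimes>(?y\<otimes>?y)" using ec yc by (simp only: m_assoc inv_inv)
   also have "?y\<otimes>?y = inv ?y" using inv_equality[of "?y\<otimes>?y" ?y] Y_cube[OF y] m_assoc[OF yc yc yc] m_closed[OF yc yc] yc by simp
   finally have "?c\<up>s = ?c" .
   then have "?c\<in>?C" using memC Wm[OF eW(1) Wi[OF eW(2)]] by blast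
   moreover have "e = ?y\<otimes>?c"
   proof -
    have "?y\<otimes>(e\<otimes>inv ?y) = (?y\<otimes>e)\<otimes>inv ?y" using ec yc by (simp only: m_assoc inv_closed)
    also have "?y\<otimes>e = e\<otimes>?y" by (rule W_central_Y[OF eW(1) y])
    finally show ?thesis using ec yc by (simp only: m_assoc inv_closed r_inv r_one)
   qed
   ultimately show "e\<in>Y<#>?C" using y unfolding set_mult_def by blast
  qed
 qed
 moreover have "Y\<inter>?C = {\<one>}"
 proof -
  have "y = \<one>" if y: "y\<in>Y" "y\<in>?C" for y
  proof -
   have "inv y = y" using s_inverts_Y[OF y(1)] y memC by simp
   then have "y\<otimes>y = \<one>" using y by (metis Yc r_inv)
   then show ?thesis using Y_cube[OF y(1)] y by simp
  qed
  then show ?thesis using Y1 subgroup.one_closed[OF Cs] by blast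
 qed
 ultimately show ?thesis
  unfolding internal_direct_product_def using Y_sub Cs W_central_Y by blast
qed

lemma W_central_mod_J: assumes w: "w\<in>W" and g: "g\<in>L" shows "[.w, g.]\<in>J"
proof -
 obtain j e where je: "j\<in>J" "e\<in>E" "w = j\<otimes>e" using W_JE[OF w] by blast
 have c: "j\<in>carrier G" "e\<in>carrier G" "g\<in>carrier G" using je g by auto
 have "[.j, g.] = inv j\<otimes>(j\<up>g)" using comm_eq_conj c by simp
 then have "[.j, g.]\<in>J" using Jm[OF Ji[OF je(1)] L_norm_J[OF g je(1)]] by simp
 then have "[.j, g.]\<up>e\<in>J" using L_norm_J je EA QL by blast
 moreover have "[.e, g.]\<in>J" using L_centralizes_E_mod_Y[OF je(2) g] YJ by blast
 ultimately show ?thesis unfolding je(3) comm_mult_left[OF c] by (rule Jm)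
qed

lemma L_mod_J: "(G\<lparr>carrier := L\<rparr> Mod J) \<cong> (integer_mod_group 3 \<times>\<times> SL23)"
proof -
 let ?M = "G\<lparr>carrier := L\<rparr> Mod J" and ?N = "G\<lparr>carrier := L\<rparr> Mod W"
 interpret M: group ?M by (rule normal.factorgroup_is_group[OF J_normal])
 interpret N: group ?N by (rule normal.factorgroup_is_group[OF W_normal])
 have mult: "(J #> u) \<otimes>\<^bsub>?M\<^esub> (J #> v) = J #> (u\<otimes>v)" if "u\<in>L" "v\<in>L" for u v
  using section_mult[OF L_sub J_normal that] by simp
 have mem: "J #> u\<in>carrier ?M" if "u\<in>L" for u unfolding section_carrier using that by blast
 have JL: "J\<subseteq>L" using JW by blast
 have WL: "W\<subseteq>L" by blast
 have central: "(J #> w) \<otimes>\<^bsub>?M\<^esub> X = X \<otimes>\<^bsub>?M\<^esub> (J #> w)" if w: "w\<in>W" and X: "X\<in>carrier ?M" for w X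
 proof -
  obtain g where g: "g\<in>L" "X = J #> g" using X unfolding section_carrier by blast
  have "(w\<otimes>g)\<otimes>inv (g\<otimes>w) = [.inv w, inv g.]" using w g by (simp add: word_simps)
  moreover have "[.inv w, inv g.]\<in>J" by (rule W_central_mod_J[OF Wi[OF w] Li[OF g(1)]])
  ultimately have "J #> (w\<otimes>g) = J #> (g\<otimes>w)" using rcos_eq_iff[OF J_sub, of "w\<otimes>g" "g\<otimes>w"] w g by simp
  then show ?thesis using mult[of w g] mult[of g w] w g by simp
 qed
 \<comment> \<open>Correct one braid generator by the central error term, so that the relation holds modulo \<open>J\<close>.\<close>
 obtain a b where ab: "a\<in>Q" "a\<notin>A" "b\<in>Q1" "b\<notin>B" "(a\<otimes>b\<otimes>a)\<otimes>inv (b\<otimes>a\<otimes>b)\<in>B"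
  by (rule braid_pair)
 define c where "c = (a\<otimes>b\<otimes>a)\<otimes>inv (b\<otimes>a\<otimes>b)"
 define b' where "b' = c\<otimes>b"
 have cB: "c\<in>B" using ab by (simp add: c_def)
 have cW: "c\<in>W" using cB BW by blast
 have b'Q: "b'\<in>Q1" using cB ab R.Qm by (auto simp: b'_def)
 have b'B: "b'\<notin>B" using subgroup_mult_cancel(1)[OF B_sub cB, of b] ab by (simp add: b'_def)
 have LL: "a\<in>L" "b\<in>L" "c\<in>L" "b'\<in>L" using ab cW b'Q QL by blast+
 have cc: "a\<in>carrier G" "b\<in>carrier G" "c\<in>carrier G" "b'\<in>carrier G" using LL by simp_all
 have aba: "a\<otimes>b\<otimes>a = c\<otimes>(b\<otimes>a\<otimes>b)" using cc by (simp add: c_def m_assoc inv_mult_group)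
 have braid: "(a\<otimes>b'\<otimes>a)\<otimes>inv (b'\<otimes>a\<otimes>b')\<in>J"
 proof -
  let ?a = "J #> a" and ?b = "J #> b" and ?c = "J #> c"
  note mm = mem[OF LL(1)] mem[OF LL(2)] mem[OF LL(3)]
  note cen = central[OF cW]
  have 0: "?a \<otimes>\<^bsub>?M\<^esub> ?b \<otimes>\<^bsub>?M\<^esub> ?a = ?c \<otimes>\<^bsub>?M\<^esub> (?b \<otimes>\<^bsub>?M\<^esub> ?a \<otimes>\<^bsub>?M\<^esub> ?b)"
   using aba mult LL Lm by simp
  have "?a \<otimes>\<^bsub>?M\<^esub> (?c \<otimes>\<^bsub>?M\<^esub> ?b) \<otimes>\<^bsub>?M\<^esub> ?a = (?a \<otimes>\<^bsub>?M\<^esub> ?c) \<otimes>\<^bsub>?M\<^esub> ?b \<otimes>\<^bsub>?M\<^esub> ?a"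
   using mm by (simp only: M.m_assoc M.m_closed)
  also have "?a \<otimes>\<^bsub>?M\<^esub> ?c = ?c \<otimes>\<^bsub>?M\<^esub> ?a" by (rule cen[OF mm(1), symmetric])
  also have "(?c \<otimes>\<^bsub>?M\<^esub> ?a) \<otimes>\<^bsub>?M\<^esub> ?b \<otimes>\<^bsub>?M\<^esub> ?a = ?c \<otimes>\<^bsub>?M\<^esub> (?a \<otimes>\<^bsub>?M\<^esub> ?b \<otimes>\<^bsub>?M\<^esub> ?a)"
   using mm by (simp only: M.m_assoc M.m_closed)
  also have "\<dots> = ?c \<otimes>\<^bsub>?M\<^esub> (?c \<otimes>\<^bsub>?M\<^esub> ((?b \<otimes>\<^bsub>?M\<^esub> ?a) \<otimes>\<^bsub>?M\<^esub> ?b))" unfolding 0 ..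
  also have "\<dots> = ?c \<otimes>\<^bsub>?M\<^esub> ((?c \<otimes>\<^bsub>?M\<^esub> (?b \<otimes>\<^bsub>?M\<^esub> ?a)) \<otimes>\<^bsub>?M\<^esub> ?b)"
   using mm by (simp only: M.m_assoc M.m_closed)
  also have "?c \<otimes>\<^bsub>?M\<^esub> (?b \<otimes>\<^bsub>?M\<^esub> ?a) = (?b \<otimes>\<^bsub>?M\<^esub> ?a) \<otimes>\<^bsub>?M\<^esub> ?c" by (rule cen[OF M.m_closed[OF mm(2,1)]])
  also have "?c \<otimes>\<^bsub>?M\<^esub> (((?b \<otimes>\<^bsub>?M\<^esub> ?a) \<otimes>\<^bsub>?M\<^esub> ?c) \<otimes>\<^bsub>?M\<^esub> ?b) = (?c \<otimes>\<^bsub>?M\<^esub> ?b) \<otimes>\<^bsub>?M\<^esub> ?a \<otimes>\<^bsub>?M\<^esub> (?c \<otimes>\<^bsub>?M\<^esub> ?b)"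
   using mm by (simp only: M.m_assoc M.m_closed)
  finally have "J #> (a\<otimes>b'\<otimes>a) = J #> (b'\<otimes>a\<otimes>b')"
   using mult LL Lm by (simp add: b'_def)
  then show ?thesis using rcos_eq_iff[OF J_sub, of "a\<otimes>b'\<otimes>a" "b'\<otimes>a\<otimes>b'"] cc by simp
 qed
 let ?K = "generate ?M {J #> a, J #> b'}"
 have K24: "card ?K \<le> 24"
  by (rule braid_quotient_bound[OF L_sub finL J_normal LL(1) _ LL(4) _ braid])
   (use ab b'Q P.Q_cube R.Q_cube J1 in auto)
 have Ksub: "subgroup ?K ?M" by (rule M.generate_is_subgroup) (use mem LL in auto)
 interpret KG: group "?M\<lparr>carrier := ?K\<rparr>" by (rule M.subgroup_imp_group[OF Ksub])
 have finM: "finite (carrier ?M)" unfolding section_carrier using finL by simp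
 have KM: "?K\<subseteq>carrier ?M" by (rule subgroup.subset[OF Ksub])
 have finK: "finite ?K" using KM finM finite_subset by blast
 obtain \<phi> where \<phi>: "\<phi>\<in>iso ?N SL23" using L_mod_W_iso by blast
 have hom\<phi>: "\<phi>\<in>hom ?N SL23" and bij\<phi>: "bij_betw \<phi> (carrier ?N) (carrier SL23)" using \<phi> by (auto simp: iso_def)
 define \<rho> where "\<rho> X = W<#>X" for X
 have \<rho>: "\<rho> (J #> g) = W #> g" if "g\<in>L" for g
 proof -
  have WJ: "W<#>J = W"
   using set_mult_subset[OF W_sub order_refl JW] set_mult_left[OF J_sub W_carrier] by blast
  have "W<#>(J #> g) = (W<#>J) #> g"
   using setmult_rcos_assoc[of W J g] W_carrier subgroup.subset[OF J_sub] that by simp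
  then show ?thesis unfolding \<rho>_def WJ .
 qed
 have hom\<rho>: "\<rho>\<in>hom ?M ?N"
 proof (rule homI)
  fix X assume "X\<in>carrier ?M"
  then obtain g where g: "g\<in>L" "X = J #> g" unfolding section_carrier by blast
  then show "\<rho> X\<in>carrier ?N" using \<rho> unfolding section_carrier by blast
  fix X' assume "X'\<in>carrier ?M"
  then obtain g' where g': "g'\<in>L" "X' = J #> g'" unfolding section_carrier by blast
  show "\<rho> (X \<otimes>\<^bsub>?M\<^esub> X') = \<rho> X \<otimes>\<^bsub>?N\<^esub> \<rho> X'"
   using g g' mult[of g g'] \<rho> Lm section_mult[OF L_sub W_normal g(1) g'(1)] by simp
 qed
 interpret X: group_hom ?M ?N \<rho>
  unfolding group_hom_def group_hom_axioms_def using hom\<rho> M.is_group N.is_group by blast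
 define \<theta> where "\<theta> = \<phi> \<circ> \<rho>"
 have hom\<theta>: "\<theta>\<in>hom ?M SL23" unfolding \<theta>_def using hom\<rho> hom\<phi> by (rule Group.hom_compose)
 have onto: "carrier ?N\<subseteq>\<rho> ` ?K"
 proof
  fix X assume "X\<in>carrier ?N"
  then obtain g where g: "g\<in>L" "X = W #> g" unfolding section_carrier by blast
  have "W #> g\<in>\<rho> ` ?K"
  proof (rule cosets_generated[OF W_normal ab(1,2) b'Q b'B])
   show "subgroup (\<rho> ` ?K) ?N" by (rule X.subgroup_img_is_subgroup[OF Ksub])
   have "J #> a\<in>?K" "J #> b'\<in>?K" by (auto intro: generate.incl)
   then show "W #> a\<in>\<rho> ` ?K" "W #> b'\<in>\<rho> ` ?K" using \<rho>[OF LL(1)] \<rho>[OF LL(4)] by (metis imageI)+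
   fix w assume "w\<in>N"
   then have "W #> w = \<one>\<^bsub>?N\<^esub>" using rcos_eq_self_iff[OF W_sub] W_eq_N by simp
   also have "\<dots> = \<rho> \<one>\<^bsub>?M\<^esub>" by (rule X.hom_one[symmetric])
   finally show "W #> w\<in>\<rho> ` ?K" using subgroup.one_closed[OF Ksub] by blast
  qed (rule g(1))
  then show "X\<in>\<rho> ` ?K" using g by simp
 qed
 have surj: "\<theta> ` ?K = carrier SL23"
 proof
  show "\<theta> ` ?K\<subseteq>carrier SL23" using hom\<theta> KM by (meson hom_carrier image_mono order_trans)
  show "carrier SL23\<subseteq>\<theta> ` ?K"
   unfolding bij_betw_imp_surj_on[OF bij\<phi>, symmetric] \<theta>_def image_comp[symmetric] by (rule image_mono[OF onto])
 qed
 have c24: "card (carrier SL23) = 24" using order_SL23 by (simp add: order_def)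
 have K24': "card ?K = 24" using card_image_le[OF finK, of \<theta>] surj K24 c24 by simp
 have inj: "inj_on \<theta> ?K" by (rule eq_card_imp_inj_on[OF finK]) (simp only: surj c24 K24')
 have "\<theta>\<in>hom (?M\<lparr>carrier := ?K\<rparr>) SL23"
 proof (rule homI)
  fix X X' assume "X\<in>carrier (?M\<lparr>carrier := ?K\<rparr>)" "X'\<in>carrier (?M\<lparr>carrier := ?K\<rparr>)"
  then have K: "X\<in>?K" "X'\<in>?K" by simp_all
  show "\<theta> X\<in>carrier SL23" by (rule hom_in_carrier[OF hom\<theta> subsetD[OF KM K(1)]])
  show "\<theta> (X \<otimes>\<^bsub>?M\<lparr>carrier := ?K\<rparr>\<^esub> X') = \<theta> X \<otimes>\<^bsub>SL23\<^esub> \<theta> X'"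
   using hom_mult[OF hom\<theta> subsetD[OF KM K(1)] subsetD[OF KM K(2)]] by simp
 qed
 then have "\<theta>\<in>iso (?M\<lparr>carrier := ?K\<rparr>) SL23" unfolding iso_def bij_betw_def using surj inj by simp
 then have iso: "inv_into ?K \<theta>\<in>iso SL23 (?M\<lparr>carrier := ?K\<rparr>)"
  using KG.iso_set_sym by fastforce
 define \<kappa> where "\<kappa> = inv_into ?K \<theta>"
 have \<kappa>K: "\<kappa> C\<in>?K" if "C\<in>carrier SL23" for C
  unfolding \<kappa>_def by (rule inv_into_into) (use surj that in blast)
 have \<kappa>m: "\<kappa> (C ** D) = \<kappa> C \<otimes>\<^bsub>?M\<^esub> \<kappa> D" if "C\<in>carrier SL23" "D\<in>carrier SL23" for C D
  using iso that unfolding iso_def hom_def \<kappa>_def[symmetric] by auto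
 have \<kappa>\<theta>: "\<theta> (\<kappa> C) = C" if "C\<in>carrier SL23" for C
  unfolding \<kappa>_def by (rule f_inv_into_f) (use surj that in blast)
 \<comment> \<open>The other factor is generated by any element of \<open>W/J\<close>.\<close>
 obtain w where w: "w\<in>W" "w\<notin>J"
 proof -
  have "J\<noteq>W" using J_card W_card by auto
  then show ?thesis using that JW by blast
 qed
 let ?w = "J #> w"
 have wM: "?w\<in>carrier ?M" using mem w by blast
 have w3: "?w [^]\<^bsub>?M\<^esub> (3::nat) = \<one>\<^bsub>?M\<^esub>"
 proof -
  have "?w [^]\<^bsub>?M\<^esub> (3::nat) = ?w \<otimes>\<^bsub>?M\<^esub> (?w \<otimes>\<^bsub>?M\<^esub> ?w)" by (rule M.cube_eq[OF wM])
  also have "\<dots> = J #> (w\<otimes>(w\<otimes>w))" using mult w Lm by simp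
  also have "w\<otimes>(w\<otimes>w) = \<one>" using W_cube[OF w(1)] cube_eq[of w] w by simp
  finally show ?thesis using subgroup.subset[OF J_sub] by simp
 qed
 have w1: "?w\<noteq>\<one>\<^bsub>?M\<^esub>" using rcos_eq_self_iff[OF J_sub, of w] w by simp
 have \<theta>w: "\<theta> ?w = mat 1"
 proof -
  have "\<rho> ?w = \<one>\<^bsub>?N\<^esub>" using \<rho>[of w] w rcos_eq_self_iff[OF W_sub, of w] by simp
  then show ?thesis unfolding \<theta>_def using hom_one[OF hom\<phi> N.is_group SL23_group] by simp
 qed
 define \<Psi> where "\<Psi> = (\<lambda>(i::int, C). (?w [^]\<^bsub>?M\<^esub> nat i) \<otimes>\<^bsub>?M\<^esub> \<kappa> C)"
 let ?D = "integer_mod_group 3 \<times>\<times> SL23"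
 have Dg: "group ?D" using DirProd_group[OF group_integer_mod_group SL23_group] .
 have carD: "carrier ?D = {0..<3} \<times> carrier SL23" by (simp add: carrier_integer_mod_group)
 have wpc: "?w [^]\<^bsub>?M\<^esub> (n::nat)\<in>carrier ?M" for n using wM by simp
 have wp: "(?w [^]\<^bsub>?M\<^esub> (n::nat)) \<otimes>\<^bsub>?M\<^esub> X = X \<otimes>\<^bsub>?M\<^esub> (?w [^]\<^bsub>?M\<^esub> n)" if X: "X\<in>carrier ?M" for n X
  using M.group_commutes_pow[OF central[OF w(1) X] wM X] .
 have hom\<Psi>: "\<Psi>\<in>hom ?D ?M"
 proof (rule homI)
  fix p assume p: "p\<in>carrier ?D"
  obtain i C where pi: "p = (i, C)" by fastforce
  have C: "C\<in>carrier SL23" and i: "0 \<le> i" "i < 3" using p[unfolded pi carD] by (simp_all only: mem_Sigma_iff atLeastLessThan_iff)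
  have \<kappa>C: "\<kappa> C\<in>carrier ?M" using \<kappa>K[OF C] KM by blast
  show "\<Psi> p\<in>carrier ?M" unfolding pi \<Psi>_def prod.case by (rule M.m_closed[OF wpc \<kappa>C])
  fix p' assume p': "p'\<in>carrier ?D"
  obtain i' C' where pi': "p' = (i', C')" by fastforce
  have C': "C'\<in>carrier SL23" and i': "0 \<le> i'" "i' < 3" using p'[unfolded pi' carD] by (simp_all only: mem_Sigma_iff atLeastLessThan_iff)
  have \<kappa>C': "\<kappa> C'\<in>carrier ?M" using \<kappa>K[OF C'] KM by blast
  have n: "nat ((i + i') mod 3) = (nat i + nat i') mod 3" using i i' by (simp add: nat_mod_distrib nat_add_distrib)
  have "\<Psi> (p \<otimes>\<^bsub>?D\<^esub> p') = (?w [^]\<^bsub>?M\<^esub> ((nat i + nat i') mod 3)) \<otimes>\<^bsub>?M\<^esub> \<kappa> (C ** C')"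
   unfolding pi pi' \<Psi>_def by (simp add: n)
  also have "\<dots> = (?w [^]\<^bsub>?M\<^esub> (nat i + nat i')) \<otimes>\<^bsub>?M\<^esub> (\<kappa> C \<otimes>\<^bsub>?M\<^esub> \<kappa> C')"
   unfolding M.pow_mod_3[OF wM w3, of "nat i + nat i'", symmetric] \<kappa>m[OF C C'] ..
  also have "\<dots> = (?w [^]\<^bsub>?M\<^esub> nat i) \<otimes>\<^bsub>?M\<^esub> ((?w [^]\<^bsub>?M\<^esub> nat i') \<otimes>\<^bsub>?M\<^esub> \<kappa> C) \<otimes>\<^bsub>?M\<^esub> \<kappa> C'"
   unfolding M.nat_pow_mult[OF wM, symmetric] using wpc \<kappa>C \<kappa>C' by (simp only: M.m_assoc M.m_closed)
  also have "(?w [^]\<^bsub>?M\<^esub> nat i') \<otimes>\<^bsub>?M\<^esub> \<kappa> C = \<kappa> C \<otimes>\<^bsub>?M\<^esub> (?w [^]\<^bsub>?M\<^esub> nat i')" by (rule wp[OF \<kappa>C])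
  also have "(?w [^]\<^bsub>?M\<^esub> nat i) \<otimes>\<^bsub>?M\<^esub> (\<kappa> C \<otimes>\<^bsub>?M\<^esub> (?w [^]\<^bsub>?M\<^esub> nat i')) \<otimes>\<^bsub>?M\<^esub> \<kappa> C' = \<Psi> p \<otimes>\<^bsub>?M\<^esub> \<Psi> p'"
   unfolding pi pi' \<Psi>_def prod.case using wpc \<kappa>C \<kappa>C' by (simp only: M.m_assoc M.m_closed)
  finally show "\<Psi> (p \<otimes>\<^bsub>?D\<^esub> p') = \<Psi> p \<otimes>\<^bsub>?M\<^esub> \<Psi> p'" .
 qed
 interpret PH: group_hom ?D ?M \<Psi>
  unfolding group_hom_def group_hom_axioms_def using hom\<Psi> Dg M.is_group by blast
 have \<theta>one: "\<theta> \<one>\<^bsub>?M\<^esub> = mat 1" using hom_one[OF hom\<theta> M.is_group SL23_group] by simp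
 have \<theta>wp: "\<theta> (?w [^]\<^bsub>?M\<^esub> (n::nat)) = mat 1" for n
 proof (induction n)
  case 0 show ?case using \<theta>one by simp
 next
  case (Suc n) then show ?case using hom_mult[OF hom\<theta> wpc[of n] wM] \<theta>w by simp
 qed
 have inj\<Psi>: "inj_on \<Psi> (carrier ?D)"
 proof -
  have "p = \<one>\<^bsub>?D\<^esub>" if p: "p\<in>carrier ?D" and e: "\<Psi> p = \<one>\<^bsub>?M\<^esub>" for p
  proof -
   obtain i C where pi: "p = (i, C)" by fastforce
   have C: "C\<in>carrier SL23" and i: "0 \<le> i" "i < 3" using p[unfolded pi carD] by (simp_all only: mem_Sigma_iff atLeastLessThan_iff)
   have \<kappa>C: "\<kappa> C\<in>carrier ?M" using \<kappa>K[OF C] KM by blast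
   have e': "(?w [^]\<^bsub>?M\<^esub> nat i) \<otimes>\<^bsub>?M\<^esub> \<kappa> C = \<one>\<^bsub>?M\<^esub>" using e by (simp add: pi \<Psi>_def)
   have "\<theta> ((?w [^]\<^bsub>?M\<^esub> nat i) \<otimes>\<^bsub>?M\<^esub> \<kappa> C) = C"
    using hom_mult[OF hom\<theta> wpc[of "nat i"] \<kappa>C] \<theta>wp[of "nat i"] \<kappa>\<theta>[OF C] by simp
   then have C1: "C = mat 1" using e' \<theta>one by simp
   have "\<kappa> C = \<one>\<^bsub>?M\<^esub>"
    using inj_onD[OF inj _ \<kappa>K[OF C] subgroup.one_closed[OF Ksub]] \<kappa>\<theta>[OF C] C1 \<theta>one by simp
   then have wi: "?w [^]\<^bsub>?M\<^esub> nat i = \<one>\<^bsub>?M\<^esub>" using e' M.r_one[OF wpc, of "nat i"] by (simp only:)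
   have "i = 0"
   proof (rule ccontr)
    assume "i\<noteq>0"
    then consider "nat i = 1" | "nat i = 2" using i by linarith
    then show False
    proof cases
     case 1 then show False using wi[unfolded 1] w1 M.nat_pow_eone[OF wM] by (simp only:)
    next
     case 2
     have "?w [^]\<^bsub>?M\<^esub> (2::nat) \<otimes>\<^bsub>?M\<^esub> ?w = ?w [^]\<^bsub>?M\<^esub> (3::nat)" by (simp add: numeral_2_eq_2 numeral_3_eq_3)
     then show False using wi[unfolded 2] w1 w3 M.l_one[OF wM] by (simp only:)
    qed
   qed
   then show ?thesis using C1 pi by simp
  qed
  then show ?thesis using PH.inj_iff_trivial_ker[unfolded kernel_def] PH.hom_one PH.G.one_closed by blast
 qed
 have cardD: "card (carrier ?D) = 72" unfolding carD by (simp add: card_cartesian_product c24[simplified])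
 have cardM: "card (carrier ?M) = 72"
 proof -
  have "order ?M * card J = card L" by (rule section_order[OF L_sub finL J_sub JL])
  then show ?thesis using J_card card_L_W W_card by (simp add: order_def)
 qed
 have "\<Psi> ` carrier ?D = carrier ?M"
  by (rule card_subset_eq[OF finM]) (use PH.hom_closed card_image[OF inj\<Psi>] cardD cardM in auto)
 then have "\<Psi>\<in>iso ?D ?M" using hom\<Psi> inj\<Psi> by (simp add: iso_def bij_betw_def)
 then have "?D \<cong> ?M" by (auto simp: is_iso_def)
 then show ?thesis by (rule group.iso_sym[OF Dg])
qed

end

section \<open>Coprime action\<close>

context group begin

text \<open>\<open>R'\<close> permutes the cosets of \<open>R\<close> by right multiplication.  Their number is
 prime to \<open>q\<close>, and a fixed coset \<open>Rn\<close> gives \<open>R' \<subseteq>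
 R\<^sup>n\<close>.\<close>

lemma sylow_conjugate:
 assumes N: "subgroup N G" "finite N" and q: "prime q" and R: "subgroup R G" "R\<subseteq>N" "card R = q ^ k"
  and m: "\<not> q dvd card N div q ^ k" and R': "subgroup R' G" "R'\<subseteq>N" "card R' = q ^ k"
 shows "\<exists>n\<in>N. R' = R\<Up>n"
proof -
 have Nc: "n\<in>carrier G" if "n\<in>N" for n using N that subgroup_carrier by blast
 have Rc: "R\<subseteq>carrier G" by (rule subgroup.subset[OF R(1)])
 note Nm = subgroup.m_closed[OF N(1)]
 let ?X = "(\<lambda>n. R #> n) ` N"
 have cX: "card ?X * card R = card N"
  by (rule card_fibres[OF N(1) R(1,2) N(2)]) (use rcos_eq_iff[OF R(1)] Nc in blast)
 have q0: "q ^ k > 0" using q prime_gt_0_nat by simp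
 have "card ?X = card N div q ^ k" using cX R(3) q0 by (metis nonzero_mult_div_cancel_right less_numeral_extra(3))
 then have nd: "card ?X mod q~=0" using m by (simp add: dvd_eq_mod_eq_0)
 have assoc: "(R #> n) #> g = R #> (n\<otimes>g)" if "n\<in>N" "g\<in>N" for n g
  using coset_mult_assoc[OF Rc Nc[OF that(1)] Nc[OF that(2)]] .
 have "card ?X mod q = card {X\<in>?X. \<forall>g\<in>R'. X #> g = X} mod q"
 proof (rule p_group_fixed_points[OF R'(1,3) q])
  show "finite ?X" using N by simp
  fix X assume "X\<in>?X"
  then obtain n where n: "n\<in>N" "X = R #> n" by blast
  show "X #> \<one> = X" using n assoc[OF n(1), of \<one>] subgroup.one_closed[OF N(1)] Nc by simp
  fix g assume g: "g\<in>R'"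
  then have gN: "g\<in>N" using R' by blast
  show "X #> g\<in>?X" using n assoc[OF n(1) gN] Nm[OF n(1) gN] by blast
  fix h assume "h\<in>R'"
  then have hN: "h\<in>N" using R' by blast
  show "X #> (g\<otimes>h) = (X #> g) #> h"
   using n assoc[OF n(1) gN] assoc[OF Nm[OF n(1) gN] hN] assoc[OF n(1) Nm[OF gN hN]] Nc gN hN by (simp add: m_assoc)
 qed
 then have "card {X\<in>?X. \<forall>g\<in>R'. X #> g = X}~=0" using nd by (metis mod_0)
 then have "{X\<in>?X. \<forall>g\<in>R'. X #> g = X}~={}" by (metis card.empty)
 then obtain X where X: "X\<in>?X" "\<forall>g\<in>R'. X #> g = X" by blast
 then obtain n where n: "n\<in>N" "X = R #> n" by blast
 have nc: "n\<in>carrier G" by (rule Nc[OF n(1)])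
 have sub: "R'\<subseteq>R\<Up>n"
 proof
  fix g assume g: "g\<in>R'"
  then have gN: "g\<in>N" using R' by blast
  have gc: "g\<in>carrier G" by (rule Nc[OF gN])
  have "R #> (n\<otimes>g) = R #> n" using X(2) n g assoc[OF n(1) gN] by simp
  then have "(n\<otimes>g)\<otimes>inv n\<in>R" using rcos_eq_iff[OF R(1), of "n\<otimes>g" n] nc gc by simp
  then have "g\<up>inv n\<in>R" using nc gc by (simp add: conj_el_def m_assoc)
  then show "g\<in>R\<Up>n" using mem_conj_set[OF Rc nc gc] by blast
 qed
 have "finite (R\<Up>n)" using R N finite_subset by (auto simp: conj_set_def)
 then have "R' = R\<Up>n" using sub card_conj_set[OF Rc nc] R R' by (intro card_subset_eq) auto
 then show ?thesis using n by blast
qed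

text \<open>\<open>Y\<close> permutes the Sylow \<open>q\<close>-subgroups of \<open>N\<close>, whose number
 divides \<open>|N|\<close> and is therefore prime to 3.\<close>

lemma invariant_sylow_exists:
 assumes N: "subgroup N G" "finite N" "coprime (card N) 3" and Y: "subgroup Y G" "card Y = 9" "Y\<subseteq>normalizing N"
  and q: "prime q"
 shows "\<exists>R. subgroup R G \<and> R\<subseteq>N \<and> card R = q ^ multiplicity q (card N) \<and> Y\<subseteq>normalizing R"
proof -
 let ?k = "multiplicity q (card N)"
 let ?X = "{R. subgroup R G \<and> R\<subseteq>N \<and> card R = q ^ ?k}"
 have Nc: "n\<in>carrier G" if "n\<in>N" for n using N that subgroup_carrier by blast
 have cN: "card N~=0" using N(2) subgroup.one_closed[OF N(1)] by auto
 have m: "\<not> q dvd card N div q ^ ?k" by (rule multiplicity_decompose) (use cN q not_prime_unit in auto)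
 interpret NG: group "G\<lparr>carrier := N\<rparr>" using N subgroup_imp_group by blast
 have "card N = q ^ ?k * (card N div q ^ ?k)" by (simp add: multiplicity_dvd)
 then obtain R where "subgroup R (grp_on G N)" "card R = q ^ ?k"
  using sylow_thm[OF q NG.is_group, of ?k] N by (auto simp: order_def)
 then have R: "subgroup R G" "R\<subseteq>N" "card R = q ^ ?k"
  using incl_subgroup[OF N(1)] subgroup.subset[of R "G\<lparr>carrier := N\<rparr>"] by auto
 have Rc: "R\<subseteq>carrier G" by (rule subgroup.subset[OF R(1)])
 have conjX: "R\<Up>n\<in>?X" if n: "n\<in>N" for n
 proof -
  have "R\<Up>n\<subseteq>N" unfolding conj_set_def using subgroup_conj[OF N(1) _ n] R by blast
  then show ?thesis using conj_set_subgroup[OF R(1) Nc[OF n]] card_conj_set[OF Rc Nc[OF n]] R by simp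
 qed
 have img: "(\<lambda>n. R\<Up>n) ` N = ?X"
 proof
  show "(\<lambda>n. R\<Up>n) ` N\<subseteq>?X" using conjX by blast
  show "?X\<subseteq>(\<lambda>n. R\<Up>n) ` N" using sylow_conjugate[OF N(1,2) q R m] by blast
 qed
 have nR: "subgroup (N\<inter>normalizing R) G" by (rule subgroups_Inter_pair[OF N(1) normalizing_subgroup[OF Rc]])
 have "card ((\<lambda>n. R\<Up>n) ` N) * card (N\<inter>normalizing R) = card N"
 proof (rule card_fibres[OF N(1) nR _ N(2)])
  fix n n' assume n: "n\<in>N" "n'\<in>N"
  have c: "n\<in>carrier G" "n'\<in>carrier G" using n Nc by blast+
  have "R\<Up>n = R\<Up>n' \<longleftrightarrow> R\<Up>(n\<otimes>inv n') = R"
  proof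
   assume "R\<Up>n = R\<Up>n'"
   then have "(R\<Up>n)\<Up>inv n' = R" using conj_set_cancel(1)[OF Rc c(2)] by simp
   then show "R\<Up>(n\<otimes>inv n') = R" using conj_set_conj[OF Rc c(1), of "inv n'"] c by simp
  next
   assume e: "R\<Up>(n\<otimes>inv n') = R"
   have "(R\<Up>(n\<otimes>inv n'))\<Up>n' = R\<Up>n"
    using conj_set_conj[OF Rc, of "n\<otimes>inv n'" n'] c by (simp add: m_assoc)
   then show "R\<Up>n = R\<Up>n'" using e by simp
  qed
  moreover have "n\<otimes>inv n'\<in>N" using n N(1) subgroup.m_closed subgroup.m_inv_closed by metis
  ultimately show "R\<Up>n = R\<Up>n' \<longleftrightarrow> n\<otimes>inv n'\<in>N\<inter>normalizing R"
   using c by (simp add: normalizing_def)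
 qed blast
 then have "card ?X * card (N\<inter>normalizing R) = card N" unfolding img .
 then have "card ?X dvd card N" by (rule dvdI[OF sym])
 then have "coprime (card ?X) 3" using N(3) coprime_divisors[of "card ?X" "card N" 3 3] by simp
 have X3: "card ?X mod 3~=0"
 proof
  assume "card ?X mod 3 = 0"
  then have "3 dvd card ?X" by (rule mod_0_imp_dvd)
  then have "is_unit (3::nat)" using coprime_common_divisor[OF \<open>coprime (card ?X) 3\<close>, of 3] by simp
  then show False by simp
 qed
 have finX: "finite ?X" using N(2) by (intro finite_subset[OF _ finite_Pow_iff[THEN iffD2, OF N(2)]]) blast
 have "card ?X mod 3 = card {R\<in>?X. \<forall>y\<in>Y. R\<Up>y = R} mod 3"
 proof (rule p_group_fixed_points[OF Y(1), where k = 2])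
  show "card Y = 3 ^ 2" using Y by simp
  show "finite ?X" by (rule finX)
  fix T assume T: "T\<in>?X"
  then have Tc: "T\<subseteq>carrier G" using subgroup.subset by blast
  show "T\<Up>\<one> = T" by (rule conj_set_one[OF Tc])
  fix y assume y: "y\<in>Y"
  have yc: "y\<in>carrier G" using Y y subgroup_carrier by blast
  have "T\<Up>y\<subseteq>N" unfolding conj_set_def using normalizing_conj[of y N] Y(3) y T by blast
  then show "T\<Up>y\<in>?X" using T conj_set_subgroup[of T y] card_conj_set[OF Tc yc] yc by simp
  fix y' assume "y'\<in>Y"
  then show "T\<Up>(y\<otimes>y') = (T\<Up>y)\<Up>y'" using conj_set_conj[OF Tc yc] Y subgroup_carrier by metis
 qed simp
 then have "card {R\<in>?X. \<forall>y\<in>Y. R\<Up>y = R}~=0" using X3 by (metis mod_0)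
 then have "{R\<in>?X. \<forall>y\<in>Y. R\<Up>y = R}~={}" by (metis card.empty)
 then obtain T where T: "T\<in>?X" "\<forall>y\<in>Y. T\<Up>y = T" by blast
 then have "Y\<subseteq>normalizing T" using Y(1) subgroup_carrier by (auto simp: normalizing_def)
 then show ?thesis using T by blast
qed

text \<open>A nontrivial \<open>q\<close>-group is not perfect: above a maximal proper normal subgroup \<open>K\<close> there is, by
 counting fixed points on cosets, a further normal subgroup that is central modulo \<open>K\<close>.\<close>

lemma p_group_derived_psubset:
 assumes R: "subgroup R G" "finite R" "card R = q ^ k" and q: "prime q" and ne: "R\<noteq>{\<one>}"
 shows "derived G R \<subset> R"
proof -
 have Rc: "r\<in>carrier G" if "r\<in>R" for r using R that subgroup_carrier by blast
 note Rm = subgroup.m_closed[OF R(1)] and Ri = subgroup.m_inv_closed[OF R(1)] and R1 = subgroup.one_closed[OF R(1)]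
 let ?F = "{K. subgroup K G \<and> K \<subset> R \<and> R\<subseteq>normalizing K}"
 have triv: "{\<one>}\<in>?F"
 proof -
  have "R\<subseteq>normalizing {\<one>}" using Rc by (auto intro!: normalizingI)
  then show ?thesis using triv_subgroup R1 ne by auto
 qed
 have "\<exists>K. K\<in>?F \<and> (\<forall>K'. K'\<in>?F \<longrightarrow> card K' \<le> card K)"
 proof (rule ex_has_greatest_nat[of "\<lambda>K. K\<in>?F" "{\<one>}" card "Suc (card R)"])
  show "\<forall>K'. K'\<in>?F \<longrightarrow> card K' < Suc (card R)" using card_mono[OF R(2)] by (auto simp: less_Suc_eq_le)
 qed (rule triv)
 then obtain K where K: "subgroup K G" "K \<subset> R" "R\<subseteq>normalizing K" and max: "\<And>K'. K'\<in>?F ==> card K' \<le> card K"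
  by blast
 have finK: "finite K" using K R finite_subset by blast
 have Kc: "K\<subseteq>carrier G" by (rule subgroup.subset[OF K(1)])
 let ?K' = "{r\<in>R. \<forall>g\<in>R. [.g, r.]\<in>K}"
 have K's: "subgroup ?K' G"
 proof -
  have eq: "R\<inter>(\<Inter>g\<in>R. {r\<in>normalizing K. [.g, r.]\<in>K}) = ?K'" using K(3) by blast
  have sub: "subgroup (\<Inter>((\<lambda>g. {r\<in>normalizing K. [.g, r.]\<in>K}) ` R)) G"
   by (rule subgroups_Inter) (use comm_set_subgroup[OF K(1) Rc] R1 in auto)
  show ?thesis using subgroups_Inter_pair[OF R(1) sub] unfolding eq .
 qed
 have KK': "K\<subseteq>?K'"
 proof
  fix x assume x: "x\<in>K"
  have "[.g, x.]\<in>K" if g: "g\<in>R" for g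
  proof -
   have "[.g, x.] = inv (x\<up>g)\<otimes>x" using x Kc Rc[OF g] by (simp add: word_simps subsetD)
   then show ?thesis using normalizing_conj[of g K x] K(3) g x subgroup.m_closed[OF K(1)] subgroup.m_inv_closed[OF K(1)] by auto
  qed
  then show "x\<in>?K'" using x K by blast
 qed
 have K'n: "R\<subseteq>normalizing ?K'"
 proof
  fix g assume g: "g\<in>R"
  show "g\<in>normalizing ?K'"
  proof (rule normalizingI)
   show "finite ?K'" using R by simp
   show "?K'\<subseteq>carrier G" using Rc by blast
   show "g\<in>carrier G" by (rule Rc[OF g])
   fix r assume r: "r\<in>?K'"
   have "[.h, r\<up>g.]\<in>K" if h: "h\<in>R" for h
   proof -
    have hi: "h\<up>inv g\<in>R" using subgroup_conj[OF R(1) h Ri[OF g]] .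
    have "[.h, r\<up>g.] = [.h\<up>inv g, r.]\<up>g" using conj_el_comm[of "h\<up>inv g" r g] r h g Rc by simp
    then show ?thesis using normalizing_conj[of g K] K(3) g r hi by auto
   qed
   then show "r\<up>g\<in>?K'" using subgroup_conj[OF R(1) _ g] r by blast
  qed
 qed
 \<comment> \<open>fixed points of \<open>R\<close> acting by conjugation on the cosets of \<open>K\<close>\<close>
 let ?X = "(\<lambda>r. K #> r) ` R"
 have cX: "card ?X * card K = q ^ k"
  using card_fibres[OF R(1) K(1) _ R(2), of "\<lambda>r. K #> r"] rcos_eq_iff[OF K(1)] Rc K(2) R(3) by auto
 have "card ?X dvd q ^ k" using cX by (metis dvd_triv_left)
 then obtain i where i: "card ?X = q ^ i" using divides_primepow_nat[OF q] by blast
 have "i\<noteq>0"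
 proof
  assume "i = 0"
  then have "card K = card R" using cX i R by simp
  then show False using psubset_card_mono[OF R(2) K(2)] by simp
 qed
 then have qX: "q dvd card ?X" using i by (simp add: dvd_power)
 have act: "(K #> r)\<Up>g = K #> (r\<up>g)" if r: "r\<in>R" and g: "g\<in>R" for r g
 proof -
  have c: "r\<in>carrier G" "g\<in>carrier G" using r g Rc by blast+
  have "(K #> r)\<Up>g = (\<lambda>x. (x\<otimes>r)\<up>g) ` K" unfolding conj_set_def r_coset_def by auto
  also have "\<dots> = (\<lambda>x. (x\<up>g)\<otimes>(r\<up>g)) ` K" using c Kc by (intro image_cong) (auto simp: conj_el_mult)
  also have "\<dots> = (\<lambda>x. x\<otimes>(r\<up>g)) ` (K\<Up>g)" unfolding conj_set_def image_image ..
  also have "K\<Up>g = K" using K(3) g by (auto simp: normalizing_def)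
  finally show ?thesis by (auto simp: r_coset_def)
 qed
 have "card ?X mod q = card {X\<in>?X. \<forall>g\<in>R. X\<Up>g = X} mod q"
 proof (rule p_group_fixed_points[OF R(1,3) q])
  show "finite ?X" using R by simp
  fix X assume "X\<in>?X"
  then obtain r where r: "r\<in>R" "X = K #> r" by blast
  have Xc: "X\<subseteq>carrier G" using r_coset_subset_G[OF Kc Rc[OF r(1)]] r by simp
  show "X\<Up>\<one> = X" by (rule conj_set_one[OF Xc])
  fix g assume g: "g\<in>R"
  show "X\<Up>g\<in>?X" using act[OF r(1) g] r subgroup_conj[OF R(1) r(1) g] by blast
  fix h assume "h\<in>R"
  then show "X\<Up>(g\<otimes>h) = (X\<Up>g)\<Up>h" using conj_set_conj[OF Xc Rc[OF g] Rc] by simp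
 qed
 from trans[OF sym[OF this] dvd_imp_mod_0[OF qX]]
 have qF: "q dvd card {X\<in>?X. \<forall>g\<in>R. X\<Up>g = X}" by (rule mod_0_imp_dvd)
 have KK: "K = K #> \<one>" using Kc by simp
 have KF: "K\<in>{X\<in>?X. \<forall>g\<in>R. X\<Up>g = X}"
  using KK R1 K(3) by (auto simp: normalizing_def intro!: image_eqI[of _ _ \<one>])
 have "{X\<in>?X. \<forall>g\<in>R. X\<Up>g = X}\<noteq>{K}" using qF q by (auto simp: prime_nat_iff)
 from other_member[OF KF this] obtain X
  where XF: "X\<in>{X\<in>?X. \<forall>g\<in>R. X\<Up>g = X}" and XK: "X\<noteq>K" by (rule bexE)
 then obtain r where r: "r\<in>R" "X = K #> r" by blast
 have rK: "r\<notin>K" using XK r rcos_eq_self_iff[OF K(1) Rc[OF r(1)]] by blast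
 have "r\<in>?K'"
 proof -
  have "[.g, r.]\<in>K" if g: "g\<in>R" for g
  proof -
   have gi: "inv g\<in>R" by (rule Ri[OF g])
   have c: "r\<in>carrier G" "g\<in>carrier G" using r g Rc by blast+
   have "K #> (r\<up>inv g) = K #> r" using act[OF r(1) gi] XF r gi by auto
   then have "(r\<up>inv g)\<otimes>inv r\<in>K" using rcos_eq_iff[OF K(1), of "r\<up>inv g" r] c by simp
   then have "((r\<up>inv g)\<otimes>inv r)\<up>(g\<otimes>r)\<in>K" using normalizing_conj[of "g\<otimes>r" K] K(3) Rm[OF g r(1)] by blast
   moreover have "((r\<up>inv g)\<otimes>inv r)\<up>(g\<otimes>r) = [.g, r.]" using c by (simp add: word_simps)
   ultimately show ?thesis by simp
  qed
  then show ?thesis using r by blast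
 qed
 then have lt: "card K < card ?K'" using KK' rK R(2) by (intro psubset_card_mono) auto
 have "?K'\<notin>?F"
 proof
  assume "?K'\<in>?F"
  from max[OF this] show False using lt by linarith
 qed
 then have "?K' = R" using K's K'n by blast
 then have comm: "[.g, r.]\<in>K" if "g\<in>R" "r\<in>R" for g r using that by blast
 have "derived G R\<subseteq>K" unfolding derived_def
 proof (rule generate_subgroup_incl[OF _ K(1)], clarify)
  fix u v assume uv: "u\<in>R" "v\<in>R"
  have "u\<otimes>v\<otimes>inv u\<otimes>inv v = [.inv u, inv v.]" using uv Rc by simp
  then show "u\<otimes>v\<otimes>inv u\<otimes>inv v\<in>K" using comm[OF Ri[OF uv(1)] Ri[OF uv(2)]] by argo
 qed
 then show ?thesis using K(2) by blast
qed

text \<open>The elementary abelian group \<open>Y\<close> of order 9 generated by \<open>z\<close> and \<open>t\<close> acts on the \<open>q\<close>-group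
 \<open>R\<close>; modulo \<open>C = C\<^sub>R(Y)\<close> every norm \<open>1 + y + y\<^sup>2\<close> vanishes, and adding the norms of the four
 subgroups of order 3 gives three times the identity.\<close>

lemma coprime_action_centralizes_p_group:
 assumes z: "z\<in>Y" and t: "t\<in>Y" and zt: "z\<otimes>t = t\<otimes>z" and Y: "Y\<subseteq>carrier G"
  and cube: "\<And>y. y\<in>Y ==> y\<otimes>(y\<otimes>y) = \<one>" and cl: "\<And>y y'. y\<in>Y ==> y'\<in>Y ==> y\<otimes>y'\<in>Y"
  and ne: "z\<noteq>\<one>" "t\<noteq>\<one>" "z\<otimes>t\<noteq>\<one>" "z\<otimes>(t\<otimes>t)\<noteq>\<one>" and q: "prime q" "q\<noteq>3"
 shows "subgroup R G ==> finite R ==> card R = q ^ k ==> Y\<subseteq>normalizing R ==>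
  (\<And>r y. r\<in>R ==> y\<in>Y ==> y\<noteq>\<one> ==> r\<up>y = r ==> r\<in>CG Y) ==> R\<subseteq>CG Y"
proof (induction "card R" arbitrary: R k rule: less_induct)
 case less
 note R = less.prems(1-3) and RY = less.prems(4) and H = less.prems(5)
 have Rc: "r\<in>carrier G" if "r\<in>R" for r using R that subgroup_carrier by blast
 have Rsub: "R\<subseteq>carrier G" by (rule subgroup.subset[OF R(1)])
 have Yc: "y\<in>carrier G" if "y\<in>Y" for y using Y that by blast
 note Rm = subgroup.m_closed[OF R(1)] and Ri = subgroup.m_inv_closed[OF R(1)] and R1 = subgroup.one_closed[OF R(1)]
 have RYc: "r\<up>y\<in>R" if "r\<in>R" "y\<in>Y" for r y using normalizing_conj[of y R r] RY that by blast
 show ?case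
 proof (cases "R = {\<one>}")
  case True then show ?thesis using subgroup.one_closed[OF centralizer_subgroup[OF Y]] by simp
 next
  case False
  let ?D = "derived G R"
  have Dps: "?D \<subset> R" by (rule p_group_derived_psubset[OF R q(1) False])
  have Ds: "subgroup ?D G" by (rule derived_is_subgroup[OF Rsub])
  have Dc: "?D\<subseteq>carrier G" by (rule subgroup.subset[OF Ds])
  have finD: "finite ?D" using Dps R finite_subset by blast
  have cD: "card ?D < card R" by (rule psubset_card_mono[OF R(2) Dps])
  have "card ?D dvd q ^ k" using card_subgroup_dvd[OF R(1) Ds _ R(2)] Dps R(3) by auto
  then obtain i where i: "card ?D = q ^ i" using divides_primepow_nat[OF q(1)] by blast
  have commD: "[.u, v.]\<in>?D" if uv: "u\<in>R" "v\<in>R" for u v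
  proof -
   have "inv u\<otimes>inv v\<otimes>inv (inv u)\<otimes>inv (inv v)\<in>?D"
    unfolding derived_def by (rule generate.incl) (use Ri uv in blast)
   then show ?thesis using uv Rc by simp
  qed
  have DY: "Y\<subseteq>normalizing ?D"
  proof
   fix y assume y: "y\<in>Y"
   have yc: "y\<in>carrier G" by (rule Yc[OF y])
   have ys: "subgroup (?D\<Up>inv y) G" by (rule conj_set_subgroup[OF Ds]) (use yc in simp)
   have "?D\<subseteq>?D\<Up>inv y"
   proof -
    have "generate G (derived_set G R)\<subseteq>?D\<Up>inv y"
    proof (rule generate_subgroup_incl[OF _ ys], clarify)
     fix u v assume uv: "u\<in>R" "v\<in>R"
     have c: "u\<in>carrier G" "v\<in>carrier G" using uv Rc by blast+
     let ?w = "u\<otimes>v\<otimes>inv u\<otimes>inv v"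
     have "?w\<up>y = [.inv (u\<up>y), inv (v\<up>y).]" using c yc by (simp add: word_simps)
     also have "\<dots>\<in>?D" by (rule commD[OF Ri[OF RYc[OF uv(1) y]] Ri[OF RYc[OF uv(2) y]]])
     finally have "?w\<up>y\<in>?D" .
     then show "?w\<in>?D\<Up>inv y" using mem_conj_set[OF Dc, of "inv y" ?w] yc c by simp
    qed
    then show ?thesis by (simp add: derived_def)
   qed
   then have "d\<up>y\<in>?D" if "d\<in>?D" for d
    using that mem_conj_set[OF Dc, of "inv y" d] yc Dc by auto
   then show "y\<in>normalizing ?D" by (rule normalizingI[OF finD Dc yc])
  qed
  have DC: "?D\<subseteq>CG Y"
   by (rule less.hyps[OF cD Ds finD i DY]) (use H Dps in blast)
  let ?C = "R\<inter>CG Y"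
  have Cs: "subgroup ?C G" by (rule subgroups_Inter_pair[OF R(1) centralizer_subgroup[OF Y]])
  have DC': "?D\<subseteq>?C" using DC Dps by blast
  have CnR: "?C \<lhd> G\<lparr>carrier := R\<rparr>"
  proof (rule normal_onI[OF R(1) Cs])
   fix a b assume ab: "a\<in>R" "b\<in>?C"
   have "b\<up>a = b\<otimes>[.b, a.]" using ab Rc by (intro conj_el_eq_comm) auto
   moreover have "[.b, a.]\<in>?C" using commD[of b a] DC' ab by blast
   ultimately show "b\<up>a\<in>?C" using subgroup.m_closed[OF Cs] ab by simp
  qed blast
  let ?M = "G\<lparr>carrier := R\<rparr> Mod ?C"
  interpret M: group ?M by (rule normal.factorgroup_is_group[OF CnR])
  have mult: "(?C #> u) \<otimes>\<^bsub>?M\<^esub> (?C #> v) = ?C #> (u\<otimes>v)" if "u\<in>R" "v\<in>R" for u v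
   using section_mult[OF R(1) CnR that] by simp
  have mem: "?C #> u\<in>carrier ?M" if "u\<in>R" for u unfolding section_carrier using that by blast
  interpret M: comm_group ?M
  proof (rule M.group_comm_groupI)
   fix X X' assume "X\<in>carrier ?M" "X'\<in>carrier ?M"
   then obtain u v where u: "u\<in>R" "X = ?C #> u" and v: "v\<in>R" "X' = ?C #> v" unfolding section_carrier by blast
   have "(u\<otimes>v)\<otimes>inv (v\<otimes>u) = [.inv u, inv v.]" using u v Rc by (simp add: word_simps)
   moreover have "[.inv u, inv v.]\<in>?C" using commD[OF Ri[OF u(1)] Ri[OF v(1)]] DC' by blast
   ultimately have "?C #> (u\<otimes>v) = ?C #> (v\<otimes>u)" using rcos_eq_iff[OF Cs, of "u\<otimes>v" "v\<otimes>u"] u v Rc by simp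
   then show "X \<otimes>\<^bsub>?M\<^esub> X' = X' \<otimes>\<^bsub>?M\<^esub> X" using u v mult by simp
  qed
  have norm: "(?C #> v) \<otimes>\<^bsub>?M\<^esub> ((?C #> (v\<up>y)) \<otimes>\<^bsub>?M\<^esub> (?C #> (v\<up>(y\<otimes>y)))) = \<one>\<^bsub>?M\<^esub>"
   if v: "v\<in>R" and y: "y\<in>Y" "y\<noteq>\<one>" for v y
  proof -
   have yc: "y\<in>carrier G" by (rule Yc[OF y(1)])
   have yy: "y\<otimes>y\<in>Y" by (rule cl[OF y(1) y(1)])
   have y3: "y\<otimes>(y\<otimes>y) = \<one>" by (rule cube[OF y(1)])
   have vR: "v\<up>y\<in>R" "v\<up>(y\<otimes>y)\<in>R" using RYc v y yy by blast+
   let ?w = "v\<otimes>((v\<up>y)\<otimes>(v\<up>(y\<otimes>y)))"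
   have wR: "?w\<in>R" using v vR Rm by blast
   have wc: "?w\<in>carrier G" "v\<in>carrier G" using wR v Rc by blast+
   have "?w\<up>y = (v\<up>y)\<otimes>((v\<up>(y\<otimes>y))\<otimes>v)"
    using wc yc y3 by (simp add: conj_el_mult conj_el_conj m_assoc)
   also have "\<dots> = ?w\<otimes>[.?w, v.]" using wc yc by (simp add: word_simps)
   finally have wy: "?w\<up>y = ?w\<otimes>[.?w, v.]" .
   have "(?w\<up>y)\<otimes>inv ?w = [.?w, v.]\<up>inv ?w"
    unfolding wy using wc by (simp only: conj_el_def inv_inv inv_closed m_closed m_assoc)
   also have "\<dots> = [.?w, v.]\<otimes>[.[.?w, v.], inv ?w.]" using wc by (intro conj_el_eq_comm) auto
   also have "\<dots>\<in>?D"
   proof (rule subgroup.m_closed[OF Ds commD[OF wR v]])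
    show "[.[.?w, v.], inv ?w.]\<in>?D" using commD[OF _ Ri[OF wR]] commD[OF wR v] Dps by blast
   qed
   finally have wyD: "(?w\<up>y)\<otimes>inv ?w\<in>?D" .
   \<comment> \<open>\<open>y\<close> acts on the coset of \<open>w\<close>, whose size is prime to 3.\<close>
   let ?X = "?D #> ?w" and ?P = "{\<one>, y, y\<otimes>y}"
   have Ps: "subgroup ?P G"
   proof (rule subgroupI)
    have iy: "inv y = y\<otimes>y" "inv (y\<otimes>y) = y"
    proof -
     show "inv y = y\<otimes>y" using cube_one_inv[OF yc] unfolding cube_eq[OF yc] y3 by simp
     show "inv (y\<otimes>y) = y" using y3 yc by (metis inv_equality m_closed)
    qed
    show "?P\<subseteq>carrier G" using yc by simp
    show "?P\<noteq>{}" by simp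
    show "inv u\<in>?P" if "u\<in>?P" for u using that iy by auto
    show "u\<otimes>v\<in>?P" if "u\<in>?P" "v\<in>?P" for u v
     using that yc y3 by (elim insertE emptyE) (simp_all add: m_assoc)
   qed
   have cP: "card ?P = 3 ^ 1"
   proof -
    have "y\<otimes>y\<noteq>\<one>" using y3 yc y(2) by auto
    moreover have "y\<otimes>y\<noteq>y" using yc y(2) by simp
    ultimately show ?thesis using y(2) by simp
   qed
   have Xy: "u\<up>y\<in>?X" if u: "u\<in>?X" for u
   proof -
    obtain d where d: "d\<in>?D" "u = d\<otimes>?w" using u by (auto simp: r_coset_def)
    have dc: "d\<in>carrier G" using d Dc by blast
    let ?e = "(?w\<up>y)\<otimes>inv ?w"
    have wyc: "?w\<up>y\<in>carrier G" by (rule conj_el_closed[OF wc(1) yc])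
    have "u\<up>y = (d\<up>y)\<otimes>(?w\<up>y)" unfolding d(2) by (rule conj_el_mult[OF dc wc(1) yc])
    also have "?w\<up>y = ?e\<otimes>?w" by (simp only: m_assoc wyc wc(1) inv_closed l_inv r_one)
    also have "(d\<up>y)\<otimes>(?e\<otimes>?w) = ((d\<up>y)\<otimes>?e)\<otimes>?w"
     by (rule m_assoc[symmetric]) (use dc yc wyc wc(1) in \<open>simp_all only: conj_el_closed m_closed inv_closed\<close>)
    finally have "u\<up>y = ((d\<up>y)\<otimes>?e)\<otimes>?w" .
    moreover have "(d\<up>y)\<otimes>?e\<in>?D"
     by (rule subgroup.m_closed[OF Ds normalizing_conj[OF _ d(1)] wyD]) (use DY y in blast)
    ultimately show ?thesis unfolding r_coset_def by blast
   qed
   have Xc: "u\<in>carrier G" if "u\<in>?X" for u using that r_coset_subset_G[OF Dc wc(1)] by blast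
   have "card ?X mod 3 = card {u\<in>?X. \<forall>g\<in>?P. u\<up>g = u} mod 3"
   proof (rule p_group_fixed_points[OF Ps cP])
    show "finite ?X" using finD by (auto simp: r_coset_def)
    fix u assume u: "u\<in>?X"
    show "u\<up>\<one> = u" using Xc[OF u] by simp
    fix g assume g: "g\<in>?P"
    have uy: "u\<up>y\<in>?X" by (rule Xy[OF u])
    have uyy: "u\<up>(y\<otimes>y)\<in>?X" using Xy[OF uy] conj_el_conj[OF Xc[OF u] yc yc] by simp
    show "u\<up>g\<in>?X" using g u uy uyy Xc[OF u] by (elim insertE emptyE) simp_all
    fix h assume h: "h\<in>?P"
    have "g\<in>carrier G" "h\<in>carrier G" using g h yc by auto
    then show "u\<up>(g\<otimes>h) = (u\<up>g)\<up>h" using conj_el_conj[OF Xc[OF u]] by simp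
   qed simp
   moreover have "card ?X = card ?D"
   proof -
    have "?X\<in>rcosets ?D" using wc(1) by (auto simp: RCOSETS_def)
    from card_cosets_equal[OF this Dc] obtain f where "bij_betw f ?D ?X" by blast
    then show ?thesis using bij_betw_same_card[of f ?D ?X] by simp
   qed
   moreover have "\<not> 3 dvd q ^ i"
   proof
    assume "3 dvd q ^ i"
    then have "3 dvd q" using prime_dvd_power[of 3 q i] by simp
    then show False using primes_dvd_imp_eq[of 3 q] q by simp
   qed
   ultimately have "card {u\<in>?X. \<forall>g\<in>?P. u\<up>g = u}\<noteq>0" unfolding i by (metis dvd_eq_mod_eq_0 mod_0)
   then have "{u\<in>?X. \<forall>g\<in>?P. u\<up>g = u}\<noteq>{}" by (metis card.empty)
   then obtain u where u: "u\<in>?X" "u\<up>y = u" by blast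
   obtain d where d: "d\<in>?D" "u = d\<otimes>?w" using u(1) by (auto simp: r_coset_def)
   have uR: "u\<in>R" using d Dps wR Rm by blast
   have "u\<in>?C" using H[OF uR y u(2)] uR by blast
   then have "?w\<in>?C" using subgroup_mult_cancel(1)[OF Cs, of d ?w] d DC' wc(1) by blast
   then have "?C #> ?w = ?C" using rcos_eq_self_iff[OF Cs wc(1)] by blast
   then show ?thesis using mult[OF v Rm[OF vR]] mult[OF vR] by simp
  qed
  have "v\<in>?C" if v: "v\<in>R" for v
  proof -
   have zc: "z\<in>carrier G" "t\<in>carrier G" using z t Yc by blast+
   have vc: "v\<in>carrier G" by (rule Rc[OF v])
   define X where "X y = ?C #> (v\<up>y)" for y
   have YY: "t\<otimes>t\<in>Y" "z\<otimes>z\<in>Y" "z\<otimes>t\<in>Y" "z\<otimes>(t\<otimes>t)\<in>Y" "(z\<otimes>z)\<otimes>t\<in>Y" "(z\<otimes>z)\<otimes>(t\<otimes>t)\<in>Y"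
    using cl z t by simp_all
   have XM: "X y\<in>carrier ?M" if "y\<in>Y" for y unfolding X_def by (rule mem[OF RYc[OF v that]])
   have X0: "X \<one>\<in>carrier ?M" unfolding X_def using mem v vc by simp
   have nrm: "X y \<otimes>\<^bsub>?M\<^esub> (X (y\<otimes>g) \<otimes>\<^bsub>?M\<^esub> X (y\<otimes>(g\<otimes>g))) = \<one>\<^bsub>?M\<^esub>"
    if "y = \<one> \<or> y\<in>Y" "g\<in>Y" "g\<noteq>\<one>" for y g
   proof -
    have yc: "y\<in>carrier G" "g\<in>carrier G" using that Yc by auto
    have vy: "v\<up>y\<in>R" using that RYc v vc by auto
    show ?thesis using norm[OF vy that(2,3)] yc vc unfolding X_def by (simp add: conj_el_conj)
   qed
   let ?a = "X \<one>" and ?b = "X z" and ?c = "X (z\<otimes>z)" and ?d = "X t" and ?e = "X (t\<otimes>t)"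
    and ?f = "X (z\<otimes>t)" and ?g = "X ((z\<otimes>z)\<otimes>(t\<otimes>t))" and ?h = "X (z\<otimes>(t\<otimes>t))" and ?i = "X ((z\<otimes>z)\<otimes>t)"
   have tz: "t\<otimes>z = z\<otimes>t" "t\<otimes>(z\<otimes>z) = (z\<otimes>z)\<otimes>t" "(t\<otimes>t)\<otimes>z = z\<otimes>(t\<otimes>t)"
     "(t\<otimes>t)\<otimes>(z\<otimes>z) = (z\<otimes>z)\<otimes>(t\<otimes>t)"
   proof -
    show 1: "t\<otimes>z = z\<otimes>t" using zt by simp
    show 2: "t\<otimes>(z\<otimes>z) = (z\<otimes>z)\<otimes>t" using 1 zc by (metis m_assoc)
    show 3: "(t\<otimes>t)\<otimes>z = z\<otimes>(t\<otimes>t)" using 1 zc by (metis m_assoc)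
    show "(t\<otimes>t)\<otimes>(z\<otimes>z) = (z\<otimes>z)\<otimes>(t\<otimes>t)" using 3 zc by (metis m_assoc m_closed)
   qed
   have sq: "(z\<otimes>t)\<otimes>(z\<otimes>t) = (z\<otimes>z)\<otimes>(t\<otimes>t)"
    "(z\<otimes>(t\<otimes>t))\<otimes>(z\<otimes>(t\<otimes>t)) = (z\<otimes>z)\<otimes>t"
   proof -
    show "(z\<otimes>t)\<otimes>(z\<otimes>t) = (z\<otimes>z)\<otimes>(t\<otimes>t)" using tz(1) zc by (metis m_assoc m_closed)
    have "(z\<otimes>(t\<otimes>t))\<otimes>(z\<otimes>(t\<otimes>t)) = z\<otimes>((t\<otimes>t)\<otimes>z)\<otimes>(t\<otimes>t)" using zc by (simp add: m_assoc)
    also have "\<dots> = (z\<otimes>z)\<otimes>((t\<otimes>(t\<otimes>t))\<otimes>t)" unfolding tz(3) using zc by (simp add: m_assoc)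
    finally show "(z\<otimes>(t\<otimes>t))\<otimes>(z\<otimes>(t\<otimes>t)) = (z\<otimes>z)\<otimes>t" using cube[OF t] zc by simp
   qed
   have n1: "?a \<otimes>\<^bsub>?M\<^esub> (?b \<otimes>\<^bsub>?M\<^esub> ?c) = \<one>\<^bsub>?M\<^esub>" using nrm[of \<one> z] z ne zc by simp
   have n2: "?d \<otimes>\<^bsub>?M\<^esub> (?f \<otimes>\<^bsub>?M\<^esub> ?i) = \<one>\<^bsub>?M\<^esub>" using nrm[of t z] z t ne tz by simp
   have n3: "?e \<otimes>\<^bsub>?M\<^esub> (?h \<otimes>\<^bsub>?M\<^esub> ?g) = \<one>\<^bsub>?M\<^esub>" using nrm[of "t\<otimes>t" z] z YY ne tz by simp
   have n4: "?a \<otimes>\<^bsub>?M\<^esub> (?d \<otimes>\<^bsub>?M\<^esub> ?e) = \<one>\<^bsub>?M\<^esub>" using nrm[of \<one> t] t ne zc by simp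
   have n5: "?a \<otimes>\<^bsub>?M\<^esub> (?f \<otimes>\<^bsub>?M\<^esub> ?g) = \<one>\<^bsub>?M\<^esub>" using nrm[of \<one> "z\<otimes>t"] YY ne zc sq by simp
   have n6: "?a \<otimes>\<^bsub>?M\<^esub> (?h \<otimes>\<^bsub>?M\<^esub> ?i) = \<one>\<^bsub>?M\<^esub>" using nrm[of \<one> "z\<otimes>(t\<otimes>t)"] YY ne zc sq by simp
   note cM = X0 XM[OF z] XM[OF t] XM[OF YY(1)] XM[OF YY(2)] XM[OF YY(3)] XM[OF YY(4)] XM[OF YY(5)] XM[OF YY(6)]
   have "(?a \<otimes>\<^bsub>?M\<^esub> (?b \<otimes>\<^bsub>?M\<^esub> ?c)) \<otimes>\<^bsub>?M\<^esub> ((?a \<otimes>\<^bsub>?M\<^esub> (?d \<otimes>\<^bsub>?M\<^esub> ?e)) \<otimes>\<^bsub>?M\<^esub>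
     ((?a \<otimes>\<^bsub>?M\<^esub> (?f \<otimes>\<^bsub>?M\<^esub> ?g)) \<otimes>\<^bsub>?M\<^esub> (?a \<otimes>\<^bsub>?M\<^esub> (?h \<otimes>\<^bsub>?M\<^esub> ?i))))
    = (?a \<otimes>\<^bsub>?M\<^esub> (?a \<otimes>\<^bsub>?M\<^esub> ?a)) \<otimes>\<^bsub>?M\<^esub> ((?a \<otimes>\<^bsub>?M\<^esub> (?b \<otimes>\<^bsub>?M\<^esub> ?c)) \<otimes>\<^bsub>?M\<^esub>
     ((?d \<otimes>\<^bsub>?M\<^esub> (?f \<otimes>\<^bsub>?M\<^esub> ?i)) \<otimes>\<^bsub>?M\<^esub> (?e \<otimes>\<^bsub>?M\<^esub> (?h \<otimes>\<^bsub>?M\<^esub> ?g))))"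
    using cM by (simp only: M.m_ac M.m_closed)
   then have "?a \<otimes>\<^bsub>?M\<^esub> (?a \<otimes>\<^bsub>?M\<^esub> ?a) = \<one>\<^bsub>?M\<^esub>"
    unfolding n1 n2 n3 n4 n5 n6 using X0 by (simp only: M.l_one M.r_one M.one_closed M.m_closed)
   then have "?C #> (v\<otimes>(v\<otimes>v)) = ?C" using mult[OF v Rm[OF v v]] mult[OF v v] vc by (simp add: X_def)
   then have v3: "v\<otimes>(v\<otimes>v)\<in>?C" using rcos_eq_self_iff[OF Cs, of "v\<otimes>(v\<otimes>v)"] vc by simp
   have "coprime (3::nat) (q ^ k)" using primes_coprime[of 3 q] q by simp
   then obtain m where m: "[3 * m = 1] (mod q ^ k)" using cong_solve_coprime_nat[of 3 "q ^ k"] by auto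
   interpret RG: group "G\<lparr>carrier := R\<rparr>" using R subgroup_imp_group by blast
   have "v [^]\<^bsub>G\<lparr>carrier := R\<rparr>\<^esub> card R = \<one>" using RG.pow_order_eq_1[of v] v by (simp add: order_def)
   then have vq: "v [^] (q ^ k) = \<one>" using R(3) by (simp add: nat_pow_consistent[symmetric])
   have "v [^] (3 * m) = v [^] (1::nat)"
   proof -
    have red: "v [^] n = v [^] (n mod q ^ k)" for n :: nat
    proof -
     have "v [^] n = v [^] (q ^ k * (n div q ^ k) + n mod q ^ k)" by simp
     also have "\<dots> = (v [^] (q ^ k)) [^] (n div q ^ k)\<otimes>v [^] (n mod q ^ k)"
     using nat_pow_mult[OF vc] nat_pow_pow[OF vc] by (simp only:)
     also have "\<dots> = v [^] (n mod q ^ k)" unfolding vq using vc by simp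
     finally show ?thesis .
    qed
    show ?thesis using red[of "3 * m"] red[of 1] m unfolding cong_def by (simp only:)
   qed
   then have "v = (v [^] (3::nat)) [^] m" using vc by (simp add: nat_pow_pow)
   also have "v [^] (3::nat) = v\<otimes>(v\<otimes>v)" by (rule cube_eq[OF vc])
   finally show ?thesis using subgroup_pow[OF Cs v3, of m] by metis
  qed
  then show ?thesis by blast
 qed
qed

end

section \<open>From the hypotheses to the configuration\<close>

context group begin

lemma group_exponent_pow:
 assumes H: "subgroup H G" "finite H" and h: "h\<in>H"
 shows "h [^] group_exponent (grp_on G H) = \<one>"
proof -
 interpret H: group "G\<lparr>carrier := H\<rparr>" using H(1) subgroup_imp_group by blast
 let ?P = "\<lambda>n::nat. n > 0 \<and> (\<forall>g\<in>carrier (grp_on G H). g [^]\<^bsub>G\<lparr>carrier := H\<rparr>\<^esub> n = \<one>\<^bsub>G\<lparr>carrier := H\<rparr>\<^esub>)"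
 have "?P (order (grp_on G H))" using H.pow_order_eq_1 H.order_gt_0_iff_finite H(2) by simp
 then have "?P (group_exponent (grp_on G H))" unfolding group_exponent_def by (rule LeastI)
 then show ?thesis using h nat_pow_consistent by simp
qed

lemma group_exponent_3I:
 assumes H: "subgroup H G" and cube: "\<And>h. h\<in>H ==> h [^] (3::nat) = \<one>" and h: "h\<in>H" "h~=\<one>"
 shows "group_exponent (grp_on G H) = 3"
 unfolding group_exponent_def
proof (rule Least_equality)
 show "3 > (0::nat) \<and> (\<forall>g\<in>carrier (grp_on G H). g [^]\<^bsub>G\<lparr>carrier := H\<rparr>\<^esub> (3::nat) = \<one>\<^bsub>G\<lparr>carrier := H\<rparr>\<^esub>)"
  using cube nat_pow_consistent by simp
next
 fix n :: nat
 assume n: "n > 0 \<and> (\<forall>g\<in>carrier (grp_on G H). g [^]\<^bsub>G\<lparr>carrier := H\<rparr>\<^esub> n = \<one>\<^bsub>G\<lparr>carrier := H\<rparr>\<^esub>)"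
 have hc: "h\<in>carrier G" using H h subgroup_carrier by blast
 have p: "h [^] n = \<one>" using n h nat_pow_consistent by simp
 show "3 \<le> n"
 proof (rule ccontr)
  assume "\<not> 3 \<le> n"
  then have "n = 1 \<or> n = 2" using n by auto
  moreover have "n~=1" using p h hc by auto
  ultimately have "h [^] (2::nat) = \<one>" using p by blast
  moreover have "h [^] (3::nat) = h [^] (2::nat)\<otimes>h" by (metis nat_pow_Suc numeral_2_eq_2 numeral_3_eq_3)
  ultimately show False using cube[OF h(1)] h hc by simp
 qed
qed

lemma p_core_on:
 assumes fin: "finite (carrier G)" and C: "subgroup C G" and p: "prime p"
  and P: "P = p_core p (grp_on G C)"
 shows "subgroup P G" "P\<subseteq>C" "\<And>c x. c\<in>C ==> x\<in>P ==> x\<up>c\<in>P" "\<exists>k. card P = p ^ k"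
  and "\<And>N k. subgroup N G ==> N\<subseteq>C ==> (\<And>c x. c\<in>C ==> x\<in>N ==> x\<up>c\<in>N) ==> card N = p ^ k ==> N\<subseteq>P"
proof -
 have gC: "group (grp_on G C)" using C subgroup_imp_group by blast
 have fC: "finite (carrier (grp_on G C))" using fin subgroup.subset[OF C] finite_subset by simp blast
 note core = p_core_greatest[OF gC fC p, folded P]
 have sC: "subgroup P (grp_on G C)" using core(1) by (rule normal_imp_subgroup)
 show "subgroup P G" using incl_subgroup[OF C sC] .
 show PC: "P\<subseteq>C" using subgroup.subset[OF sC] by simp
 show "\<And>c x. c\<in>C ==> x\<in>P ==> x\<up>c\<in>P" by (rule normal_on_conj[OF C core(1)])
 show "\<exists>k. card P = p ^ k" using core(2) by (simp add: p_group_def order_def)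
 fix N k assume N: "subgroup N G" "N\<subseteq>C" "\<And>c x. c\<in>C ==> x\<in>N ==> x\<up>c\<in>N" "card N = p ^ k"
 have n: "N \<lhd> G\<lparr>carrier := C\<rparr>" by (rule normal_onI[OF C N(1,2)]) (rule N(3))
 have "group (grp_on G N)" using N(1) subgroup_imp_group by blast
 then have "p_group p (G\<lparr>carrier := C\<rparr>\<lparr>carrier := N\<rparr>)" using N(4) by (auto simp: p_group_def order_def)
 then show "N\<subseteq>P" using core(3)[OF n] by blast
qed

lemma sylow_maximal:
 assumes fin: "finite (carrier G)" and p: "prime p" and T: "sylow_subgroup p G T"
  and K: "subgroup K G" "T\<subseteq>K" "card K = p ^ m"
 shows "K = T"
proof -
 have fK: "finite K" using fin subgroup.subset[OF K(1)] finite_subset by blast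
 have "card K dvd order G" using card_subgroup_dvd[OF subgroup_self K(1) subgroup.subset[OF K(1)] fin] by (simp add: order_def)
 then have d: "p ^ m dvd order G" using K(3) by simp
 have "order G~=0" using fin order_gt_0_iff_finite by simp
 then have "m \<le> multiplicity p (order G)" using d p by (intro multiplicity_geI) (auto dest: prime_gt_1_nat)
 then have "card K \<le> card T" using T K(3) p by (simp add: sylow_subgroup_def power_increasing prime_gt_0_nat Suc_leI)
 then show ?thesis using card_seteq[OF fK K(2)] by blast
qed

text \<open>\<open>TQ\<close> is a 3-group, so \<open>Q\<subseteq>T\<close>; then \<open>Z\<close> centralizes
 \<open>Q\<close> and is its centre.  The elements of \<open>C(Z)\<close> trivial on \<open>Q/Z\<close> form a
 normal subgroup, in which cubes centralize \<open>Q\<close>; it has exponent dividing 9 and lies in the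
 core.\<close>

lemma large_extraspecial_of_core:
 assumes fin: "finite (carrier G)" and T: "sylow_subgroup 3 G T"
  and Z: "Z = centre (grp_on G T)"
  and Q: "Q = p_core 3 (grp_on G (CG Z))"
  and ex: "extraspecial_plus 3 2 (grp_on G Q)" and self: "CG Q\<subseteq>Q"
 shows "large_extraspecial G Z Q"
proof -
 let ?C = "CG Z"
 have p3: "prime (3::nat)" by simp
 have Tsub: "subgroup T G" using T by (simp add: sylow_subgroup_def)
 have Tc: "T\<subseteq>carrier G" using subgroup.subset[OF Tsub] .
 have fT: "finite T" using Tc fin finite_subset by blast
 obtain k where Tk: "card T = 3 ^ k" using T by (simp add: sylow_subgroup_def)
 have Zeq: "Z = {c\<in>T. \<forall>t\<in>T. c\<otimes>t = t\<otimes>c}" unfolding Z by (rule centre_on)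
 have ZTC: "Z = T\<inter>CG T" unfolding Zeq centralizer_def using Tc by blast
 have Zsub: "subgroup Z G" unfolding ZTC by (rule subgroups_Inter_pair[OF Tsub centralizer_subgroup[OF Tc]])
 have Zc: "Z\<subseteq>carrier G" using subgroup.subset[OF Zsub] .
 have ZT: "Z\<subseteq>T" using ZTC by blast
 have Csub: "subgroup ?C G" by (rule centralizer_subgroup[OF Zc])
 have TC: "T\<subseteq>?C"
 proof
  fix t assume t: "t\<in>T"
  have "t\<otimes>a = a\<otimes>t" if a: "a\<in>Z" for a
  proof -
   have "a\<in>{c\<in>T. \<forall>t\<in>T. c\<otimes>t = t\<otimes>c}" using a unfolding Zeq .
   then have "a\<otimes>t = t\<otimes>a" using t by blast
   then show ?thesis by (rule sym)
  qed
  then show "t\<in>?C" unfolding centralizer_def using t Tc by blast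
 qed
 note core = p_core_on[OF fin Csub p3 Q]
 have Qs: "Q\<subseteq>carrier G" using subgroup.subset[OF core(1)] .
 have fQ: "finite Q" using Qs fin finite_subset by blast
 have Q243: "card Q = 243" using ex by (simp add: extraspecial_plus_def order_def)
 have QT: "Q\<subseteq>T"
 proof -
  have sub: "subgroup (T<#>Q) G" by (rule set_mult_subgroup[OF Tsub core(1)]) (use core(3) TC in blast)
  have "card (T<#>Q) * card (T\<inter>Q) = 3 ^ k * 3 ^ 5" using card_set_mult_inter[OF Tsub fT core(1) fQ] Tk Q243 by simp
  then have "card (T<#>Q) dvd 3 ^ (k + 5)" by (metis dvd_triv_left power_add)
  then obtain m where "card (T<#>Q) = 3 ^ m" using divides_primepow_nat[OF p3] by blast
  then have "T<#>Q = T" using sylow_maximal[OF fin p3 T sub set_mult_left[OF core(1) Tc]] by blast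
  then show ?thesis using set_mult_right[OF Tsub Qs] by simp
 qed
 have ZQ: "Z\<subseteq>Q"
 proof -
  have "Z\<subseteq>CG Q" unfolding centralizer_def using Zc QT Zeq by blast
  then show ?thesis using self by blast
 qed
 have cQ: "centre (grp_on G Q) = {c\<in>Q. \<forall>t\<in>Q. c\<otimes>t = t\<otimes>c}" by (rule centre_on)
 have cQ3: "card (centre (grp_on G Q)) = 3" using ex unfolding extraspecial_plus_def extraspecial_def by blast
 have fcQ: "finite (centre (grp_on G Q))" unfolding cQ using fQ by simp
 have ZcQ: "Z\<subseteq>centre (grp_on G Q)" unfolding cQ using ZQ QT Zeq by blast
 have Z3: "card Z = 3"
 proof -
  have "card T mod 3 = card {c\<in>T. \<forall>g\<in>T. c\<up>g = c} mod 3"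
  proof (rule p_group_fixed_points[OF Tsub Tk p3 fT])
   show "c\<up>g\<in>T" if "g\<in>T" "c\<in>T" for g c by (rule subgroup_conj[OF Tsub that(2,1)])
   show "c\<up>\<one> = c" if "c\<in>T" for c by (rule conj_el_one(1)[OF subsetD[OF Tc that]])
   show "c\<up>(g\<otimes>h) = (c\<up>g)\<up>h" if "g\<in>T" "h\<in>T" "c\<in>T" for g h c
    by (rule conj_el_conj[OF subsetD[OF Tc that(3)] subsetD[OF Tc that(1)] subsetD[OF Tc that(2)], symmetric])
  qed
  moreover have "{c\<in>T. \<forall>g\<in>T. c\<up>g = c} = Z"
  proof -
   have "c\<up>g = c \<longleftrightarrow> c\<otimes>g = g\<otimes>c" if "c\<in>T" "g\<in>T" for c g
    using that Tc conj_el_fixed by blast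
   then show ?thesis unfolding Zeq by blast
  qed
  moreover have "3 dvd card T"
  proof -
   have "card Q dvd card T" by (rule card_subgroup_dvd[OF Tsub core(1) QT fT])
   then show ?thesis using Q243 dvd_trans[of 3 243 "card T"] by simp
  qed
  ultimately have d: "3 dvd card Z" by (simp add: dvd_eq_mod_eq_0)
  have "card Z \<le> 3" using card_mono[OF fcQ ZcQ] cQ3 by simp
  moreover have "card Z > 0" using finite_subset[OF ZT fT] subgroup.one_closed[OF Zsub] card_gt_0_iff by blast
  ultimately show ?thesis using d by (auto elim!: dvdE)
 qed
 have ZcQeq: "Z = centre (grp_on G Q)" using card_subset_eq[OF fcQ ZcQ] Z3 cQ3 by simp
 have Qcomm: "[.q, r.]\<in>Z" if q: "q\<in>Q" and r: "r\<in>Q" for q r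
 proof -
  have "derived (grp_on G Q) Q = Z" using ex ZcQeq by (simp add: extraspecial_plus_def extraspecial_def)
  then have "derived G Q = Z" using derived_consistent[OF _ core(1), of Q] by simp
  moreover have "[.q, r.]\<in>derived G Q"
  proof -
   have i: "inv q\<in>Q" "inv r\<in>Q" using q r subgroup.m_inv_closed[OF core(1)] by blast+
   have "inv q\<otimes>inv r\<otimes>inv (inv q)\<otimes>inv (inv r)\<in>derived_set G Q" using i by blast
   moreover have "inv (inv q) = q" "inv (inv r) = r" using q r Qs by auto
   ultimately show ?thesis unfolding derived_def by (simp add: generate.incl)
  qed
  ultimately show ?thesis by simp
 qed
 have Qcube: "q [^] (3::nat) = \<one>" if "q\<in>Q" for q
  using group_exponent_pow[OF core(1) fQ that] ex by (simp add: extraspecial_plus_def)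
 have stab: "g\<in>Q" if g: "g\<in>?C" and st: "\<And>q. q\<in>Q ==> [.q, g.]\<in>Z" for g
 proof -
  have fZ: "finite Z" using ZT fT finite_subset by blast
  have Cc: "c\<in>carrier G" if "c\<in>?C" for c using that centralizer_carrier[of Z] by blast
  have Zfix: "z\<up>c = z" if "z\<in>Z" "c\<in>?C" for z c using centralizer_conj_el[OF that(2,1)] that Zc by blast
  have nZ: "c\<in>normalizing Z" if "c\<in>?C" for c
   by (rule normalizingI[OF fZ Zc Cc[OF that]]) (use Zfix that in simp)
  have nQ: "c\<in>normalizing Q" if "c\<in>?C" for c
   by (rule normalizingI[OF fQ Qs Cc[OF that]]) (use core(3) that in blast)
  let ?K = "?C\<inter>trivial_on Q Z"
  have Ksub: "subgroup ?K G"
   by (rule subgroups_Inter_pair[OF Csub trivial_on_subgroup[OF Qs Zsub]])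
  have KC: "?K\<subseteq>?C" by blast
  have Kcon: "k\<up>c\<in>?K" if c: "c\<in>?C" and k: "k\<in>?K" for c k
  proof -
   have kc: "k\<in>?C" "k\<in>carrier G" using k Cc by blast+
   have kC: "k\<up>c\<in>?C" using subgroup_conj[OF Csub kc(1) c] .
   moreover have "k\<up>c\<in>trivial_on Q Z"
   proof (rule trivial_onI[OF nQ[OF kC] nZ[OF kC]])
    fix q assume q: "q\<in>Q"
    have ci: "inv c\<in>?C" "c\<in>carrier G" using c Cc subgroup.m_inv_closed[OF Csub c] by blast+
    have qi: "q\<up>inv c\<in>Q" "q\<in>carrier G" using core(3)[OF ci(1) q] q Qs by blast+
    have e: "[.q\<up>inv c, k.]\<in>Z" using k qi(1) trivial_onD by blast
    have "[.q\<up>inv c, k.]\<up>c = [.(q\<up>inv c)\<up>c, k\<up>c.]"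
     by (rule conj_el_comm) (use qi Qs kc ci in auto)
    then have "[.q, k\<up>c.] = [.q\<up>inv c, k.]\<up>c" using qi ci by simp
    then show "[.q, k\<up>c.]\<in>Z" using Zfix[OF e c] e by simp
   qed
   ultimately show ?thesis by blast
  qed
  have "k [^] (3 ^ 2 :: nat) = \<one>" if k: "k\<in>?K" for k
  proof -
   have kc: "k\<in>?C" "k\<in>carrier G" using k Cc by blast+
   let ?h = "k\<otimes>(k\<otimes>k)"
   have "q\<up>?h = q" if q: "q\<in>Q" for q
   proof -
    have qc: "q\<in>carrier G" using q Qs by blast
    obtain z where z: "z\<in>Z" "q\<up>k = q\<otimes>z"
     using trivial_onD[of k Q Z q] k q conj_el_eq_comm[OF qc kc(2)] by blast
    have zc: "z\<in>carrier G" using z Zc by blast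
    have z3: "z\<otimes>(z\<otimes>z) = \<one>" using order_3_subgroup[OF Zsub Z3 z(1)] by (cases "z = \<one>") auto
    have "q\<up>?h = ((q\<up>k)\<up>k)\<up>k" using qc kc by (simp add: conj_el_conj m_assoc)
    also have "\<dots> = q\<otimes>(z\<otimes>(z\<otimes>z))"
     using qc kc zc z(2) Zfix[OF z(1) kc(1)] by (simp add: conj_el_mult m_assoc)
    finally show ?thesis using z3 qc by simp
   qed
   then have "?h\<in>CG Q" using kc Qs by (intro centralizerI) auto
   then have hQ: "?h\<in>Q" using self by blast
   have "k [^] (3 ^ 2 :: nat) = k [^] (3 * 3 :: nat)" by simp
   also have "\<dots> = (k [^] (3::nat)) [^] (3::nat)" using nat_pow_pow[OF kc(2), of 3 3] by simp
   also have "\<dots> = ?h [^] (3::nat)" using cube_eq[OF kc(2)] by simp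
   finally show ?thesis using Qcube[OF hQ] by simp
  qed
  then obtain m where "card ?K = 3 ^ m"
   using prime_power_orderI[OF Ksub _ p3, of 2] fin finite_subset[OF subgroup.subset[OF Ksub]] by blast
  then have "?K\<subseteq>Q" using core(5)[OF Ksub KC, of m] Kcon by blast
  moreover have "g\<in>?K" using g st trivial_onI[OF nQ[OF g] nZ[OF g]] by blast
  ultimately show ?thesis by blast
 qed
 have norm: "normalizing Z\<subseteq>normalizing Q"
 proof
  fix g assume g: "g\<in>normalizing Z"
  have gc: "g\<in>carrier G" using g by (rule normalizing_carrier)
  have gi: "inv g\<in>normalizing Z" using subgroup.m_inv_closed[OF normalizing_subgroup[OF Zc] g] .
  have Cc: "c\<in>carrier G" if "c\<in>?C" for c using that centralizer_carrier[of Z] by blast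
  have sub: "subgroup (Q\<Up>g) G" by (rule conj_set_subgroup[OF core(1) gc])
  have QgC: "Q\<Up>g\<subseteq>?C"
  proof
   fix v assume "v\<in>Q\<Up>g"
   then obtain q where q: "q\<in>Q" "v = q\<up>g" by (auto simp: conj_set_def)
   then show "v\<in>?C" using centralizer_normal[OF Zc, of q g] core(2) g by blast
  qed
  have inv: "v\<up>c\<in>Q\<Up>g" if c: "c\<in>?C" and v: "v\<in>Q\<Up>g" for c v
  proof -
   obtain q where q: "q\<in>Q" "v = q\<up>g" using v by (auto simp: conj_set_def)
   have cg: "c\<up>inv g\<in>?C" using centralizer_normal[OF Zc, of c "inv g"] c gi by blast
   have qc: "q\<in>carrier G" and cc: "c\<in>carrier G" using q Qs c Cc by blast+
   have "v\<up>c = (q\<up>(c\<up>inv g))\<up>g" using q qc cc gc by (simp add: word_simps)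
   then show ?thesis using core(3)[OF cg q(1)] by (simp add: conj_setI)
  qed
  have "card (Q\<Up>g) = 3 ^ 5" using card_conj_set[OF Qs gc] Q243 by simp
  then have "Q\<Up>g\<subseteq>Q" using core(5)[OF sub QgC, of 5] inv by blast
  then show "g\<in>normalizing Q" using conj_setI[of _ Q g] by (intro normalizingI[OF fQ Qs gc]) blast
 qed
 show ?thesis
 proof (rule large_extraspecial.intro[OF is_group], rule large_extraspecial_axioms.intro)
  show "finite (carrier G)" "subgroup Q G" "card Q = 243" "subgroup Z G" "card Z = 3" "Z\<subseteq>Q"
   "CG Q\<subseteq>Q" "normalizing Z\<subseteq>normalizing Q"
   by (fact fin core(1) Q243 Zsub Z3 ZQ self norm)+
  show "\<And>q. q\<in>Q ==> q\<in>Z \<longleftrightarrow> (\<forall>r\<in>Q. q\<otimes>r = r\<otimes>q)" using ZcQeq cQ by blast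
  show "\<And>q r. q\<in>Q ==> r\<in>Q ==> [.q, r.]\<in>Z" by (rule Qcomm)
  show "\<And>q. q\<in>Q ==> q [^] (3::nat) = \<one>" by (rule Qcube)
  fix g assume g: "g\<in>CG Z" "\<And>q. q\<in>Q ==> [.q, g.]\<in>Z"
  show "g\<in>Q" by (rule stab[OF g(1)]) (rule g(2))
 qed
qed

end

context extraspecial_pair begin

text \<open>A normal 3-subgroup of \<open>L\<close> fixes a nontrivial element of \<open>Y\<close>.  Its fixed
 points in \<open>Y\<close> are invariant under \<open>Q\<close> and \<open>Q\<^sub>1\<close>, so they contain
 \<open>Z\<close>, then \<open>Z\<^sub>1\<close>, and the subgroup centralizes \<open>Y\<close>.\<close>

lemma core_L: "p_core 3 (grp_on G L) = W"
proof -
 have p3: "prime (3::nat)" by simp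
 let ?M = "p_core 3 (grp_on G L)"
 note core = p_core_on[OF P.fin L_sub p3 refl]
 obtain k where k: "card ?M = 3 ^ k" using core(4) by blast
 have "card W = 3 ^ 5" using W_card by simp
 then have WM: "W\<subseteq>?M" using core(5)[OF W_sub _ L_norm_W] by blast
 have Mc: "m\<in>carrier G" "m\<in>L" if "m\<in>?M" for m using that core(2) Lc by blast+
 let ?F = "{y\<in>Y. \<forall>m\<in>?M. y\<up>m = y}"
 have Fc: "y\<in>carrier G" if "y\<in>?F" for y using that Yc by blast
 have Fm: "u\<otimes>v\<in>?F" if "u\<in>?F" "v\<in>?F" for u v
  using that Ym conj_el_mult[of u v] Fc Mc by auto
 have Fi: "inv u\<in>?F" if "u\<in>?F" for u
  using that Yi conj_el_inv[of u] Fc Mc by auto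
 have Fl: "u\<up>l\<in>?F" if u: "u\<in>?F" and l: "l\<in>L" for u l
 proof -
  have uc: "u\<in>carrier G" and lc: "l\<in>carrier G" using u l Fc by auto
  have "u\<up>l\<in>Y" using L_norm_Y l u normalizing_conj by blast
  moreover have "(u\<up>l)\<up>m = u\<up>l" if m: "m\<in>?M" for m
  proof -
   have m': "m\<up>inv l\<in>?M" using core(3)[OF Li[OF l] m] .
   have "(u\<up>l)\<up>m = (u\<up>(m\<up>inv l))\<up>l" using uc lc Mc[OF m] by (simp add: word_simps)
   then show ?thesis using u m' by simp
  qed
  ultimately show ?thesis by blast
 qed
 have "card Y mod 3 = card ?F mod 3"
 proof (rule p_group_fixed_points[OF core(1) k p3 finY])
  show "y\<up>m\<in>Y" if "m\<in>?M" "y\<in>Y" for m y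
   by (rule normalizing_conj[OF subsetD[OF L_norm_Y Mc(2)[OF that(1)]] that(2)])
  show "y\<up>\<one> = y" if "y\<in>Y" for y by (rule conj_el_one(1)[OF Yc[OF that]])
  show "y\<up>(m\<otimes>m') = (y\<up>m)\<up>m'" if "m\<in>?M" "m'\<in>?M" "y\<in>Y" for m m' y
   by (rule conj_el_conj[OF Yc[OF that(3)] Mc(1)[OF that(1)] Mc(1)[OF that(2)], symmetric])
 qed
 then have F1: "card ?F~=1" using Y_card by auto
 have oneF: "\<one>\<in>?F" using Y1 Mc by simp
 have "?F~={\<one>}"
 proof
  assume e: "?F = {\<one>}"
  have "card ?F = 1" unfolding e by simp
  then show False using F1 by blast
 qed
 from other_member[OF oneF this] obtain y where y: "y\<in>?F" "y~=\<one>" by (rule bexE)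
 obtain z where z: "z\<in>?F" "z\<in>Z" "z~=\<one>"
 proof (cases "y\<in>Z")
  case True then show ?thesis using that y by blast
 next
  case False
  obtain q where q: "q\<in>Q" "q~:A" by (rule Q_not_A)
  have yY: "y\<in>Y" "y\<in>carrier G" "q\<in>carrier G" using y q Fc by auto
  have ne: "y\<up>q~=y" using Y_commuting_Q[OF q yY(1)] False by blast
  have e: "[.y, q.] = inv y\<otimes>(y\<up>q)" using comm_eq_conj yY by blast
  have "y\<up>q\<in>?F" using Fl[OF y(1)] q QL by blast
  then have "[.y, q.]\<in>?F" unfolding e using Fm[OF Fi[OF y(1)]] by blast
  moreover have "[.y, q.]\<in>Z" using P.Q_comm yY YQ q by blast
  moreover have "[.y, q.]~=\<one>" using comm_one_iff'[OF yY(2,3)] ne by blast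
  ultimately show ?thesis using that by blast
 qed
 have ZF: "Z\<subseteq>?F" using P.Z_gen(1)[OF z(2,3)] z(1) Fm[OF z(1) z(1)] oneF by blast
 obtain z1 where z1: "z1\<in>Z1" "z1~=\<one>" by (rule R.Z_ex)
 have zQ: "z\<in>Q1" "z~:Z1" using z ZQ1 dis by blast+
 obtain r where r: "r\<in>Q1" "[.r, z.] = z1" using R.comm_onto[OF zQ z1(1)] by blast
 have rc: "r\<in>carrier G" "r\<in>L" "z\<in>carrier G" using r QL z by auto
 have "[.z, r.]\<in>?F" using comm_eq_conj[OF rc(3,1)] Fm[OF Fi[OF z(1)] Fl[OF z(1) rc(2)]] by simp
 then have "inv [.z, r.]\<in>?F" by (rule Fi)
 then have z1F: "z1\<in>?F" using inv_comm_swap[OF rc(3,1)] r(2) by simp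
 have Z1F: "Z1\<subseteq>?F" using R.Z_gen(1)[OF z1] z1F Fm[OF z1F z1F] oneF by blast
 have fixed: "y\<up>m = y" if y: "y\<in>Y" and m: "m\<in>?M" for y m
 proof -
  obtain a b where ab: "a\<in>Z" "b\<in>Z1" "y = a\<otimes>b" using y unfolding set_mult_def by blast
  have "a\<otimes>b\<in>?F" by (rule Fm[OF subsetD[OF ZF ab(1)] subsetD[OF Z1F ab(2)]])
  then show ?thesis unfolding ab(3) using m by blast
 qed
 have "?M\<subseteq>CG Y"
 proof
  fix m assume m: "m\<in>?M"
  show "m\<in>CG Y" by (rule centralizerI) (use Mc[OF m] Y_carrier fixed[OF _ m] in auto)
 qed
 then show ?thesis using WM core(2) by blast
qed

lemma W_exponent: "group_exponent (grp_on G W) = 3"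
proof -
 obtain z where z: "z\<in>Z" "z~=\<one>" by (rule P.Z_ex)
 have "z\<in>W" using z ZY YA AW by blast
 then show ?thesis using group_exponent_3I[OF W_sub W_cube _ z(2)] by blast
qed

lemma S_sylow: "sylow_subgroup 3 (grp_on G L) Syl"
proof -
 have "order (grp_on G L) = 5832" using card_L_W W_card by (simp add: order_def)
 moreover have "multiplicity 3 (5832::nat) = 6" by (rule multiplicity_eqI) simp_all
 moreover have "subgroup Syl (grp_on G L)" using subgroup_incl[OF S_sub L_sub SL] .
 ultimately show ?thesis using S_card by (simp add: sylow_subgroup_def)
qed

text \<open>\<open>Q\<close> permutes transitively the subgroups of order 3 of \<open>Y\<close> other than
 \<open>Z\<close>, and \<open>Z\<^sub>1\<close> is one of them.\<close>

lemma Y_elements_conjugate_centre: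
 assumes y: "y\<in>Y" "y~=\<one>"
 shows "\<exists>Zy Qy. large_extraspecial G Zy Qy \<and> y\<in>Zy \<and> Y\<subseteq>Qy"
proof (cases "y\<in>Z")
 case True
 then show ?thesis using P.large_extraspecial_axioms YQ by blast
next
 case False
 obtain z w where zw: "z\<in>Z" "w\<in>Z1" "y = z\<otimes>w" using y(1) unfolding set_mult_def by blast
 have "w~=\<one>" using zw False by auto
 then have w: "w\<in>Q" "w~:Z" using zw Z1Q dis by blast+
 obtain q where q: "q\<in>Q" "[.q, w.] = inv z" using P.comm_onto[OF w P.Zi[OF zw(1)]] by blast
 have c: "q\<in>carrier G" "w\<in>carrier G" "z\<in>carrier G" using q w zw by auto
 have "[.w, q.] = z" using inv_comm_swap[OF c(1,2)] q(2) c(3) by simp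
 then have "w\<up>q = y" using conj_el_eq_comm[OF c(2,1)] ZZ1_commute[OF zw(1,2)] zw(3) by simp
 then have "y\<in>Z1\<Up>q" using conj_setI[OF zw(2), of q] by simp
 moreover have "Y\<subseteq>Q1\<Up>q"
 proof -
  have "Y\<Up>q = Y" using Q_norm_Y q(1) unfolding normalizing_def by blast
  then show ?thesis using conj_set_mono[OF YQ1, of q] by simp
 qed
 ultimately show ?thesis using R.conj_large[OF c(1)] by blast
qed

text \<open>If \<open>n\<in>M\<close> commutes with \<open>1\<noteq>y\<in>Y\<close>, it normalizes the
 extraspecial group \<open>Q'\<close> of \<open>y\<close>, and \<open>[Y, n]\<close> lies in \<open>Q' \<inter>
 M = 1\<close>.  So the noncyclic group \<open>Y\<close> centralizes each \<open>Y\<close>-invariant Sylow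
 subgroup of \<open>M\<close>.\<close>

lemma coprime_centralized:
 assumes N: "subgroup M G" "coprime (card M) 3" "Y\<subseteq>normalizing M"
 shows "M\<subseteq>CG Y"
proof -
 have fM: "finite M" using P.fin subgroup.subset[OF N(1)] finite_subset by blast
 have Mc: "m\<in>carrier G" if "m\<in>M" for m using that N(1) subgroup_carrier by blast
 have key: "n\<in>CG Y" if n: "n\<in>M" and y: "y\<in>Y" "y~=\<one>" and f: "n\<up>y = n" for n y
 proof -
  obtain Zy Qy where ZQy: "large_extraspecial G Zy Qy" "y\<in>Zy" "Y\<subseteq>Qy"
   using Y_elements_conjugate_centre[OF y] by blast
  interpret H: large_extraspecial G Zy Qy by (rule ZQy(1))
  have nc: "n\<in>carrier G" using n Mc by blast
  have yc: "y\<in>carrier G" using y by simp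
  have ny: "y\<up>n = y" using conj_el_fixed[OF nc yc] conj_el_fixed[OF yc nc] f by simp
  have "z\<up>n = z" if "z\<in>Zy" for z
  proof -
   have "z = \<one> \<or> z = y \<or> z = y\<otimes>y" using H.Z_gen(1)[OF ZQy(2) y(2)] that by blast
   then show ?thesis using ny nc yc conj_el_mult[OF yc yc nc] by auto
  qed
  then have "n\<in>CG Zy" using nc H.Z_carrier by (intro centralizerI) auto
  then have nQ: "n\<in>normalizing Qy" using H.cent_Z_normalizes by blast
  have sub: "subgroup (Qy\<inter>M) G" by (rule subgroups_Inter_pair[OF H.Q_sub N(1)])
  have one: "Qy\<inter>M = {\<one>}"
  proof -
   have d: "card (Qy\<inter>M) dvd card Qy" "card (Qy\<inter>M) dvd card M"
    using card_subgroup_dvd[OF H.Q_sub sub _ H.finQ] card_subgroup_dvd[OF N(1) sub _ fM] by blast+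
   have "coprime (card M) (3 ^ 5)" by (rule coprime_power_right_iff[THEN iffD2]) (use N(2) in simp)
   then have "coprime (card M) (card Qy)" using H.Q_card by simp
   then have "is_unit (card (Qy\<inter>M))" using d coprime_common_divisor by blast
   then have "card (Qy\<inter>M) = 1" by simp
   then show ?thesis using subgroup.one_closed[OF sub] by (metis card_1_singletonE singletonD)
  qed
  have "y'\<up>n = y'" if y': "y'\<in>Y" for y'
  proof -
   have c: "y'\<in>carrier G" using y' by simp
   have Q: "y'\<in>Qy" using y' ZQy by blast
   have "[.y', n.]\<in>Qy" using comm_eq_conj[OF c nc] H.Qm[OF H.Qi[OF Q] normalizing_conj[OF nQ Q]] by simp
   moreover have "[.y', n.]\<in>M"
   proof -
    have "[.y', n.] = inv n\<up>y'\<otimes>n" using c nc by (simp add: word_simps)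
    moreover have "inv n\<up>y'\<in>M" using normalizing_conj N(3) y' subgroup.m_inv_closed[OF N(1) n] by blast
    ultimately show ?thesis using subgroup.m_closed[OF N(1) _ n] by simp
   qed
   ultimately have "[.y', n.] = \<one>" using one by blast
   then show ?thesis using comm_one_iff'[OF c nc] by blast
  qed
  then show ?thesis using nc Y_carrier by (intro centralizerI) auto
 qed
 obtain z where z: "z\<in>Z" "z~=\<one>" by (rule P.Z_ex)
 obtain t where t: "t\<in>Z1" "t~=\<one>" by (rule R.Z_ex)
 have zY: "z\<in>Y" "t\<in>Y" using z t ZY Z1Y by blast+
 have ti: "t\<otimes>t\<in>Z1" using R.Zm[OF t(1) t(1)] .
 have notinv: "z\<otimes>v~=\<one>" if v: "v\<in>Z1" for v
 proof
  assume e: "z\<otimes>v = \<one>"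
  have "z = inv v" using e v z by (simp add: inv_equality)
  then have "z\<in>Z1" using R.Zi[OF v] by simp
  then show False using dis z by blast
 qed
 let ?D = "M\<inter>CG Y"
 have Dsub: "subgroup ?D G" by (rule subgroups_Inter_pair[OF N(1) C_sub])
 have "card M dvd card ?D"
 proof (rule multiplicity_le_imp_dvd)
  show "card M~=0" using fM subgroup.one_closed[OF N(1)] by auto
  fix q :: nat assume q: "prime q"
  show "multiplicity q (card M) \<le> multiplicity q (card ?D)"
  proof (cases "q = 3")
   case True
   then have "\<not> q dvd card M" using N(2) q by (metis coprime_common_divisor dvd_refl not_prime_unit)
   then show ?thesis by (simp add: not_dvd_imp_multiplicity_0)
  next
   case False
   obtain R where R: "subgroup R G" "R\<subseteq>M" "card R = q ^ multiplicity q (card M)" "Y\<subseteq>normalizing R"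
    using invariant_sylow_exists[OF N(1) fM N(2) Y_sub Y_card N(3) q] by blast
   have fR: "finite R" using R fM finite_subset by blast
   have "R\<subseteq>CG Y"
   proof (rule coprime_action_centralizes_p_group[OF zY Y_abelian[OF zY] Y_carrier _ _ z(2) t(2) notinv[OF t(1)] notinv[OF ti] q False R(1) fR R(3,4)])
    show "\<And>y. y\<in>Y ==> y\<otimes>(y\<otimes>y) = \<one>" by (rule Y_cube)
    show "\<And>y y'. y\<in>Y ==> y'\<in>Y ==> y\<otimes>y'\<in>Y" by (rule Ym)
    fix r y assume r: "r\<in>R" "y\<in>Y" "y~=\<one>" "r\<up>y = r"
    show "r\<in>CG Y" by (rule key[OF subsetD[OF R(2) r(1)] r(2-4)])
   qed
   then have "R\<subseteq>?D" using R by blast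
   then have "card R dvd card ?D" using card_subgroup_dvd[OF Dsub R(1)] fM by blast
   moreover have "card ?D~=0" using fM subgroup.one_closed[OF Dsub] by auto
   ultimately show ?thesis using R(3) q by (intro multiplicity_geI) (auto dest: prime_gt_1_nat)
  qed
 qed
 then have "card M \<le> card ?D" using fM subgroup.one_closed[OF Dsub] by (intro dvd_imp_le) (auto simp: card_gt_0_iff)
 then have "?D = M" using card_seteq[OF fM, of ?D] by blast
 then show ?thesis by blast
qed

lemma coprime_commutator:
 assumes N: "subgroup M G" "coprime (card M) 3" "Y\<subseteq>normalizing M"
 shows "commutator_subgroup G Y M = {\<one>}"
proof -
 have triv: "[.y, m.] = \<one>" if "y\<in>Y" "m\<in>M" for y m
 proof -
  have "m\<in>CG Y" using coprime_centralized[OF N] that by blast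
  then have "m\<in>carrier G" "m\<otimes>y = y\<otimes>m" using centralizer_carrier centralizerD that by blast+
  then show ?thesis using comm_one_iff[of y m] that by simp
 qed
 have "{[.y, m.] | y m. y\<in>Y \<and> m\<in>M} = {\<one>}"
 proof
  show "{[.y, m.] | y m. y\<in>Y \<and> m\<in>M}\<subseteq>{\<one>}"
  proof
   fix v assume "v\<in>{[.y, m.] | y m. y\<in>Y \<and> m\<in>M}"
   then obtain y m where "y\<in>Y" "m\<in>M" "v = [.y, m.]" by blast
   then show "v\<in>{\<one>}" using triv[of y m] by simp
  qed
  have one: "\<one>\<in>M" by (rule subgroup.one_closed[OF N(1)])
  show "{\<one>}\<subseteq>{[.y, m.] | y m. y\<in>Y \<and> m\<in>M}" using triv[OF Y1 one, symmetric] Y1 one by blast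
 qed
 then show ?thesis unfolding commutator_subgroup_def by (simp add: generate_one)
qed

end

section \<open>Heisenberg groups of order 27\<close>

context group begin

lemma inverts_sectionI:
 assumes A: "subgroup A G" "finite A" and B: "B \<lhd> G\<lparr>carrier := A\<rparr>" and u: "u\<in>carrier G"
  and uA: "\<And>a. a\<in>A ==> a\<up>u\<in>A" and uB: "\<And>b. b\<in>B ==> b\<up>u\<in>B"
  and inv: "\<And>a. a\<in>A ==> (a\<up>u)\<otimes>a\<in>B"
 shows "inverts_section G u A B"
proof -
 interpret M: group "G\<lparr>carrier := A\<rparr> Mod B" by (rule normal.factorgroup_is_group[OF B])
 have Ac: "A\<subseteq>carrier G" using subgroup.subset[OF A(1)] .
 have Bs: "subgroup B G" using incl_subgroup[OF A(1) normal_imp_subgroup[OF B]] .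
 have BA: "B\<subseteq>A" using subgroup.subset[OF normal_imp_subgroup[OF B]] by simp
 have fB: "finite B" using BA A(2) finite_subset by blast
 have Bc: "B\<subseteq>carrier G" using BA Ac by blast
 have 1: "A\<Up>u = A" using normalizingI[OF A(2) Ac u uA] by (simp add: normalizing_def)
 have 2: "B\<Up>u = B" using normalizingI[OF fB Bc u uB] by (simp add: normalizing_def)
 have 3: "B #> (a\<up>u) = inv\<^bsub>G\<lparr>carrier := A\<rparr> Mod B\<^esub> (B #> a)" if a: "a\<in>A" for a
 proof -
  have "(B #> (a\<up>u))<#>(B #> a) = B #> ((a\<up>u)\<otimes>a)" by (rule section_mult[OF A(1) B uA[OF a] a])
  also have "\<dots> = B" using rcos_eq_self_iff[OF Bs] inv[OF a] Bc by blast
  finally have "(B #> (a\<up>u)) \<otimes>\<^bsub>G\<lparr>carrier := A\<rparr> Mod B\<^esub> (B #> a) = \<one>\<^bsub>G\<lparr>carrier := A\<rparr> Mod B\<^esub>"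
   by (simp add: FactGroup_def set_mult_def)
  moreover have "B #> (a\<up>u)\<in>carrier (G\<lparr>carrier := A\<rparr> Mod B)" "B #> a\<in>carrier (G\<lparr>carrier := A\<rparr> Mod B)"
   unfolding section_carrier using a uA by blast+
  ultimately show ?thesis using M.inv_equality by metis
 qed
 show ?thesis unfolding inverts_section_def using 1 2 3 by blast
qed

lemma power_shift:
 assumes c: "p\<in>carrier G" "q\<in>carrier G" "d\<in>carrier G" and dq: "d\<otimes>q = q\<otimes>d" and e: "q\<otimes>p = p\<otimes>(q\<otimes>d)"
 shows "q [^] (n::nat)\<otimes>p = p\<otimes>(q [^] n\<otimes>d [^] n)"
proof (induction n)
 case 0 then show ?case using c by simp
next
 case (Suc n)
 have dn: "d [^] n\<otimes>q = q\<otimes>d [^] n"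
  using group_commutes_pow[OF dq c(3,2), of n] .
 have "q [^] Suc n\<otimes>p = q [^] n\<otimes>(q\<otimes>p)" using c by (simp add: m_assoc)
 also have "\<dots> = (q [^] n\<otimes>p)\<otimes>(q\<otimes>d)" unfolding e using c by (simp add: m_assoc)
 also have "\<dots> = p\<otimes>(q [^] n\<otimes>((d [^] n\<otimes>q)\<otimes>d))" unfolding Suc.IH using c by (simp add: m_assoc)
 also have "\<dots> = p\<otimes>(q [^] Suc n\<otimes>d [^] Suc n)" unfolding dn using c by (simp add: m_assoc)
 finally show ?case .
qed

lemma power_shift2:
 assumes c: "p\<in>carrier G" "q\<in>carrier G" "d\<in>carrier G" and dq: "d\<otimes>q = q\<otimes>d" and dp: "d\<otimes>p = p\<otimes>d"
  and e: "q\<otimes>p = p\<otimes>(q\<otimes>d)"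
 shows "q [^] (n::nat)\<otimes>p [^] (m::nat) = p [^] m\<otimes>(q [^] n\<otimes>d [^] (n * m))"
proof (induction m)
 case 0 then show ?case using c by simp
next
 case (Suc m)
 have dm: "d [^] (n * m)\<otimes>p = p\<otimes>d [^] (n * m)"
  using group_commutes_pow[OF dp c(3,1), of "n * m"] .
 have "q [^] n\<otimes>p [^] Suc m = (q [^] n\<otimes>p [^] m)\<otimes>p" using c by (simp add: m_assoc)
 also have "\<dots> = p [^] m\<otimes>(q [^] n\<otimes>(d [^] (n * m)\<otimes>p))" unfolding Suc.IH using c by (simp add: m_assoc)
 also have "\<dots> = p [^] m\<otimes>((q [^] n\<otimes>p)\<otimes>d [^] (n * m))" unfolding dm using c by (simp add: m_assoc)
 also have "\<dots> = p [^] m\<otimes>(p\<otimes>(q [^] n\<otimes>(d [^] n\<otimes>d [^] (n * m))))"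
  unfolding power_shift[OF c dq e] using c by (simp add: m_assoc)
 also have "\<dots> = p [^] Suc m\<otimes>(q [^] n\<otimes>d [^] (n * Suc m))" using c by (simp add: m_assoc nat_pow_mult)
 finally show ?case .
qed

definition heis :: "'a \<Rightarrow> 'a \<Rightarrow> 'a \<Rightarrow> nat \<times> nat \<times> nat \<Rightarrow> 'a" where
 "heis p q d = (\<lambda>(i, j, k). p [^] i\<otimes>(q [^] j\<otimes>d [^] k))"

text \<open>Exponents multiply in this way when \<open>qp = pqd\<close> with \<open>d\<close> central of order
 3.\<close>

definition heis_mult :: "nat \<times> nat \<times> nat \<Rightarrow> nat \<times> nat \<times> nat \<Rightarrow> nat \<times> nat \<times> nat" where
 "heis_mult = (\<lambda>(i, j, k) (i', j', k'). ((i + i') mod 3, (j + j') mod 3, (k + k' + j * i') mod 3))"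

definition heisenberg_basis :: "'a set \<Rightarrow> 'a \<Rightarrow> 'a \<Rightarrow> 'a \<Rightarrow> bool" where
 "heisenberg_basis X p q d \<longleftrightarrow> subgroup X G \<and> card X = 27 \<and> p\<in>X \<and> q\<in>X \<and> d\<in>X \<and>
  p [^] (3::nat) = \<one> \<and> q [^] (3::nat) = \<one> \<and> d [^] (3::nat) = \<one> \<and> d~=\<one> \<and>
  d\<otimes>q = q\<otimes>d \<and> d\<otimes>p = p\<otimes>d \<and> q\<otimes>p = p\<otimes>(q\<otimes>d)"

abbreviation cube3 :: "(nat \<times> nat \<times> nat) set" where
 "cube3 \<equiv> {0..<3} \<times> {0..<3} \<times> {0..<3}"

lemma heis_mult_closed: "heis_mult s t\<in>cube3"
 by (cases s; cases t) (simp add: heis_mult_def)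

lemma heis_hom:
 assumes b: "heisenberg_basis X p q d"
 shows "heis p q d s\<otimes>heis p q d t = heis p q d (heis_mult s t)"
proof -
 obtain i j k where s: "s = (i, j, k)" by (cases s)
 obtain i' j' k' where t: "t = (i', j', k')" by (cases t)
 have c: "p\<in>carrier G" "q\<in>carrier G" "d\<in>carrier G"
  using b subgroup_carrier unfolding heisenberg_basis_def by blast+
 have e: "d\<otimes>q = q\<otimes>d" "d\<otimes>p = p\<otimes>d" "q\<otimes>p = p\<otimes>(q\<otimes>d)" "p [^] (3::nat) = \<one>" "q [^] (3::nat) = \<one>" "d [^] (3::nat) = \<one>"
  using b unfolding heisenberg_basis_def by blast+
 have dp: "d [^] n\<otimes>p [^] m = p [^] m\<otimes>d [^] n" for n m :: nat
  using group_commutes_pow[OF group_commutes_pow[OF e(2) c(3,1), of n, symmetric] c(1) nat_pow_closed[OF c(3)], of m] by (rule sym)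
 have dq: "d [^] n\<otimes>q [^] m = q [^] m\<otimes>d [^] n" for n m :: nat
  using group_commutes_pow[OF group_commutes_pow[OF e(1) c(3,2), of n, symmetric] c(2) nat_pow_closed[OF c(3)], of m] by (rule sym)
 have "heis p q d s\<otimes>heis p q d t = p [^] i\<otimes>(q [^] j\<otimes>((d [^] k\<otimes>p [^] i')\<otimes>(q [^] j'\<otimes>d [^] k')))"
  unfolding heis_def s t using c by (simp add: m_assoc)
 also have "\<dots> = p [^] i\<otimes>((q [^] j\<otimes>p [^] i')\<otimes>((d [^] k\<otimes>q [^] j')\<otimes>d [^] k'))"
  unfolding dp using c by (simp add: m_assoc)
 also have "\<dots> = p [^] i\<otimes>(p [^] i'\<otimes>(q [^] j\<otimes>(d [^] (j * i')\<otimes>q [^] j')\<otimes>(d [^] k\<otimes>d [^] k')))"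
  unfolding dq[of k j'] power_shift2[OF c e(1,2,3)] using c by (simp add: m_assoc)
 also have "\<dots> = p [^] (i + i')\<otimes>(q [^] (j + j')\<otimes>d [^] (j * i' + (k + k')))"
  unfolding dq using c by (simp add: m_assoc flip: nat_pow_mult)
 also have "\<dots> = p [^] ((i + i') mod 3)\<otimes>(q [^] ((j + j') mod 3)\<otimes>d [^] ((j * i' + (k + k')) mod 3))"
  using pow_mod_3[OF c(1) e(4)] pow_mod_3[OF c(2) e(5)] pow_mod_3[OF c(3) e(6)] by presburger
 finally show ?thesis unfolding heis_def heis_mult_def s t by (simp add: add.commute add.left_commute)
qed

text \<open>The exponents \<open>i\<close> and \<open>j\<close> of an element are read off from its commutators
 with \<open>q\<close> and \<open>p\<close>.\<close>

lemma heis_bij: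
 assumes b: "heisenberg_basis X p q d"
 shows "bij_betw (heis p q d) cube3 X"
proof -
 have X: "subgroup X G" "card X = 27" "p\<in>X" "q\<in>X" "d\<in>X" "d~=\<one>" using b unfolding heisenberg_basis_def by blast+
 have c: "p\<in>carrier G" "q\<in>carrier G" "d\<in>carrier G" using X subgroup_carrier by blast+
 have e: "d\<otimes>q = q\<otimes>d" "d\<otimes>p = p\<otimes>d" "q\<otimes>p = p\<otimes>(q\<otimes>d)" "p [^] (3::nat) = \<one>" "q [^] (3::nat) = \<one>" "d [^] (3::nat) = \<one>"
  using b unfolding heisenberg_basis_def by blast+
 let ?e = "heis p q d"
 have ec: "?e s\<in>X" for s
 proof (cases s)
  case (fields i j k)
  then show ?thesis unfolding heis_def using subgroup_pow[OF X(1) X(3)] subgroup_pow[OF X(1) X(4)] subgroup_pow[OF X(1) X(5)]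
   subgroup.m_closed[OF X(1)] by simp
 qed
 have ecc: "?e s\<in>carrier G" for s using subgroup_carrier[OF X(1) ec] .
 have pows: "d [^] i = d [^] j ==> i = j" if "i < 3" "j < 3" for i j :: nat
 proof -
  have d2: "d [^] (2::nat) = d\<otimes>d" using c by (simp add: numeral_2_eq_2)
  have d3: "d\<otimes>(d\<otimes>d) = \<one>" using cube_eq[OF c(3)] e(6) by simp
  have n2: "d\<otimes>d~=\<one>" using d3 X(6) c(3) by auto
  have n3: "d\<otimes>d~=d" using X(6) c(3) by simp
  have "i = 0 \<or> i = 1 \<or> i = 2" "j = 0 \<or> j = 1 \<or> j = 2" using that by auto
  then show "d [^] i = d [^] j ==> i = j" using X(6) n2 n3 X(6)[symmetric] n2[symmetric] n3[symmetric] c(3) d2 by (elim disjE) simp_all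
 qed
 have p1: "p [^] (1::nat) = p" "q [^] (1::nat) = q" using c by simp_all
 have qs: "q\<otimes>?e (i, j, k) = ?e (i, j, k)\<otimes>(q\<otimes>d [^] i)" if "i < 3" "j < 3" "k < 3" for i j k
 proof -
  have q: "q = ?e (0, 1, 0)" and qd: "q\<otimes>d [^] i = ?e (0, 1, i)" unfolding heis_def using c by simp_all
  have "heis_mult (0, 1, 0) (i, j, k) = heis_mult (i, j, k) (0, 1, i)" by (simp add: heis_mult_def ac_simps)
  then show ?thesis using heis_hom[OF b] q qd by metis
 qed
 have ps: "?e (i, j, k)\<otimes>p = p\<otimes>?e (i, j, k)\<otimes>d [^] j" if "i < 3" "j < 3" "k < 3" for i j k
 proof -
  have p: "p = ?e (1, 0, 0)" and d: "d [^] j = ?e (0, 0, j)" unfolding heis_def using c by simp_all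
  have "heis_mult (i, j, k) (1, 0, 0) = heis_mult (heis_mult (1, 0, 0) (i, j, k)) (0, 0, j)"
   by (simp add: heis_mult_def mod_simps ac_simps)
  then show ?thesis using heis_hom[OF b] p d by metis
 qed
 have inj: "inj_on ?e cube3"
 proof (rule inj_onI)
  fix s t assume st: "s\<in>cube3" "t\<in>cube3" and eq: "?e s = ?e t"
  obtain i j k where s: "s = (i, j, k)" "i < 3" "j < 3" "k < 3" using st(1) by auto
  obtain i' j' k' where t: "t = (i', j', k')" "i' < 3" "j' < 3" "k' < 3" using st(2) by auto
  have "?e t\<otimes>(q\<otimes>d [^] i) = ?e t\<otimes>(q\<otimes>d [^] i')"
   using qs[OF s(2-)] qs[OF t(2-)] eq unfolding s(1) t(1) by simp
  then have "d [^] i = d [^] i'" using ecc c by simp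
  then have i: "i = i'" using pows s t by blast
  have "p\<otimes>?e t\<otimes>d [^] j = p\<otimes>?e t\<otimes>d [^] j'"
   using ps[OF s(2-)] ps[OF t(2-)] eq unfolding s(1) t(1) by simp
  then have "d [^] j = d [^] j'" using ecc c by simp
  then have j: "j = j'" using pows s t by blast
  have "d [^] k = d [^] k'" using eq c unfolding s(1) t(1) i j heis_def by simp
  then have "k = k'" using pows s t by blast
  then show "s = t" using i j s t by simp
 qed
 have "card (?e ` cube3) = card X" using card_image[OF inj] X(2) by (simp add: card_cartesian_product)
 moreover have "?e ` cube3\<subseteq>X" using ec by blast
 moreover have "finite X" using X(2) by (metis card.infinite zero_neq_numeral)
 ultimately have "?e ` cube3 = X" using card_subset_eq by blast
 then show ?thesis using inj by (simp add: bij_betw_def)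
qed

lemma heisenberg_iso:
 assumes X: "heisenberg_basis X p q d" and X': "heisenberg_basis X' p' q' d'"
 shows "G\<lparr>carrier := X\<rparr> \<cong> G\<lparr>carrier := X'\<rparr>"
proof -
 let ?e = "heis p q d" and ?e' = "heis p' q' d'"
 let ?f = "?e' \<circ> inv_into cube3 ?e"
 have b: "bij_betw ?f X X'"
  using bij_betw_trans[OF bij_betw_inv_into[OF heis_bij[OF X]] heis_bij[OF X']] .
 have f: "?f (?e s) = ?e' s" if "s\<in>cube3" for s
  using bij_betw_inv_into_left[OF heis_bij[OF X] that] by simp
 have h: "?f (x\<otimes>y) = ?f x\<otimes>?f y" if x: "x\<in>X" and y: "y\<in>X" for x y
 proof -
  have im: "?e ` cube3 = X" using heis_bij[OF X] by (rule bij_betw_imp_surj_on)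
  obtain s where s: "s\<in>cube3" "x = ?e s" using x im by blast
  obtain t where t: "t\<in>cube3" "y = ?e t" using y im by blast
  have "?f (x\<otimes>y) = ?f (?e (heis_mult s t))" using heis_hom[OF X, of s t] s(2) t(2) by presburger
  also have "\<dots> = ?e' (heis_mult s t)" by (rule f[OF heis_mult_closed])
  also have "\<dots> = ?e' s\<otimes>?e' t" using heis_hom[OF X', of s t] by simp
  also have "\<dots> = ?f x\<otimes>?f y" using f s t by presburger
  finally show ?thesis .
 qed
 have "?f\<in>iso (grp_on G X) (grp_on G X')"
  unfolding iso_def hom_def using b h bij_betwE[OF b] by auto
 then show ?thesis by (auto simp: is_iso_def)
qed

end

lemma divisors_27: "(n::nat) dvd 27 ==> n = 1 \<or> n = 3 \<or> n = 9 \<or> n = 27"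
proof -
 assume "n dvd 27"
 then have "n dvd 3 ^ 3" by simp
 moreover have "prime (3::nat)" by simp
 ultimately obtain i where "i \<le> 3" "n = 3 ^ i" using divides_primepow_nat[of 3 n 3] by blast
 moreover from this have "i = 0 \<or> i = 1 \<or> i = 2 \<or> i = 3" by auto
 ultimately show ?thesis by auto
qed

lemma divisors_243: "(n::nat) dvd 243 ==> n = 1 \<or> n = 3 \<or> n = 9 \<or> n = 27 \<or> n = 81 \<or> n = 243"
proof -
 assume "n dvd 243"
 then have "n dvd 3 ^ 5" by simp
 moreover have "prime (3::nat)" by simp
 ultimately obtain i where "i \<le> 5" "n = 3 ^ i" using divides_primepow_nat[of 3 n 5] by blast
 moreover from this have "i = 0 \<or> i = 1 \<or> i = 2 \<or> i = 3 \<or> i = 4 \<or> i = 5" by auto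
 ultimately show ?thesis by auto
qed

context large_extraspecial begin

lemma commute_iff: "[|q\<in>Q; r\<in>Q|] ==> q\<otimes>r = r\<otimes>q \<longleftrightarrow> [.q, r.] = \<one>"
 using comm_one_iff[of q r] Qc by blast

lemma cent_in_subgroup:
 assumes X: "subgroup X G" "Z\<subseteq>X" "X\<subseteq>Q" and x: "x\<in>X"
 shows "subgroup (X\<inter>CG {x}) G" "Z\<subseteq>X\<inter>CG {x}" "x\<in>X\<inter>CG {x}"
  "\<And>y. y\<in>X\<inter>CG {x} ==> y\<in>X \<and> y\<otimes>x = x\<otimes>y"
  "\<And>y. y\<in>X ==> y\<otimes>x = x\<otimes>y ==> y\<in>X\<inter>CG {x}"
proof -
 have xc: "{x}\<subseteq>carrier G" "x\<in>Q" using x X Qc by blast+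
 show "subgroup (X\<inter>CG {x}) G" by (rule subgroups_Inter_pair[OF X(1) centralizer_subgroup[OF xc(1)]])
 show 1: "\<And>y. y\<in>X\<inter>CG {x} ==> y\<in>X \<and> y\<otimes>x = x\<otimes>y" using centralizerD by blast
 show 2: "y\<in>X\<inter>CG {x}" if "y\<in>X" "y\<otimes>x = x\<otimes>y" for y
  using that X Qc unfolding centralizer_def by blast
 show "Z\<subseteq>X\<inter>CG {x}" using 2 Z_commutes X(2) xc(2) by blast
 show "x\<in>X\<inter>CG {x}" using 2 x by blast
qed

text \<open>A group of order 9 is abelian, so it would be its own centre.\<close>

lemma card_not_9:
 assumes X: "subgroup X G" "Z\<subseteq>X" "X\<subseteq>Q" and cen: "\<And>x. x\<in>X ==> (\<And>y. y\<in>X ==> y\<otimes>x = x\<otimes>y) ==> x\<in>Z"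
 shows "card X~=9"
proof
 assume c: "card X = 9"
 have fX: "finite X" using X finQ finite_subset by blast
 have "X~=Z" using c Z_card by auto
 then obtain x where x: "x\<in>X" "x~:Z" using X(2) by blast
 note cx = cent_in_subgroup[OF X x(1)]
 let ?K = "X\<inter>CG {x}"
 have d: "card ?K dvd 9" using card_subgroup_dvd[OF X(1) cx(1) _ fX] c by simp
 have "Z \<subset> ?K" using cx(2,3) x by blast
 then have "3 < card ?K" using psubset_card_mono[of ?K Z] fX Z_card by simp
 moreover have "card ?K = 1 \<or> card ?K = 3 \<or> card ?K = 9 \<or> card ?K = 27" using divisors_27[OF dvd_trans[OF d, of 27]] by simp
 ultimately have "card ?K = 9" using d dvd_imp_le[OF d] by auto
 then have "?K = X" using card_subset_eq[OF fX, of ?K] c by simp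
 then have "\<And>y. y\<in>X ==> y\<otimes>x = x\<otimes>y" using cx(4) by blast
 then show False using cen[OF x(1)] x(2) by blast
qed

text \<open>A maximal subgroup \<open>M\<close> not containing \<open>Z\<close> would satisfy \<open>MZ =
 X\<close> and so contain all commutators.  Conversely an element outside \<open>Z\<close> is avoided by the
 centralizer of some noncentral element, which is maximal.\<close>

lemma extraspecial_27:
 assumes X: "subgroup X G" "Z\<subseteq>X" "X\<subseteq>Q" and cen: "\<And>x. x\<in>X ==> (\<And>y. y\<in>X ==> y\<otimes>x = x\<otimes>y) ==> x\<in>Z"
  and c: "card X = 27"
 shows "extraspecial_plus 3 1 (grp_on G X)" and "\<exists>p q d. heisenberg_basis X p q d \<and> d = [.q, p.]"
proof -
 have fX: "finite X" using X finQ finite_subset by blast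
 interpret X: group "G\<lparr>carrier := X\<rparr>" using X(1) subgroup_imp_group by blast
 let ?X = "G\<lparr>carrier := X\<rparr>"
 have Xc: "x\<in>carrier G" if "x\<in>X" for x using that X Qc by blast
 have "X~=Z" using c Z_card by auto
 then obtain p where p: "p\<in>X" "p~:Z" using X(2) by blast
 then obtain q where q: "q\<in>X" "q\<otimes>p~=p\<otimes>q" using cen by blast
 let ?d = "[.q, p.]"
 have pqQ: "p\<in>Q" "q\<in>Q" using p q X by blast+
 have d: "?d\<in>Z" "?d~=\<one>" using Q_comm[OF pqQ(2,1)] commute_iff[OF pqQ(2,1)] q(2) by blast+
 have dX: "?d\<in>X" using d X by blast
 have e: "q\<otimes>p = p\<otimes>(q\<otimes>?d)" using Qc[OF pqQ(1)] Qc[OF pqQ(2)] by (simp add: word_simps)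
 have "heisenberg_basis X p q ?d"
  unfolding heisenberg_basis_def
  using X(1) c p q(1) dX d e Q_cube pqQ X(3) Z_commutes[OF d(1)] by (intro conjI) blast+
 then show "\<exists>p q d. heisenberg_basis X p q d \<and> d = [.q, p.]" by blast
 have centre: "centre ?X = Z"
 proof
  show "centre ?X\<subseteq>Z"
  proof
   fix x assume "x\<in>centre ?X"
   then have x: "x\<in>X" "\<And>y. y\<in>X ==> y\<otimes>x = x\<otimes>y" unfolding centre_on by auto
   show "x\<in>Z" by (rule cen) (fact x)+
  qed
  show "Z\<subseteq>centre ?X" unfolding centre_on using Z_commutes X by blast
 qed
 have comm_gen: "Z\<subseteq>K" if "subgroup K G" "?d\<in>K" for K
  by (rule order_3_subset[OF Z_sub Z_card d that])
 have der: "derived ?X (carrier ?X) = centre ?X"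
 proof -
  have "derived ?X (carrier ?X) = derived G X" using derived_consistent[OF _ X(1), of X] by simp
  moreover have "derived G X = Z"
  proof
   have "derived_set G X\<subseteq>Z"
   proof
    fix v assume "v\<in>derived_set G X"
    then obtain a b where ab: "a\<in>X" "b\<in>X" "v = a\<otimes>b\<otimes>inv a\<otimes>inv b" by blast
    have i: "inv a\<in>Q" "inv b\<in>Q" "a\<in>carrier G" "b\<in>carrier G" using ab X Qi Xc by blast+
    have "v = [.inv a, inv b.]" using ab(3) i by simp
    then show "v\<in>Z" using Q_comm[OF i(1,2)] by simp
   qed
   then show "derived G X\<subseteq>Z" unfolding derived_def using generate_subgroup_incl[OF _ Z_sub] by blast
   have i: "inv q\<in>X" "inv p\<in>X" using p q subgroup.m_inv_closed[OF X(1)] by blast+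
   have "inv q\<otimes>inv p\<otimes>inv (inv q)\<otimes>inv (inv p)\<in>derived_set G X" using i by blast
   moreover have "inv (inv q) = q" "inv (inv p) = p" using p q Xc by auto
   ultimately have "?d\<in>derived G X" unfolding derived_def by (simp add: generate.incl)
   moreover have "subgroup (derived G X) G" using derived_is_subgroup[OF subgroup.subset[OF X(1)]] .
   ultimately show "Z\<subseteq>derived G X" using comm_gen by blast
  qed
  ultimately show ?thesis using centre by simp
 qed
 have frat: "centre ?X = frattini ?X"
 proof
  have ZM: "Z\<subseteq>M" if M: "maximal_subgroup ?X M" for M
  proof (rule ccontr)
   assume nZ: "\<not> Z\<subseteq>M"
   have Msx: "subgroup M ?X" and Mne: "M~=X" and Mmax: "\<And>K. subgroup K ?X ==> M\<subseteq>K ==> K = M \<or> K = X"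
    using M unfolding maximal_subgroup_def by auto
   have Ms: "subgroup M G" using incl_subgroup[OF X(1) Msx] .
   have MX: "M\<subseteq>X" using subgroup.subset[OF Msx] by simp
   have Mc: "m\<in>Q" if "m\<in>M" for m using that MX X by blast
   have s: "subgroup (M<#>Z) G"
    by (rule set_mult_subgroup[OF Ms Z_sub]) (use Z_fixed Mc in simp)
   have sX: "M<#>Z\<subseteq>X" by (rule set_mult_subset[OF X(1) MX X(2)])
   have MM: "M\<subseteq>M<#>Z" "Z\<subseteq>M<#>Z"
    using set_mult_left[OF Z_sub subgroup.subset[OF Ms]] set_mult_right[OF Ms Z_carrier] by blast+
   have "M<#>Z = X" using Mmax[OF subgroup_incl[OF s X(1) sX] MM(1)] MM(2) nZ by blast
   then obtain m z m' z' where mz: "m\<in>M" "z\<in>Z" "q = m\<otimes>z" "m'\<in>M" "z'\<in>Z" "p = m'\<otimes>z'"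
    using p q unfolding set_mult_def by blast
   have Qs: "m\<in>Q" "m'\<in>Q" "z\<in>Q" "z'\<in>Q" using mz Mc ZQ by blast+
   have zz: "[.v, w.] = \<one>" if "v\<in>Z" "w\<in>Q" for v w using that commute_iff Z_commutes ZQ by blast
   have zz': "[.w, v.] = \<one>" if "v\<in>Z" "w\<in>Q" for v w using zz[OF that] commute_iff[of v w] commute_iff[of w v] that ZQ by fastforce
   have "?d = [.m, m'.]"
    unfolding mz(3,6) using comm_left[OF Qs(1,3) Qm[OF Qs(2,4)]] comm_right[OF Qs(1,2,4)] zz[OF mz(2) Qm[OF Qs(2,4)]] zz'[OF mz(5) Qs(1)] Qs
    by simp
   then have "?d\<in>M" using subgroup_comm[OF Ms mz(1,4)] by simp
   then show False using comm_gen[OF Ms] nZ by blast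
  qed
  then show "centre ?X\<subseteq>frattini ?X" unfolding centre frattini_def using X(2) by auto
  show "frattini ?X\<subseteq>centre ?X"
  proof
   fix g assume g: "g\<in>frattini ?X"
   show "g\<in>centre ?X" unfolding centre
   proof (rule ccontr)
    assume gZ: "g~:Z"
    have gX: "g\<in>X" using g by (simp add: frattini_def)
    obtain h where h: "h\<in>X" "h\<otimes>g~=g\<otimes>h" using cen[OF gX] gZ by blast
    note ch = cent_in_subgroup[OF X h(1)]
    let ?M = "X\<inter>CG {h}"
    have gM: "g~:?M" using ch(4)[of g] h(2) by fastforce
    have hZ: "h~:Z" using Z_commutes gX X(3) h(2) by blast
    have M1: "3 < card ?M" using psubset_card_mono[of ?M Z] fX Z_card ch(2,3) hZ by auto
    have M2: "card ?M < 27" using psubset_card_mono[OF fX, of ?M] gM gX c by auto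
    have "card ?M dvd 27" using card_subgroup_dvd[OF X(1) ch(1) _ fX] c by simp
    then have M9: "card ?M = 9" using divisors_27 M1 M2 by fastforce
    have "maximal_subgroup ?X ?M" unfolding maximal_subgroup_def
    proof (intro conjI allI impI)
     show "subgroup ?M ?X" using subgroup_incl[OF ch(1) X(1)] by blast
     show "?M~=carrier ?X" using gM gX by auto
     fix K assume K: "subgroup K ?X \<and> ?M\<subseteq>K"
     have KX: "K\<subseteq>X" using K subgroup.subset by fastforce
     have Ks: "subgroup K G" using incl_subgroup[OF X(1)] K by blast
     have fK: "finite K" using KX fX finite_subset by blast
     have "card K dvd 27" using card_subgroup_dvd[OF X(1) Ks KX fX] c by simp
     then have k: "card K = 1 \<or> card K = 3 \<or> card K = 9 \<or> card K = 27" by (rule divisors_27)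
     have "9 \<le> card K" using card_mono[OF fK, of ?M] K M9 by simp
     then have "card K = 9 \<or> card K = 27" using k by auto
     then show "K = ?M \<or> K = carrier ?X"
     using card_subset_eq[OF fK, of ?M] card_subset_eq[OF fX KX] K M9 c by auto
    qed
    then show False using g gM unfolding frattini_def by blast
   qed
  qed
 qed
 have "\<not> comm_group ?X"
 proof
  assume "comm_group ?X"
  then interpret cg: comm_group ?X .
  show False using cg.m_comm[of q p] p q by simp
 qed
 moreover have "p_group 3 ?X" unfolding p_group_def using X.is_group c
  by (auto simp: order_def intro!: exI[of _ 3])
 ultimately have "extraspecial 3 ?X" unfolding extraspecial_def using der frat centre Z_card by simp
 moreover have "group_exponent ?X = 3"
  by (rule group_exponent_3I[OF X(1) _ p(1)]) (use Q_cube X p Z1 in auto)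
 ultimately show "extraspecial_plus 3 1 ?X" unfolding extraspecial_plus_def using c by (simp add: order_def)
qed

end

section \<open>Involutions centralizing the Sylow subgroup modulo Q\<close>

locale involution_centralizing_quotient = extraspecial_pair_involution +
 fixes u
 assumes u_cent: "u\<in>CG Z" and u_sq: "u\<otimes>u = \<one>" and u_ne: "u~=\<one>"
  and u_S: "\<And>g. g\<in>Syl ==> [.u, g.]\<in>Q"
begin

lemma uc [simp]: "u\<in>carrier G" using u_cent centralizer_carrier[of Z] by blast
lemma inv_u [simp]: "inv u = u" using u_sq by (simp add: inv_equality)
lemma conj_uu: "g\<in>carrier G ==> (g\<up>u)\<up>u = g" using u_sq by (simp add: conj_el_conj)
lemma Q_u: "q\<in>Q ==> q\<up>u\<in>Q" using P.cent_Z_normalizes u_cent normalizing_conj by blast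
lemma Z_u: "z\<in>Z ==> z\<up>u = z" using centralizer_conj_el[OF u_cent] by simp

lemma S_u: assumes g: "g\<in>Syl" shows "[.g, u.]\<in>Q" "g\<up>u\<in>Syl"
proof -
 have gc: "g\<in>carrier G" using g by simp
 have "inv [.u, g.]\<in>Q" using P.Qi[OF u_S[OF g]] .
 then show 1: "[.g, u.]\<in>Q" using inv_comm_swap[OF uc gc] by simp
 then show "g\<up>u\<in>Syl" using conj_el_eq_comm[OF gc uc] Sm[OF g] QS by auto
qed

lemma J_u: assumes j: "j\<in>J" shows "j\<up>u\<in>J"
proof -
 have Jcc: "J\<subseteq>carrier G" using subgroup.subset[OF J_sub] .
 have "J\<Up>u = J"
 proof (rule abelian_large_eq_J)
  show "subgroup (J\<Up>u) G" by (rule conj_set_subgroup[OF J_sub uc])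
  show "J\<Up>u\<subseteq>Syl" using S_u(2) JS unfolding conj_set_def by blast
  show "81 \<le> card (J\<Up>u)" using card_conj_set[OF Jcc uc] J_card by simp
  fix a b assume "a\<in>J\<Up>u" "b\<in>J\<Up>u"
  then obtain a' b' where ab: "a'\<in>J" "b'\<in>J" "a = a'\<up>u" "b = b'\<up>u" unfolding conj_set_def by blast
  have c: "a'\<in>carrier G" "b'\<in>carrier G" using ab by auto
  have "a\<otimes>b = (a'\<otimes>b')\<up>u" unfolding ab(3,4) using conj_el_mult[OF c uc] by simp
  also have "\<dots> = (b'\<otimes>a')\<up>u" using J_abelian[OF ab(1,2)] by simp
  also have "\<dots> = b\<otimes>a" unfolding ab(3,4) using conj_el_mult[OF c(2,1) uc] by simp
  finally show "a\<otimes>b = b\<otimes>a" .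
 qed
 then show ?thesis using conj_setI[OF j, of u] by simp
qed

definition C where "C = Q\<inter>CG {u}"
definition I where "I = {q\<in>Q. (q\<up>u)\<otimes>q\<in>Z}"

lemma fixed_iff: "g\<in>carrier G ==> g\<in>CG {u} \<longleftrightarrow> g\<up>u = g"
 using conj_el_fixed[OF _ uc, of g] unfolding centralizer_def by blast

lemma cent_u_sub: "subgroup (CG {u}) G" by (rule centralizer_subgroup) simp

lemma C_iff: "q\<in>C \<longleftrightarrow> q\<in>Q \<and> q\<up>u = q" unfolding C_def using fixed_iff P.Qc by blast
lemma C_sub: "subgroup C G" unfolding C_def by (rule subgroups_Inter_pair[OF P.Q_sub cent_u_sub])

lemma comm_swap_Z: assumes "q\<in>Q" "r\<in>Q" shows "\<exists>z\<in>Z. q\<otimes>r = r\<otimes>(q\<otimes>z)"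
proof
 show "[.q, r.]\<in>Z" by (rule P.Q_comm[OF assms])
 show "q\<otimes>r = r\<otimes>(q\<otimes>[.q, r.])" using P.Qc[OF assms(1)] P.Qc[OF assms(2)] by (simp add: word_simps)
qed

lemma Q_cube': "q\<in>Q ==> q\<otimes>(q\<otimes>q) = \<one>" using P.Q_cube[of q] cube_eq[of q] by simp

lemma I_sub: "subgroup I G"
proof (rule subgroupI)
 show "I\<subseteq>carrier G" unfolding I_def by auto
 show "I~={}" unfolding I_def using P.Q1 P.Z1 by auto
next
 fix q assume q: "q\<in>I"
 have qQ: "q\<in>Q" "q\<in>carrier G" "(q\<up>u)\<otimes>q\<in>Z" using q unfolding I_def by auto
 let ?z = "(q\<up>u)\<otimes>q"
 have uQ: "q\<up>u\<in>carrier G" using qQ by simp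
 have zc: "?z\<otimes>q = q\<otimes>?z" by (rule P.Z_commutes[OF qQ(3,1)])
 have "q\<otimes>(q\<up>u) = q\<otimes>?z\<otimes>inv q" using qQ(2) uQ by (simp add: m_assoc)
 also have "\<dots> = ?z" using zc qQ(2) uQ by (metis inv_solve_right m_closed)
 finally have e: "q\<otimes>(q\<up>u) = ?z" .
 have "(inv q\<up>u)\<otimes>inv q = inv (q\<otimes>(q\<up>u))" using qQ(2) uQ conj_el_inv[OF qQ(2) uc] by (simp add: inv_mult_group)
 then show "inv q\<in>I" unfolding I_def using e P.Zi[OF qQ(3)] P.Qi[OF qQ(1)] by simp
next
 fix q r assume "q\<in>I" "r\<in>I"
 then have q: "q\<in>Q" "q\<in>carrier G" "(q\<up>u)\<otimes>q\<in>Z" and r: "r\<in>Q" "r\<in>carrier G" "(r\<up>u)\<otimes>r\<in>Z"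
  unfolding I_def by auto
 have qu: "q\<up>u\<in>Q" "r\<up>u\<in>Q" "q\<up>u\<in>carrier G" "r\<up>u\<in>carrier G" using Q_u q r by auto
 obtain z where z: "z\<in>Z" "(r\<up>u)\<otimes>q = q\<otimes>((r\<up>u)\<otimes>z)" using comm_swap_Z[OF qu(2) q(1)] by blast
 have zc: "z\<in>carrier G" "z\<otimes>r = r\<otimes>z" using z(1) P.Z_commutes r by auto
 have "((q\<otimes>r)\<up>u)\<otimes>(q\<otimes>r) = (q\<up>u)\<otimes>(((r\<up>u)\<otimes>q)\<otimes>r)"
  using q(2) r(2) qu by (simp add: conj_el_mult m_assoc)
 also have "\<dots> = (q\<up>u)\<otimes>(q\<otimes>((r\<up>u)\<otimes>(z\<otimes>r)))" unfolding z(2) using q(2) r(2) qu zc(1) by (simp add: m_assoc)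
 also have "\<dots> = ((q\<up>u)\<otimes>q)\<otimes>(((r\<up>u)\<otimes>r)\<otimes>z)" unfolding zc(2) using q(2) r(2) qu zc(1) by (simp add: m_assoc)
 finally show "q\<otimes>r\<in>I" unfolding I_def using P.Zm[OF q(3) P.Zm[OF r(3) z(1)]] P.Qm[OF q(1) r(1)] by simp
qed

lemma ZC: "Z\<subseteq>C" using C_iff Z_u P.ZQ by blast
lemma ZI: "Z\<subseteq>I" unfolding I_def using Z_u P.ZQ P.Zm by auto
lemma CQ: "C\<subseteq>Q" unfolding C_def by blast
lemma IQ: "I\<subseteq>Q" unfolding I_def by blast
lemma C_cap_I: "C\<inter>I = Z"
proof
 show "C\<inter>I\<subseteq>Z"
 proof
  fix q assume q: "q\<in>C\<inter>I"
  have qQ: "q\<in>Q" "q\<in>carrier G" "q\<up>u = q" using q C_iff by auto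
  have "q\<otimes>q\<in>Z" using q qQ unfolding I_def by simp
  moreover have "inv q = q\<otimes>q" using cube_one_inv[OF qQ(2) P.Q_cube[OF qQ(1)]] .
  ultimately have "inv q\<in>Z" by simp
  then show "q\<in>Z" using subgroup_inv_iff[OF P.Z_sub qQ(2)] by blast
 qed
qed (use ZC ZI in blast)

text \<open>For \<open>q\<in>K\<close> the element \<open>q q\<^sup>u\<close> is fixed by \<open>u\<close>,
 the element \<open>q (q\<^sup>u)\<inverse>\<close> is inverted, and their product is \<open>q\<^sup>2 =
 q\<inverse>\<close>.\<close>

lemma decompose:
 assumes K: "subgroup K G" "Z\<subseteq>K" "K\<subseteq>Q" and Ku: "\<And>k. k\<in>K ==> k\<up>u\<in>K"
 shows "K = (K\<inter>C)<#>(K\<inter>I)" "card (K\<inter>C) * card (K\<inter>I) = 3 * card K"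
proof -
 have KC: "subgroup (K\<inter>C) G" and KI: "subgroup (K\<inter>I) G"
  by (rule subgroups_Inter_pair[OF K(1) C_sub], rule subgroups_Inter_pair[OF K(1) I_sub])
 have fK: "finite K" using K(3) P.finQ finite_subset by blast
 have inv: "inv q\<in>(K\<inter>C)<#>(K\<inter>I)" if q: "q\<in>K" for q
 proof -
  let ?r = "q\<up>u"
  have Q: "q\<in>Q" "?r\<in>Q" "?r\<in>K" using q K Q_u Ku by blast+
  have c: "q\<in>carrier G" "?r\<in>carrier G" using Q by auto
  have ru: "?r\<up>u = q" by (rule conj_uu[OF c(1)])
  \<comment> \<open>\<open>a\<close> is centralized by \<open>u\<close> modulo \<open>Z\<close>, hence centralized by \<open>u\<close>\<close>
  let ?a = "q\<otimes>?r" and ?b = "q\<otimes>inv ?r"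
  have ac: "?a\<in>carrier G" and aK: "?a\<in>K" "?a\<in>Q" using c subgroup.m_closed[OF K(1) q Q(3)] P.Qm Q by auto
  have bK: "?b\<in>K" "?b\<in>Q" using subgroup.m_closed[OF K(1) q subgroup.m_inv_closed[OF K(1) Q(3)]] K(3) by blast+
  have au: "?a\<up>u = ?r\<otimes>q" using c ru by (simp add: conj_el_mult)
  obtain z where z: "z\<in>Z" "?r\<otimes>q = q\<otimes>(?r\<otimes>z)" using comm_swap_Z[OF Q(2,1)] by blast
  have zc: "z\<in>carrier G" using z by simp
  have au': "?a\<up>u = ?a\<otimes>z" using au z(2) c zc by (simp add: m_assoc)
  have "?a = (?a\<up>u)\<up>u" using conj_uu[OF ac] by simp
  also have "\<dots> = (?a\<otimes>z)\<otimes>z" unfolding au' using conj_el_mult[OF ac zc uc] au' Z_u[OF z(1)] by simp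
  also have "\<dots> = ?a\<otimes>(z\<otimes>z)" using ac zc by (simp add: m_assoc)
  finally have "z\<otimes>z = \<one>" using ac zc by (metis l_cancel_one' m_closed)
  then have "z = \<one>" using P.Z_gen(2)[OF z(1)] zc by (cases "z = \<one>") auto
  then have aC: "?a\<in>K\<inter>C" using au' ac aK C_iff by simp
  have "(?b\<up>u)\<otimes>?b = \<one>" using c ru by (simp add: conj_el_mult conj_el_inv m_assoc)
  then have bI: "?b\<in>K\<inter>I" unfolding I_def using bK P.Z1 by simp
  have "?a\<otimes>?b = q\<otimes>(?r\<otimes>q)\<otimes>inv ?r" using c by (simp add: m_assoc)
  also have "\<dots> = q\<otimes>(q\<otimes>?r)\<otimes>inv ?r" using z(2) \<open>z = \<one>\<close> c by simp
  also have "\<dots> = q\<otimes>q" using c by (simp add: m_assoc)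
  also have "\<dots> = inv q" using cube_one_inv[OF c(1) P.Q_cube[OF Q(1)]] by simp
  finally show ?thesis using set_multI[OF aC bI] by simp
 qed
 show eq: "K = (K\<inter>C)<#>(K\<inter>I)"
 proof
  show "(K\<inter>C)<#>(K\<inter>I)\<subseteq>K" by (rule set_mult_subset[OF K(1)]) blast+
  show "K\<subseteq>(K\<inter>C)<#>(K\<inter>I)"
  proof
   fix q assume q: "q\<in>K"
   have "q\<in>carrier G" using q K by auto
   then show "q\<in>(K\<inter>C)<#>(K\<inter>I)" using inv[OF subgroup.m_inv_closed[OF K(1) q]] by simp
  qed
 qed
 have "(K\<inter>C)\<inter>(K\<inter>I) = Z" using C_cap_I K(2) by blast
 then show "card (K\<inter>C) * card (K\<inter>I) = 3 * card K"
  using card_set_mult_inter[OF KC _ KI] fK eq P.Z_card by simp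
qed

lemma Q_eq: "Q = C<#>I" and card_C_I: "card C * card I = 729"
proof -
 have 1: "Q\<inter>C = C" "Q\<inter>I = I" using CQ IQ by blast+
 show "Q = C<#>I" using decompose(1)[OF P.Q_sub P.ZQ subset_refl Q_u] unfolding 1 .
 show "card C * card I = 729" using decompose(2)[OF P.Q_sub P.ZQ subset_refl Q_u] P.Q_card unfolding 1 by simp
qed

lemma I_inv: assumes i: "i\<in>I" obtains z where "z\<in>Z" "i\<up>u = z\<otimes>inv i"
proof -
 have ic: "i\<in>carrier G" "(i\<up>u)\<otimes>i\<in>Z" using i unfolding I_def by auto
 have "i\<up>u = ((i\<up>u)\<otimes>i)\<otimes>inv i" using ic(1) by (simp add: m_assoc)
 then show ?thesis using that ic(2) by blast
qed

text \<open>Conjugation by \<open>u\<close> fixes \<open>[c, i]\<in>Z\<close> but turns it into \<open>[c,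
 i\<inverse>] = [c, i]\<inverse>\<close>.\<close>

lemma C_I_commute: assumes c: "c\<in>C" and i: "i\<in>I" shows "c\<otimes>i = i\<otimes>c"
proof -
 have Q: "c\<in>Q" "i\<in>Q" "c\<in>carrier G" "i\<in>carrier G" "c\<up>u = c" using c i CQ IQ C_iff by auto
 let ?t = "[.c, i.]"
 have t: "?t\<in>Z" by (rule P.Q_comm[OF Q(1,2)])
 obtain z where z: "z\<in>Z" "i\<up>u = z\<otimes>inv i" by (rule I_inv[OF i])
 have zQ: "z\<in>Q" "inv i\<in>Q" using z P.ZQ P.Qi Q by blast+
 have "[.c, z.] = \<one>" using P.commute_iff[OF Q(1) zQ(1)] P.Z_commutes[OF z(1) Q(1)] by simp
 then have 1: "[.c, z\<otimes>inv i.] = [.c, inv i.]" using P.comm_right[OF Q(1) zQ] Q zQ by simp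
 have "?t = ?t\<up>u" using Z_u[OF t] by simp
 also have "\<dots> = [.c, z\<otimes>inv i.]" using conj_el_comm[OF Q(3,4) uc] Q(5) z(2) by simp
 finally have 2: "?t = [.c, inv i.]" using 1 by simp
 have "?t\<otimes>[.c, inv i.] = [.c, i\<otimes>inv i.]" using P.comm_right[OF Q(1,2) zQ(2)] by simp
 also have "\<dots> = \<one>" using Q by simp
 finally have "?t\<otimes>?t = \<one>" using 2 by simp
 then have "?t = \<one>" using P.Z_gen(2)[OF t] t P.Zc by (metis r_one)
 then show ?thesis using P.commute_iff[OF Q(1,2)] by blast
qed

lemma centre_of_factor:
 assumes "w\<in>Q" "\<And>c. c\<in>C ==> c\<otimes>w = w\<otimes>c" "\<And>i. i\<in>I ==> i\<otimes>w = w\<otimes>i"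
 shows "w\<in>Z"
proof -
 have wc: "w\<in>carrier G" using assms(1) by simp
 have "w\<otimes>q = q\<otimes>w" if q: "q\<in>Q" for q
 proof -
  have "q\<in>C<#>I" using q Q_eq by simp
  then obtain c i where ci: "c\<in>C" "i\<in>I" "q = c\<otimes>i" unfolding set_mult_def by blast
  have cc: "c\<in>carrier G" "i\<in>carrier G" using ci CQ IQ by auto
  have "q\<otimes>w = c\<otimes>(i\<otimes>w)" using ci(3) cc wc by (simp add: m_assoc)
  also have "\<dots> = (c\<otimes>w)\<otimes>i" unfolding assms(3)[OF ci(2)] using cc wc by (simp add: m_assoc)
  also have "\<dots> = w\<otimes>q" unfolding assms(2)[OF ci(1)] ci(3) using cc wc by (simp add: m_assoc)
  finally show ?thesis by simp
 qed
 then show ?thesis using P.Z_centre assms(1) by blast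
qed

lemma centre_C: "w\<in>C ==> (\<And>y. y\<in>C ==> y\<otimes>w = w\<otimes>y) ==> w\<in>Z"
 by (rule centre_of_factor) (use CQ in \<open>blast intro: C_I_commute[symmetric]\<close>)+
lemma centre_I: "w\<in>I ==> (\<And>y. y\<in>I ==> y\<otimes>w = w\<otimes>y) ==> w\<in>Z"
 by (rule centre_of_factor) (use IQ in \<open>blast intro: C_I_commute\<close>)+

lemma card_C: "card C = 3 \<or> card C = 27"
proof -
 have "card C dvd 243" using card_subgroup_dvd[OF P.Q_sub C_sub CQ P.finQ] P.Q_card by simp
 then have c: "card C = 1 \<or> card C = 3 \<or> card C = 9 \<or> card C = 27 \<or> card C = 81 \<or> card C = 243" by (rule divisors_243)
 have 1: "card C~=1" using card_mono[OF finite_subset[OF CQ P.finQ] ZC] P.Z_card by simp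
 have 9: "card C~=9" using P.card_not_9[OF C_sub ZC CQ centre_C] by blast
 have 81: "card C~=81"
 proof
  assume "card C = 81"
  then have "card I = 9" using card_C_I by simp
  then show False using P.card_not_9[OF I_sub ZI IQ centre_I] by blast
 qed
 have 243: "card C~=243"
 proof
  assume "card C = 243"
  then have "C = Q" using card_subset_eq[OF P.finQ CQ] P.Q_card by simp
  then have fixed: "q\<up>u = q" if "q\<in>Q" for q using C_iff that by blast
  have "u\<in>CG Q" by (rule centralizerI[OF uc P.Q_carrier fixed])
  then have "u\<in>Q" using P.Q_self by blast
  then show False using Q_cube'[of u] u_sq u_ne by simp
 qed
 show ?thesis using c 1 9 81 243 by blast
qed

lemma finC: "finite C" using finite_subset[OF CQ P.finQ] .
lemma finI: "finite I" using finite_subset[OF IQ P.finQ] .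

text \<open>Put \<open>n = [j, u]\<close>.  Then \<open>u\<close> inverts \<open>n\<close>, and \<open>n\<^sup>3
 = 1\<close> makes \<open>j n\<inverse>\<close> a fixed point.\<close>

lemma lift_fixed:
 assumes j: "j\<in>J"
 shows "\<exists>c\<in>J\<inter>CG {u}. \<exists>n\<in>J\<inter>Q. j = c\<otimes>n"
proof -
 let ?n = "[.j, u.]"
 have jc: "j\<in>carrier G" using j by simp
 have jS: "j\<in>Syl" using j JS by blast
 have e: "?n = inv j\<otimes>(j\<up>u)" by (rule comm_eq_conj[OF jc uc])
 have nJ: "?n\<in>J" unfolding e by (rule Jm[OF Ji[OF j] J_u[OF j]])
 have nQ: "?n\<in>Q" by (rule S_u(1)[OF jS])
 have nc: "?n\<in>carrier G" using nQ by simp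
 have ju: "j\<up>u = j\<otimes>?n" by (rule conj_el_eq_comm[OF jc uc])
 have "?n\<up>u = inv (j\<up>u)\<otimes>j"
  unfolding e using conj_el_mult[of "inv j" "j\<up>u" u] conj_el_inv[OF jc uc] conj_uu[OF jc] jc by simp
 also have "\<dots> = inv ?n" unfolding ju using jc nc by (simp add: inv_mult_group m_assoc)
 finally have nu: "?n\<up>u = inv ?n" .
 let ?c = "j\<otimes>inv ?n"
 have n2: "?n\<otimes>?n = inv ?n" using cube_one_inv[OF nc P.Q_cube[OF nQ]] by simp
 have "?c\<up>u = (j\<otimes>?n)\<otimes>?n"
  using conj_el_mult[OF jc inv_closed[OF nc] uc] conj_el_inv[OF nc uc] nu ju nc by simp
 also have "\<dots> = j\<otimes>(?n\<otimes>?n)" by (rule m_assoc[OF jc nc nc])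
 finally have "?c\<up>u = ?c" unfolding n2 .
 moreover have cJ: "?c\<in>J" by (rule Jm[OF j Ji[OF nJ]])
 ultimately have "?c\<in>J\<inter>CG {u}" using fixed_iff[of ?c] by simp
 moreover have "j = ?c\<otimes>?n"
 proof -
  have "?c\<otimes>?n = j\<otimes>(inv ?n\<otimes>?n)" by (rule m_assoc[OF jc inv_closed[OF nc] nc])
  also have "\<dots> = j" using l_inv[OF nc] jc by (simp only: r_one)
  finally show ?thesis by (rule sym)
 qed
 ultimately show ?thesis using nJ nQ by blast
qed

lemma Z2_u: "k\<in>J\<inter>Q ==> k\<up>u\<in>J\<inter>Q" using J_u Q_u by blast
lemma J_cent_sub: "subgroup (J\<inter>CG {u}) G" by (rule subgroups_Inter_pair[OF J_sub cent_u_sub])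
lemma finJc: "finite (J\<inter>CG {u})" using finJ by simp
lemma finZ2: "finite (J\<inter>Q)" using finJ by simp

lemma card_fixed_J: "card (J\<inter>CG {u}) = 3 * card (J\<inter>Q\<inter>C)"
proof -
 have "(J\<inter>CG {u})<#>(J\<inter>Q) = J"
 proof
  show "(J\<inter>CG {u})<#>(J\<inter>Q)\<subseteq>J" by (rule set_mult_subset[OF J_sub]) blast+
  show "J\<subseteq>(J\<inter>CG {u})<#>(J\<inter>Q)"
  proof
   fix j assume "j\<in>J"
   then obtain c n where cn: "c\<in>J\<inter>CG {u}" "n\<in>J\<inter>Q" "j = c\<otimes>n" using lift_fixed by blast
   show "j\<in>(J\<inter>CG {u})<#>(J\<inter>Q)" unfolding cn(3) by (rule set_multI[OF cn(1,2)])
  qed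
 qed
 moreover have "J\<inter>CG {u}\<inter>(J\<inter>Q) = J\<inter>Q\<inter>C" unfolding C_def by blast
 ultimately show ?thesis
  using card_set_mult_inter[OF J_cent_sub finJc Z2_sub finZ2] J_card Z2_card by simp
qed

lemma card_fixed_S: "card (Syl\<inter>CG {u}) = 3 * card C"
proof -
 have sub: "subgroup (Syl\<inter>CG {u}) G" by (rule subgroups_Inter_pair[OF S_sub cent_u_sub])
 have fS: "finite (Syl\<inter>CG {u})" using finS by simp
 have "(Syl\<inter>CG {u})<#>Q = Syl"
 proof
  show "(Syl\<inter>CG {u})<#>Q\<subseteq>Syl" by (rule set_mult_subset[OF S_sub]) (use QS in blast)+
  show "Syl\<subseteq>(Syl\<inter>CG {u})<#>Q"
  proof
   fix g assume "g\<in>Syl"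
   then obtain q j where qj: "q\<in>Q" "j\<in>J" "g = q\<otimes>j" using S_ex by blast
   obtain c n where cn: "c\<in>J\<inter>CG {u}" "n\<in>J\<inter>Q" "j = c\<otimes>n" using lift_fixed[OF qj(2)] by blast
   have cc: "c\<in>carrier G" "n\<in>carrier G" "q\<in>carrier G" "c\<in>Syl" using cn qj JS by auto
   have "q\<up>c\<in>Q" using S_norm_Q cc(4) qj(1) normalizing_conj by blast
   then have "(q\<up>c)\<otimes>n\<in>Q" using P.Qm cn by blast
   moreover have "g = c\<otimes>((q\<up>c)\<otimes>n)" unfolding qj(3) cn(3) using cc by (simp add: word_simps)
   ultimately show "g\<in>(Syl\<inter>CG {u})<#>Q" using cn cc(4) set_multI by blast
  qed
 qed
 moreover have "Syl\<inter>CG {u}\<inter>Q = C" unfolding C_def using QS by blast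
 ultimately show ?thesis
  using card_set_mult_inter[OF sub fS P.Q_sub P.finQ] S_card P.Q_card by simp
qed

lemma inverting_case:
 assumes C3: "card C = 3"
 shows "inverts_section G u Q Z" "card (J\<inter>CG {u}) = 9" "inverts_section G u Syl J"
proof -
 have "C = Z" using card_subset_eq[OF finC ZC] C3 P.Z_card by simp
 have "card I = 243" using card_C_I C3 by simp
 then have "I = Q" using card_subset_eq[OF P.finQ IQ] P.Q_card by simp
 then have inv: "(q\<up>u)\<otimes>q\<in>Z" if "q\<in>Q" for q using that unfolding I_def by blast
 have Zn: "Z \<lhd> G\<lparr>carrier := Q\<rparr>"
  by (rule normal_onI[OF P.Q_sub P.Z_sub P.ZQ]) (use P.Z_fixed in simp)
 show "inverts_section G u Q Z"
  by (rule inverts_sectionI[OF P.Q_sub P.finQ Zn uc Q_u _ inv]) (use Z_u in auto)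
 have "J\<inter>Q\<inter>C = Z" using \<open>C = Z\<close> ZZ2 by blast
 then show "card (J\<inter>CG {u}) = 9" using card_fixed_J P.Z_card by simp
 have Jn: "J \<lhd> G\<lparr>carrier := Syl\<rparr>"
  by (rule normal_onI[OF S_sub J_sub JS]) (rule S_norm_J)
 have inv2: "(g\<up>u)\<otimes>g\<in>J" if "g\<in>Syl" for g
 proof -
  obtain q j where qj: "q\<in>Q" "j\<in>J" "g = q\<otimes>j" using S_ex[OF \<open>g\<in>Syl\<close>] by blast
  have c: "q\<in>carrier G" "j\<in>carrier G" "q\<up>u\<in>carrier G" "j\<up>u\<in>carrier G" using qj by auto
  have "(g\<up>u)\<otimes>g = ((q\<up>u)\<otimes>q)\<otimes>(((j\<up>u)\<up>q)\<otimes>j)"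
   unfolding qj(3) conj_el_mult[OF c(1,2) uc] using c by (simp add: conj_el_def[of G "conj_el G j u"] m_assoc)
  moreover have "(q\<up>u)\<otimes>q\<in>J" using inv[OF qj(1)] ZZ2 by blast
  moreover have "(j\<up>u)\<up>q\<in>J" using S_norm_J QS J_u qj by blast
  ultimately show ?thesis using Jm qj(2) by simp
 qed
 show "inverts_section G u Syl J"
  by (rule inverts_sectionI[OF S_sub finS Jn uc S_u(2) J_u inv2])
qed

text \<open>Each \<open>i\<in>I\<close> satisfies \<open>[i, u]\<in>iZ\<close>, and two noncommuting
 commutators of this form generate \<open>Z\<close>.\<close>

lemma commutator_u: "C~=Q ==> I~=Z ==> commutator_subgroup G Q {u} = I"
proof -
 assume IZ: "I~=Z"
 let ?X = "{[.a, b.] | a b. a\<in>Q \<and> b\<in>{u}}"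
 let ?K = "generate G ?X"
 have XI: "?X\<subseteq>I"
 proof
  fix v assume "v\<in>?X"
  then obtain q where q: "q\<in>Q" "v = [.q, u.]" by blast
  let ?r = "q\<up>u"
  have c: "q\<in>carrier G" "?r\<in>carrier G" "?r\<in>Q" using q Q_u by auto
  have v: "v = inv q\<otimes>?r" using q(2) comm_eq_conj[OF c(1) uc] by simp
  have vQ: "v\<in>Q" unfolding v using P.Qm P.Qi q c by blast
  have "v\<up>u = inv ?r\<otimes>q" unfolding v using conj_el_mult[of "inv q" ?r u] conj_el_inv[OF c(1) uc] conj_uu[OF c(1)] c by simp
  then have "(v\<up>u)\<otimes>v = \<one>" unfolding v using c by (simp add: m_assoc)
  then show "v\<in>I" unfolding I_def using vQ P.Z1 by simp
 qed
 have KI: "?K\<subseteq>I" using generate_subgroup_incl[OF XI I_sub] .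
 have Kc: "?X\<subseteq>carrier G" using XI IQ by auto
 have Ks: "subgroup ?K G" by (rule generate_is_subgroup[OF Kc])
 have lift: "\<exists>k\<in>?K. \<exists>z\<in>Z. k = i\<otimes>z" if i: "i\<in>I" for i
 proof -
  have ic: "i\<in>carrier G" "i\<in>Q" using i IQ by auto
  obtain z where z: "z\<in>Z" "i\<up>u = z\<otimes>inv i" by (rule I_inv[OF i])
  have "[.i, u.] = inv i\<otimes>(z\<otimes>inv i)" using comm_eq_conj[OF ic(1) uc] z(2) by simp
  also have "\<dots> = inv i\<otimes>(inv i\<otimes>z)" using P.Z_commutes[OF z(1) P.Qi[OF ic(2)]] by simp
  also have "\<dots> = (inv i\<otimes>inv i)\<otimes>z" using ic z by (simp add: m_assoc)
  also have "inv i\<otimes>inv i = i"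
   using cube_one_inv[OF inv_closed[OF ic(1)] P.Q_cube[OF P.Qi[OF ic(2)]]] ic by simp
  finally have "[.i, u.] = i\<otimes>z" .
  moreover have "[.i, u.]\<in>?K" using ic by (blast intro: generate.incl)
  ultimately show ?thesis using z(1) by blast
 qed
 have "Z \<subset> I" using IZ ZI by blast
 then obtain i where i: "i\<in>I" "i~:Z" by blast
 then obtain i' where i': "i'\<in>I" "i'\<otimes>i~=i\<otimes>i'" using centre_I[OF i(1)] i(2) by blast
 obtain k z where k: "k\<in>?K" "z\<in>Z" "k = i\<otimes>z" using lift[OF i(1)] by blast
 obtain k' z' where k': "k'\<in>?K" "z'\<in>Z" "k' = i'\<otimes>z'" using lift[OF i'(1)] by blast
 have Q: "i\<in>Q" "i'\<in>Q" "k\<in>Q" "k'\<in>Q" using i i' KI k k' IQ by blast+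
 have c: "i\<in>carrier G" "i'\<in>carrier G" "z\<in>carrier G" "z'\<in>carrier G" using Q k k' by auto
 have kne: "k'\<otimes>k~=k\<otimes>k'"
 proof
  assume "k'\<otimes>k = k\<otimes>k'"
  then have "(i'\<otimes>i)\<otimes>(z\<otimes>z') = (i\<otimes>i')\<otimes>(z\<otimes>z')"
  proof -
   have 1: "z'\<otimes>i = i\<otimes>z'" "z\<otimes>i' = i'\<otimes>z" "z'\<otimes>z = z\<otimes>z'"
    using P.Z_commutes k k' Q P.ZQ by blast+
   have "k'\<otimes>k = i'\<otimes>((z'\<otimes>i)\<otimes>z)" using k(3) k'(3) c by (simp add: m_assoc)
   also have "\<dots> = (i'\<otimes>i)\<otimes>(z'\<otimes>z)" unfolding 1(1) using c by (simp add: m_assoc)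
   finally have a: "k'\<otimes>k = (i'\<otimes>i)\<otimes>(z\<otimes>z')" unfolding 1(3) .
   have "k\<otimes>k' = i\<otimes>((z\<otimes>i')\<otimes>z')" using k(3) k'(3) c by (simp add: m_assoc)
   also have "\<dots> = (i\<otimes>i')\<otimes>(z\<otimes>z')" unfolding 1(2) using c by (simp add: m_assoc)
   finally have b: "k\<otimes>k' = (i\<otimes>i')\<otimes>(z\<otimes>z')" .
   show ?thesis using a b \<open>k'\<otimes>k = k\<otimes>k'\<close> by simp
  qed
  then show False using i'(2) c by simp
 qed
 have d: "[.k', k.]\<in>Z" "[.k', k.]~=\<one>" using P.Q_comm[OF Q(4,3)] P.commute_iff[OF Q(4,3)] kne by blast+
 have dK: "[.k', k.]\<in>?K" by (rule subgroup_comm[OF Ks k'(1) k(1)])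
 have ZK: "Z\<subseteq>?K" using P.Z_gen(1)[OF d] dK subgroup.m_closed[OF Ks dK dK] subgroup.one_closed[OF Ks] by blast
 have "I\<subseteq>?K"
 proof
  fix w assume w: "w\<in>I"
  obtain v y where v: "v\<in>?K" "y\<in>Z" "v = w\<otimes>y" using lift[OF w] by blast
  have wc: "w\<in>carrier G" "y\<in>carrier G" using w v IQ by auto
  have "w = v\<otimes>inv y" using v(3) wc by (simp add: m_assoc)
  then show "w\<in>?K" using subgroup.m_closed[OF Ks v(1)] ZK P.Zi[OF v(2)] by blast
 qed
 then show ?thesis unfolding commutator_subgroup_def using KI by blast
qed

context
 assumes C27: "card C = 27"
begin

lemma I27: "card I = 27" using card_C_I C27 by simp

lemma I_extraspecial: "extraspecial_plus 3 1 (grp_on G I)"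
 using P.extraspecial_27(1)[OF I_sub ZI IQ centre_I I27] by blast

lemma C_iso_I: "G\<lparr>carrier := C\<rparr> \<cong> G\<lparr>carrier := I\<rparr>"
 using P.extraspecial_27(2)[OF C_sub ZC CQ centre_C C27] P.extraspecial_27(2)[OF I_sub ZI IQ centre_I I27] heisenberg_iso
 by blast

lemma Q_u_commutator: "commutator_subgroup G Q {u} = I"
 by (rule commutator_u) (use C27 I27 P.Q_card P.Z_card in auto)

lemma not_abelian_in_J: "\<not> C\<subseteq>J" "\<not> I\<subseteq>J"
proof -
 have ne: "C~=Z" "I~=Z" using C27 I27 P.Z_card by auto
 show "\<not> C\<subseteq>J"
 proof
  assume "C\<subseteq>J"
  then have "\<And>x y. x\<in>C ==> y\<in>C ==> y\<otimes>x = x\<otimes>y" using J_abelian by blast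
  then have "C\<subseteq>Z" using centre_C by blast
  then show False using ne ZC by blast
 qed
 show "\<not> I\<subseteq>J"
 proof
  assume "I\<subseteq>J"
  then have "\<And>x y. x\<in>I ==> y\<in>I ==> y\<otimes>x = x\<otimes>y" using J_abelian by blast
  then have "I\<subseteq>Z" using centre_I by blast
  then show False using ne ZI by blast
 qed
qed

lemma card_Z2_parts: "card (J\<inter>Q\<inter>C) = 9" "card (J\<inter>Q\<inter>I) = 9"
proof -
 have ZZ: "Z\<subseteq>J\<inter>Q" by (rule ZZ2)
 have prod: "card (J\<inter>Q\<inter>C) * card (J\<inter>Q\<inter>I) = 81"
  using decompose(2)[OF Z2_sub ZZ _ Z2_u] Z2_card by simp
 have sC: "subgroup (J\<inter>Q\<inter>C) G" and sI: "subgroup (J\<inter>Q\<inter>I) G"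
  by (rule subgroups_Inter_pair[OF Z2_sub C_sub], rule subgroups_Inter_pair[OF Z2_sub I_sub])
 have "card (J\<inter>Q\<inter>C) dvd 27" using card_subgroup_dvd[OF C_sub sC _ finC] C27 by simp
 then have c: "card (J\<inter>Q\<inter>C) = 1 \<or> card (J\<inter>Q\<inter>C) = 3 \<or> card (J\<inter>Q\<inter>C) = 9 \<or> card (J\<inter>Q\<inter>C) = 27"
  by (rule divisors_27)
 have "card (J\<inter>Q\<inter>C)~=27"
 proof
  assume "card (J\<inter>Q\<inter>C) = 27"
  then have "J\<inter>Q\<inter>C = C" using card_subset_eq[OF finC, of "J\<inter>Q\<inter>C"] C27 by auto
  then show False using not_abelian_in_J by blast
 qed
 moreover have "card (J\<inter>Q\<inter>I)~=27"
 proof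
  assume "card (J\<inter>Q\<inter>I) = 27"
  then have "J\<inter>Q\<inter>I = I" using card_subset_eq[OF finI, of "J\<inter>Q\<inter>I"] I27 by auto
  then show False using not_abelian_in_J by blast
 qed
 moreover have "card (J\<inter>Q\<inter>C)~=1"
  using card_mono[of "J\<inter>Q\<inter>C" Z] finC ZZ ZC P.Z_card by auto
 ultimately show 9: "card (J\<inter>Q\<inter>C) = 9" using c prod by auto
 then show "card (J\<inter>Q\<inter>I) = 9" using prod by simp
qed

lemma card_J_fixed: "card (J\<inter>CG {u}) = 27" using card_fixed_J card_Z2_parts by simp
lemma card_S_fixed: "card (Syl\<inter>CG {u}) = 81" using card_fixed_S C27 by simp

lemma proper_subset_too_large:
 assumes "Y\<subseteq>K" "card K = 9" "finite K" "d\<in>K" "d~:Y" shows False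
 using card_subset_eq[of K Y] assms Y_card by auto

lemma J_comm_not_Y:
 assumes q: "q\<in>Q" "q~:A" and j: "j\<in>J" "j~:Q"
 shows "[.j, q.]\<in>J\<inter>Q" "[.j, q.]~:Y"
proof -
 show "[.j, q.]\<in>J\<inter>Q" using S_comm[of j q] j q JS QS by blast
 show "[.j, q.]~:Y"
 proof
  assume "[.j, q.]\<in>Y"
  then have "[.j, q.]\<in>E" using YE by blast
  then have "j\<in>A" using W_commuting_Q[OF q] j JW by blast
  then show False using j by blast
 qed
qed

text \<open>Otherwise \<open>Y\<close> lies in \<open>C\<close> or in \<open>I\<close>, and the other factor
 lies in \<open>A\<close>.  Choosing \<open>j\<in>J - Q\<close> fixed by \<open>u\<close> and
 \<open>q\<close> in the same factor as \<open>Y\<close> but outside \<open>A\<close>, the commutator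
 \<open>[j, q]\<close> enlarges \<open>Y\<close> inside a group of order 9.\<close>

lemma u_moves_Y: "u~:normalizing Y"
proof
 assume uY: "u\<in>normalizing Y"
 have prod: "card (Y\<inter>C) * card (Y\<inter>I) = 27"
  using decompose(2)[OF Y_sub ZY YQ normalizing_conj[OF uY]] Y_card by simp
 obtain j where j: "j\<in>J" "j\<in>CG {u}" "j~:Q"
 proof -
  have "\<not> J\<inter>CG {u}\<subseteq>J\<inter>Q\<inter>C"
   using card_mono[of "J\<inter>Q\<inter>C" "J\<inter>CG {u}"] finC card_Z2_parts(1) card_J_fixed by auto
  then show ?thesis using that unfolding C_def by blast
 qed
 have jc: "j\<in>carrier G" "j\<in>Syl" using j JS by auto
 have ju: "j\<up>u = j" using fixed_iff[OF jc(1)] j(2) by blast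
 have YZ2: "Y\<subseteq>J\<inter>Q" using YJ YQ by blast
 have "Y\<subseteq>C \<or> Y\<subseteq>I"
 proof -
  have s: "subgroup (Y\<inter>C) G" "subgroup (Y\<inter>I) G"
   by (rule subgroups_Inter_pair[OF Y_sub C_sub], rule subgroups_Inter_pair[OF Y_sub I_sub])
  have d9: "card (Y\<inter>C) dvd 9" using card_subgroup_dvd[OF Y_sub s(1) _ finY] Y_card by simp
  have d: "card (Y\<inter>C) = 1 \<or> card (Y\<inter>C) = 3 \<or> card (Y\<inter>C) = 9 \<or> card (Y\<inter>C) = 27"
   using divisors_27[OF dvd_trans[OF d9, of 27]] by simp
  have "card (Y\<inter>I) \<le> 9" "card (Y\<inter>C) \<le> 9" using card_mono[OF finY] Y_card by auto
  then have "card (Y\<inter>C) = 9 \<or> card (Y\<inter>I) = 9" using d prod by auto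
  then show ?thesis
   using card_subset_eq[OF finY, of "Y\<inter>C"] card_subset_eq[OF finY, of "Y\<inter>I"] Y_card by auto
 qed
 then show False
 proof
  assume YC: "Y\<subseteq>C"
  have IA: "I\<subseteq>A"
  proof
   fix i assume i: "i\<in>I"
   have ic: "i\<in>carrier G" "i\<in>Q" using i IQ by auto
   have "y\<up>i = y" if "y\<in>Y" for y
    using C_I_commute[of y i] YC that i conj_el_fixed[of y i] ic by auto
   then show "i\<in>A" unfolding A_alt using ic centralizerI[OF ic(1) Y_carrier] by blast
  qed
  have "\<not> C\<subseteq>A"
  proof
   assume "C\<subseteq>A"
   then have "Q\<subseteq>A" using set_mult_subset[OF A_sub _ IA, of C] Q_eq by simp
   then show False using Q_not_A by blast
  qed
  then obtain q where q: "q\<in>C" "q~:A" by blast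
  have qQ: "q\<in>Q" "q\<in>carrier G" "q\<up>u = q" using q C_iff by auto
  note d = J_comm_not_Y[OF qQ(1) q(2) j(1,3)]
  have "[.j, q.]\<up>u = [.j, q.]" using conj_el_comm[OF jc(1) qQ(2) uc] ju qQ(3) by simp
  then have "[.j, q.]\<in>J\<inter>Q\<inter>C" using d(1) C_iff by blast
  then show False using proper_subset_too_large[OF _ card_Z2_parts(1) _ _ d(2)] YC YZ2 finC by blast
 next
  assume YI: "Y\<subseteq>I"
  have CA: "C\<subseteq>A"
  proof
   fix c assume c: "c\<in>C"
   have cc: "c\<in>carrier G" "c\<in>Q" using c CQ by auto
   have "y\<up>c = y" if "y\<in>Y" for y
    using C_I_commute[of c y] YI that c conj_el_fixed[of y c] cc by auto
   then show "c\<in>A" unfolding A_alt using cc centralizerI[OF cc(1) Y_carrier] by blast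
  qed
  have "\<not> I\<subseteq>A"
  proof
   assume "I\<subseteq>A"
   then have "Q\<subseteq>A" using set_mult_subset[OF A_sub CA, of I] Q_eq by simp
   then show False using Q_not_A by blast
  qed
  then obtain q where q: "q\<in>I" "q~:A" by blast
  have qQ: "q\<in>Q" "q\<in>carrier G" "inv q\<in>Q" using q IQ P.Qi by auto
  obtain z where z: "z\<in>Z" "q\<up>u = z\<otimes>inv q" by (rule I_inv[OF q(1)])
  have zc: "z\<in>carrier G" "inv q\<in>carrier G" using z qQ by auto
  note d = J_comm_not_Y[OF qQ(1) q(2) j(1,3)]
  let ?d = "[.j, q.]"
  have dc: "?d\<in>carrier G" "?d\<in>Q" using d(1) by auto
  have "z\<up>j = z" by (rule Z_fixed_S[OF z(1) jc(2)])
  then have jz: "[.j, z.] = \<one>" using conj_el_fixed[OF zc(1) jc(1)] comm_one_iff[OF jc(1) zc(1)] by simp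
  have "?d\<up>u = [.j, z\<otimes>inv q.]" using conj_el_comm[OF jc(1) qQ(2) uc] ju z(2) by simp
  also have "\<dots> = [.j, inv q.]\<otimes>([.j, z.]\<up>inv q)" by (rule comm_mult_right[OF jc(1) zc])
  also have "\<dots> = [.j, inv q.]" unfolding jz using jc zc by simp
  finally have du: "?d\<up>u = [.j, inv q.]" .
  have "[.j, inv q.]\<otimes>?d = [.inv q, ?d.]" using jc(1) qQ(2) by (simp add: word_simps)
  then have "(?d\<up>u)\<otimes>?d\<in>Z" using P.Q_comm[OF qQ(3) dc(2)] du by simp
  then have "?d\<in>J\<inter>Q\<inter>I" unfolding I_def using d(1) by blast
  then show False using proper_subset_too_large[OF _ card_Z2_parts(2) _ _ d(2)] YI YZ2 finI by blast
 qed
qed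

lemma J_u_commutator:
 "commutator_subgroup G J {u} = commutator_subgroup G Y {u}" "card (commutator_subgroup G J {u}) = 3"
proof -
 let ?f = "\<lambda>j. [.j, u.]"
 let ?K = "?f ` J"
 have fe: "?f j = inv j\<otimes>(j\<up>u)" if "j\<in>J" for j using comm_eq_conj[of j u] that by simp
 have fJ: "?f j\<in>J" if "j\<in>J" for j unfolding fe[OF that] using Jm Ji J_u that by blast
 have hom: "?f (a\<otimes>b) = ?f a\<otimes>?f b" if a: "a\<in>J" and b: "b\<in>J" for a b
 proof -
  have c: "a\<in>carrier G" "b\<in>carrier G" using a b by auto
  have "?f a\<up>b = ?f a" using conj_el_fixed[of "?f a" b] J_abelian[OF fJ[OF a] b] c by simp
  then show ?thesis using comm_mult_left[OF c uc] by simp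
 qed
 have finv: "?f (inv a) = inv (?f a)" if a: "a\<in>J" for a
 proof -
  have ac: "a\<in>carrier G" "inv a\<in>carrier G" using a by auto
  have "?f (inv a)\<otimes>?f a = ?f (inv a\<otimes>a)" using hom[OF Ji[OF a] a] by simp
  also have "\<dots> = \<one>" using ac u_sq by simp
  finally have e: "?f (inv a)\<otimes>?f a = \<one>" .
  have k: "?f (inv a)\<in>carrier G" "?f a\<in>carrier G" using fJ[OF Ji[OF a]] fJ[OF a] Jc by blast+
  show ?thesis using inv_equality[OF e k(2,1)] by simp
 qed
 have Ks: "subgroup ?K G"
 proof (rule subgroupI)
  show "?K\<subseteq>carrier G" using fJ by auto
  show "?K~={}" using J1 by blast
  show "inv a\<in>?K" if a: "a\<in>?K" for a
  proof -
   obtain a' where a': "a'\<in>J" "a = ?f a'" using a by blast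
   have "inv a = ?f (inv a')" unfolding a'(2) by (rule finv[OF a'(1), symmetric])
   then show ?thesis using Ji[OF a'(1)] by blast
  qed
  show "a\<otimes>b\<in>?K" if a: "a\<in>?K" and b: "b\<in>?K" for a b
  proof -
   obtain a' where a': "a'\<in>J" "a = ?f a'" using a by blast
   obtain b' where b': "b'\<in>J" "b = ?f b'" using b by blast
   have "a\<otimes>b = ?f (a'\<otimes>b')" using hom[OF a'(1) b'(1)] a'(2) b'(2) by (simp only:)
   then show ?thesis using Jm[OF a'(1) b'(1)] by blast
  qed
 qed
 have K3: "card ?K = 3"
 proof -
  have "card ?K * card (J\<inter>CG {u}) = card J"
  proof (rule card_fibres[OF J_sub J_cent_sub _ finJ])
   show "J\<inter>CG {u}\<subseteq>J" by blast
   fix a b assume a: "a\<in>J" and b: "b\<in>J"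
   have ab: "a\<otimes>inv b\<in>J" by (rule Jm[OF a Ji[OF b]])
   have c: "a\<otimes>inv b\<in>carrier G" "?f a\<in>carrier G" "?f b\<in>carrier G" using Jc[OF ab] fJ[OF a] fJ[OF b] Jc by blast+
   have "?f (a\<otimes>inv b) = ?f a\<otimes>inv (?f b)" using hom[OF a Ji[OF b]] finv[OF b] by simp
   moreover have "?f a\<otimes>inv (?f b) = \<one> \<longleftrightarrow> ?f a = ?f b" using inv_solve_right'[of \<one> "?f a" "?f b"] c by simp
   moreover have "?f (a\<otimes>inv b) = \<one> \<longleftrightarrow> a\<otimes>inv b\<in>CG {u}"
    using comm_one_iff'[OF c(1) uc] fixed_iff[OF c(1)] by blast
   ultimately show "?f a = ?f b \<longleftrightarrow> a\<otimes>inv b\<in>J\<inter>CG {u}" using ab by simp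
  qed
  then show ?thesis using card_J_fixed J_card by simp
 qed
 have setJ: "{[.a, b.] | a b. a\<in>X \<and> b\<in>{u}} = ?f ` X" for X by blast
 have cJ: "commutator_subgroup G J {u} = ?K"
  unfolding commutator_subgroup_def setJ using generateI[OF Ks subset_refl] generate_subgroup_incl[OF subset_refl Ks] generate.incl
  by (metis subsetI subset_antisym)
 have "commutator_subgroup G Y {u} = ?K"
 proof
  have sub: "?f ` Y\<subseteq>?K" using YJ by blast
  show "commutator_subgroup G Y {u}\<subseteq>?K"
   unfolding commutator_subgroup_def setJ by (rule generate_subgroup_incl[OF sub Ks])
  obtain y where y: "y\<in>Y" "y\<up>u~=y"
  proof -
   have "\<not> (\<forall>y\<in>Y. y\<up>u = y)"
   proof
    assume "\<forall>y\<in>Y. y\<up>u = y"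
    then have "u\<in>normalizing Y" by (intro normalizingI[OF finY Y_carrier uc]) simp
    then show False using u_moves_Y by blast
   qed
   then show ?thesis using that by blast
  qed
  have ne: "?f y~=\<one>" using comm_one_iff'[OF Yc[OF y(1)] uc] y(2) by blast
  have yK: "?f y\<in>?K" using y YJ by blast
  have gs: "subgroup (generate G (?f ` Y)) G" by (rule generate_is_subgroup) (use sub subgroup.subset[OF Ks] in blast)
  have yg: "?f y\<in>generate G (?f ` Y)" using y by (blast intro: generate.incl)
  have "?K = {\<one>, ?f y, ?f y\<otimes>?f y}" by (rule order_3_subgroup(1)[OF Ks K3 yK ne])
  moreover have "{\<one>, ?f y, ?f y\<otimes>?f y}\<subseteq>generate G (?f ` Y)"
   using yg subgroup.m_closed[OF gs yg yg] subgroup.one_closed[OF gs] by blast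
  ultimately show "?K\<subseteq>commutator_subgroup G Y {u}" unfolding commutator_subgroup_def setJ by (simp only:)
 qed
 then show "commutator_subgroup G J {u} = commutator_subgroup G Y {u}" using cJ by simp
 show "card (commutator_subgroup G J {u}) = 3" unfolding cJ by (rule K3)
qed

end

end

section \<open>The structure theorem\<close>

context group begin

lemma section_mult_eq: "X \<otimes>\<^bsub>G\<lparr>carrier := C\<rparr> Mod B\<^esub> X' = X<#>X'"
 by (simp add: FactGroup_def set_mult_def)

lemma section_one: "\<one>\<^bsub>G\<lparr>carrier := C\<rparr> Mod B\<^esub> = B"
 by (simp add: FactGroup_def)

lemma section_commutator_trivial:
 assumes C: "subgroup C G" and B: "B \<lhd> G\<lparr>carrier := C\<rparr>" and u: "u\<in>C" and g: "g\<in>C" "g\<in>S"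
  and h: "commutator_subgroup (G\<lparr>carrier := C\<rparr> Mod B) {B #> u} (carrier (G\<lparr>carrier := S\<rparr> Mod B)) = {\<one>\<^bsub>G\<lparr>carrier := C\<rparr> Mod B\<^esub>}"
 shows "[.u, g.]\<in>B"
proof -
 let ?M = "G\<lparr>carrier := C\<rparr> Mod B"
 interpret M: group ?M by (rule normal.factorgroup_is_group[OF B])
 have Bs: "subgroup B G" using incl_subgroup[OF C normal_imp_subgroup[OF B]] .
 have Bc: "B\<subseteq>carrier G" using subgroup.subset[OF Bs] .
 have mult: "(B #> a) \<otimes>\<^bsub>?M\<^esub> (B #> b) = B #> (a\<otimes>b)" if "a\<in>C" "b\<in>C" for a b
  unfolding section_mult_eq by (rule section_mult[OF C B that])
 have mem: "B #> a\<in>carrier ?M" if "a\<in>C" for a unfolding section_carrier using that by blast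
 have inv: "inv\<^bsub>?M\<^esub> (B #> a) = B #> inv a" if a: "a\<in>C" for a
 proof (rule M.inv_equality)
  have ai: "inv a\<in>C" using subgroup.m_inv_closed[OF C a] .
  show "B #> inv a\<in>carrier ?M" "B #> a\<in>carrier ?M" using mem a ai by blast+
  have "(B #> inv a) \<otimes>\<^bsub>?M\<^esub> (B #> a) = B #> (inv a\<otimes>a)" by (rule mult[OF ai a])
  also have "\<dots> = B" using subgroup_carrier[OF C a] Bc by simp
  finally show "(B #> inv a) \<otimes>\<^bsub>?M\<^esub> (B #> a) = \<one>\<^bsub>?M\<^esub>" unfolding section_one .
 qed
 have i: "inv u\<in>C" "inv g\<in>C" using subgroup.m_inv_closed[OF C] u g by blast+
 have c1: "inv u\<otimes>inv g\<in>C" "inv u\<otimes>inv g\<otimes>u\<in>C" using subgroup.m_closed[OF C] i u by blast+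
 let ?X = "{inv\<^bsub>?M\<^esub> a \<otimes>\<^bsub>?M\<^esub> inv\<^bsub>?M\<^esub> b \<otimes>\<^bsub>?M\<^esub> a \<otimes>\<^bsub>?M\<^esub> b | a b. a\<in>{B #> u} \<and> b\<in>carrier (G\<lparr>carrier := S\<rparr> Mod B)}"
 have "B #> g\<in>carrier (G\<lparr>carrier := S\<rparr> Mod B)" unfolding section_carrier using g by blast
 then have "inv\<^bsub>?M\<^esub> (B #> u) \<otimes>\<^bsub>?M\<^esub> inv\<^bsub>?M\<^esub> (B #> g) \<otimes>\<^bsub>?M\<^esub> (B #> u) \<otimes>\<^bsub>?M\<^esub> (B #> g)\<in>?X" by blast
 then have "inv\<^bsub>?M\<^esub> (B #> u) \<otimes>\<^bsub>?M\<^esub> inv\<^bsub>?M\<^esub> (B #> g) \<otimes>\<^bsub>?M\<^esub> (B #> u) \<otimes>\<^bsub>?M\<^esub> (B #> g)\<in>generate ?M ?X"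
  by (rule generate.incl)
 then have "inv\<^bsub>?M\<^esub> (B #> u) \<otimes>\<^bsub>?M\<^esub> inv\<^bsub>?M\<^esub> (B #> g) \<otimes>\<^bsub>?M\<^esub> (B #> u) \<otimes>\<^bsub>?M\<^esub> (B #> g) = B"
  using h unfolding commutator_subgroup_def section_one by blast
 then have "B #> [.u, g.] = B"
  unfolding inv[OF u] inv[OF g(1)] mult[OF i] mult[OF c1(1) u] mult[OF c1(2) g(1)] .
 moreover have "[.u, g.]\<in>carrier G" using subgroup_carrier[OF C] u g by simp
 ultimately show ?thesis using rcos_eq_self_iff[OF Bs] by blast
qed

end

theorem theorem3p10:
  fixes G :: "('a, 'm) monoid_scheme" (structure)
    and T Z Q Qx Y L W S J Z2 :: "'a set" and x :: 'a
  assumes "group G" and "finite (carrier G)"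
    and "sylow_subgroup 3 G T"
    and "Z = centre (grp_on G T)"
    and "Q = p_core 3 (grp_on G (centralizer G Z))"
    and "extraspecial_plus 3 2 (grp_on G Q)"
    and "centralizer G Q \<subseteq> Q"
    and "x \<in> carrier G" and "Z \<noteq> conj_set G Z x" and "conj_set G Z x \<subseteq> Q"
    and "Qx = conj_set G Q x"
    and "Y = Z <#> conj_set G Z x"
    and "L = generate G (Q \<union> Qx)"
    and "W = L \<inter> centralizer G Y"
    and "S = Q <#> W"
    and "J = thompson (grp_on G S)"
    and "Z2 = J \<inter> Q"
  shows
    "\<comment> \<open>(i)\<close>
     (Z \<subseteq> Qx \<and> subgroup Y G \<and> Y \<subseteq> Q \<inter> Qx) \<and>
     \<comment> \<open>(ii)\<close>
     L \<subseteq> normalizer G Y \<and>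
     \<comment> \<open>(iii)\<close>
     (W = p_core 3 (grp_on G L) \<and> card W = 3 ^ 5 \<and> (grp_on G L Mod W) \<cong> SL23) \<and>
     \<comment> \<open>(iv)\<close>
     (centre (grp_on G W) = Y \<and> derived G W = Y \<and> group_exponent (grp_on G W) = 3) \<and>
     \<comment> \<open>(v)\<close>
     (sylow_subgroup 3 (grp_on G L) S \<and>
      (\<exists>s\<in>L. involution G s \<and> W #> s \<in> centre (grp_on G L Mod W)) \<and>
      (\<forall>s\<in>L. involution G s \<and> W #> s \<in> centre (grp_on G L Mod W) \<longrightarrow>
         J = thompson (grp_on G W) \<and>
         J = commutator_subgroup G S {s} \<and>
         J = commutator_subgroup G W {s} \<and>
         J = commutator_subgroup G J {s} \<and>
         inverts G s J) \<and>
      elementary_abelian 3 (grp_on G J) \<and> card J = 3 ^ 4) \<and>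
     \<comment> \<open>(vi)\<close>
     (card Z2 = 27 \<and> carrier (grp_on G Z2 Mod Z) = centre (grp_on G S Mod Z)) \<and>
     \<comment> \<open>(vii)\<close>
     (Y \<subseteq> derived G S \<and> derived G S \<subseteq> Z2) \<and>
     \<comment> \<open>(viii)\<close>
     (\<forall>S0. subgroup S0 G \<and> J \<subset> S0 \<and> S0 \<subset> S \<longrightarrow> card (centre (grp_on G S0)) = 9) \<and>
     \<comment> \<open>(ix)\<close>
     (natural_SL23_module G L W Y {\<one>} \<and>
      natural_SL23_module G L W W (Q \<inter> Qx) \<and>
      natural_SL23_module G L W J Y) \<and>
     \<comment> \<open>(x)\<close>
     (grp_on G L Mod J) \<cong> (integer_mod_group 3 \<times>\<times> SL23) \<and>
     \<comment> \<open>(xi)\<close>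
     ((\<forall>s\<in>L. involution G s \<and> W #> s \<in> centre (grp_on G L Mod W) \<longrightarrow>
         internal_direct_product G (Q \<inter> Qx) Y (W \<inter> centralizer G {s})) \<and>
      card (Q \<inter> Qx) = 3 ^ 3) \<and>
     \<comment> \<open>(xii)\<close>
     (\<forall>N. subgroup N G \<and> coprime (card N) 3 \<and> Y \<subseteq> normalizer G N \<longrightarrow>
        commutator_subgroup G Y N = {\<one>}) \<and>
     \<comment> \<open>(xiii)\<close>
     (\<forall>u\<in>centralizer G Z. involution G u \<and>
        commutator_subgroup (grp_on G (centralizer G Z) Mod Q)
          {Q #> u} (carrier (grp_on G S Mod Q)) = {\<one>\<^bsub>grp_on G (centralizer G Z) Mod Q\<^esub>} \<longrightarrow>
        (inverts_section G u Q Z \<and> card (J \<inter> centralizer G {u}) = 3 ^ 2 \<and>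
         inverts_section G u S J) \<or>
        (central_product G Q (Q \<inter> centralizer G {u}) (commutator_subgroup G Q {u}) \<and>
         grp_on G (Q \<inter> centralizer G {u}) \<cong> grp_on G (commutator_subgroup G Q {u}) \<and>
         extraspecial_plus 3 1 (grp_on G (commutator_subgroup G Q {u})) \<and>
         u \<notin> normalizer G Y \<and>
         card (S \<inter> centralizer G {u}) = 3 ^ 4 \<and>
         card (J \<inter> centralizer G {u}) = 3 ^ 3 \<and>
         commutator_subgroup G J {u} = commutator_subgroup G Y {u} \<and>
         card (commutator_subgroup G J {u}) = 3))"
proof -
 interpret group G by (rule assms(1))
 have xc: "x \<in> carrier G" by (rule assms(8))
 interpret P: large_extraspecial G Z Q by (rule large_extraspecial_of_core[OF assms(2-7)])
 let ?Z1 = "conj_set G Z x"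
 have big: "large_extraspecial G ?Z1 Qx" unfolding assms(11) by (rule P.conj_large[OF xc])
 have ZQx: "Z \<subseteq> Qx" unfolding assms(11) by (rule P.conjugate_centre_symmetric[OF xc assms(9,10)])
 interpret E: extraspecial_pair G Z Q ?Z1 Qx x
  by (rule extraspecial_pair.intro[OF is_group P.large_extraspecial_axioms big], rule extraspecial_pair_axioms.intro)
   (use assms(8-11) ZQx in auto)
 have Y: "Y = E.Y" by (rule assms(12))
 have L: "L = E.L" by (rule assms(13))
 have W: "W = E.W" unfolding assms(14) L Y ..
 have S: "S = E.Syl" unfolding assms(15) W ..
 have inv: "extraspecial_pair_involution G Z Q ?Z1 Qx x s"
  if "s \<in> E.L" "involution G s \<and> E.W #> s \<in> centre (G\<lparr>carrier := E.L\<rparr> Mod E.W)" for s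
  by (rule extraspecial_pair_involution.intro[OF E.extraspecial_pair_axioms], rule extraspecial_pair_involution_axioms.intro)
   (use that E.involution_square[of s] in auto)
 obtain s0 where s0: "s0 \<in> E.L" "involution G s0 \<and> E.W #> s0 \<in> centre (G\<lparr>carrier := E.L\<rparr> Mod E.W)"
  using E.central_involution_exists by blast
 interpret I: extraspecial_pair_involution G Z Q ?Z1 Qx x s0 by (rule inv[OF s0])
 have J: "J = I.J" unfolding assms(16) S by (rule I.thompson_eq_J[OF E.S_sub I.JS subset_refl])
 have Z2: "Z2 = I.J \<inter> Q" unfolding assms(17) J ..
 have ii: "E.L \<subseteq> normalizer G E.Y" unfolding normalizer_eq_normalizing[OF E.Y_carrier] by (rule E.L_norm_Y)
 have v1: "I.J = thompson (G\<lparr>carrier := E.W\<rparr>) \<and> I.J = commutator_subgroup G E.Syl {s} \<and>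
   I.J = commutator_subgroup G E.W {s} \<and> I.J = commutator_subgroup G I.J {s} \<and> inverts G s I.J \<and>
   internal_direct_product G (Q \<inter> Qx) E.Y (E.W \<inter> centralizer G {s})"
  if s: "s \<in> E.L" "involution G s \<and> E.W #> s \<in> centre (G\<lparr>carrier := E.L\<rparr> Mod E.W)" for s
 proof -
  interpret K: extraspecial_pair_involution G Z Q ?Z1 Qx x s by (rule inv[OF s])
  have "K.J = I.J"
   using I.thompson_eq_J[OF E.S_sub I.JS subset_refl] K.thompson_eq_J[OF E.S_sub K.JS subset_refl] by simp
  moreover have "thompson (G\<lparr>carrier := E.W\<rparr>) = K.J" by (rule K.thompson_eq_J[OF E.W_sub K.JW E.WS])
  moreover have "commutator_subgroup G E.Syl {s} = K.J" by (rule K.commutator_s[OF K.JS E.SL])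
  moreover have "commutator_subgroup G E.W {s} = K.J" by (rule K.commutator_s[OF K.JW]) blast
  moreover have "commutator_subgroup G K.J {s} = K.J" by (rule K.commutator_s[OF subset_refl]) (use K.JW in blast)
  ultimately show ?thesis using K.inverts_J K.E_split by simp
 qed
 have elab: "elementary_abelian 3 (G\<lparr>carrier := I.J\<rparr>)"
 proof -
  have g: "group (G\<lparr>carrier := I.J\<rparr>)" by (rule subgroup_imp_group[OF I.J_sub])
  have "comm_group (G\<lparr>carrier := I.J\<rparr>)" by (rule group.group_comm_groupI[OF g]) (use I.J_abelian in simp)
  moreover have "j [^]\<^bsub>G\<lparr>carrier := I.J\<rparr>\<^esub> (3::nat) = \<one>" if "j \<in> I.J" for j
   using I.J_cube[OF that] cube_eq[OF I.Jc[OF that]] nat_pow_consistent[of j 3 "I.J"] by simp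
  ultimately show ?thesis unfolding elementary_abelian_def by simp
 qed
 have xiii: "(inverts_section G u Q Z \<and> card (I.J \<inter> centralizer G {u}) = 3 ^ 2 \<and> inverts_section G u E.Syl I.J) \<or>
   (central_product G Q (Q \<inter> centralizer G {u}) (commutator_subgroup G Q {u}) \<and>
    G\<lparr>carrier := Q \<inter> centralizer G {u}\<rparr> \<cong> G\<lparr>carrier := commutator_subgroup G Q {u}\<rparr> \<and>
    extraspecial_plus 3 1 (G\<lparr>carrier := commutator_subgroup G Q {u}\<rparr>) \<and>
    u \<notin> normalizer G E.Y \<and>
    card (E.Syl \<inter> centralizer G {u}) = 3 ^ 4 \<and>
    card (I.J \<inter> centralizer G {u}) = 3 ^ 3 \<and>
    commutator_subgroup G I.J {u} = commutator_subgroup G E.Y {u} \<and>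
    card (commutator_subgroup G I.J {u}) = 3)"
  if u: "u \<in> centralizer G Z" and iu: "involution G u"
   and h: "commutator_subgroup (G\<lparr>carrier := centralizer G Z\<rparr> Mod Q) {Q #> u} (carrier (G\<lparr>carrier := E.Syl\<rparr> Mod Q))
    = {\<one>\<^bsub>G\<lparr>carrier := centralizer G Z\<rparr> Mod Q\<^esub>}" for u
 proof -
  have Csub: "subgroup (centralizer G Z) G" by (rule centralizer_subgroup[OF P.Z_carrier])
  have Qn: "Q \<lhd> G\<lparr>carrier := centralizer G Z\<rparr>"
   by (rule normal_onI[OF Csub P.Q_sub P.Q_cent_Z]) (use P.cent_Z_normalizes normalizing_conj in blast)
  have SC: "E.Syl \<subseteq> centralizer G Z" by (rule I.S_in_cent_Z)
  have us: "inv u \<otimes> inv g \<otimes> u \<otimes> g \<in> Q" if "g \<in> E.Syl" for g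
   by (rule section_commutator_trivial[OF Csub Qn u _ that h]) (use SC that in blast)
  interpret U: involution_centralizing_quotient G Z Q ?Z1 Qx x s0 u
   by (rule involution_centralizing_quotient.intro[OF I.extraspecial_pair_involution_axioms],
     rule involution_centralizing_quotient_axioms.intro)
    (use u us E.involution_square[OF iu] in auto)
  have fixC: "Q \<inter> centralizer G {u} = U.C" by (simp add: U.C_def)
  from U.card_C show ?thesis
  proof
   assume "card U.C = 3"
   from U.inverting_case[OF this] show ?thesis by simp
  next
   assume c: "card U.C = 27"
   have k: "commutator_subgroup G Q {u} = U.I" by (rule U.Q_u_commutator[OF c])
   have "central_product G Q U.C U.I"
    unfolding central_product_def using U.C_sub U.I_sub U.Q_eq U.C_I_commute by blast
   moreover have "u \<notin> normalizer G E.Y"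
    unfolding normalizer_eq_normalizing[OF E.Y_carrier] by (rule U.u_moves_Y[OF c])
   ultimately show ?thesis
    unfolding k fixC
    using U.C_iso_I[OF c] U.I_extraspecial[OF c] U.card_S_fixed[OF c] U.card_J_fixed[OF c] U.J_u_commutator[OF c] by simp
  qed
 qed
 show ?thesis
  unfolding Z2 J S W L Y
 proof (intro conjI)
  show "\<exists>s\<in>E.L. involution G s \<and> E.W #> s \<in> centre (G\<lparr>carrier := E.L\<rparr> Mod E.W)" by (rule E.central_involution_exists)
  show "sylow_subgroup 3 (G\<lparr>carrier := E.L\<rparr>) E.Syl" by (rule E.S_sylow)
  show "elementary_abelian 3 (G\<lparr>carrier := I.J\<rparr>)" by (rule elab)
  show "card I.J = 3 ^ 4" using I.J_card by simp
  show "card (I.J \<inter> Q) = 27" by (rule I.Z2_card)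
  show "carrier (G\<lparr>carrier := I.J \<inter> Q\<rparr> Mod Z) = centre (G\<lparr>carrier := E.Syl\<rparr> Mod Z)" by (rule I.Z2_mod_Z_centre)
  show "E.Y \<subseteq> derived G E.Syl" "derived G E.Syl \<subseteq> I.J \<inter> Q" by (rule I.S_derived)+
  show "\<forall>S0. subgroup S0 G \<and> I.J \<subset> S0 \<and> S0 \<subset> E.Syl \<longrightarrow> card (centre (G\<lparr>carrier := S0\<rparr>)) = 9"
   by (intro allI impI) (rule I.intermediate_centre, blast+)
  show "natural_SL23_module G E.L E.W E.Y {\<one>}" by (rule E.Y_module)
  show "natural_SL23_module G E.L E.W E.W (Q \<inter> Qx)" by (rule E.W_E_module)
  show "natural_SL23_module G E.L E.W I.J E.Y" by (rule I.J_Y_module)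
  show "(G\<lparr>carrier := E.L\<rparr> Mod I.J) \<cong> (integer_mod_group 3 \<times>\<times> SL23)" by (rule I.L_mod_J)
  show "card (Q \<inter> Qx) = 3 ^ 3" using E.E_card by simp
  show "\<forall>N. subgroup N G \<and> coprime (card N) 3 \<and> E.Y \<subseteq> normalizer G N \<longrightarrow> commutator_subgroup G E.Y N = {\<one>}"
  proof (intro allI impI)
   fix N assume N: "subgroup N G \<and> coprime (card N) 3 \<and> E.Y \<subseteq> normalizer G N"
   have Ns: "subgroup N G" using N by blast
   have "E.Y \<subseteq> normalizing N" using N normalizer_eq_normalizing[OF subgroup.subset[OF Ns]] by simp
   then show "commutator_subgroup G E.Y N = {\<one>}" using E.coprime_commutator[OF Ns] N by blast
  qed
  show "Z \<subseteq> Qx" "subgroup E.Y G" "E.Y \<subseteq> Q \<inter> Qx" by (rule ZQx, rule E.Y_sub, rule E.YE)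
  show "E.L \<subseteq> normalizer G E.Y" by (rule ii)
  show "E.W = p_core 3 (G\<lparr>carrier := E.L\<rparr>)" by (rule E.core_L[symmetric])
  show "card E.W = 3 ^ 5" using E.W_card by simp
  show "(G\<lparr>carrier := E.L\<rparr> Mod E.W) \<cong> SL23" using E.L_mod_W_iso unfolding is_iso_def by blast
  show "centre (G\<lparr>carrier := E.W\<rparr>) = E.Y" by (rule E.W_centre_eq)
  show "derived G E.W = E.Y" by (rule E.W_derived)
  show "group_exponent (G\<lparr>carrier := E.W\<rparr>) = 3" by (rule E.W_exponent)
  show "\<forall>s\<in>E.L. involution G s \<and> E.W #> s \<in> centre (G\<lparr>carrier := E.L\<rparr> Mod E.W) \<longrightarrow>
    I.J = thompson (G\<lparr>carrier := E.W\<rparr>) \<and> I.J = commutator_subgroup G E.Syl {s} \<and>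
    I.J = commutator_subgroup G E.W {s} \<and> I.J = commutator_subgroup G I.J {s} \<and> inverts G s I.J"
  proof (intro ballI impI)
   fix s assume s: "s \<in> E.L" "involution G s \<and> E.W #> s \<in> centre (G\<lparr>carrier := E.L\<rparr> Mod E.W)"
   show "I.J = thompson (G\<lparr>carrier := E.W\<rparr>) \<and> I.J = commutator_subgroup G E.Syl {s} \<and>
     I.J = commutator_subgroup G E.W {s} \<and> I.J = commutator_subgroup G I.J {s} \<and> inverts G s I.J"
    using v1[OF s] by (elim conjE) (intro conjI)
  qed
  show "\<forall>s\<in>E.L. involution G s \<and> E.W #> s \<in> centre (G\<lparr>carrier := E.L\<rparr> Mod E.W) \<longrightarrow>
    internal_direct_product G (Q \<inter> Qx) E.Y (E.W \<inter> centralizer G {s})"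
  proof (intro ballI impI)
   fix s assume s: "s \<in> E.L" "involution G s \<and> E.W #> s \<in> centre (G\<lparr>carrier := E.L\<rparr> Mod E.W)"
   show "internal_direct_product G (Q \<inter> Qx) E.Y (E.W \<inter> centralizer G {s})" using v1[OF s] by (elim conjE)
  qed
 qed (intro ballI impI, elim conjE, rule xiii)
qed

end
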